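(* Let $d\geq 1$, let $v=(v_1,\dots,v_d)\in\mathbf{R}^d$ satisfy $v_j\neq 0$ for $1\leq j\leq d$, and let $p(\xi)=\sum_{j=1}^d p_j(\xi_j)$, $\xi\in\mathbf{R}^d$, where $p_j(\xi_j)=\sum_{k=0}^{m_j}c_{j,k}\xi_j^k$ with $c_{j,k}\in\mathbf{R}$, $c_{j,m_j}\neq 0$, and $m=\max_{1\leq j\leq d} m_j\geq 2$. Let $P_m(\xi)=\sum_{j:\ m_j=m}c_{j,m}\xi_j^m$ be the principal part of $p$ and let $$\chi_t(x,\xi)=(x+t\nabla P_m(\xi),\xi),\quad t\in\mathbf{R},\quad (x,\xi)\in T^*\mathbf{R}^d\setminus 0,$$ be the Hamilton flow of $P_m(\xi)$. Let $\mathscr{K}_t:\mathscr{S}(\mathbf{R}^d)\to\mathscr{S}(\mathbf{R}^d)$ be the solution operator for the evolution equation $$\partial_t u(t,x)+i\left(p(D_x)+\langle v,x\rangle\right)u(t,x)=0,\quad x\in\mathbf{R}^d,\ t\in\mathbf{R},\qquad u(0,\cdot)=u_0.$$ If $\nu\geq\mu(m-1)>1$ then $\mathscr{K}_t$ is continuous on $\Sigma_\nu^\mu(\mathbf{R}^d)$, extends uniquely to a continuous linear operator on $(\Sigma_\nu^\mu)'(\mathbf{R}^d)$, and $$\mathrm{WF}^{\nu,\mu}(\mathscr{K}_tu)=\chi_t\left(\mathrm{WF}^{\nu,\mu}(u)\right),\quad t\in\mathbf{R},\quad u\in(\Sigma_\nu^\mu)'(\mathbf{R}^d),\quad \nu=\mu(m-1)>1,$$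 $$\mathrm{WF}^{\nu,\mu}(\mathscr{K}_tu)=\mathrm{WF}^{\nu,\mu}(u),\quad t\in\mathbf{R},\quad u\in(\Sigma_\nu^\mu)'(\mathbf{R}^d),\quad \nu>\mu(m-1)>1.$$
   Context: $T^*\mathbf{R}^d$ is identified with $\mathbf{R}^{2d}$; $\setminus 0$ denotes removal of the origin; $D_j=-i\partial_j$. The Fourier transform is $\widehat f(\xi)=(2\pi)^{-d/2}\int f(x)e^{-i\langle x,\xi\rangle}dx$. The pairing $(\cdot,\cdot)$ is conjugate linear in the second argument. Solution operator: let $q_j$ be a polynomial with $q_j'=p_j$, $1\leq j\leq d$, and set $\varphi_t(\xi)=\sum_{j=1}^d v_j^{-1}\left(q_j(\xi_j-tv_j)-q_j(\xi_j)\right)$. For $f\in\mathscr{S}(\mathbf{R}^d)$, $\mathscr{K}_tf(x)=e^{-it\langle x,v\rangle}\mathscr{F}^{-1}\left(e^{i\varphi_t}\widehat f\,\right)(x)$, with Schwartz kernel $K_t(x,y)=(2\pi)^{-d/2}e^{-it\langle x,v\rangle}\mathscr{F}^{-1}(e^{i\varphi_t})(x-y)$. Gelfand--Shilov spaces: for $\nu,\mu>0$ with $\nu+\mu>1$, $\Sigma_\nu^\mu(\mathbf{R}^d)$ is the Fréchet space of $f\in C^\infty(\mathbf{R}^d)$ such that $\sup_{x\in\mathbf{R}^d,\ \alpha,\beta\in\mathbf{N}^d}\frac{|x^\alpha D^\beta f(x)|}{h^{|\alpha+\beta|}\alpha!^\nu\beta!^\mu}<\infty$ for every $h>0$, with these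 quantities as seminorms. $(\Sigma_\nu^\mu)'(\mathbf{R}^d)$ is its topological dual, equipped with the weak$^*$ topology. Gelfand--Shilov wave front set: for $\varphi\in\Sigma_\nu^\mu(\mathbf{R}^d)\setminus 0$ and $u\in(\Sigma_\nu^\mu)'(\mathbf{R}^d)$ put $V_\varphi u(x,\xi)=(2\pi)^{-d/2}(u,e^{i\langle\cdot,\xi\rangle}\varphi(\cdot-x))$. A point $z_0\in T^*\mathbf{R}^d\setminus 0$ satisfies $z_0\notin\mathrm{WF}^{\nu,\mu}(u)$ if there is an open set $U\subseteq T^*\mathbf{R}^d\setminus 0$ containing $z_0$ such that $\sup_{\lambda>0,\ (x,\xi)\in U}e^{r\lambda}|V_\varphi u(\lambda^\nu x,\lambda^\mu\xi)|<\infty$ for all $r>0$. *)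

theory Defs
  imports "HOL-Analysis.Analysis" "HOL-Computational_Algebra.Polynomial"
begin

definition D_op :: "'d::finite \<Rightarrow> (real ^ 'd \<Rightarrow> complex) \<Rightarrow> real ^ 'd \<Rightarrow> complex" where
  "D_op j f x = - \<i> * frechet_derivative f (at x) (axis j 1)"

text \<open>Smoothness: every iterated partial derivative, in any order, is Frechet differentiable
  (hence continuous).\<close>

definition smooth :: "(real ^ 'd::finite \<Rightarrow> complex) \<Rightarrow> bool" where
  "smooth f \<longleftrightarrow> (\<forall>js. foldr D_op js f differentiable_on UNIV)"

text \<open>Multi-indices are vectors of type \<open>nat ^ 'd\<close>. The operator \<open>D_multi \<beta>\<close> applies
  \<open>D_op j\<close> exactly \<open>\<beta> $ j\<close> times for each \<open>j\<close>. The order of application is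
  an arbitrary choice, which is immaterial on smooth functions by symmetry of mixed derivatives.\<close>

definition D_multi :: "nat ^ 'd::finite \<Rightarrow> (real ^ 'd \<Rightarrow> complex) \<Rightarrow> real ^ 'd \<Rightarrow> complex" where
  "D_multi \<beta> f = foldr D_op (SOME js. \<forall>j. count_list js j = \<beta> $ j) f"

definition mi_power :: "real ^ 'd::finite \<Rightarrow> nat ^ 'd \<Rightarrow> real" where
  "mi_power x \<alpha> = (\<Prod>j\<in>UNIV. (x $ j) ^ (\<alpha> $ j))"

definition mi_size :: "nat ^ 'd::finite \<Rightarrow> nat" where
  "mi_size \<alpha> = (\<Sum>j\<in>UNIV. \<alpha> $ j)"

definition mi_fact :: "nat ^ 'd::finite \<Rightarrow> real" where
  "mi_fact \<alpha> = (\<Prod>j\<in>UNIV. fact (\<alpha> $ j))"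


subsection \<open>Gelfand--Shilov spaces and their duals\<close>

definition gs_quot ::
    "real \<Rightarrow> real \<Rightarrow> real \<Rightarrow> (real ^ 'd::finite \<Rightarrow> complex)
      \<Rightarrow> (real ^ 'd) \<times> (nat ^ 'd) \<times> (nat ^ 'd) \<Rightarrow> real" where
  "gs_quot \<nu> \<mu> h f = (\<lambda>(x, \<alpha>, \<beta>).
     cmod (complex_of_real (mi_power x \<alpha>) * D_multi \<beta> f x)
       / (h ^ mi_size (\<alpha> + \<beta>) * mi_fact \<alpha> powr \<nu> * mi_fact \<beta> powr \<mu>))"

definition gs_space :: "real \<Rightarrow> real \<Rightarrow> (real ^ 'd::finite \<Rightarrow> complex) set" where
  "gs_space \<nu> \<mu> = {f. smooth f \<and> (\<forall>h>0. bdd_above (range (gs_quot \<nu> \<mu> h f)))}"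

definition gs_seminorm :: "real \<Rightarrow> real \<Rightarrow> real \<Rightarrow> (real ^ 'd::finite \<Rightarrow> complex) \<Rightarrow> real" where
  "gs_seminorm \<nu> \<mu> h f = (SUP z. gs_quot \<nu> \<mu> h f z)"

definition gs_topology :: "real \<Rightarrow> real \<Rightarrow> (real ^ 'd::finite \<Rightarrow> complex) topology" where
  "gs_topology \<nu> \<mu> = topology_generated_by
     {{g \<in> gs_space \<nu> \<mu>. gs_seminorm \<nu> \<mu> h (\<lambda>x. g x - f x) < e} |f h e.
        f \<in> gs_space \<nu> \<mu> \<and> h > 0 \<and> e > 0}"

text \<open>A functional on the space is represented by a function on all of
  \<open>real ^ 'd \<Rightarrow> complex\<close> that vanishes off the space. This makes the representation
  unique and the vector space operations pointwise, and the weak* topology (pointwise convergence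
  on the space) is then the topology of pointwise convergence.\<close>

definition gs_dual :: "real \<Rightarrow> real \<Rightarrow> ((real ^ 'd::finite \<Rightarrow> complex) \<Rightarrow> complex) set" where
  "gs_dual \<nu> \<mu> = {u.
     continuous_map (gs_topology \<nu> \<mu>) euclidean u \<and>
     (\<forall>f\<in>gs_space \<nu> \<mu>. \<forall>g\<in>gs_space \<nu> \<mu>. \<forall>a b.
        u (\<lambda>x. a * f x + b * g x) = a * u f + b * u g) \<and>
     (\<forall>f. f \<notin> gs_space \<nu> \<mu> \<longrightarrow> u f = 0)}"

definition weak_star ::
    "real \<Rightarrow> real \<Rightarrow> ((real ^ 'd::finite \<Rightarrow> complex) \<Rightarrow> complex) topology" where
  "weak_star \<nu> \<mu> =
     subtopology (product_topology (\<lambda>_. euclidean) UNIV) (gs_dual \<nu> \<mu>)"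

text \<open>The pairing \<open>(u, f)\<close>, conjugate linear in \<open>f\<close>, of a linear functional
  \<open>u\<close> with a test function \<open>f\<close>.\<close>

definition pairing ::
    "((real ^ 'd::finite \<Rightarrow> complex) \<Rightarrow> complex) \<Rightarrow> (real ^ 'd \<Rightarrow> complex) \<Rightarrow> complex" where
  "pairing u f = u (\<lambda>x. cnj (f x))"

text \<open>The embedding of the space into its dual, normalized such that the pairing extends the
  inner product of \<open>L\<^sup>2\<close>.\<close>

definition gs_embed ::
    "real \<Rightarrow> real \<Rightarrow> (real ^ 'd::finite \<Rightarrow> complex) \<Rightarrow> (real ^ 'd \<Rightarrow> complex) \<Rightarrow> complex" where
  "gs_embed \<nu> \<mu> f = (\<lambda>g. if g \<in> gs_space \<nu> \<mu> then (LINT x|lborel. f x * g x) else 0)"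

text \<open>\<open>T\<close> is a continuous linear operator on the dual that extends \<open>A\<close>; its values
  off the dual are pinned to \<open>undefined\<close>, so that it is determined by its values on the dual.\<close>

definition dual_extension ::
    "real \<Rightarrow> real \<Rightarrow> ((real ^ 'd::finite \<Rightarrow> complex) \<Rightarrow> real ^ 'd \<Rightarrow> complex)
      \<Rightarrow> (((real ^ 'd \<Rightarrow> complex) \<Rightarrow> complex) \<Rightarrow> (real ^ 'd \<Rightarrow> complex) \<Rightarrow> complex) \<Rightarrow> bool" where
  "dual_extension \<nu> \<mu> A T \<longleftrightarrow>
     T \<in> extensional (gs_dual \<nu> \<mu>) \<and>
     continuous_map (weak_star \<nu> \<mu>) (weak_star \<nu> \<mu>) T \<and>
     (\<forall>u\<in>gs_dual \<nu> \<mu>. \<forall>w\<in>gs_dual \<nu> \<mu>. \<forall>a b.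
        T (\<lambda>f. a * u f + b * w f) = (\<lambda>f. a * T u f + b * T w f)) \<and>
     (\<forall>f\<in>gs_space \<nu> \<mu>. T (gs_embed \<nu> \<mu> f) = gs_embed \<nu> \<mu> (A f))"


subsection \<open>Wave front sets\<close>

definition stft ::
    "(real ^ 'd::finite \<Rightarrow> complex) \<Rightarrow> ((real ^ 'd \<Rightarrow> complex) \<Rightarrow> complex)
      \<Rightarrow> real ^ 'd \<Rightarrow> real ^ 'd \<Rightarrow> complex" where
  "stft \<phi> u x \<xi> = complex_of_real ((2 * pi) powr (- (real CARD('d) / 2))) *
     pairing u (\<lambda>y. exp (\<i> * complex_of_real (y \<bullet> \<xi>)) * \<phi> (y - x))"

text \<open>The window \<open>\<phi>\<close> is kept as a parameter.\<close>

definition gs_WF ::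
    "real \<Rightarrow> real \<Rightarrow> (real ^ 'd::finite \<Rightarrow> complex) \<Rightarrow> ((real ^ 'd \<Rightarrow> complex) \<Rightarrow> complex)
      \<Rightarrow> ((real ^ 'd) \<times> (real ^ 'd)) set" where
  "gs_WF \<nu> \<mu> \<phi> u = {z\<^sub>0. z\<^sub>0 \<noteq> 0 \<and>
     \<not> (\<exists>U. open U \<and> U \<subseteq> - {0} \<and> z\<^sub>0 \<in> U \<and>
          (\<forall>r>0. bdd_above {exp (r * s) * cmod (stft \<phi> u ((s powr \<nu>) *\<^sub>R x) ((s powr \<mu>) *\<^sub>R \<xi>))
                           |s x \<xi>. s > 0 \<and> (x, \<xi>) \<in> U}))}"


subsection \<open>The solution operator and the Hamilton flow\<close>

definition fourier :: "(real ^ 'd::finite \<Rightarrow> complex) \<Rightarrow> real ^ 'd \<Rightarrow> complex" where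
  "fourier f \<xi> = complex_of_real ((2 * pi) powr (- (real CARD('d) / 2))) *
     (LINT x|lborel. f x * exp (- \<i> * complex_of_real (x \<bullet> \<xi>)))"

definition inv_fourier :: "(real ^ 'd::finite \<Rightarrow> complex) \<Rightarrow> real ^ 'd \<Rightarrow> complex" where
  "inv_fourier g x = complex_of_real ((2 * pi) powr (- (real CARD('d) / 2))) *
     (LINT \<xi>|lborel. g \<xi> * exp (\<i> * complex_of_real (x \<bullet> \<xi>)))"

definition phase :: "real ^ 'd::finite \<Rightarrow> ('d \<Rightarrow> real poly) \<Rightarrow> real \<Rightarrow> real ^ 'd \<Rightarrow> real" where
  "phase v q t \<xi> = (\<Sum>j\<in>UNIV. inverse (v $ j) *
     (poly (q j) (\<xi> $ j - t * v $ j) - poly (q j) (\<xi> $ j)))"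

text \<open>The solution operator of \<open>\<partial>\<^sub>t u + i (p(D) + \<langle>v, x\<rangle>) u = 0\<close>,
  where \<open>p(\<xi>) = \<Sum>\<^sub>j p\<^sub>j(\<xi>\<^sub>j)\<close> and \<open>q\<^sub>j\<close> is any primitive of
  \<open>p\<^sub>j\<close>. On the Fourier side the equation is the transport equation
  \<open>\<partial>\<^sub>t w - \<langle>v, \<nabla>w\<rangle> + i p w = 0\<close>, with solution
  \<open>w(t, \<xi>) = exp (i \<phi>\<^sub>t(\<xi> + t v)) w(0, \<xi> + t v)\<close>,
  \<open>\<phi>\<^sub>t = phase v q t\<close>.\<close>

definition solution_op ::
    "real ^ 'd::finite \<Rightarrow> ('d \<Rightarrow> real poly) \<Rightarrow> real
      \<Rightarrow> (real ^ 'd \<Rightarrow> complex) \<Rightarrow> real ^ 'd \<Rightarrow> complex" where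
  "solution_op v q t f x = exp (- \<i> * complex_of_real (t * (x \<bullet> v))) *
     inv_fourier (\<lambda>\<xi>. exp (\<i> * complex_of_real (phase v q t \<xi>)) * fourier f \<xi>) x"

definition max_degree :: "('d::finite \<Rightarrow> real poly) \<Rightarrow> nat" where
  "max_degree p = Max (range (\<lambda>j. degree (p j)))"

definition principal_part :: "('d::finite \<Rightarrow> real poly) \<Rightarrow> real ^ 'd \<Rightarrow> real" where
  "principal_part p \<xi> =
     (\<Sum>j | degree (p j) = max_degree p. coeff (p j) (max_degree p) * (\<xi> $ j) ^ max_degree p)"

definition gradient :: "(real ^ 'd::finite \<Rightarrow> real) \<Rightarrow> real ^ 'd \<Rightarrow> real ^ 'd" where
  "gradient F \<xi> = (\<chi> j. frechet_derivative F (at \<xi>) (axis j 1))"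

definition hamilton_flow ::
    "('d::finite \<Rightarrow> real poly) \<Rightarrow> real \<Rightarrow> (real ^ 'd) \<times> (real ^ 'd) \<Rightarrow> (real ^ 'd) \<times> (real ^ 'd)" where
  "hamilton_flow p t = (\<lambda>(x, \<xi>). (x + t *\<^sub>R gradient (principal_part p) \<xi>, \<xi>))"

end

theory Submission
  imports Defs "HOL-Probability.Probability" "HOL-Complex_Analysis.Complex_Analysis"
begin

text \<open>
  A continuous function belongs to \<open>\<Sigma>\<^sub>\<nu>\<^sup>\<mu>\<close> if and only if it is the Fourier transform of a function whose
  pure coordinate derivatives satisfy \<open>\<bar>\<partial>\<^sub>j\<^sup>n F(\<eta>)\<bar> \<le> C h\<^sup>n n!\<^sup>\<nu> exp (- r \<bar>\<eta>\<bar>\<^bsup>1/\<mu>\<^esup>)\<close> for all \<open>h, r > 0\<close>.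
  Conjugated with the Fourier transform, the solution operator is a translation by \<open>t v\<close> followed by
  multiplication by \<open>exp (i Q)\<close>, where \<open>Q(\<eta>) = \<Sum>\<^sub>j Q\<^sub>j(\<eta>\<^sub>j)\<close> has real polynomial components of degree at
  most \<open>m\<close>. Since \<open>\<nu> \<ge> \<mu> (m - 1)\<close>, Cauchy's estimate on circles of suitable radius shows that this
  factor preserves the class, whence the continuity; the extension is the transpose of an operator of
  the same kind, and it is unique because the test functions are weak* dense in the dual.

  For the wave front set, freeze \<open>Q\<close> at a frequency and split off its first order Taylor polynomial.
  The linear part translates a time-frequency shifted window, and the remainder satisfies uniform
  derivative estimates up to a factor \<open>exp (O(\<lambda>))\<close> at scale \<open>\<lambda>\<close>. Hence the short-time Fourier transform
  of the image of the window decays faster than every exponential in the anisotropic distance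
  \<open>\<bar>x\<bar>\<^bsup>1/\<nu>\<^esup> + \<bar>\<xi>\<bar>\<^bsup>1/\<mu>\<^esup>\<close> from the transported point. Pairing with \<open>u\<close> through the reconstruction formula,
  exponential decay of the transform of \<open>u\<close> near the preimage of a point implies it for the image of \<open>u\<close>
  near that point. The rescaled transport converges to the flow of \<open>P\<^sub>m\<close> if \<open>\<nu> = \<mu> (m - 1)\<close> and to
  the identity if \<open>\<nu> > \<mu> (m - 1)\<close>; the reverse inclusion follows with \<open>- t\<close>.
\<close>

text \<open>Every bound is required for all \<open>h\<close> and all \<open>r\<close>. A Leibniz
  product may therefore double \<open>h\<close>, and a growing factor may consume part of a decay
  rate, as long as the loss is the same for all functions concerned; hence the many auxiliary scales
  and rates below. The condition on the exponents has a single source. Near a point of size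
  \<open>Y^\<mu>\<close> a phase of degree \<open>m\<close> has a derivative of size
  \<open>Y^(\<mu> (m - 1))\<close>, at most \<open>Y^\<nu>\<close>, so on a complex disc of radius
  proportional to \<open>Y^(1 - \<nu>)\<close> it varies by at most \<open>Y\<close>, and
  \<open>exp Y\<close> is a factor that decay of order \<open>1/\<mu>\<close> can absorb. The
  obstacle for wave front sets is that this derivative acts as a translation in space that may be as
  large as the scale \<open>\<lambda>^\<nu>\<close> itself. Decay cannot absorb it, so it has to be
  removed exactly, before anything is estimated. What remains costs
  \<open>exp (\<nu> \<lambda>)\<close>; near the transported point this is paid by the decay of the
  transform of \<open>u\<close>, which is of every exponential rate, and elsewhere by the kernel,
  whose rate is arbitrary too.\<close>

section \<open>Powers, factorials and stretched exponentials\<close>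

lemma power_over_fact_le_exp:
  fixes x :: real
  assumes "x \<ge> 0"
  shows "x ^ n / fact n \<le> exp x"
proof -
  have s: "(\<lambda>n. x ^ n / fact n) sums exp x"
    using exp_converges[of x] by (simp add: field_simps)
  have "x ^ n / fact n = (\<Sum>k\<in>{n}. x ^ k / fact k)" by simp
  also have "\<dots> \<le> (\<Sum>k. x ^ k / fact k)"
    by (rule sum_le_suminf) (use s assms in \<open>auto simp: sums_iff\<close>)
  also have "\<dots> = exp x" using s by (simp add: sums_iff)
  finally show ?thesis .
qed

lemma powr_power_commute:
  fixes Z b :: real
  assumes "Z \<ge> 0" "b > 0"
  shows "(Z powr b) ^ n = (Z ^ n) powr b"
  using assms
  by (cases "Z = 0") (auto simp: powr_realpow[symmetric] powr_powr mult.commute power_0_left)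

text \<open>Apply \<open>Y ^ n / n! \<le> exp Y\<close> to \<open>Y = r X^(1/b) / b\<close> and
  raise it to the power \<open>b\<close>. A large \<open>r\<close> makes the geometric constant
  \<open>(b / r)^b\<close> as small as desired; this is how powers of a variable are traded for a
  factorial and a stretched exponential.\<close>

lemma power_le_fact_powr_exp:
  fixes X b r :: real
  assumes X: "X \<ge> 0" and b: "b > 0" and r: "r > 0"
  shows "X ^ n \<le> ((b / r) powr b) ^ n * fact n powr b * exp (r * X powr (1 / b))"
proof -
  define Y where "Y = r * X powr (1 / b) / b"
  have Y: "Y \<ge> 0" using b r by (simp add: Y_def)
  have "X = (X powr (1 / b)) powr b" using X b by (simp add: powr_powr)
  also have "X powr (1 / b) = (b / r) * Y" using b r by (simp add: Y_def)
  finally have X0: "X = ((b / r) * Y) powr b" .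
  have X': "X = (b / r) powr b * Y powr b"
    unfolding X0 by (rule powr_mult)
  have "(Y powr b) ^ n = (Y ^ n) powr b"
    using Y b by (rule powr_power_commute)
  also have "\<dots> \<le> (fact n * exp Y) powr b"
    using power_over_fact_le_exp[OF Y, of n] Y b by (intro powr_mono2) (auto simp: field_simps)
  also have "\<dots> = fact n powr b * exp (b * Y)"
    by (simp add: powr_mult exp_powr_real mult.commute)
  also have "b * Y = r * X powr (1 / b)" using b by (simp add: Y_def)
  finally have *: "(Y powr b) ^ n \<le> fact n powr b * exp (r * X powr (1 / b))" .
  have "X ^ n = ((b / r) powr b) ^ n * (Y powr b) ^ n"
    by (subst X') (simp add: power_mult_distrib)
  also have "\<dots> \<le> ((b / r) powr b) ^ n * (fact n powr b * exp (r * X powr (1 / b)))"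
    by (rule mult_left_mono[OF *]) simp
  finally show ?thesis by (simp add: mult.assoc)
qed

text \<open>The converse trade, by summing the exponential series. The constant in the hypothesis
  carries \<open>2 * r\<close> instead of \<open>r\<close>: after taking \<open>b\<close>-th roots
  the spare factor 2 leaves a geometric series of ratio 1/2, whose sum 2 returns as
  \<open>2 powr b\<close> in the conclusion.\<close>

lemma exp_powr_le_of_powers:
  fixes X B C b r :: real
  assumes b: "b > 0" and r: "r > 0" and X: "X \<ge> 0" and B: "B \<ge> 0"
    and le: "\<And>n. X ^ n * B \<le> C * ((b / (2 * r)) powr b) ^ n * fact n powr b"
  shows "B * exp (r * X powr (1 / b)) \<le> 2 powr b * C"
proof (cases "B = 0")
  case True
  then show ?thesis using le[of 0] by simp
next
  case False
  then have B: "B > 0" using B by simp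
  have C: "C > 0" using le[of 0] B by simp
  define Y where "Y = r * X powr (1 / b) / b"
  have Y: "Y \<ge> 0" using b r by (simp add: Y_def)
  have "X = (X powr (1 / b)) powr b" using X b by (simp add: powr_powr)
  also have "X powr (1 / b) = (b / (2 * r)) * (2 * Y)" using b r by (simp add: Y_def)
  finally have X0: "X = ((b / (2 * r)) * (2 * Y)) powr b" .
  have X': "X = (b / (2 * r)) powr b * (2 * Y) powr b"
    unfolding X0 by (rule powr_mult)
  define K where "K = (C / B) powr (1 / b)"
  have summand: "Y ^ n / fact n \<le> K * (1 / 2) ^ n" for n
  proof -
    have pos: "((b / (2 * r)) powr b) ^ n > 0" using b r by simp
    have "((b / (2 * r)) powr b) ^ n * (((2 * Y) powr b) ^ n * B) = X ^ n * B"
      by (subst X') (simp add: power_mult_distrib)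
    also have "\<dots> \<le> ((b / (2 * r)) powr b) ^ n * (C * fact n powr b)" using le[of n] by (simp add: mult_ac)
    finally have "((2 * Y) powr b) ^ n * B \<le> C * fact n powr b"
      using pos by (simp only: mult_le_cancel_left_pos)
    moreover have "((2 * Y) powr b) ^ n = ((2 * Y) ^ n) powr b"
      using Y b by (intro powr_power_commute) auto
    ultimately have "((2 * Y) ^ n) powr b / fact n powr b \<le> C / B"
      using B by (simp add: field_simps)
    then have "((2 * Y) ^ n / fact n) powr b \<le> C / B" using Y by (simp add: powr_divide)
    then have "(((2 * Y) ^ n / fact n) powr b) powr (1 / b) \<le> K"
      unfolding K_def using b by (intro powr_mono2) auto
    then have "(2 * Y) ^ n / fact n \<le> K" using Y b by (simp add: powr_powr)
    then show ?thesis by (simp add: power_mult_distrib field_simps power_divide)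
  qed
  have "exp Y = (\<Sum>n. Y ^ n / fact n)" using exp_converges[of Y] by (simp add: sums_iff field_simps)
  also have "\<dots> \<le> (\<Sum>n. K * (1 / 2) ^ n)"
  proof (intro suminf_le summand)
    show "summable (\<lambda>n. Y ^ n / fact n)" using exp_converges[of Y] by (simp add: sums_iff field_simps)
    show "summable (\<lambda>n. K * (1 / 2) ^ n)" by (intro summable_mult summable_geometric) simp
  qed
  also have "\<dots> = 2 * K" by (subst suminf_mult) (auto simp: suminf_geometric summable_geometric)
  finally have "exp Y powr b \<le> (2 * K) powr b" using b by (intro powr_mono2) auto
  also have "\<dots> = 2 powr b * (C / B)" unfolding K_def using b B C by (simp add: powr_mult powr_powr)
  finally have "exp Y powr b \<le> 2 powr b * (C / B)" .
  moreover have "exp Y powr b = exp (r * X powr (1 / b))" using b by (simp add: exp_powr_real Y_def)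
  ultimately show ?thesis using B by (simp add: field_simps)
qed

lemma powr_add_le:
  fixes X Y a :: real
  assumes "X \<ge> 0" "Y \<ge> 0" "a > 0"
  shows "(X + Y) powr a \<le> 2 powr a * (X powr a + Y powr a)"
proof -
  have "(X + Y) powr a \<le> (2 * max X Y) powr a" using assms by (intro powr_mono2) auto
  also have "\<dots> = 2 powr a * max X Y powr a" using assms by (simp add: powr_mult)
  also have "\<dots> \<le> 2 powr a * (X powr a + Y powr a)" by (intro mult_left_mono) (auto simp: max_def)
  finally show ?thesis .
qed

lemma norm_add_powr_le:
  fixes x y :: "'a::real_normed_vector"
  assumes "a > 0"
  shows "norm (x + y) powr a \<le> 2 powr a * (norm x powr a + norm y powr a)"
proof -
  have "norm (x + y) powr a \<le> (norm x + norm y) powr a"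
    using assms by (intro powr_mono2 norm_triangle_ineq) auto
  also have "\<dots> \<le> 2 powr a * (norm x powr a + norm y powr a)" using assms by (intro powr_add_le) auto
  finally show ?thesis .
qed

text \<open>A multinomial coefficient is at most \<open>card S ^ n\<close>. In the induction a
  single term of the binomial expansion of \<open>(k + 1) ^ (a x + n)\<close> is kept.\<close>

lemma fact_sum_le:
  assumes "finite S"
  shows "fact (\<Sum>j\<in>S. a j) \<le> real (card S) ^ (\<Sum>j\<in>S. a j) * (\<Prod>j\<in>S. fact (a j))"
  using assms
proof (induction S)
  case (insert x S)
  define n where "n = (\<Sum>j\<in>S. a j)"
  define k where "k = real (card S)"
  have bin: "real ((a x + n) choose n) * k ^ n \<le> (k + 1) ^ (a x + n)"
  proof -
    have "real ((a x + n) choose n) * k ^ n * 1 ^ (a x + n - n)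
        \<le> (\<Sum>i\<le>a x + n. real ((a x + n) choose i) * k ^ i * 1 ^ (a x + n - i))"
      by (rule member_le_sum) (auto simp: k_def)
    then show ?thesis by (simp add: binomial_ring)
  qed
  have "(fact (a x + n) :: real) = real ((a x + n) choose n) * (fact n * fact (a x))"
    using binomial_fact_lemma[of n "a x + n"] 
    by (metis (no_types, lifting) add_diff_cancel_right' le_add2 mult.commute of_nat_fact of_nat_mult)
  also have "\<dots> \<le> real ((a x + n) choose n) * ((k ^ n * (\<Prod>j\<in>S. fact (a j))) * fact (a x))"
    using insert.IH unfolding n_def k_def by (intro mult_left_mono mult_right_mono) auto
  also have "\<dots> = (real ((a x + n) choose n) * k ^ n) * (fact (a x) * (\<Prod>j\<in>S. fact (a j)))" by simp
  also have "\<dots> \<le> (k + 1) ^ (a x + n) * (fact (a x) * (\<Prod>j\<in>S. fact (a j)))"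
    by (intro mult_right_mono bin mult_nonneg_nonneg prod_nonneg) auto
  finally show ?case using insert by (simp add: n_def k_def add.commute)
qed simp

subsection \<open>An integrable weight\<close>

text \<open>A tensor product, so that integrability reduces to one variable. Its reciprocal is a
  polynomial, and it changes by a bounded factor under short shifts along an axis, which makes it
  the standard majorant for dominated convergence.\<close>

definition wt :: "real ^ 'd::finite \<Rightarrow> real" where
  "wt x = (\<Prod>j\<in>UNIV. 1 / (1 + (x $ j)\<^sup>2))"

lemma one_plus_square_pos: "1 + (x::real)\<^sup>2 > 0" by (simp add: add_pos_nonneg)

lemma wt_pos: "wt x > 0" unfolding wt_def by (intro prod_pos) (simp add: one_plus_square_pos)

lemma wt_nonneg [simp]: "wt x \<ge> 0" using wt_pos[of x] by simp

lemma wt_le_1: "wt x \<le> 1" unfolding wt_def by (intro prod_le_1) (auto simp: field_simps add_pos_nonneg)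

text \<open>Lebesgue measure is built on functions over the set of basis vectors, whereas the
  product integrals below are indexed by the coordinate type; the two product measures are matched
  along \<open>j \<mapsto> axis j 1\<close>.\<close>

lemma lborel_vec_conv_PiM:
  "(lborel :: (real ^ 'd::finite) measure) =
     distr (\<Pi>\<^sub>M j\<in>UNIV. lborel) borel (\<lambda>f. \<chi> j. f j)"
proof -
  have m: "(\<lambda>f. \<Sum>b\<in>Basis. f b *\<^sub>R b) \<in> measurable (\<Pi>\<^sub>M b\<in>(Basis :: (real^'d) set). (lborel::real measure)) borel"
    by measurable
  have inj: "inj_on (\<lambda>j::'d. axis j (1::real)) UNIV"
    by (auto simp: inj_on_def axis_eq_axis)
  have B: "(Basis :: (real^'d) set) = range (\<lambda>j. axis j 1)" by (auto simp: Basis_vec_def)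
  interpret P: product_sigma_finite "\<lambda>_::'d. lborel :: real measure" ..
  interpret Q: product_sigma_finite "\<lambda>_::real^'d. lborel :: real measure" ..
  define T where "T = (\<lambda>f. \<lambda>b\<in>(Basis :: (real^'d) set). f (THE j::'d. b = axis j 1) :: real)"
  have T_ax: "T f (axis j 1) = f j" for f j
    by (auto simp: T_def axis_eq_axis B)
  have Tm [measurable]: "T \<in> measurable (\<Pi>\<^sub>M j\<in>UNIV. lborel) (\<Pi>\<^sub>M b\<in>Basis. lborel)"
    unfolding T_def by measurable
  \<comment> \<open>A product measure is characterised by its values on boxes, so only these are
    compared.\<close>
  have TP: "(\<Pi>\<^sub>M b\<in>(Basis :: (real^'d) set). (lborel::real measure)) = distr (\<Pi>\<^sub>M j\<in>(UNIV::'d set). lborel) (\<Pi>\<^sub>M b\<in>Basis. lborel) T"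
  proof (rule Q.PiM_eqI[symmetric])
    show "finite (Basis :: (real^'d) set)" by simp
    fix A :: "real^'d \<Rightarrow> real set" assume A: "\<And>i. i \<in> Basis \<Longrightarrow> A i \<in> sets lborel"
    have "emeasure (distr (\<Pi>\<^sub>M j\<in>(UNIV::'d set). lborel) (\<Pi>\<^sub>M b\<in>Basis. lborel) T) (Pi\<^sub>E Basis A)
        = emeasure (\<Pi>\<^sub>M j\<in>(UNIV::'d set). lborel) (T -` (Pi\<^sub>E Basis A) \<inter> space (\<Pi>\<^sub>M j\<in>(UNIV::'d set). lborel))"
      using A by (intro emeasure_distr) (auto intro!: sets_PiM_I_finite)
    also have "T -` (Pi\<^sub>E Basis A) \<inter> space (\<Pi>\<^sub>M j\<in>(UNIV::'d set). lborel) = Pi\<^sub>E UNIV (\<lambda>j. A (axis j 1))"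
    proof -
      have "T f \<in> Pi\<^sub>E Basis A \<longleftrightarrow> (\<forall>j. f j \<in> A (axis j 1))" for f
      proof -
        have "T f \<in> Pi\<^sub>E Basis A \<longleftrightarrow> (\<forall>b\<in>Basis. T f b \<in> A b)"
          by (auto simp: PiE_iff T_def)
        then show ?thesis by (simp add: B T_ax)
      qed
      then show ?thesis by (intro set_eqI) (simp add: space_PiM PiE_iff)
    qed
    also have "emeasure (\<Pi>\<^sub>M j\<in>(UNIV::'d set). lborel) \<dots> = (\<Prod>j\<in>UNIV. emeasure lborel (A (axis j 1)))"
      using A by (intro P.emeasure_PiM) (auto simp: B)
    also have "\<dots> = (\<Prod>b\<in>Basis. emeasure lborel (A b))"
      unfolding B by (subst prod.reindex[OF inj]) simp
    finally show "emeasure (distr (\<Pi>\<^sub>M j\<in>(UNIV::'d set). lborel) (\<Pi>\<^sub>M b\<in>Basis. lborel) T) (Pi\<^sub>E Basis A)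
        = (\<Prod>b\<in>Basis. emeasure lborel (A b))" .
  qed simp
  have "(lborel :: (real ^ 'd) measure) = distr (distr (\<Pi>\<^sub>M j\<in>(UNIV::'d set). lborel) (\<Pi>\<^sub>M b\<in>Basis. lborel) T) borel (\<lambda>f. \<Sum>b\<in>Basis. f b *\<^sub>R b)"
    by (subst lborel_eq) (simp only: TP[symmetric])
  also have "\<dots> = distr (\<Pi>\<^sub>M j\<in>UNIV. lborel) borel ((\<lambda>f. \<Sum>b\<in>Basis. f b *\<^sub>R b) \<circ> T)"
    by (rule distr_distr) (use m in auto)
  also have "((\<lambda>f. \<Sum>b\<in>Basis. f b *\<^sub>R b) \<circ> T) = (\<lambda>f. \<chi> j::'d. f j)"
  proof (intro ext, unfold vec_eq_iff, intro allI)
    fix f :: "'d \<Rightarrow> real" and i :: 'd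
    have "(\<Sum>b\<in>Basis. T f b *\<^sub>R b) $ i = (\<Sum>j\<in>UNIV. f j * (axis j 1 :: real^'d) $ i)"
      unfolding B by (subst sum.reindex[OF inj]) (simp add: T_ax)
    also have "\<dots> = f i" by (simp add: axis_def if_distrib cong: if_cong)
    finally show "((\<lambda>f. \<Sum>b\<in>Basis. f b *\<^sub>R b) \<circ> T) f $ i = (\<chi> j. f j) $ i" by simp
  qed
  finally show ?thesis .
qed

lemma
  fixes f :: "'d::finite \<Rightarrow> real \<Rightarrow> 'a::{real_normed_field, banach, second_countable_topology}"
  assumes f: "\<And>j. integrable lborel (f j)"
  shows integrable_lborel_vec_prod: "integrable lborel (\<lambda>x::real^'d. \<Prod>j\<in>UNIV. f j (x $ j))"
    and integral_lborel_vec_prod: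
      "(LINT x|lborel. (\<Prod>j\<in>UNIV. f j ((x::real^'d) $ j))) = (\<Prod>j\<in>UNIV. LINT s|lborel. f j s)"
proof -
  interpret P: product_sigma_finite "\<lambda>_::'d. lborel :: real measure" ..
  have m: "(\<lambda>f. \<chi> j. f j) \<in> measurable (\<Pi>\<^sub>M j\<in>(UNIV::'d set). lborel) (borel :: (real^'d) measure)"
  proof -
    have "(\<lambda>f. \<chi> j. f j) = (\<lambda>f. \<Sum>j\<in>UNIV. f j *\<^sub>R (axis j 1 :: real^'d))"
      by (auto simp: fun_eq_iff vec_eq_iff axis_def if_distrib cong: if_cong)
    also have "\<dots> \<in> measurable (\<Pi>\<^sub>M j\<in>(UNIV::'d set). lborel) borel" by measurable
    finally show ?thesis .
  qed
  have fm [measurable]: "f j \<in> borel_measurable borel" for j using f[of j] by (auto dest: borel_measurable_integrable)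
  have pm: "(\<lambda>x::real^'d. \<Prod>j\<in>UNIV. f j (x $ j)) \<in> borel_measurable borel" by measurable
  show "integrable lborel (\<lambda>x::real^'d. \<Prod>j\<in>UNIV. f j (x $ j))"
    by (subst lborel_vec_conv_PiM, subst integrable_distr_eq[OF m pm])
       (simp add: P.product_integrable_prod[OF _ f])
  show "(LINT x|lborel. (\<Prod>j\<in>UNIV. f j ((x::real^'d) $ j))) = (\<Prod>j\<in>UNIV. LINT s|lborel. f j s)"
    by (subst lborel_vec_conv_PiM, subst integral_distr[OF m pm])
       (simp add: P.product_integral_prod[OF _ f])
qed

lemma integrable_wt: "integrable lborel (wt :: real^'d::finite \<Rightarrow> real)"
proof -
  have "set_integrable lborel (einterval (-\<infinity>) \<infinity>) (\<lambda>x::real. inverse (1 + x\<^sup>2))"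
    by (rule integrable_inverse_1_plus_square)
  then have "integrable lborel (\<lambda>x::real. 1 / (1 + x\<^sup>2))"
    by (simp add: set_integrable_def einterval_def inverse_eq_divide)
  then show ?thesis unfolding wt_def by (rule integrable_lborel_vec_prod)
qed

text \<open>A derivative bounded by \<open>K * wt\<close> then gives difference quotients with the
  integrable majorant \<open>3 * K * wt\<close>, uniformly for steps of length at most 1.\<close>

lemma wt_shift_le:
  fixes x :: "real^'d::finite"
  assumes "\<bar>s\<bar> \<le> 1"
  shows "wt (x + s *\<^sub>R axis j 1) \<le> 3 * wt x"
proof -
  \<comment> \<open>The sides of \<open>y^2 \<le> 2 (y + s)^2 + 2 s^2\<close> differ by the square
    \<open>(y + 2 s)^2\<close>.\<close>
  have one: "1 + y\<^sup>2 \<le> 3 * (1 + (y + s)\<^sup>2)" for y :: real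
  proof -
    have "y\<^sup>2 \<le> 2 * (y + s)\<^sup>2 + 2 * s\<^sup>2"
      using sum_squares_ge_zero[of "y + 2 * s" 0] by (simp add: power2_eq_square algebra_simps)
    moreover have "s\<^sup>2 \<le> 1" using assms by (simp add: abs_square_le_1)
    ultimately have "1 + y\<^sup>2 \<le> 3 + 2 * (y + s)\<^sup>2" by linarith
    then show ?thesis using zero_le_power2[of "y + s"] unfolding distrib_left by linarith
  qed
  have sp: "wt z = (1 / (1 + (z $ j)\<^sup>2)) * (\<Prod>l\<in>UNIV - {j}. 1 / (1 + (z $ l)\<^sup>2))" for z :: "real^'d"
    unfolding wt_def by (rule prod.remove) auto
  have "wt (x + s *\<^sub>R axis j 1) = (1 / (1 + (x $ j + s)\<^sup>2)) * (\<Prod>l\<in>UNIV - {j}. 1 / (1 + (x $ l)\<^sup>2))"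
    unfolding sp by (intro arg_cong2[where f="(*)"] prod.cong) (auto simp: axis_def)
  also have "\<dots> \<le> (3 * (1 / (1 + (x $ j)\<^sup>2))) * (\<Prod>l\<in>UNIV - {j}. 1 / (1 + (x $ l)\<^sup>2))"
    using one[of "x $ j"] by (intro mult_right_mono prod_nonneg) (auto simp: field_simps add_pos_nonneg)
  also have "\<dots> = 3 * wt x" unfolding sp by simp
  finally show ?thesis .
qed

lemma inverse_wt_le: "1 / wt (x::real^'d::finite) \<le> (1 + (norm x)\<^sup>2) ^ CARD('d)"
proof -
  have "1 / wt x = (\<Prod>j\<in>UNIV. 1 + (x $ j)\<^sup>2)" by (simp add: wt_def prod_dividef)
  also have "\<dots> \<le> (\<Prod>j\<in>(UNIV::'d set). 1 + (norm x)\<^sup>2)"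
    by (intro prod_mono) (auto simp: add_nonneg_nonneg intro!: power2_le_iff_abs_le[THEN iffD2] component_le_norm_cart)
  finally show ?thesis by simp
qed

text \<open>The reciprocal of the weight grows polynomially, so every stretched exponential beats
  it.\<close>

lemma exp_le_wt:
  assumes "r > 0" "b > 0"
  shows "\<exists>C>0. \<forall>x::real^'d::finite. exp (- r * norm x powr (1 / b)) \<le> C * wt x"
proof -
  define D where "D = CARD('d)"
  define C where "C = 2 ^ D * (1 + ((b / r) powr b) ^ (2 * D) * fact (2 * D) powr b)"
  have "exp (- r * norm x powr (1 / b)) \<le> C * wt x" for x :: "real^'d"
  proof -
    define e where "e = exp (r * norm x powr (1 / b))"
    have e: "e \<ge> 1" using assms by (simp add: e_def)
    have "1 / wt x \<le> (1 + (norm x)\<^sup>2) ^ D" unfolding D_def by (rule inverse_wt_le)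
    also have "\<dots> \<le> (2 * max 1 ((norm x)\<^sup>2)) ^ D" by (intro power_mono) auto
    also have "\<dots> = 2 ^ D * max 1 ((norm x)\<^sup>2) ^ D" by (rule power_mult_distrib)
    also have "max 1 ((norm x)\<^sup>2) ^ D \<le> 1 + norm x ^ (2 * D)" by (auto simp: max_def power_mult)
    also have "norm x ^ (2 * D) \<le> ((b / r) powr b) ^ (2 * D) * fact (2 * D) powr b * e"
      unfolding e_def by (rule power_le_fact_powr_exp) (use assms in auto)
    also have "1 + ((b / r) powr b) ^ (2 * D) * fact (2 * D) powr b * e
        \<le> (1 + ((b / r) powr b) ^ (2 * D) * fact (2 * D) powr b) * e" using e by (simp add: algebra_simps)
    finally have "1 / wt x \<le> C * e" by (simp add: C_def mult.assoc)
    then have "1 \<le> C * e * wt x" using wt_pos[of x] by (simp add: field_simps)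
    moreover have "exp (- r * norm x powr (1 / b)) = 1 / e" by (simp add: e_def exp_minus field_simps)
    moreover have "1 / e \<le> C * wt x" using calculation(1) e by (simp add: field_simps)
    ultimately show ?thesis by simp
  qed
  moreover have "C > 0" unfolding C_def by (intro mult_pos_pos add_pos_nonneg) auto
  ultimately show ?thesis by blast
qed

lemma integrable_wt_bound:
  fixes G :: "real^'d::finite \<Rightarrow> complex"
  assumes "continuous_on UNIV G" and "\<And>x. cmod (G x) \<le> K * wt x"
  shows "integrable lborel G"
proof (rule Bochner_Integration.integrable_bound)
  show "integrable lborel (\<lambda>x::real^'d. K * wt x)" by (intro integrable_mult_right integrable_wt)
  show "G \<in> borel_measurable lborel" using assms(1) by (simp add: borel_measurable_continuous_onI)
  show "AE x in lborel. norm (G x) \<le> norm (K * wt x)"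
    using assms(2) by (intro AE_I2) (metis abs_ge_self order_trans real_norm_def)
qed

subsection \<open>Families of coordinate derivatives\<close>

text \<open>\<open>H j n\<close> plays the role of the \<open>n\<close>-th derivative of \<open>H j 0\<close> in the direction of the
  \<open>j\<close>-th coordinate. Mixed derivatives are never needed: bounds for the pure ones already determine
  the decay of the Fourier transform.\<close>

definition coord_fam :: "('d::finite \<Rightarrow> nat \<Rightarrow> real^'d \<Rightarrow> complex) \<Rightarrow> bool" where
  "coord_fam H \<longleftrightarrow> (\<forall>j n. continuous_on UNIV (H j n)) \<and>
     (\<forall>j n x. ((\<lambda>s. H j n (x + s *\<^sub>R axis j 1)) has_vector_derivative H j (Suc n) x) (at 0)) \<and>
     (\<forall>i j. H i 0 = H j 0)"

text \<open>\<open>a\<close> is the Gevrey order and \<open>h\<close> the scale of the derivatives.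
  The weight \<open>A\<close> is an arbitrary function, so that products, translations and
  reflections of families act on it pointwise.\<close>

definition fam_bound ::
    "real \<Rightarrow> real \<Rightarrow> (real^'d \<Rightarrow> real) \<Rightarrow> ('d::finite \<Rightarrow> nat \<Rightarrow> real^'d \<Rightarrow> complex) \<Rightarrow> bool" where
  "fam_bound a h A H \<longleftrightarrow> (\<forall>j n x. cmod (H j n x) \<le> A x * h ^ n * fact n powr a)"

section \<open>Products, translations and reflections of families\<close>

definition fam_mult ::
    "('d::finite \<Rightarrow> nat \<Rightarrow> real^'d \<Rightarrow> complex) \<Rightarrow> ('d \<Rightarrow> nat \<Rightarrow> real^'d \<Rightarrow> complex)
      \<Rightarrow> 'd \<Rightarrow> nat \<Rightarrow> real^'d \<Rightarrow> complex" where
  "fam_mult P H j n x = (\<Sum>k\<le>n. of_nat (n choose k) * P j k x * H j (n - k) x)"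

lemma fam_bound_nonneg:
  assumes "fam_bound a h A (H :: 'd::finite \<Rightarrow> nat \<Rightarrow> real^'d \<Rightarrow> complex)"
  shows "A x \<ge> 0"
proof -
  have "cmod (H undefined 0 x) \<le> A x * h ^ 0 * fact 0 powr a"
    using assms unfolding fam_bound_def by blast
  then have "cmod (H undefined 0 x) \<le> A x" by simp
  then show ?thesis by (rule order_trans[OF norm_ge_zero])
qed

lemma coord_famD:
  assumes "coord_fam H"
  shows "continuous_on UNIV (H j n)"
    and "((\<lambda>s. H j n (x + s *\<^sub>R axis j 1)) has_vector_derivative H j (Suc n) x) (at 0)"
    and "H i 0 = H j 0"
  using assms unfolding coord_fam_def by blast+

lemma coord_fam_deriv:
  assumes "coord_fam H"
  shows "((\<lambda>s. H j n (x + s *\<^sub>R axis j 1)) has_vector_derivative H j (Suc n) (x + s *\<^sub>R axis j 1)) (at s)"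
proof -
  have "((\<lambda>u. H j n ((x + s *\<^sub>R axis j 1) + u *\<^sub>R axis j 1)) has_vector_derivative H j (Suc n) (x + s *\<^sub>R axis j 1)) (at (s - s))"
    using coord_famD(2)[OF assms] by simp
  then have "(((\<lambda>u. H j n ((x + s *\<^sub>R axis j 1) + u *\<^sub>R axis j 1)) \<circ> (\<lambda>u. u - s)) has_vector_derivative
      1 *\<^sub>R H j (Suc n) (x + s *\<^sub>R axis j 1)) (at s)"
    by (intro vector_diff_chain_at) (auto intro!: derivative_eq_intros)
  then show ?thesis by (simp add: o_def algebra_simps scaleR_diff_left)
qed

lemma fam_mult_0: "fam_mult P H j 0 x = P j 0 x * H j 0 x"
  by (simp add: fam_mult_def)

text \<open>Pascal's rule, after shifting the index in the terms where \<open>P\<close> is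
  differentiated.\<close>

lemma leibniz_sum:
  fixes P H :: "nat \<Rightarrow> 'a::comm_ring_1"
  shows "(\<Sum>k\<le>n. of_nat (n choose k) * (P (Suc k) * H (n - k) + P k * H (Suc n - k)))
    = (\<Sum>k\<le>Suc n. of_nat (Suc n choose k) * (P k * H (Suc n - k)))"
proof -
  have "(\<Sum>k\<le>Suc n. of_nat (Suc n choose k) * (P k * H (Suc n - k)))
      = P 0 * H (Suc n) + (\<Sum>k\<le>n. of_nat (Suc n choose Suc k) * (P (Suc k) * H (n - k)))"
    by (subst sum.atMost_Suc_shift) simp
  also have "(\<Sum>k\<le>n. of_nat (Suc n choose Suc k) * (P (Suc k) * H (n - k)))
      = (\<Sum>k\<le>n. of_nat (n choose k) * (P (Suc k) * H (n - k))) +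
        (\<Sum>k\<le>n. of_nat (n choose Suc k) * (P (Suc k) * H (n - k)))"
    by (simp add: sum.distrib[symmetric] algebra_simps)
  also have "P 0 * H (Suc n) + (\<dots>) =
      (\<Sum>k\<le>n. of_nat (n choose k) * (P (Suc k) * H (n - k))) +
      (\<Sum>k\<le>Suc n. of_nat (n choose k) * (P k * H (Suc n - k)))"
  proof -
    have "(\<Sum>k\<le>Suc n. of_nat (n choose k) * (P k * H (Suc n - k)))
        = P 0 * H (Suc n) + (\<Sum>k\<le>n. of_nat (n choose Suc k) * (P (Suc k) * H (n - k)))"
      by (subst sum.atMost_Suc_shift) simp
    then show ?thesis by (simp only: add_ac)
  qed
  also have "(\<Sum>k\<le>Suc n. of_nat (n choose k) * (P k * H (Suc n - k)))
      = (\<Sum>k\<le>n. of_nat (n choose k) * (P k * H (Suc n - k)))" by (simp add: binomial_eq_0)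
  finally show ?thesis by (simp add: sum.distrib[symmetric] algebra_simps)
qed

lemma coord_fam_mult:
  assumes P: "coord_fam P" and H: "coord_fam H"
  shows "coord_fam (fam_mult P H)"
  unfolding coord_fam_def
proof (intro conjI allI)
  show "continuous_on UNIV (fam_mult P H j n)" for j n
    unfolding fam_mult_def by (intro continuous_intros coord_famD(1) P H)
  show "fam_mult P H i 0 = fam_mult P H j 0" for i j
    by (rule ext) (simp add: fam_mult_0 coord_famD(3)[OF P, of i j] coord_famD(3)[OF H, of i j])
  fix j n and x :: "real^'a"
  let ?e = "axis j 1 :: real^'a"
  have "((\<lambda>s. fam_mult P H j n (x + s *\<^sub>R ?e)) has_vector_derivative
      (\<Sum>k\<le>n. of_nat (n choose k) * (P j (Suc k) x * H j (n - k) x + P j k x * H j (Suc n - k) x))) (at 0)"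
  proof -
    have "((\<lambda>s. P j k (x + s *\<^sub>R ?e) * H j (n - k) (x + s *\<^sub>R ?e)) has_vector_derivative
        (P j (Suc k) x * H j (n - k) x + P j k x * H j (Suc n - k) x)) (at 0)" if "k \<le> n" for k
      using has_vector_derivative_mult[OF coord_famD(2)[OF P, where j=j and x=x and n=k] coord_famD(2)[OF H, where j=j and x=x and n="n-k"]] that
      by (simp add: Suc_diff_le add.commute)
    then have "((\<lambda>s. of_nat (n choose k) * (P j k (x + s *\<^sub>R ?e) * H j (n - k) (x + s *\<^sub>R ?e))) has_vector_derivative
        of_nat (n choose k) * (P j (Suc k) x * H j (n - k) x + P j k x * H j (Suc n - k) x)) (at 0)" if "k \<le> n" for k
      using that by (intro has_vector_derivative_mult_right) auto
    then have "((\<lambda>s. \<Sum>k\<le>n. of_nat (n choose k) * (P j k (x + s *\<^sub>R ?e) * H j (n - k) (x + s *\<^sub>R ?e))) has_vector_derivative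
        (\<Sum>k\<le>n. of_nat (n choose k) * (P j (Suc k) x * H j (n - k) x + P j k x * H j (Suc n - k) x))) (at 0)"
      by (intro has_vector_derivative_sum) auto
    then show ?thesis by (simp add: fam_mult_def mult.assoc)
  qed
  then show "((\<lambda>s. fam_mult P H j n (x + s *\<^sub>R ?e)) has_vector_derivative fam_mult P H j (Suc n) x) (at 0)"
    by (subst (asm) leibniz_sum) (simp add: fam_mult_def mult.assoc)
qed

lemma fact_mult_fact_le:
  assumes "k \<le> n"
  shows "(fact k * fact (n - k) :: real) \<le> fact n"
proof -
  have "fact k * fact (n - k) dvd (fact n :: nat)" using assms by (rule choose_dvd)
  then have "fact k * fact (n - k) \<le> (fact n :: nat)" by (intro dvd_imp_le) auto
  then show ?thesis by (metis of_nat_fact of_nat_le_iff of_nat_mult)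
qed

text \<open>Since \<open>k! (n - k)! \<le> n!\<close>, all Leibniz terms obey the same bound, and
  the binomial coefficients add up to \<open>2 ^ n\<close>; this is the loss from \<open>h\<close>
  to \<open>2 * h\<close>.\<close>

lemma fam_bound_mult:
  assumes P: "fam_bound a h A P" and H: "fam_bound a h B H"
    and a: "a \<ge> 0" and h: "h > 0"
  shows "fam_bound a (2 * h) (\<lambda>x. A x * B x) (fam_mult P H)"
  unfolding fam_bound_def
proof (intro allI)
  fix j n x
  have A0: "A x \<ge> 0" by (rule fam_bound_nonneg[OF P])
  have B0: "B x \<ge> 0" by (rule fam_bound_nonneg[OF H])
  have "cmod (fam_mult P H j n x) \<le> (\<Sum>k\<le>n. real (n choose k) * (A x * B x * h ^ n * fact n powr a))"
    unfolding fam_mult_def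
  proof (intro order_trans[OF norm_sum] sum_mono)
    fix k assume "k \<in> {..n}"
    then have k: "k \<le> n" by simp
    have "cmod (P j k x) * cmod (H j (n - k) x) \<le> (A x * h ^ k * fact k powr a) * (B x * h ^ (n - k) * fact (n - k) powr a)"
      by (intro mult_mono) (use P H A0 h in \<open>auto simp: fam_bound_def\<close>)
    also have "\<dots> = A x * B x * (h ^ k * h ^ (n - k)) * (fact k * fact (n - k)) powr a"
      by (simp add: powr_mult)
    also have "h ^ k * h ^ (n - k) = h ^ n" using k by (simp flip: power_add)
    also have "A x * B x * h ^ n * (fact k * fact (n - k)) powr a \<le> A x * B x * h ^ n * fact n powr a"
      using A0 B0 h a fact_mult_fact_le[OF k] by (intro mult_left_mono powr_mono2) auto
    finally show "cmod (of_nat (n choose k) * P j k x * H j (n - k) x) \<le> real (n choose k) * (A x * B x * h ^ n * fact n powr a)"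
      by (simp add: norm_mult mult.assoc mult_left_mono)
  qed
  also have "\<dots> = 2 ^ n * (A x * B x * h ^ n * fact n powr a)"
    by (simp add: sum_distrib_right[symmetric] choose_row_sum flip: of_nat_sum)
  finally show "cmod (fam_mult P H j n x) \<le> A x * B x * (2 * h) ^ n * fact n powr a"
    by (simp add: power_mult_distrib mult_ac)
qed

lemma fam_bound_mono:
  assumes "fam_bound a h A H" and "\<And>x. A x \<le> B x" and "h \<le> h'" and "0 < h"
  shows "fam_bound a h' B H"
  unfolding fam_bound_def
proof (intro allI)
  fix j n x
  have B0: "B x \<ge> 0" using fam_bound_nonneg[OF assms(1), of x] assms(2)[of x] by linarith
  have "cmod (H j n x) \<le> A x * h ^ n * fact n powr a" using assms(1) by (simp add: fam_bound_def)
  also have "\<dots> \<le> B x * h' ^ n * fact n powr a"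
    using assms B0 by (intro mult_right_mono mult_mono power_mono) auto
  finally show "cmod (H j n x) \<le> B x * h' ^ n * fact n powr a" .
qed

definition fam_shift :: "real^'d \<Rightarrow> ('d::finite \<Rightarrow> nat \<Rightarrow> real^'d \<Rightarrow> complex) \<Rightarrow> 'd \<Rightarrow> nat \<Rightarrow> real^'d \<Rightarrow> complex" where
  "fam_shift a H j n x = H j n (x + a)"

lemma coord_fam_shift:
  assumes "coord_fam H"
  shows "coord_fam (fam_shift a H)"
  unfolding coord_fam_def fam_shift_def
proof (intro conjI allI)
  show "continuous_on UNIV (\<lambda>x. H j n (x + a))" for j n
    by (rule continuous_on_compose2[OF coord_famD(1)[OF assms]]) (auto intro!: continuous_intros)
  show "(\<lambda>x. H i 0 (x + a)) = (\<lambda>x. H j 0 (x + a))" for i j using coord_famD(3)[OF assms, of i j] by simp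
  show "((\<lambda>s. H j n (x + s *\<^sub>R axis j 1 + a)) has_vector_derivative H j (Suc n) (x + a)) (at 0)" for j n x
    using coord_famD(2)[OF assms, of j n "x + a"] by (simp add: algebra_simps)
qed

definition fam_neg :: "('d::finite \<Rightarrow> nat \<Rightarrow> real^'d \<Rightarrow> complex) \<Rightarrow> 'd \<Rightarrow> nat \<Rightarrow> real^'d \<Rightarrow> complex" where
  "fam_neg H j n x = (-1) ^ n * H j n (- x)"

lemma coord_fam_neg:
  assumes "coord_fam H"
  shows "coord_fam (fam_neg H)"
  unfolding coord_fam_def
proof (intro conjI allI)
  show "continuous_on UNIV (fam_neg H j n)" for j n
    unfolding fam_neg_def
    by (intro continuous_intros continuous_on_compose2[OF coord_famD(1)[OF assms]]) auto
  show "fam_neg H i 0 = fam_neg H j 0" for i j by (rule ext) (simp add: fam_neg_def coord_famD(3)[OF assms, of i j])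
  fix j n and x :: "real^'a"
  have "((\<lambda>s. H j n (- x + s *\<^sub>R axis j 1)) has_vector_derivative H j (Suc n) (- x)) (at (- 0))"
    using coord_famD(2)[OF assms, of j n "- x"] by simp
  then have "(((\<lambda>s. H j n (- x + s *\<^sub>R axis j 1)) \<circ> uminus) has_vector_derivative (-1) *\<^sub>R H j (Suc n) (- x)) (at 0)"
    by (intro vector_diff_chain_at) (auto intro!: derivative_eq_intros)
  then have "((\<lambda>s. H j n (- (x + s *\<^sub>R axis j 1))) has_vector_derivative - H j (Suc n) (- x)) (at 0)"
    by (simp add: o_def minus_diff_commute)
  then have "((\<lambda>s. (-1) ^ n * H j n (- (x + s *\<^sub>R axis j 1))) has_vector_derivative (-1) ^ n * (- H j (Suc n) (- x))) (at 0)"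
    by (rule has_vector_derivative_mult_right)
  then show "((\<lambda>s. fam_neg H j n (x + s *\<^sub>R axis j 1)) has_vector_derivative fam_neg H j (Suc n) x) (at 0)"
    by (simp add: fam_neg_def)
qed

lemma fam_bound_neg: "fam_bound a h A H \<Longrightarrow> fam_bound a h (\<lambda>x. A (- x)) (fam_neg H)"
  by (auto simp: fam_bound_def fam_neg_def norm_mult norm_power)

lemma fam_bound_shift: "fam_bound a h A H \<Longrightarrow> fam_bound a h (\<lambda>x. A (x + c)) (fam_shift c H)"
  by (auto simp: fam_bound_def fam_shift_def)

section \<open>Monomials as families\<close>

text \<open>\<open>(\<beta> j choose n) * n!\<close> is the falling factorial; it vanishes for
  \<open>n > \<beta> j\<close>, where the truncated exponent \<open>\<beta> j - n\<close> alone
  would give a wrong value.\<close>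

definition monom_fam :: "('d::finite \<Rightarrow> nat) \<Rightarrow> 'd \<Rightarrow> nat \<Rightarrow> real^'d \<Rightarrow> complex" where
  "monom_fam \<beta> j n x = of_real ((\<Prod>l\<in>UNIV - {j}. (x $ l) ^ \<beta> l) *
     (real (\<beta> j choose n) * fact n * (x $ j) ^ (\<beta> j - n)))"

lemma monom_fam_0: "monom_fam \<beta> j 0 x = of_real (\<Prod>l\<in>UNIV. (x $ l) ^ \<beta> l)"
  by (simp add: monom_fam_def prod.remove[of UNIV j] mult.commute)

lemma coord_fam_monom: "coord_fam (monom_fam \<beta>)"
  unfolding coord_fam_def
proof (intro conjI allI)
  show "continuous_on UNIV (monom_fam \<beta> j n)" for j n
    unfolding monom_fam_def by (intro continuous_intros)
  show "monom_fam \<beta> i 0 = monom_fam \<beta> j 0" for i j by (rule ext) (simp add: monom_fam_0)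
  fix j :: 'a and n and x :: "real^'a"
  define c where "c = (\<Prod>l\<in>UNIV - {j}. (x $ l) ^ \<beta> l)"
  have eq: "monom_fam \<beta> j n (x + s *\<^sub>R axis j 1) = of_real (c * (real (\<beta> j choose n) * fact n * (x $ j + s) ^ (\<beta> j - n)))" for n s
  proof -
    have "(\<Prod>l\<in>UNIV - {j}. ((x + s *\<^sub>R axis j 1) $ l) ^ \<beta> l) = c"
      unfolding c_def by (intro prod.cong) (auto simp: axis_def)
    then show ?thesis unfolding monom_fam_def by (simp add: axis_def)
  qed
  have abs: "real (\<beta> j choose Suc n) * fact (Suc n) = real (\<beta> j choose n) * fact n * real (\<beta> j - n)"
  proof -
    have "(\<beta> j choose Suc n) * Suc n = (\<beta> j choose n) * (\<beta> j - n)"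
      by (metis Suc_times_binomial_add binomial_absorb_comp binomial_absorption mult.commute)
    then have "real (\<beta> j choose Suc n) * real (Suc n) = real (\<beta> j choose n) * real (\<beta> j - n)"
      by (metis of_nat_mult)
    then have "(real (\<beta> j choose Suc n) * real (Suc n)) * fact n = (real (\<beta> j choose n) * real (\<beta> j - n)) * fact n"
      by (rule arg_cong)
    then show ?thesis by (simp only: fact_Suc mult_ac)
  qed
  have "((\<lambda>s. (x $ j + s) ^ (\<beta> j - n)) has_real_derivative (real (\<beta> j - n) * (x $ j) ^ (\<beta> j - Suc n))) (at 0)"
    by (auto intro!: derivative_eq_intros)
  then have "((\<lambda>s. c * (real (\<beta> j choose n) * fact n * (x $ j + s) ^ (\<beta> j - n))) has_real_derivative
      (c * (real (\<beta> j choose n) * fact n * (real (\<beta> j - n) * (x $ j) ^ (\<beta> j - Suc n))))) (at 0)"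
    by (intro DERIV_cmult)
  also have "(c * (real (\<beta> j choose n) * fact n * (real (\<beta> j - n) * (x $ j) ^ (\<beta> j - Suc n))))
     = c * (real (\<beta> j choose Suc n) * fact (Suc n) * (x $ j) ^ (\<beta> j - Suc n))"
    unfolding abs by (simp add: mult.assoc)
  finally have "((\<lambda>s. c * (real (\<beta> j choose n) * fact n * (x $ j + s) ^ (\<beta> j - n))) has_vector_derivative
      c * (real (\<beta> j choose Suc n) * fact (Suc n) * (x $ j) ^ (\<beta> j - Suc n))) (at 0)"
    by (simp only: has_real_derivative_iff_has_vector_derivative)
  then have "((\<lambda>s. complex_of_real (c * (real (\<beta> j choose n) * fact n * (x $ j + s) ^ (\<beta> j - n)))) has_vector_derivative
      complex_of_real (c * (real (\<beta> j choose Suc n) * fact (Suc n) * (x $ j) ^ (\<beta> j - Suc n)))) (at 0)"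
    by (rule bounded_linear.has_vector_derivative[OF bounded_linear_of_real])
  then show "((\<lambda>s. monom_fam \<beta> j n (x + s *\<^sub>R axis j 1)) has_vector_derivative monom_fam \<beta> j (Suc n) x) (at 0)"
    using eq[of "Suc n" 0] by (simp add: eq)
qed

text \<open>The bound is uniform in the multi-index, as required for estimating all derivatives of a
  Fourier transform at once. The factorial \<open>n!\<close> created by differentiation is paid for
  by \<open>n!^a\<close> together with the factor \<open>n!^b\<close> gained in passing from
  \<open>M!^b\<close> to \<open>(M - n)!^b\<close>; this is possible because
  \<open>a + b > 1\<close>.\<close>

lemma fam_bound_monom:
  assumes ab: "a > 0" "b > 0" "a + b > 1" and h: "h > 0"
  shows "\<exists>C>0. \<exists>R>0. \<forall>\<beta> :: 'd::finite \<Rightarrow> nat.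
    fam_bound a h (\<lambda>x. C * h ^ (\<Sum>l\<in>UNIV. \<beta> l) * fact (\<Sum>l\<in>UNIV. \<beta> l) powr b * exp (R * norm x powr (1 / b))) (monom_fam \<beta>)"
proof -
  \<comment> \<open>Half of \<open>h\<close>, to absorb the factor \<open>2 ^ M\<close> that bounds
    the binomial coefficients.\<close>
  define g where "g = h / 2"
  have g: "g > 0" using h by (simp add: g_def)
  define R where "R = b / g powr (1 / b)"
  have R: "R > 0" using ab g by (simp add: R_def)
  have gR: "(b / R) powr b = g" using ab g by (simp add: R_def powr_powr)
  define t where "t = a + b - 1"
  have t: "t > 0" using ab by (simp add: t_def)
  define C where "C = exp (t * (1 / (g * h)) powr (1 / t))"
  \<comment> \<open>A positive power \<open>t\<close> of \<open>k!\<close> outgrows the geometric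
    sequence \<open>(1 / (g * h)) ^ k\<close>; this is the power bound with exponent and rate both
    equal to \<open>t\<close>.\<close>
  have key: "1 \<le> C * (g * h) ^ k * fact k powr t" for k :: nat
  proof -
    have "(1 / (g * h)) ^ k \<le> ((t / t) powr t) ^ k * fact k powr t * exp (t * (1 / (g * h)) powr (1 / t))"
      by (rule power_le_fact_powr_exp) (use g h t in auto)
    then have "(1 / (g * h)) ^ k \<le> fact k powr t * C" using t by (simp add: C_def)
    then show ?thesis using g h by (simp add: power_divide field_simps power_mult_distrib)
  qed
  have "fam_bound a h (\<lambda>x. C * h ^ M * fact M powr b * exp (R * norm x powr (1 / b))) (monom_fam \<beta>)"
    if M: "M = (\<Sum>l\<in>UNIV. \<beta> l)" for \<beta> :: "'d \<Rightarrow> nat" and M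
    unfolding fam_bound_def
  proof (intro allI)
    fix j n and x :: "real^'d"
    show "cmod (monom_fam \<beta> j n x) \<le> C * h ^ M * fact M powr b * exp (R * norm x powr (1 / b)) * h ^ n * fact n powr a"
    proof (cases "n \<le> \<beta> j")
      case False
      then show ?thesis using h by (simp add: monom_fam_def binomial_eq_0 C_def)
    next
      case True
      have bM: "\<beta> j \<le> M" unfolding M by (rule member_le_sum) auto
      have sumM: "M = \<beta> j + (\<Sum>l\<in>UNIV - {j}. \<beta> l)" unfolding M by (rule sum.remove) auto
      have "cmod (monom_fam \<beta> j n x) =
          (\<Prod>l\<in>UNIV - {j}. \<bar>x $ l\<bar> ^ \<beta> l) * (real (\<beta> j choose n) * fact n * \<bar>x $ j\<bar> ^ (\<beta> j - n))"
        unfolding monom_fam_def norm_of_real by (simp add: abs_mult abs_prod power_abs)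
      also have "\<dots> \<le> (\<Prod>l\<in>UNIV - {j}. norm x ^ \<beta> l) * (2 ^ M * fact n * norm x ^ (\<beta> j - n))"
      proof (intro mult_mono prod_mono)
        show "real (\<beta> j choose n) \<le> 2 ^ M"
        proof -
          have "\<beta> j choose n \<le> 2 ^ \<beta> j" using binomial_le_pow2 by blast
          also have "\<dots> \<le> 2 ^ M" using bM by (intro power_increasing) auto
          finally show ?thesis by (metis of_nat_le_iff of_nat_numeral of_nat_power)
        qed
      qed (auto intro!: power_mono component_le_norm_cart prod_nonneg)
      also have "\<dots> = 2 ^ M * fact n * norm x ^ (M - n)"
      proof -
        have "M - n = (\<Sum>l\<in>UNIV - {j}. \<beta> l) + (\<beta> j - n)" using sumM True by simp
        then show ?thesis by (simp add: power_sum power_add)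
      qed
      also have "norm x ^ (M - n) \<le> g ^ (M - n) * fact (M - n) powr b * exp (R * norm x powr (1 / b))"
        using power_le_fact_powr_exp[of "norm x" b R "M - n"] ab R gR by simp
      also have "2 ^ M * fact n * (g ^ (M - n) * fact (M - n) powr b * exp (R * norm x powr (1 / b)))
          \<le> C * h ^ M * fact M powr b * exp (R * norm x powr (1 / b)) * h ^ n * fact n powr a"
      proof -
        have nM: "n \<le> M" using True bM by simp
        have "fact (M - n) powr b * fact n powr b \<le> fact M powr b"
          using fact_mult_fact_le[OF nM] ab by (simp flip: powr_mult add: mult.commute powr_mono2)
        then have f1: "fact (M - n) powr b \<le> fact M powr b * fact n powr (- b)"
          by (simp add: powr_minus field_simps)
        have gM: "g ^ M = g ^ (M - n) * g ^ n" using nM by (simp flip: power_add)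
        have "fact n * (g ^ (M - n) * fact (M - n) powr b) \<le> fact n * (g ^ (M - n) * (fact M powr b * fact n powr (- b)))"
          using f1 g by (intro mult_left_mono) auto
        also have "\<dots> \<le> fact n * (g ^ (M - n) * (fact M powr b * fact n powr (- b))) * (C * (g * h) ^ n * fact n powr t)"
        proof -
          have "0 \<le> fact n * (g ^ (M - n) * (fact M powr b * fact n powr (- b)))" using g by simp
          from mult_left_mono[OF key[of n] this] show ?thesis by simp
        qed
        also have "\<dots> = C * g ^ M * fact M powr b * h ^ n * (fact n powr 1 * fact n powr (- b) * fact n powr t)"
          unfolding gM by (simp add: power_mult_distrib mult_ac)
        also have "fact n powr 1 * fact n powr (- b) * fact n powr t = (fact n :: real) powr a"
          unfolding powr_add[symmetric] by (simp add: t_def)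
        finally have "2 ^ M * (fact n * (g ^ (M - n) * fact (M - n) powr b)) \<le> 2 ^ M * (C * g ^ M * fact M powr b * h ^ n * fact n powr a)"
          by (rule mult_left_mono) simp
        also have "\<dots> = C * h ^ M * fact M powr b * h ^ n * fact n powr a"
          by (simp add: g_def power_divide)
        finally have "(2 ^ M * (fact n * (g ^ (M - n) * fact (M - n) powr b))) * exp (R * norm x powr (1 / b))
            \<le> (C * h ^ M * fact M powr b * h ^ n * fact n powr a) * exp (R * norm x powr (1 / b))"
          by (rule mult_right_mono) simp
        then show ?thesis by (simp add: mult_ac)
      qed
      finally show ?thesis by simp
    qed
  qed
  moreover have "C > 0" by (simp add: C_def)
  ultimately show ?thesis using R by blast
qed

subsection \<open>The Fourier transform of rapidly decreasing functions\<close>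

text \<open>The unnormalised transform: applied twice it gives \<open>(2 * pi) ^ CARD('d)\<close>
  times the reflection, and this factor is divided out in the inverse transforms below.\<close>

definition ft :: "(real^'d::finite \<Rightarrow> complex) \<Rightarrow> real^'d \<Rightarrow> complex" where
  "ft G y = (LINT x|lborel. G x * exp (- \<i> * complex_of_real (x \<bullet> y)))"

lemma cmod_exp_i [simp]: "cmod (exp (\<i> * complex_of_real t)) = 1"
  "cmod (exp (- \<i> * complex_of_real t)) = 1" "cmod (exp (- (\<i> * complex_of_real t))) = 1"
  using norm_exp_i_times[of t] norm_exp_i_times[of "- t"] by simp_all

text \<open>The working domain of the transform: continuity supplies measurability, the majorant
  supplies integrability, and both survive multiplication by bounded continuous functions.\<close>

definition wt_dom :: "(real^'d::finite \<Rightarrow> complex) \<Rightarrow> bool" where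
  "wt_dom G \<longleftrightarrow> continuous_on UNIV G \<and> (\<exists>K. \<forall>x. cmod (G x) \<le> K * wt x)"

lemma wt_domI: "continuous_on UNIV G \<Longrightarrow> (\<And>x. cmod (G x) \<le> K * wt x) \<Longrightarrow> wt_dom G"
  by (auto simp: wt_dom_def)

lemma wt_dom_continuous: "wt_dom G \<Longrightarrow> continuous_on S G"
  by (auto simp: wt_dom_def intro: continuous_on_subset)

lemma wt_dom_measurable: "wt_dom G \<Longrightarrow> G \<in> borel_measurable borel"
  by (intro borel_measurable_continuous_onI wt_dom_continuous)

lemma wt_dom_integrable: "wt_dom G \<Longrightarrow> integrable lborel G"
  by (auto simp: wt_dom_def intro: integrable_wt_bound)

lemma wt_dom_mult:
  assumes G: "wt_dom G" and F: "continuous_on UNIV F" and K: "\<And>x. cmod (F x) \<le> K"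
  shows "wt_dom (\<lambda>x. G x * F x)"
proof -
  obtain L where L: "\<And>x. cmod (G x) \<le> L * wt x" using G by (auto simp: wt_dom_def)
  have K0: "K \<ge> 0" using K[of 0] norm_ge_zero order_trans by blast
  have "cmod (G x * F x) \<le> (L * K) * wt x" for x
  proof -
    have "cmod (G x * F x) \<le> (L * wt x) * K" unfolding norm_mult
      by (intro mult_mono L K) (use L[of x] norm_ge_zero order_trans in blast, simp)
    then show ?thesis by (simp add: mult_ac)
  qed
  moreover have "continuous_on UNIV (\<lambda>x. G x * F x)"
    by (rule continuous_on_mult[OF wt_dom_continuous[OF G] F])
  ultimately show ?thesis by (intro wt_domI)
qed

lemma wt_dom_char: "wt_dom G \<Longrightarrow> wt_dom (\<lambda>x. G x * exp (- \<i> * complex_of_real (x \<bullet> y)))"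
  by (rule wt_dom_mult[where K=1]) (auto intro!: continuous_intros)

lemma integrable_char: "wt_dom G \<Longrightarrow> integrable lborel (\<lambda>x. G x * exp (- \<i> * complex_of_real (x \<bullet> y)))"
  by (intro wt_dom_integrable wt_dom_char)

lemma ft_add:
  assumes "wt_dom F" "wt_dom G"
  shows "ft (\<lambda>x. a * F x + b * G x) y = a * ft F y + b * ft G y"
  unfolding ft_def
  by (simp add: distrib_right mult.assoc integrable_char[OF assms(1), simplified] integrable_char[OF assms(2), simplified])

lemma ft_cmult: "ft (\<lambda>x. a * F x) y = a * ft F y"
  unfolding ft_def by (simp add: mult.assoc)

lemma ft_norm_le:
  fixes G :: "real^'d::finite \<Rightarrow> complex"
  assumes "continuous_on UNIV G" "\<And>x. cmod (G x) \<le> K * wt x"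
  shows "cmod (ft G y) \<le> K * (LINT x|lborel. wt (x::real^'d))"
proof -
  have "cmod (ft G y) \<le> (LINT x|lborel. K * wt (x::real^'d))"
    unfolding ft_def
  proof (rule Bochner_Integration.integral_norm_bound_integral)
    show "integrable lborel (\<lambda>x. G x * exp (- \<i> * complex_of_real (x \<bullet> y)))"
      by (intro integrable_char wt_domI[OF assms])
    show "integrable lborel (\<lambda>x::real^'d. K * wt x)" by (intro integrable_mult_right integrable_wt)
  qed (use assms(2) in \<open>simp add: norm_mult\<close>)
  then show ?thesis by simp
qed

section \<open>Affine substitutions, and the transform of a derivative\<close>

lemma integral_lborel_shift:
  fixes f :: "'a::euclidean_space \<Rightarrow> 'b::{banach,second_countable_topology}"
  assumes "f \<in> borel_measurable borel"
  shows "(LINT x|lborel. f (x + c)) = (LINT x|lborel. f x)"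
proof -
  have "(LINT x|lborel. f x) = (LINT x|distr lborel borel ((+) c). f x)" by (simp add: lborel_distr_plus)
  also have "\<dots> = (LINT x|lborel. f (c + x))" by (rule integral_distr) (use assms in auto)
  finally show ?thesis by (simp add: add.commute)
qed

lemma integral_lborel_affine:
  fixes f :: "'a::euclidean_space \<Rightarrow> 'b::{banach,second_countable_topology}"
  assumes f: "f \<in> borel_measurable borel" and c: "c \<noteq> 0"
  shows "(LINT x|lborel. f x) = \<bar>c\<bar> ^ DIM('a) *\<^sub>R (LINT x|lborel. f (t + c *\<^sub>R x))"
proof -
  have "(LINT x|lborel. f x) = (LINT x|density (distr lborel borel (\<lambda>x. t + c *\<^sub>R x)) (\<lambda>_. ennreal (\<bar>c\<bar>^DIM('a))). f x)"
    by (subst lborel_affine[OF c, of t]) simp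
  also have "\<dots> = (LINT x|distr lborel borel (\<lambda>x. t + c *\<^sub>R x). \<bar>c\<bar> ^ DIM('a) *\<^sub>R f x)"
    by (rule integral_density) (use f in auto)
  also have "\<dots> = (LINT x|lborel. \<bar>c\<bar> ^ DIM('a) *\<^sub>R f (t + c *\<^sub>R x))"
    by (rule integral_distr) (use f in auto)
  finally show ?thesis by simp
qed

lemma integral_lborel_uminus:
  fixes f :: "'a::euclidean_space \<Rightarrow> 'b::{banach,second_countable_topology}"
  assumes "f \<in> borel_measurable borel"
  shows "(LINT x|lborel. f (- x)) = (LINT x|lborel. f x)"
  using integral_lborel_affine[OF assms, of "-1" 0] by simp

lemma integrable_lborel_affine:
  fixes f :: "'a::euclidean_space \<Rightarrow> 'b::{banach,second_countable_topology}"
  assumes f: "integrable lborel f" and c: "c \<noteq> 0"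
  shows "integrable lborel (\<lambda>x. f (t + c *\<^sub>R x))"
proof -
  have m: "f \<in> borel_measurable borel" using borel_measurable_integrable[OF f] by simp
  have "integrable (density (distr lborel borel (\<lambda>x. t + c *\<^sub>R x)) (\<lambda>_. ennreal (\<bar>c\<bar>^DIM('a)))) f"
    by (subst lborel_affine[OF c, of t, symmetric]) (rule f)
  then have "integrable (distr lborel borel (\<lambda>x. t + c *\<^sub>R x)) (\<lambda>x. \<bar>c\<bar> ^ DIM('a) *\<^sub>R f x)"
    by (subst (asm) integrable_density) (use m in auto)
  then have "integrable lborel (\<lambda>x. \<bar>c\<bar> ^ DIM('a) *\<^sub>R f (t + c *\<^sub>R x))"
    by (subst (asm) integrable_distr_eq) (use m in auto)
  then have "integrable lborel (\<lambda>x. (1 / \<bar>c\<bar> ^ DIM('a)) *\<^sub>R (\<bar>c\<bar> ^ DIM('a) *\<^sub>R f (t + c *\<^sub>R x)))"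
    by (rule integrable_scaleR_right)
  then show ?thesis using c by simp
qed

lemma has_vector_derivative_quotient:
  fixes f :: "real \<Rightarrow> 'a::real_normed_vector"
  assumes "(f has_vector_derivative d) (at 0)"
  shows "((\<lambda>u. (f u - f 0) /\<^sub>R u) \<longlongrightarrow> d) (at 0)"
proof -
  have "((\<lambda>u. norm (f u - f 0 - u *\<^sub>R d) / norm u) \<longlongrightarrow> 0) (at 0)"
    using assms by (simp add: has_vector_derivative_def has_derivative_iff_norm)
  moreover have "\<forall>\<^sub>F u in at 0. norm (f u - f 0 - u *\<^sub>R d) / norm u = norm ((f u - f 0) /\<^sub>R u - d)"
    unfolding eventually_at_filter
  proof (intro always_eventually allI impI)
    fix u :: real assume "u \<noteq> 0"
    then have "(f u - f 0) /\<^sub>R u - d = (f u - f 0 - u *\<^sub>R d) /\<^sub>R u" by (simp add: algebra_simps)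
    then show "norm (f u - f 0 - u *\<^sub>R d) / norm u = norm ((f u - f 0) /\<^sub>R u - d)"
      by (simp add: divide_inverse mult.commute)
  qed
  ultimately have "((\<lambda>u. norm ((f u - f 0) /\<^sub>R u - d)) \<longlongrightarrow> 0) (at 0)" by (rule Lim_transform_eventually)
  then show ?thesis by (simp add: tendsto_norm_zero_iff LIM_zero_iff)
qed

text \<open>The mean value inequality along the segment, whose points stay within distance 1 of
  \<open>x\<close>, so that the weight grows by at most the factor 3.\<close>

lemma difference_bound:
  assumes H: "coord_fam H" and K: "\<And>x. cmod (H j (Suc n) x) \<le> K * wt x" and s: "0 < s" "s \<le> 1"
  shows "cmod (H j n (x + s *\<^sub>R axis j 1) - H j n x) \<le> s * (3 * K * wt x)"
proof -
  have K0: "K \<ge> 0" using K[of 0] wt_pos[of "0::real^'a"] norm_ge_zero[of "H j (Suc n) 0"]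
    by (meson order_trans zero_le_mult_iff not_le)
  have "norm ((\<lambda>s. H j n (x + s *\<^sub>R axis j 1)) s - (\<lambda>s. H j n (x + s *\<^sub>R axis j 1)) 0) \<le> (3 * K * wt x) * norm (s - 0)"
  proof (rule differentiable_bound[where S="{0..s}"])
    show "((\<lambda>s. H j n (x + s *\<^sub>R axis j 1)) has_derivative (\<lambda>h. h *\<^sub>R H j (Suc n) (x + u *\<^sub>R axis j 1))) (at u within {0..s})" for u
      using coord_fam_deriv[OF H] by (auto simp: has_vector_derivative_def intro: has_derivative_at_withinI)
    show "onorm (\<lambda>h. h *\<^sub>R H j (Suc n) (x + u *\<^sub>R axis j 1)) \<le> 3 * K * wt x" if "u \<in> {0..s}" for u
    proof (rule onorm_le)
      fix h
      have "cmod (H j (Suc n) (x + u *\<^sub>R axis j 1)) \<le> K * wt (x + u *\<^sub>R axis j 1)" by (rule K)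
      also have "\<dots> \<le> K * (3 * wt x)" using that s K0 by (intro mult_left_mono wt_shift_le) auto
      finally have "\<bar>h\<bar> * cmod (H j (Suc n) (x + u *\<^sub>R axis j 1)) \<le> \<bar>h\<bar> * (K * (3 * wt x))"
        by (rule mult_left_mono) simp
      then show "norm (h *\<^sub>R H j (Suc n) (x + u *\<^sub>R axis j 1)) \<le> 3 * K * wt x * norm h"
        by (simp add: mult_ac)
    qed
  qed (use s in auto)
  then show ?thesis using s by (simp add: mult_ac)
qed

text \<open>Passing to the limit in the Fourier transform of difference quotients avoids the boundary terms
  of an integration by parts.\<close>

lemma ft_coord_deriv:
  assumes H: "coord_fam H" and K: "\<And>x. cmod (H j n x) \<le> K * wt x" and L: "\<And>x. cmod (H j (Suc n) x) \<le> L * wt x"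
  shows "ft (H j (Suc n)) y = \<i> * of_real (y $ j) * ft (H j n) y"
proof -
  \<comment> \<open>Steps in \<open>(0, 1]\<close> tending to 0, for which the mean value estimate
    provides one integrable majorant.\<close>
  define s where "s m = 1 / real (Suc m)" for m
  have s: "s m > 0" "s m \<le> 1" for m by (auto simp: s_def)
  have s0: "s \<longlonglongrightarrow> 0" unfolding s_def using LIMSEQ_inverse_real_of_nat by (simp add: inverse_eq_divide)
  let ?e = "axis j 1 :: real^'a"
  let ?E = "\<lambda>x. exp (- \<i> * complex_of_real (x \<bullet> y))"
  have dom: "wt_dom (H j k)" if "k = n \<or> k = Suc n" for k
    using that wt_domI[OF coord_famD(1)[OF H] K] wt_domI[OF coord_famD(1)[OF H] L] by auto
  have m: "H j k \<in> borel_measurable borel" for k by (intro borel_measurable_continuous_onI coord_famD(1) H)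
  define D where "D m x = ((H j n (x + s m *\<^sub>R ?e) - H j n x) / of_real (s m)) * ?E x" for m x
  have "(\<lambda>m. LINT x|lborel. D m x) \<longlonglongrightarrow> (LINT x|lborel. H j (Suc n) x * ?E x)"
  proof (rule integral_dominated_convergence[where w="\<lambda>x. 3 * L * wt x"])
    show "(\<lambda>x. H j (Suc n) x * ?E x) \<in> borel_measurable lborel" using m[of "Suc n"] by measurable
    show "D m \<in> borel_measurable lborel" for m unfolding D_def using m[of n] by measurable
    show "integrable lborel (\<lambda>x::real^'a. 3 * L * wt x)" by (intro integrable_mult_right integrable_wt)
    show "AE x in lborel. (\<lambda>m. D m x) \<longlonglongrightarrow> H j (Suc n) x * ?E x"
    proof (intro AE_I2)
      fix x
      have "((\<lambda>u. (H j n (x + u *\<^sub>R ?e) - H j n x) /\<^sub>R u) \<longlongrightarrow> H j (Suc n) x) (at 0)"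
        using has_vector_derivative_quotient[OF coord_famD(2)[OF H, of j n x]] by simp
      then have "(\<lambda>m. (H j n (x + s m *\<^sub>R ?e) - H j n x) /\<^sub>R s m) \<longlonglongrightarrow> H j (Suc n) x"
        by (rule filterlim_compose) (use s0 s(1) in \<open>auto simp: filterlim_at intro!: always_eventually less_imp_neq[symmetric]\<close>)
      then have "(\<lambda>m. ((H j n (x + s m *\<^sub>R ?e) - H j n x) /\<^sub>R s m) * ?E x) \<longlonglongrightarrow> H j (Suc n) x * ?E x"
        by (intro tendsto_intros)
      then show "(\<lambda>m. D m x) \<longlonglongrightarrow> H j (Suc n) x * ?E x"
        by (simp add: D_def scaleR_conv_of_real divide_inverse mult.commute)
    qed
    show "AE x in lborel. norm (D m x) \<le> 3 * L * wt x" for m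
    proof (intro AE_I2)
      fix x
      have "norm (D m x) = cmod (H j n (x + s m *\<^sub>R ?e) - H j n x) / s m"
        using s(1)[of m] by (simp add: D_def norm_mult norm_divide)
      also have "\<dots> \<le> (s m * (3 * L * wt x)) / s m"
        using s(1)[of m] by (intro divide_right_mono difference_bound[OF H L s(1)[of m] s(2)[of m]]) auto
      finally show "norm (D m x) \<le> 3 * L * wt x" using s(1)[of m] by simp
    qed
  qed
  \<comment> \<open>Translation invariance moves the difference quotient from the function to the
    character, where it becomes the scalar \<open>(exp (i s y_j) - 1) / s\<close>.\<close>
  moreover have "(LINT x|lborel. D m x) = ((exp (\<i> * of_real (s m * y $ j)) - 1) / of_real (s m)) * ft (H j n) y" for m
  proof -
    have i1: "integrable lborel (\<lambda>x. H j n x * ?E x)" using integrable_char[OF dom[of n], of y] by simp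
    then have "integrable lborel (\<lambda>x. H j n (s m *\<^sub>R ?e + 1 *\<^sub>R x) * ?E (s m *\<^sub>R ?e + 1 *\<^sub>R x))"
      by (rule integrable_lborel_affine) simp
    then have i2: "integrable lborel (\<lambda>x. H j n (x + s m *\<^sub>R ?e) * ?E (x + s m *\<^sub>R ?e))" by (simp add: add.commute)
    have Es: "?E x = exp (\<i> * of_real (s m * y $ j)) * ?E (x + s m *\<^sub>R ?e)" for x
      by (simp add: inner_add_left inner_axis' algebra_simps flip: exp_add)
    have "D m x = (exp (\<i> * of_real (s m * y $ j)) * (H j n (x + s m *\<^sub>R ?e) * ?E (x + s m *\<^sub>R ?e)) - H j n x * ?E x) / of_real (s m)" for x
    proof -
      have "D m x = (H j n (x + s m *\<^sub>R ?e) * ?E x - H j n x * ?E x) / of_real (s m)"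
        unfolding D_def by (simp add: algebra_simps)
      also have "H j n (x + s m *\<^sub>R ?e) * ?E x = exp (\<i> * of_real (s m * y $ j)) * (H j n (x + s m *\<^sub>R ?e) * ?E (x + s m *\<^sub>R ?e))"
        by (subst Es) (simp only: mult_ac)
      finally show ?thesis .
    qed
    then have "(LINT x|lborel. D m x) = (exp (\<i> * of_real (s m * y $ j)) * (LINT x|lborel. H j n (x + s m *\<^sub>R ?e) * ?E (x + s m *\<^sub>R ?e)) - (LINT x|lborel. H j n x * ?E x)) / of_real (s m)"
      using i1 i2 by simp
    also have "(LINT x|lborel. H j n (x + s m *\<^sub>R ?e) * ?E (x + s m *\<^sub>R ?e)) = (LINT x|lborel. H j n x * ?E x)"
      by (rule integral_lborel_shift[of "\<lambda>x. H j n x * ?E x"]) (use m[of n] in measurable)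
    finally show ?thesis by (simp add: ft_def algebra_simps)
  qed
  moreover have "(\<lambda>m. ((exp (\<i> * of_real (s m * y $ j)) - 1) / of_real (s m)) * ft (H j n) y) \<longlonglongrightarrow> (\<i> * of_real (y $ j)) * ft (H j n) y"
  proof (intro tendsto_intros)
    have "((\<lambda>u. exp (\<i> * of_real (u * y $ j))) has_vector_derivative (\<i> * of_real (y $ j))) (at 0)"
    proof -
      have "((\<lambda>z. exp (\<i> * (z * of_real (y $ j)))) has_field_derivative (\<i> * of_real (y $ j))) (at (of_real 0))"
        by (auto intro!: derivative_eq_intros)
      then have "((\<lambda>z. exp (\<i> * (z * of_real (y $ j)))) \<circ> of_real has_vector_derivative 1 * (\<i> * of_real (y $ j))) (at 0)"
        by (intro field_vector_diff_chain_at) (auto intro!: derivative_eq_intros has_vector_derivative_real_field simp: has_vector_derivative_of_real)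
      then show ?thesis by (simp add: o_def)
    qed
    then have "((\<lambda>u. (exp (\<i> * of_real (u * y $ j)) - 1) /\<^sub>R u) \<longlongrightarrow> \<i> * of_real (y $ j)) (at 0)"
      using has_vector_derivative_quotient by fastforce
    then have "(\<lambda>m. (exp (\<i> * of_real (s m * y $ j)) - 1) /\<^sub>R s m) \<longlonglongrightarrow> \<i> * of_real (y $ j)"
      by (rule filterlim_compose) (use s0 s(1) in \<open>auto simp: filterlim_at intro!: always_eventually less_imp_neq[symmetric]\<close>)
    then show "(\<lambda>m. (exp (\<i> * of_real (s m * y $ j)) - 1) / of_real (s m)) \<longlonglongrightarrow> \<i> * of_real (y $ j)"
      by (simp add: scaleR_conv_of_real divide_inverse mult.commute)
  qed
  ultimately show ?thesis unfolding ft_def using LIMSEQ_unique by fastforce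
qed

text \<open>Reduces decay in all of space to pure derivatives in a single direction that depends on
  the point.\<close>

lemma norm_le_max_coord:
  fixes y :: "real^'d::finite"
  obtains k where "norm y \<le> real CARD('d) * \<bar>y $ k\<bar>"
proof -
  have "finite (range (\<lambda>l. \<bar>y $ l\<bar>))" by simp
  then obtain k where k: "\<bar>y $ k\<bar> = Max (range (\<lambda>l. \<bar>y $ l\<bar>))"
    by (metis (mono_tags, lifting) Max_in UNIV_not_empty image_is_empty imageE)
  have "norm y \<le> (\<Sum>l\<in>UNIV. \<bar>y $ l\<bar>)" by (rule norm_le_l1_cart)
  also have "\<dots> \<le> (\<Sum>l\<in>(UNIV::'d set). \<bar>y $ k\<bar>)" by (intro sum_mono) (simp add: k)
  finally show ?thesis by (intro that[of k]) simp
qed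

text \<open>The transform of the \<open>n\<close>-th derivative in the direction of the largest
  coordinate of \<open>y\<close> bounds \<open>norm y ^ n\<close> times the transform, up to the
  dimension factor \<open>d ^ n\<close>; summing over \<open>n\<close> turns this into a stretched
  exponential. The direction may depend on \<open>y\<close> because all directions of a family share
  the same function at order 0.\<close>

lemma ft_decay:
  assumes a: "a > 0" and r: "r > 0"
  shows "\<exists>h>0. \<exists>C>0. \<forall>(H :: 'd::finite \<Rightarrow> nat \<Rightarrow> real^'d \<Rightarrow> complex) K j y. coord_fam H \<longrightarrow> fam_bound a h (\<lambda>x. K * wt x) H \<longrightarrow>
     cmod (ft (H j 0) y) \<le> C * K * exp (- r * norm y powr (1 / a))"
proof -
  define I where "I = (LINT x|lborel. wt (x::real^'d))"
  have I: "I \<ge> 0" unfolding I_def by (rule integral_nonneg_AE) simp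
  define d where "d = real CARD('d)"
  have d: "d > 0" by (simp add: d_def)
  \<comment> \<open>The constant demanded by the summation of powers; dividing it by the dimension
    in \<open>h\<close> cancels the \<open>d ^ n\<close> from the passage to one coordinate.\<close>
  define g where "g = (a / (2 * r)) powr a"
  have g: "g > 0" using a r by (simp add: g_def)
  define h where "h = g / d"
  have h: "h > 0" using g d by (simp add: h_def)
  have "cmod (ft (H j 0) y) \<le> (2 powr a * (I + 1)) * K * exp (- r * norm y powr (1 / a))"
    if H: "coord_fam H" and b: "fam_bound a h (\<lambda>x. K * wt x) H" for H :: "'d \<Rightarrow> nat \<Rightarrow> real^'d \<Rightarrow> complex" and K j y
  proof -
    have K: "K \<ge> 0" using fam_bound_nonneg[OF b, of 0] wt_pos[of "0::real^'d"] by (simp add: zero_le_mult_iff)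
    have bd: "cmod (H k n x) \<le> (K * h ^ n * fact n powr a) * wt x" for k n x
      using b by (simp add: fam_bound_def mult_ac)
    have it: "ft (H k n) y = (\<i> * of_real (y $ k)) ^ n * ft (H k 0) y" for k n
    proof (induction n)
      case (Suc n)
      then show ?case using ft_coord_deriv[OF H bd bd, of k n y] by (simp add: mult_ac)
    qed simp
    obtain k where ny: "norm y \<le> d * \<bar>y $ k\<bar>" unfolding d_def using norm_le_max_coord by blast
    have pow: "norm y ^ n * cmod (ft (H j 0) y) \<le> (I * K) * g ^ n * fact n powr a" for n
    proof -
      have "norm y ^ n * cmod (ft (H k 0) y) \<le> (d * \<bar>y $ k\<bar>) ^ n * cmod (ft (H k 0) y)"
        by (intro mult_right_mono power_mono ny) auto
      also have "\<dots> = d ^ n * cmod (ft (H k n) y)" unfolding it[of k n] by (simp add: norm_mult norm_power power_mult_distrib)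
      also have "cmod (ft (H k n) y) \<le> (K * h ^ n * fact n powr a) * I"
        unfolding I_def by (rule ft_norm_le) (use H bd in \<open>auto intro: coord_famD(1)\<close>)
      also have "d ^ n * ((K * h ^ n * fact n powr a) * I) = (I * K) * g ^ n * fact n powr a"
        using d by (simp add: h_def power_divide)
      finally show ?thesis using d coord_famD(3)[OF H, of j k] by simp
    qed
    have "cmod (ft (H j 0) y) * exp (r * norm y powr (1 / a)) \<le> 2 powr a * (I * K)"
      by (rule exp_powr_le_of_powers[OF a r]) (use pow in \<open>auto simp: g_def\<close>)
    also have "\<dots> \<le> 2 powr a * (I + 1) * K" using K by (simp add: algebra_simps)
    finally show ?thesis by (simp add: exp_minus field_simps)
  qed
  moreover have "2 powr a * (I + 1) > 0" using I by simp
  ultimately show ?thesis using h by blast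
qed

text \<open>The second order remainder of the exponential is at most
  \<open>(x \<bullet> h)^2 / 2\<close>, so two powers of decay beyond the weight control both the
  derivative and the remainder.\<close>

lemma ft_has_derivative:
  fixes G :: "real^'d::finite \<Rightarrow> complex"
  assumes c: "continuous_on UNIV G" and K: "\<And>x. (1 + norm x)\<^sup>2 * cmod (G x) \<le> K * wt x"
  shows "(ft G has_derivative (\<lambda>h. ft (\<lambda>x. (- \<i> * of_real (x \<bullet> h)) * G x) y)) (at y)"
proof -
  have Gle': "c * cmod (G x) \<le> K * wt x" if "c \<le> (1 + norm x)\<^sup>2" for c x
    by (rule order_trans[OF mult_right_mono[OF that norm_ge_zero] K])
  have Gle: "cmod (G x) \<le> K * wt x" "norm x * cmod (G x) \<le> K * wt x" "(norm x)\<^sup>2 * cmod (G x) \<le> K * wt x" for x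
    using Gle'[of 1 x] Gle'[of "norm x" x] Gle'[of "(norm x)\<^sup>2" x]
    by (simp_all add: power2_eq_square algebra_simps)
  have K0: "K \<ge> 0" using Gle(1)[of 0] wt_pos[of "0::real^'d"] norm_ge_zero[of "G 0"]
    by (meson order_trans zero_le_mult_iff not_le)
  have domG: "wt_dom G" by (rule wt_domI[OF c Gle(1)])
  have domh: "wt_dom (\<lambda>x. (- \<i> * of_real (x \<bullet> h)) * G x)" for h
  proof (rule wt_domI[where K="norm h * K"])
    show "continuous_on UNIV (\<lambda>x. - \<i> * complex_of_real (x \<bullet> h) * G x)" by (intro continuous_intros c)
    fix x
    have "cmod (- \<i> * complex_of_real (x \<bullet> h) * G x) = \<bar>x \<bullet> h\<bar> * cmod (G x)" by (simp add: norm_mult)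
    also have "\<dots> \<le> (norm x * norm h) * cmod (G x)" by (intro mult_right_mono Cauchy_Schwarz_ineq2) simp
    also have "\<dots> = norm h * (norm x * cmod (G x))" by simp
    also have "\<dots> \<le> norm h * (K * wt x)" by (intro mult_left_mono Gle) simp
    finally show "cmod (- \<i> * complex_of_real (x \<bullet> h) * G x) \<le> norm h * K * wt x" by simp
  qed
  define I where "I = (LINT x|lborel. wt (x::real^'d))"
  have I: "I \<ge> 0" unfolding I_def by (rule integral_nonneg_AE) simp
  show ?thesis
  proof (rule has_derivativeI_sandwich[where e=1 and H="\<lambda>z. norm (z - y) * (K / 2 * I)"])
    show "bounded_linear (\<lambda>h. ft (\<lambda>x. (- \<i> * of_real (x \<bullet> h)) * G x) y)"
    proof (rule bounded_linear_intro[where K="K * I"])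
      fix h k :: "real^'d" and r :: real
      show "ft (\<lambda>x. (- \<i> * of_real (x \<bullet> (h + k))) * G x) y = ft (\<lambda>x. (- \<i> * of_real (x \<bullet> h)) * G x) y + ft (\<lambda>x. (- \<i> * of_real (x \<bullet> k)) * G x) y"
        using ft_add[OF domh[of h] domh[of k], of 1 1 y] by (simp add: inner_add_right algebra_simps)
      show "ft (\<lambda>x. (- \<i> * of_real (x \<bullet> (r *\<^sub>R h))) * G x) y = r *\<^sub>R ft (\<lambda>x. (- \<i> * of_real (x \<bullet> h)) * G x) y"
        using ft_cmult[of "of_real r" "\<lambda>x. (- \<i> * of_real (x \<bullet> h)) * G x" y]
        by (simp add: scaleR_conv_of_real[where 'a=complex] mult_ac)
      have "cmod (ft (\<lambda>x. (- \<i> * of_real (x \<bullet> h)) * G x) y) \<le> (norm h * K) * I"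
        unfolding I_def
      proof (rule ft_norm_le)
        show "continuous_on UNIV (\<lambda>x. - \<i> * complex_of_real (x \<bullet> h) * G x)" by (intro continuous_intros c)
        fix x
        have "cmod (- \<i> * complex_of_real (x \<bullet> h) * G x) = \<bar>x \<bullet> h\<bar> * cmod (G x)" by (simp add: norm_mult)
        also have "\<dots> \<le> (norm x * norm h) * cmod (G x)" by (intro mult_right_mono Cauchy_Schwarz_ineq2) simp
        also have "\<dots> = norm h * (norm x * cmod (G x))" by simp
        also have "\<dots> \<le> norm h * (K * wt x)" by (intro mult_left_mono Gle) simp
        finally show "cmod (- \<i> * complex_of_real (x \<bullet> h) * G x) \<le> norm h * K * wt x" by simp
      qed
      then show "norm (ft (\<lambda>x. (- \<i> * of_real (x \<bullet> h)) * G x) y) \<le> norm h * (K * I)" by (simp add: mult.assoc)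
    qed
    show "norm ((ft G z - ft G y) - ft (\<lambda>x. (- \<i> * of_real (x \<bullet> (z - y))) * G x) y) / norm (z - y) \<le> norm (z - y) * (K / 2 * I)"
      if "z \<noteq> y" for z
    proof -
      define h where "h = z - y"
      have h: "norm h > 0" using that by (simp add: h_def)
      \<comment> \<open>With the character at \<open>y\<close> factored out, the increment of the
        transform minus its linear part is the transform of \<open>R\<close>.\<close>
      define R where "R x = G x * (exp (- \<i> * of_real (x \<bullet> h)) - 1 + \<i> * of_real (x \<bullet> h))" for x
      have Rc: "continuous_on UNIV R" unfolding R_def by (intro continuous_intros c)
      have Rle: "cmod (R x) \<le> ((norm h)\<^sup>2 * K / 2) * wt x" for x
      proof -
        have "cmod (exp (- \<i> * of_real (x \<bullet> h)) - 1 + \<i> * of_real (x \<bullet> h)) \<le> (x \<bullet> h)\<^sup>2 / 2"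
          using iexp_approx1[of "- (x \<bullet> h)" 1] by (simp add: power2_eq_square numeral_2_eq_2 algebra_simps)
        also have "\<dots> \<le> (norm x * norm h)\<^sup>2 / 2"
          using Cauchy_Schwarz_ineq2[of x h] by (intro divide_right_mono power2_le_iff_abs_le[THEN iffD2]) auto
        finally have "cmod (R x) \<le> cmod (G x) * ((norm x * norm h)\<^sup>2 / 2)"
          unfolding R_def norm_mult by (intro mult_left_mono) auto
        also have "\<dots> = (norm h)\<^sup>2 / 2 * ((norm x)\<^sup>2 * cmod (G x))" by (simp add: power_mult_distrib)
        also have "\<dots> \<le> (norm h)\<^sup>2 / 2 * (K * wt x)" by (intro mult_left_mono Gle) simp
        finally show ?thesis by simp
      qed
      have dR: "wt_dom R" by (rule wt_domI[OF Rc Rle])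
      have "ft R y = ft G z - ft G y - ft (\<lambda>x. (- \<i> * of_real (x \<bullet> h)) * G x) y"
      proof -
        have i: "integrable lborel (\<lambda>x. G x * exp (- \<i> * complex_of_real (x \<bullet> z)))"
          "integrable lborel (\<lambda>x. G x * exp (- \<i> * complex_of_real (x \<bullet> y)))"
          "integrable lborel (\<lambda>x. (- \<i> * of_real (x \<bullet> h)) * G x * exp (- \<i> * complex_of_real (x \<bullet> y)))"
          using integrable_char[OF domG] integrable_char[OF domh] by auto
        have "exp (- \<i> * complex_of_real (x \<bullet> z)) = exp (- \<i> * of_real (x \<bullet> h)) * exp (- \<i> * complex_of_real (x \<bullet> y))" for x
          unfolding h_def by (simp add: inner_diff_right algebra_simps flip: exp_add)
        then have "R x * exp (- \<i> * complex_of_real (x \<bullet> y)) = G x * exp (- \<i> * complex_of_real (x \<bullet> z)) - G x * exp (- \<i> * complex_of_real (x \<bullet> y))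
            - (- \<i> * of_real (x \<bullet> h)) * G x * exp (- \<i> * complex_of_real (x \<bullet> y))" for x
          unfolding R_def by (simp only:) (simp add: algebra_simps)
        then show ?thesis unfolding ft_def by (simp only: Bochner_Integration.integral_diff i Bochner_Integration.integrable_diff)
      qed
      moreover have "cmod (ft R y) \<le> ((norm h)\<^sup>2 * K / 2) * I" unfolding I_def by (rule ft_norm_le[OF Rc Rle])
      ultimately have "cmod (ft G z - ft G y - ft (\<lambda>x. (- \<i> * of_real (x \<bullet> h)) * G x) y) / norm h \<le> ((norm h)\<^sup>2 * K / 2) * I / norm h"
        by (intro divide_right_mono) auto
      also have "\<dots> = norm h * (K / 2 * I)" using h by (simp add: power2_eq_square)
      finally show ?thesis by (simp only: h_def)
    qed
    show "((\<lambda>z. norm (z - y) * (K / 2 * I)) \<longlongrightarrow> 0) (at y within UNIV)"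
      by (rule tendsto_eq_intros refl | simp)+
  qed simp
qed

section \<open>Gaussians, Fubini and Fourier inversion\<close>

lemma exp_iy_std_normal:
  "(LINT s|lborel. of_real (std_normal_density s) * exp (\<i> * of_real (t * s))) = complex_of_real (exp (- t\<^sup>2 / 2))"
proof -
  have "char std_normal_distribution t = (LINT s|lborel. std_normal_density s *\<^sub>R exp (\<i> * of_real (t * s)))"
    unfolding char_def by (subst integral_density) (auto simp: normal_density_nonneg)
  then show ?thesis by (simp add: char_std_normal_distribution scaleR_conv_of_real)
qed

text \<open>The characteristic function of the standard normal law, dilated by
  \<open>\<sigma>\<close>. Writing the result as a normal density exhibits its total mass and its
  concentration at the origin as \<open>\<sigma>\<close> tends to 0.\<close>

lemma gauss_ft_1d:
  assumes s: "\<sigma> > 0"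
  shows "integrable lborel (\<lambda>s. complex_of_real (exp (- (\<sigma> * s)\<^sup>2 / 2)) * exp (- \<i> * of_real (s * u)))"
    and "(LINT s|lborel. complex_of_real (exp (- (\<sigma> * s)\<^sup>2 / 2)) * exp (- \<i> * of_real (s * u)))
      = of_real (2 * pi * normal_density 0 \<sigma> u)"
proof -
  let ?f = "\<lambda>s. complex_of_real (exp (- s\<^sup>2 / 2)) * exp (- \<i> * of_real (s * (u / \<sigma>)))"
  have f_eq: "?f s = of_real (sqrt (2 * pi)) * (of_real (std_normal_density s) * exp (\<i> * of_real ((- (u / \<sigma>)) * s)))" for s
    by (simp add: std_normal_density_def mult_ac)
  have int0: "integrable lborel (\<lambda>s. complex_of_real (std_normal_density s) * exp (\<i> * of_real ((- (u / \<sigma>)) * s)))"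
  proof (rule Bochner_Integration.integrable_bound)
    show "integrable lborel (\<lambda>s. complex_of_real (std_normal_density s))"
      by (intro integrable_of_real integrable_normal_density) simp
  qed (auto simp: norm_mult)
  have int: "integrable lborel ?f" unfolding f_eq by (intro integrable_mult_right int0)
  have m: "?f \<in> borel_measurable borel" using borel_measurable_integrable[OF int] by simp
  have sc: "?f (0 + \<sigma> *\<^sub>R s) = complex_of_real (exp (- (\<sigma> * s)\<^sup>2 / 2)) * exp (- \<i> * of_real (s * u))" for s
    using s by (simp add: mult_ac)
  show "integrable lborel (\<lambda>s. complex_of_real (exp (- (\<sigma> * s)\<^sup>2 / 2)) * exp (- \<i> * of_real (s * u)))"
    using integrable_lborel_affine[OF int, of \<sigma> 0] s unfolding sc by simp
  have "(LINT s|lborel. ?f s) = of_real (sqrt (2 * pi)) * of_real (exp (- (u / \<sigma>)\<^sup>2 / 2))"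
    unfolding f_eq using exp_iy_std_normal[of "- (u / \<sigma>)"] by simp
  moreover have "(LINT s|lborel. ?f s) = \<sigma> *\<^sub>R (LINT s|lborel. complex_of_real (exp (- (\<sigma> * s)\<^sup>2 / 2)) * exp (- \<i> * of_real (s * u)))"
    using integral_lborel_affine[OF m, of \<sigma> 0] s unfolding sc by simp
  ultimately have "(LINT s|lborel. complex_of_real (exp (- (\<sigma> * s)\<^sup>2 / 2)) * exp (- \<i> * of_real (s * u)))
      = of_real ((sqrt (2 * pi)) * (exp (- (u / \<sigma>)\<^sup>2 / 2)) / \<sigma>)"
    using s by (simp add: scaleR_conv_of_real field_simps)
  also have "(sqrt (2 * pi)) * (exp (- (u / \<sigma>)\<^sup>2 / 2)) / \<sigma> = 2 * pi * normal_density 0 \<sigma> u"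
  proof -
    have "2 * pi = sqrt (2 * pi) * sqrt (2 * pi)" by simp
    then show ?thesis using s
      by (simp add: normal_density_def real_sqrt_mult power_divide field_simps)
  qed
  finally show "(LINT s|lborel. complex_of_real (exp (- (\<sigma> * s)\<^sup>2 / 2)) * exp (- \<i> * of_real (s * u)))
      = of_real (2 * pi * normal_density 0 \<sigma> u)" .
qed

definition gauss :: "real \<Rightarrow> real^'d::finite \<Rightarrow> complex" where
  "gauss \<sigma> x = (\<Prod>j\<in>UNIV. complex_of_real (exp (- (\<sigma> * x $ j)\<^sup>2 / 2)))"

lemma gauss_char:
  "gauss \<sigma> (x::real^'d::finite) * exp (- \<i> * complex_of_real (x \<bullet> u)) =
    (\<Prod>j\<in>UNIV. complex_of_real (exp (- (\<sigma> * x $ j)\<^sup>2 / 2)) * exp (- \<i> * of_real (x $ j * u $ j)))"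
  unfolding gauss_def prod.distrib
  by (subst exp_sum[symmetric]) (simp_all add: inner_vec_def sum_distrib_left sum_negf)

lemma
  assumes "\<sigma> > 0"
  shows gauss_integrable: "integrable lborel (gauss \<sigma> :: real^'d::finite \<Rightarrow> complex)"
    and ft_gauss: "ft (gauss \<sigma>) (u::real^'d::finite) = of_real ((2 * pi) ^ CARD('d) * (\<Prod>j\<in>UNIV. normal_density 0 \<sigma> (u $ j)))"
proof -
  show "integrable lborel (gauss \<sigma> :: real^'d::finite \<Rightarrow> complex)"
    using integrable_lborel_vec_prod[where 'd='d, OF gauss_ft_1d(1)[OF assms, of 0]] by (simp add: gauss_def[abs_def])
  show "ft (gauss \<sigma>) (u::real^'d) = of_real ((2 * pi) ^ CARD('d) * (\<Prod>j\<in>UNIV. normal_density 0 \<sigma> (u $ j)))"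
    unfolding ft_def gauss_char
    using integral_lborel_vec_prod[where 'd='d, of "\<lambda>j s. complex_of_real (exp (- (\<sigma> * s)\<^sup>2 / 2)) * exp (- \<i> * of_real (s * u $ j))"]
      gauss_ft_1d[OF assms]
    by (simp add: prod.distrib)
qed

lemma gauss_le_1: "cmod (gauss \<sigma> x) \<le> 1"
  unfolding gauss_def by (auto simp: prod_norm[symmetric] intro!: prod_le_1)

lemma continuous_on_gauss [continuous_intros]: "continuous_on S (gauss \<sigma>)"
  unfolding gauss_def by (intro continuous_intros) auto

text \<open>A product majorant makes Fubini applicable, and measurability is stated for the Borel
  sets of the product space, where continuity gives it at once.\<close>

lemma
  fixes F :: "'a::euclidean_space \<Rightarrow> 'b::euclidean_space \<Rightarrow> complex"
  assumes m [measurable]: "case_prod F \<in> borel_measurable borel"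
    and A: "integrable lborel A" and B: "integrable lborel B"
    and le: "\<And>x y. cmod (F x y) \<le> A x * B y"
  shows integrable_pair_bound: "integrable lborel (case_prod F)"
    and Fubini_bound: "(LINT x|lborel. LINT y|lborel. F x y) = (LINT y|lborel. LINT x|lborel. F x y)"
    and Fubini_pair: "(LINT z|lborel. F (fst z) (snd z)) = (LINT x|lborel. LINT y|lborel. F x y)"
proof -
  have m' [measurable]: "case_prod F \<in> borel_measurable (lborel \<Otimes>\<^sub>M lborel)"
    using m by (simp add: lborel_prod)
  have Fx [measurable]: "F x \<in> borel_measurable borel" for x
    using measurable_compose[OF measurable_Pair1'[of x "lborel :: 'a measure" "lborel :: 'b measure"] m'] by simp
  have iF: "integrable lborel (F x)" for x
  proof (rule Bochner_Integration.integrable_bound)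
    show "integrable lborel (\<lambda>y. A x * B y)" by (intro integrable_mult_right B)
    show "AE y in lborel. norm (F x y) \<le> norm (A x * B y)"
      using le by (intro AE_I2) (metis abs_ge_self order_trans real_norm_def)
  qed simp
  have int: "integrable (lborel \<Otimes>\<^sub>M lborel) (case_prod F)"
  proof (rule lborel_pair.Fubini_integrable)
    show "integrable lborel (\<lambda>x. LINT y|lborel. norm (case_prod F (x, y)))"
    proof (rule Bochner_Integration.integrable_bound)
      show "integrable lborel (\<lambda>x. A x * (LINT y|lborel. B y))" by (intro integrable_mult_left A)
      show "(\<lambda>x. LINT y|lborel. norm (case_prod F (x, y))) \<in> borel_measurable lborel" by measurable
      show "AE x in lborel. norm (LINT y|lborel. norm (case_prod F (x, y))) \<le> norm (A x * (LINT y|lborel. B y))"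
      proof (intro AE_I2)
        fix x
        have "(LINT y|lborel. norm (F x y)) \<le> (LINT y|lborel. A x * B y)"
          by (intro integral_mono integrable_norm iF integrable_mult_right B le)
        moreover have "(LINT y|lborel. norm (F x y)) \<ge> 0" by (rule integral_nonneg_AE) simp
        ultimately show "norm (LINT y|lborel. norm (case_prod F (x, y))) \<le> norm (A x * (LINT y|lborel. B y))" by simp
      qed
    qed
    show "AE x in lborel. integrable lborel (\<lambda>y. case_prod F (x, y))" using iF by simp
  qed simp
  then show "integrable lborel (case_prod F)" by (simp add: lborel_prod)
  show "(LINT x|lborel. LINT y|lborel. F x y) = (LINT y|lborel. LINT x|lborel. F x y)"
    using lborel_pair.Fubini_integral[OF int] by simp
  have "(LINT z|lborel. F (fst z) (snd z)) = (LINT z|(lborel \<Otimes>\<^sub>M lborel). case_prod F z)"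
    by (simp add: lborel_prod case_prod_unfold)
  also have "\<dots> = (LINT x|lborel. LINT y|lborel. F x y)"
    using lborel_pair.integral_fst'[OF int] by simp
  finally show "(LINT z|lborel. F (fst z) (snd z)) = (LINT x|lborel. LINT y|lborel. F x y)" .
qed

lemma borel_measurable_pair_continuous:
  fixes F :: "'a::euclidean_space \<Rightarrow> 'b::euclidean_space \<Rightarrow> complex"
  assumes "continuous_on UNIV (\<lambda>z. F (fst z) (snd z))"
  shows "case_prod F \<in> borel_measurable borel"
  using borel_measurable_continuous_onI[OF assms] by (simp add: case_prod_unfold)

lemma continuous_on_fst_comp: "continuous_on UNIV G \<Longrightarrow> continuous_on S (\<lambda>z. G (fst z))"
  by (rule continuous_on_compose2[where t=UNIV]) (auto intro!: continuous_intros)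

lemma continuous_on_snd_comp: "continuous_on UNIV G \<Longrightarrow> continuous_on S (\<lambda>z. G (snd z))"
  by (rule continuous_on_compose2[where t=UNIV]) (auto intro!: continuous_intros)

text \<open>Fubini for \<open>F x * exp (- i x \<bullet> y) * G y\<close>. Here \<open>G\<close> may
  be any continuous integrable function, in particular a modulated Gaussian or a reflected test
  function.\<close>

lemma ft_mult_swap:
  fixes F G :: "real^'d::finite \<Rightarrow> complex"
  assumes F: "wt_dom F" and G: "continuous_on UNIV G" "integrable lborel G"
  shows "(LINT y|lborel. ft F y * G y) = (LINT x|lborel. F x * ft G x)"
proof -
  obtain K where K: "\<And>x. cmod (F x) \<le> K * wt x" using F by (auto simp: wt_dom_def)
  define Q where "Q x y = F x * exp (- \<i> * complex_of_real (x \<bullet> y)) * G y" for x y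
  have "(LINT y|lborel. ft F y * G y) = (LINT y|lborel. LINT x|lborel. Q x y)"
    unfolding ft_def Q_def by simp
  also have "\<dots> = (LINT x|lborel. LINT y|lborel. Q x y)"
  proof (rule Fubini_bound[symmetric])
    show "case_prod Q \<in> borel_measurable borel"
      unfolding Q_def
      by (intro borel_measurable_pair_continuous continuous_intros continuous_on_fst_comp continuous_on_snd_comp G wt_dom_continuous[OF F])
    show "integrable lborel (\<lambda>x::real^'d. K * wt x)" by (intro integrable_mult_right integrable_wt)
    show "integrable lborel (\<lambda>x. cmod (G x))" by (intro integrable_norm G)
    show "cmod (Q x y) \<le> K * wt x * cmod (G y)" for x y
      unfolding Q_def norm_mult using K by (simp add: mult_right_mono)
  qed
  also have "\<dots> = (LINT x|lborel. F x * ft G x)"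
    unfolding ft_def Q_def by (simp add: mult.assoc mult.commute[of "exp _" "G _"] inner_commute)
  finally show ?thesis .
qed

lemma ft_continuous:
  assumes "wt_dom G"
  shows "continuous_on UNIV (ft G)"
proof -
  obtain K where K: "\<And>x. cmod (G x) \<le> K * wt x" using assms by (auto simp: wt_dom_def)
  have m: "G \<in> borel_measurable borel" by (rule wt_dom_measurable[OF assms])
  have "(\<lambda>i. ft G (u i)) \<longlonglongrightarrow> ft G a" if "u \<longlonglongrightarrow> a" for u a
    unfolding ft_def
  proof (rule integral_dominated_convergence[where w="\<lambda>x. K * wt x"])
    show "integrable lborel (\<lambda>x::real^'a. K * wt x)" by (intro integrable_mult_right integrable_wt)
    show "AE x in lborel. (\<lambda>i. G x * exp (- \<i> * complex_of_real (x \<bullet> u i))) \<longlonglongrightarrow> G x * exp (- \<i> * complex_of_real (x \<bullet> a))"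
      by (intro AE_I2 tendsto_intros that)
  qed (use m K in \<open>auto simp: norm_mult\<close>)
  then show ?thesis by (simp add: continuous_on_sequentially o_def)
qed

text \<open>Fourier inversion, by inserting Gaussian convergence factors.\<close>

lemma ft_inversion:
  fixes f :: "real^'d::finite \<Rightarrow> complex"
  assumes f: "wt_dom f" and ftf: "wt_dom (ft f)"
  shows "ft (ft f) x = (2 * pi) ^ CARD('d) * f (- x)"
proof -
  obtain K where K: "\<And>x. cmod (f x) \<le> K * wt x" using f by (auto simp: wt_dom_def)
  obtain L where L: "\<And>x. cmod (ft f x) \<le> L * wt x" using ftf by (auto simp: wt_dom_def)
  have K0: "K \<ge> 0" using K[of 0] wt_pos[of "0::real^'d"] norm_ge_zero[of "f 0"]
    by (meson order_trans zero_le_mult_iff not_le)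
  have fK: "cmod (f x) \<le> K" for x using K[of x] wt_le_1[of x] K0 by (meson mult_left_le order_trans)
  have mf: "f \<in> borel_measurable borel" and mff: "ft f \<in> borel_measurable borel"
    using f ftf by (auto intro: wt_dom_measurable)
  define \<sigma> where "\<sigma> n = 1 / real (Suc n)" for n
  have s: "\<sigma> n > 0" for n by (simp add: \<sigma>_def)
  have s0: "\<sigma> \<longlonglongrightarrow> 0" unfolding \<sigma>_def using LIMSEQ_inverse_real_of_nat by (simp add: inverse_eq_divide)
  define E where "E y = exp (- \<i> * complex_of_real (y \<bullet> x))" for y :: "real^'d"
  define \<gamma> where "\<gamma> y = complex_of_real (\<Prod>j\<in>UNIV. std_normal_density (y $ j))" for y :: "real^'d"
  have g1: "integrable lborel std_normal_density" by simp
  have int\<gamma>': "integrable lborel (\<lambda>y::real^'d. \<Prod>j\<in>UNIV. std_normal_density (y $ j))"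
    by (rule integrable_lborel_vec_prod[OF g1])
  then have int\<gamma>: "integrable lborel \<gamma>" unfolding \<gamma>_def[abs_def] by (rule integrable_of_real)
  have I\<gamma>: "(LINT y|lborel. \<gamma> y) = 1"
  proof -
    have "(LINT y|lborel. (\<Prod>j\<in>UNIV. std_normal_density ((y::real^'d) $ j))) = (\<Prod>j\<in>(UNIV::'d set). LINT s|lborel. std_normal_density s)"
      by (rule integral_lborel_vec_prod[OF g1])
    then show ?thesis unfolding \<gamma>_def by (simp add: integral_normal_density del: of_real_prod)
  qed
  have m\<gamma>: "\<gamma> \<in> borel_measurable borel" using borel_measurable_integrable[OF int\<gamma>] by simp
  \<comment> \<open>The multiplication formula moves the Gaussian to the side of \<open>f\<close>,
    where it becomes a normal density; rescaling around \<open>- x\<close> makes this density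
    independent of \<open>n\<close>.\<close>
  have eq: "(LINT y|lborel. ft f y * (gauss (\<sigma> n) y * E y)) = (2 * pi) ^ CARD('d) * (LINT y|lborel. f (- x + \<sigma> n *\<^sub>R y) * \<gamma> y)" for n
  proof -
    have gE: "integrable lborel (\<lambda>y. gauss (\<sigma> n) y * E y)"
    proof (rule Bochner_Integration.integrable_bound[OF gauss_integrable[OF s[of n]]])
      show "(\<lambda>y. gauss (\<sigma> n) y * E y) \<in> borel_measurable lborel" unfolding E_def
        by (simp, intro borel_measurable_continuous_onI continuous_intros)
    qed (simp add: E_def norm_mult)
    have ftgE: "ft (\<lambda>y. gauss (\<sigma> n) y * E y) z = ft (gauss (\<sigma> n)) (z + x)" for z
      unfolding ft_def E_def by (simp add: mult.assoc inner_add_right algebra_simps flip: exp_add)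
    have "(LINT y|lborel. ft f y * (gauss (\<sigma> n) y * E y)) = (LINT z|lborel. f z * ft (\<lambda>y. gauss (\<sigma> n) y * E y) z)"
      by (rule ft_mult_swap[OF f _ gE]) (auto simp: E_def intro!: continuous_intros)
    also have "\<dots> = (LINT z|lborel. f z * ft (gauss (\<sigma> n)) (z + x))" by (simp only: ftgE)
    also have "\<dots> = \<bar>\<sigma> n\<bar> ^ DIM(real^'d) *\<^sub>R (LINT y|lborel. f (- x + \<sigma> n *\<^sub>R y) * ft (gauss (\<sigma> n)) ((- x + \<sigma> n *\<^sub>R y) + x))"
    proof (rule integral_lborel_affine)
      have "continuous_on UNIV (\<lambda>z. ft (gauss (\<sigma> n)) (z + x))"
        unfolding ft_gauss[OF s[of n]] normal_density_def using s[of n] by (intro continuous_intros) auto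
      then show "(\<lambda>z. f z * ft (gauss (\<sigma> n)) (z + x)) \<in> borel_measurable borel"
        by (intro borel_measurable_times mf) (rule borel_measurable_continuous_onI)
    qed (use s[of n] in auto)
    also have "\<dots> = (LINT y|lborel. (2 * pi) ^ CARD('d) * (f (- x + \<sigma> n *\<^sub>R y) * \<gamma> y))"
    proof -
      have nd: "\<sigma> n * normal_density 0 (\<sigma> n) (\<sigma> n * t) = std_normal_density t" for t
        using s[of n] by (simp add: normal_density_def real_sqrt_mult power_mult_distrib)
      have "\<bar>\<sigma> n\<bar> ^ DIM(real^'d) * (\<Prod>j\<in>UNIV. normal_density 0 (\<sigma> n) (\<sigma> n * y $ j)) = (\<Prod>j\<in>UNIV. std_normal_density (y $ j))" for y :: "real^'d"
      proof -
        have "\<bar>\<sigma> n\<bar> ^ DIM(real^'d) = (\<Prod>j\<in>(UNIV::'d set). \<sigma> n)" using s[of n] by simp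
        then show ?thesis by (simp only: prod.distrib[symmetric] nd)
      qed
      then have "complex_of_real (\<bar>\<sigma> n\<bar> ^ DIM(real^'d)) * of_real (\<Prod>j\<in>UNIV. normal_density 0 (\<sigma> n) (\<sigma> n * y $ j)) = \<gamma> y" for y
        unfolding \<gamma>_def by (metis of_real_mult)
      then have "\<bar>\<sigma> n\<bar> ^ DIM(real^'d) *\<^sub>R (f (- x + \<sigma> n *\<^sub>R y) * ft (gauss (\<sigma> n)) ((- x + \<sigma> n *\<^sub>R y) + x)) = (2 * pi) ^ CARD('d) * (f (- x + \<sigma> n *\<^sub>R y) * \<gamma> y)" for y
        unfolding ft_gauss[OF s[of n]] scaleR_conv_of_real[where 'a=complex] by (simp add: mult_ac)
      then show ?thesis by (subst integral_scaleR_right[symmetric]) simp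
    qed
    finally show ?thesis by simp
  qed
  \<comment> \<open>On this side the Gaussian factor tends to 1.\<close>
  have "(\<lambda>n. LINT y|lborel. ft f y * (gauss (\<sigma> n) y * E y)) \<longlonglongrightarrow> (LINT y|lborel. ft f y * (1 * E y))"
  proof (rule integral_dominated_convergence[where w="\<lambda>x. L * wt x"])
    have Em: "E \<in> borel_measurable borel" unfolding E_def by (intro borel_measurable_continuous_onI continuous_intros)
    show "(\<lambda>y. ft f y * (1 * E y)) \<in> borel_measurable lborel" using mff Em by simp
    show "(\<lambda>y. ft f y * (gauss (\<sigma> n) y * E y)) \<in> borel_measurable lborel" for n
    proof -
      have "(\<lambda>y. ft f y * (gauss (\<sigma> n) y * E y)) \<in> borel_measurable borel"
        by (intro borel_measurable_times mff Em borel_measurable_continuous_onI[OF continuous_on_gauss])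
      then show ?thesis by simp
    qed
    show "integrable lborel (\<lambda>x::real^'d. L * wt x)" by (intro integrable_mult_right integrable_wt)
    show "AE y in lborel. (\<lambda>n. ft f y * (gauss (\<sigma> n) y * E y)) \<longlonglongrightarrow> ft f y * (1 * E y)"
    proof (intro AE_I2 tendsto_intros)
      fix y :: "real^'d"
      have "(\<lambda>n. gauss (\<sigma> n) y) \<longlonglongrightarrow> gauss 0 y" unfolding gauss_def by (intro tendsto_intros s0) simp
      then show "(\<lambda>n. gauss (\<sigma> n) y) \<longlonglongrightarrow> 1" by (simp add: gauss_def)
    qed
    show "AE y in lborel. norm (ft f y * (gauss (\<sigma> n) y * E y)) \<le> L * wt y" for n
    proof (intro AE_I2)
      fix y
      have "norm (ft f y * (gauss (\<sigma> n) y * E y)) \<le> cmod (ft f y)"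
        unfolding norm_mult using gauss_le_1[of "\<sigma> n" y] by (simp add: E_def mult_left_le)
      then show "norm (ft f y * (gauss (\<sigma> n) y * E y)) \<le> L * wt y" using L[of y] by simp
    qed
  qed
  then have "(\<lambda>n. (2 * pi) ^ CARD('d) * (LINT y|lborel. f (- x + \<sigma> n *\<^sub>R y) * \<gamma> y)) \<longlonglongrightarrow> ft (ft f) x"
    unfolding eq by (simp add: E_def ft_def)
  \<comment> \<open>On the other side the argument shrinks to \<open>- x\<close>, where
    \<open>f\<close> is continuous, and the bound \<open>K\<close> of \<open>f\<close> supplies the
    majorant.\<close>
  moreover have "(\<lambda>n. (2 * pi) ^ CARD('d) * (LINT y|lborel. f (- x + \<sigma> n *\<^sub>R y) * \<gamma> y)) \<longlonglongrightarrow> (2 * pi) ^ CARD('d) * (LINT y|lborel. f (- x) * \<gamma> y)"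
  proof (intro tendsto_intros integral_dominated_convergence[where w="\<lambda>y. K * cmod (\<gamma> y)"])
    show "(\<lambda>y. f (- x) * \<gamma> y) \<in> borel_measurable lborel" using m\<gamma> by simp
    show "(\<lambda>y. f (- x + \<sigma> n *\<^sub>R y) * \<gamma> y) \<in> borel_measurable lborel" for n using m\<gamma> mf by simp
    show "integrable lborel (\<lambda>y. K * cmod (\<gamma> y))" using int\<gamma> by simp
    show "AE y in lborel. (\<lambda>n. f (- x + \<sigma> n *\<^sub>R y) * \<gamma> y) \<longlonglongrightarrow> f (- x) * \<gamma> y"
    proof (intro AE_I2 tendsto_intros)
      fix y
      have "isCont f (- x)" using wt_dom_continuous[OF f, of UNIV] by (simp add: continuous_on_eq_continuous_at)
      moreover have "(\<lambda>n. - x + \<sigma> n *\<^sub>R y) \<longlonglongrightarrow> - x + 0 *\<^sub>R y" by (intro tendsto_intros s0)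
      ultimately show "(\<lambda>n. f (- x + \<sigma> n *\<^sub>R y)) \<longlonglongrightarrow> f (- x)" using isCont_tendsto_compose[of "- x" f "\<lambda>n. - x + \<sigma> n *\<^sub>R y" sequentially] by simp
    qed
    show "AE y in lborel. norm (f (- x + \<sigma> n *\<^sub>R y) * \<gamma> y) \<le> K * cmod (\<gamma> y)" for n
      using fK by (intro AE_I2) (simp add: norm_mult mult_right_mono)
  qed
  ultimately have "ft (ft f) x = (2 * pi) ^ CARD('d) * (LINT y|lborel. f (- x) * \<gamma> y)" by (rule LIMSEQ_unique)
  then show ?thesis by (simp add: I\<gamma>)
qed

subsection \<open>Gelfand--Shilov classes of families\<close>

text \<open>\<open>a\<close> is the order of the derivatives and \<open>b\<close> the order of
  decay; the Fourier transform exchanges them. Functions in \<open>gs_space \<nu> \<mu>\<close> have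
  \<open>a = \<mu>\<close> and \<open>b = \<nu>\<close>, their transforms \<open>a = \<nu>\<close>
  and \<open>b = \<mu>\<close>.\<close>

abbreviation gs_fam_bound :: "real \<Rightarrow> real \<Rightarrow> real \<Rightarrow> real \<Rightarrow> real \<Rightarrow> ('d::finite \<Rightarrow> nat \<Rightarrow> real^'d \<Rightarrow> complex) \<Rightarrow> bool" where
  "gs_fam_bound a b h r C H \<equiv> fam_bound a h (\<lambda>x. C * exp (- r * norm x powr (1 / b))) H"

definition gs_fam :: "real \<Rightarrow> real \<Rightarrow> ('d::finite \<Rightarrow> nat \<Rightarrow> real^'d \<Rightarrow> complex) \<Rightarrow> bool" where
  "gs_fam a b H \<longleftrightarrow> coord_fam H \<and> (\<forall>h>0. \<forall>r>0. \<exists>C. gs_fam_bound a b h r C H)"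

lemma gs_fam_bound_nonneg:
  assumes "gs_fam_bound a b h r C (H :: 'd::finite \<Rightarrow> nat \<Rightarrow> real^'d \<Rightarrow> complex)"
  shows "C \<ge> 0"
  using fam_bound_nonneg[OF assms, of 0] by (simp add: zero_le_mult_iff)

lemma gs_fam_bound_mono:
  assumes H: "gs_fam_bound a b h r C H" and "h \<le> h'" "0 < h" "r' \<le> r" "C \<le> C'"
  shows "gs_fam_bound a b h' r' C' H"
proof (rule fam_bound_mono[OF H])
  fix x
  have "r' * norm x powr (1 / b) \<le> r * norm x powr (1 / b)" using assms by (intro mult_right_mono) auto
  then show "C * exp (- r * norm x powr (1 / b)) \<le> C' * exp (- r' * norm x powr (1 / b))"
    using gs_fam_bound_nonneg[OF H] assms by (intro mult_mono) auto
qed (use assms in auto)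

text \<open>Stable under multiplication by polynomials, which differentiation of the transform
  produces.\<close>

definition rapid :: "(real^'d::finite \<Rightarrow> complex) \<Rightarrow> bool" where
  "rapid G \<longleftrightarrow> continuous_on UNIV G \<and> (\<forall>n. \<exists>K. \<forall>x. (1 + norm x) ^ n * cmod (G x) \<le> K * wt x)"

lemma rapid_wt_dom: "rapid G \<Longrightarrow> wt_dom G"
  unfolding rapid_def wt_dom_def by (metis (no_types, lifting) mult_1 power_0)

definition vpow :: "('d::finite \<Rightarrow> nat) \<Rightarrow> real^'d \<Rightarrow> complex" where
  "vpow \<beta> x = of_real (\<Prod>l\<in>UNIV. (x $ l) ^ \<beta> l)"

lemma continuous_on_vpow [continuous_intros]: "continuous_on S (vpow \<beta>)"
  unfolding vpow_def by (intro continuous_intros)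

lemma cmod_vpow_le: "cmod (vpow \<beta> x) \<le> norm x ^ (\<Sum>l\<in>UNIV. \<beta> l)"
proof -
  have "cmod (vpow \<beta> x) = (\<Prod>l\<in>UNIV. \<bar>x $ l\<bar> ^ \<beta> l)" by (simp add: vpow_def norm_of_real abs_prod power_abs del: of_real_prod)
  also have "\<dots> \<le> (\<Prod>l\<in>UNIV. norm x ^ \<beta> l)" by (intro prod_mono) (auto intro!: power_mono component_le_norm_cart)
  finally show ?thesis by (simp add: power_sum)
qed

lemma rapid_vpow:
  assumes "rapid G"
  shows "rapid (\<lambda>x. vpow \<beta> x * G x)"
  unfolding rapid_def
proof (intro conjI allI)
  show "continuous_on UNIV (\<lambda>x. vpow \<beta> x * G x)" using assms by (intro continuous_intros) (simp add: rapid_def)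
  fix n
  define M where "M = (\<Sum>l\<in>UNIV. \<beta> l)"
  obtain K where K: "\<And>x. (1 + norm x) ^ (n + M) * cmod (G x) \<le> K * wt x" using assms by (auto simp: rapid_def)
  have "(1 + norm x) ^ n * cmod (vpow \<beta> x * G x) \<le> K * wt x" for x
  proof -
    have "cmod (vpow \<beta> x) \<le> (1 + norm x) ^ M"
      using cmod_vpow_le[of \<beta> x] power_mono[of "norm x" "1 + norm x" M] by (simp add: M_def)
    then have "(1 + norm x) ^ n * cmod (vpow \<beta> x * G x) \<le> (1 + norm x) ^ n * ((1 + norm x) ^ M * cmod (G x))"
      unfolding norm_mult by (intro mult_left_mono mult_right_mono) auto
    then show ?thesis using K[of x] by (simp add: power_add mult.assoc)
  qed
  then show "\<exists>K. \<forall>x. (1 + norm x) ^ n * cmod (vpow \<beta> x * G x) \<le> K * wt x" by blast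
qed

text \<open>Decay of rate 2 is split: one unit cancels the polynomial factor, the other yields the
  weight.\<close>

lemma gs_fam_rapid:
  assumes b: "b > 0" and H: "gs_fam a b (H :: 'd::finite \<Rightarrow> nat \<Rightarrow> real^'d \<Rightarrow> complex)"
  shows "rapid (H j n)"
  unfolding rapid_def
proof (intro conjI allI)
  show "continuous_on UNIV (H j n)" using H by (auto simp: gs_fam_def intro: coord_famD)
  fix m
  obtain C where C: "gs_fam_bound a b 1 2 C H" using H unfolding gs_fam_def by (meson zero_less_numeral zero_less_one)
  obtain W where W: "W > 0" "\<And>x::real^'d. exp (- 1 * norm x powr (1 / b)) \<le> W * wt x" using exp_le_wt[of 1 b] b by auto
  define c where "c = ((b / 1) powr b) ^ m * fact m powr b"
  define D where "D = C * fact n powr a"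
  have D: "D \<ge> 0" using gs_fam_bound_nonneg[OF C] by (simp add: D_def)
  have "(1 + norm x) ^ m * cmod (H j n x) \<le> (2 ^ m * (1 + c) * D * W) * wt x" for x
  proof -
    define e where "e = exp (norm x powr (1 / b))"
    have e: "e \<ge> 1" by (simp add: e_def)
    have "(1 + norm x) ^ m \<le> (2 * max 1 (norm x)) ^ m" by (intro power_mono) auto
    also have "\<dots> = 2 ^ m * max 1 (norm x) ^ m" by (rule power_mult_distrib)
    also have "max 1 (norm x) ^ m \<le> 1 + norm x ^ m" by (auto simp: max_def)
    also have "norm x ^ m \<le> c * e" using power_le_fact_powr_exp[of "norm x" b 1 m] b by (simp add: c_def e_def)
    also have "1 + c * e \<le> (1 + c) * e" using e by (simp add: algebra_simps)
    finally have 1: "(1 + norm x) ^ m \<le> 2 ^ m * ((1 + c) * e)" by simp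
    have 2: "cmod (H j n x) \<le> D * (1 / e * exp (- 1 * norm x powr (1 / b)))"
    proof -
      have "cmod (H j n x) \<le> C * exp (- 2 * norm x powr (1 / b)) * 1 ^ n * fact n powr a" using C unfolding fam_bound_def by blast
      also have "exp (- 2 * norm x powr (1 / b)) = 1 / e * exp (- 1 * norm x powr (1 / b))"
        by (simp add: e_def exp_minus[symmetric] inverse_eq_divide[symmetric] flip: exp_add)
      finally show ?thesis by (simp add: D_def mult_ac)
    qed
    have "(1 + norm x) ^ m * cmod (H j n x) \<le> (2 ^ m * ((1 + c) * e)) * (D * (1 / e * (W * wt x)))"
      using e D c_def by (intro mult_mono order_trans[OF 2] 1 mult_left_mono W) auto
    then show ?thesis using e by simp
  qed
  then show "\<exists>K. \<forall>x. (1 + norm x) ^ m * cmod (H j n x) \<le> K * wt x" by blast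
qed

text \<open>The monomial is multiplied into the family by the Leibniz rule and the decay lemma is
  applied to the product. Since \<open>vpow \<beta>\<close> corresponds to a derivative of the
  transform, this controls all its derivatives, with decay, uniformly in
  \<open>\<beta>\<close>.\<close>

lemma ft_monom_bound:
  assumes ab: "a > 0" "b > 0" "a + b > 1" and h: "h > 0" and r: "r > 0"
  shows "\<exists>h'>0. \<exists>r'>0. \<exists>A>0. \<forall>(H :: 'd::finite \<Rightarrow> nat \<Rightarrow> real^'d \<Rightarrow> complex) C \<beta> j y. coord_fam H \<longrightarrow> gs_fam_bound a b h' r' C H \<longrightarrow>
    cmod (ft (\<lambda>x. vpow \<beta> x * H j 0 x) y) \<le> A * C * h ^ (\<Sum>l\<in>UNIV. \<beta> l) * fact (\<Sum>l\<in>UNIV. \<beta> l) powr b * exp (- r * norm y powr (1 / a))"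
proof -
  obtain h0 C0 where h0: "h0 > 0" and C0: "C0 > 0" and dec: "\<And>(H :: 'd \<Rightarrow> nat \<Rightarrow> real^'d \<Rightarrow> complex) K j y. coord_fam H \<Longrightarrow> fam_bound a h0 (\<lambda>x. K * wt x) H \<Longrightarrow>
     cmod (ft (H j 0) y) \<le> C0 * K * exp (- r * norm y powr (1 / a))"
    using ft_decay[where 'd='d, OF ab(1) r] by blast
  \<comment> \<open>The Leibniz product doubles the scale, which must end below \<open>h0\<close>,
    and the powers in the monomial bound must end below those of \<open>h\<close>.\<close>
  define h1 where "h1 = min h (h0 / 2)"
  have h1: "h1 > 0" "h1 \<le> h" "2 * h1 \<le> h0" using h h0 by (auto simp: h1_def)
  obtain C1 R where C1: "C1 > 0" and R: "R > 0" and mb: "\<And>\<beta> :: 'd \<Rightarrow> nat.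
     fam_bound a h1 (\<lambda>x. C1 * h1 ^ (\<Sum>l\<in>UNIV. \<beta> l) * fact (\<Sum>l\<in>UNIV. \<beta> l) powr b * exp (R * norm x powr (1 / b))) (monom_fam \<beta>)"
    using fam_bound_monom[where 'd='d, OF ab h1(1)] by blast
  obtain W where W: "W > 0" "\<And>x::real^'d. exp (- 1 * norm x powr (1 / b)) \<le> W * wt x" using exp_le_wt[of 1 b] ab by auto
  \<comment> \<open>Of the rate \<open>R + 1\<close> the part \<open>R\<close> cancels the growth of
    the monomial bound; the remaining 1 gives the integrable weight.\<close>
  have "cmod (ft (\<lambda>x. vpow \<beta> x * H j 0 x) y) \<le> (C0 * C1 * W) * C * h ^ (\<Sum>l\<in>UNIV. \<beta> l) * fact (\<Sum>l\<in>UNIV. \<beta> l) powr b * exp (- r * norm y powr (1 / a))"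
    if H: "coord_fam H" and b: "gs_fam_bound a b h1 (R + 1) C H" for H :: "'d \<Rightarrow> nat \<Rightarrow> real^'d \<Rightarrow> complex" and C \<beta> j y
  proof -
    define M where "M = (\<Sum>l\<in>UNIV. \<beta> l)"
    define K where "K = C1 * h1 ^ M * fact M powr b * C * W"
    have C: "C \<ge> 0" by (rule gs_fam_bound_nonneg[OF b])
    have "fam_bound a h0 (\<lambda>x. K * wt x) (fam_mult (monom_fam \<beta>) H)"
    proof (rule fam_bound_mono[OF fam_bound_mult[OF mb b]])
      fix x :: "real^'d"
      have "C1 * h1 ^ (\<Sum>l\<in>UNIV. \<beta> l) * fact (\<Sum>l\<in>UNIV. \<beta> l) powr b * exp (R * norm x powr (1 / b)) * (C * exp (- (R + 1) * norm x powr (1 / b)))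
         = C1 * h1 ^ M * fact M powr b * C * (exp (R * norm x powr (1 / b)) * exp (- (R + 1) * norm x powr (1 / b)))" by (simp add: M_def)
      also have "exp (R * norm x powr (1 / b)) * exp (- (R + 1) * norm x powr (1 / b)) = exp (- 1 * norm x powr (1 / b))"
        by (simp add: algebra_simps flip: exp_add)
      also have "C1 * h1 ^ M * fact M powr b * C * \<dots> \<le> C1 * h1 ^ M * fact M powr b * C * (W * wt x)"
        using C C1 h1 by (intro mult_left_mono W) auto
      finally show "C1 * h1 ^ (\<Sum>l\<in>UNIV. \<beta> l) * fact (\<Sum>l\<in>UNIV. \<beta> l) powr b * exp (R * norm x powr (1 / b)) * (C * exp (- (R + 1) * norm x powr (1 / b)))
         \<le> K * wt x" by (simp add: K_def mult_ac)
    qed (use ab h1 in auto)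
    from dec[OF coord_fam_mult[OF coord_fam_monom H] this, of j y]
    have "cmod (ft (\<lambda>x. vpow \<beta> x * H j 0 x) y) \<le> C0 * K * exp (- r * norm y powr (1 / a))"
      by (simp add: fam_mult_0[abs_def] monom_fam_0 vpow_def)
    also have "\<dots> \<le> C0 * (C1 * h ^ M * fact M powr b * C * W) * exp (- r * norm y powr (1 / a))"
      unfolding K_def using C0 C1 C W h1 by (intro mult_right_mono mult_left_mono power_mono) auto
    finally show ?thesis by (simp add: M_def mult_ac)
  qed
  moreover have "C0 * C1 * W > 0" using C0 C1 W by simp
  moreover have "R + 1 > 0" using R by simp
  ultimately show ?thesis using h1(1) by blast
qed

text \<open>The coordinate derivatives of \<open>ft f\<close>, as obtained by differentiating under
  the integral.\<close>

definition ft_fam :: "(real^'d::finite \<Rightarrow> complex) \<Rightarrow> 'd \<Rightarrow> nat \<Rightarrow> real^'d \<Rightarrow> complex" where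
  "ft_fam f j n = ft (\<lambda>x. (- \<i> * of_real (x $ j)) ^ n * f x)"

lemma ft_fam_0: "ft_fam f j 0 = ft f"
  by (simp add: ft_fam_def)

definition unit_idx :: "'d::finite \<Rightarrow> nat \<Rightarrow> 'd \<Rightarrow> nat" where
  "unit_idx j n l = (if l = j then n else 0)"

lemma sum_unit_idx [simp]: "(\<Sum>l\<in>UNIV. unit_idx j n l) = n"
  by (simp add: unit_idx_def)

lemma vpow_unit_idx: "vpow (unit_idx j n) x = of_real (x $ j) ^ n"
proof -
  have "(\<Prod>l\<in>UNIV. (x $ l) ^ unit_idx j n l) = (\<Prod>l\<in>UNIV. if l = j then (x $ j) ^ n else 1)"
    by (intro prod.cong) (auto simp: unit_idx_def)
  then show ?thesis by (simp add: vpow_def)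
qed

lemma ft_fam_vpow: "ft_fam f j n y = (- \<i>) ^ n * ft (\<lambda>x. vpow (unit_idx j n) x * f x) y"
  unfolding ft_fam_def vpow_unit_idx
  by (subst ft_cmult[symmetric]) (simp only: power_mult_distrib[of "- \<i>"] mult.assoc)

lemma rapid_has_derivative:
  assumes "rapid G"
  shows "(ft G has_derivative (\<lambda>h. ft (\<lambda>x. (- \<i> * of_real (x \<bullet> h)) * G x) y)) (at y)"
proof -
  obtain K where K: "\<And>x. (1 + norm x) ^ 2 * cmod (G x) \<le> K * wt x" using assms unfolding rapid_def by blast
  show ?thesis by (rule ft_has_derivative[OF _ K]) (use assms in \<open>simp add: rapid_def\<close>)
qed

lemma rapid_cmult:
  assumes "rapid G"
  shows "rapid (\<lambda>x. c * G x)"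
  unfolding rapid_def
proof (intro conjI allI)
  show "continuous_on UNIV (\<lambda>x. c * G x)" using assms by (intro continuous_intros) (simp add: rapid_def)
  fix n
  obtain K where K: "\<And>x. (1 + norm x) ^ n * cmod (G x) \<le> K * wt x" using assms by (auto simp: rapid_def)
  have "(1 + norm x) ^ n * cmod (c * G x) \<le> (cmod c * K) * wt x" for x
    using mult_left_mono[OF K[of x], of "cmod c"] by (simp add: norm_mult mult_ac)
  then show "\<exists>K. \<forall>x. (1 + norm x) ^ n * cmod (c * G x) \<le> K * wt x" by blast
qed

lemma rapid_pow:
  assumes "rapid G"
  shows "rapid (\<lambda>x. (- \<i> * of_real (x $ j)) ^ n * G x)"
proof -
  have "rapid (\<lambda>x. vpow (unit_idx j n) x * G x)" by (rule rapid_vpow[OF assms])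
  moreover have "(- \<i> * of_real (x $ j)) ^ n * G x = (- \<i>) ^ n * (vpow (unit_idx j n) x * G x)" for x
    by (simp only: vpow_unit_idx power_mult_distrib[of "- \<i>"] mult.assoc)
  ultimately show ?thesis by (simp only: rapid_cmult)
qed

lemma coord_fam_ft:
  assumes "rapid G"
  shows "coord_fam (ft_fam G)"
  unfolding coord_fam_def
proof (intro conjI allI)
  show "continuous_on UNIV (ft_fam G j n)" for j n
    unfolding ft_fam_def by (intro ft_continuous rapid_wt_dom rapid_pow assms)
  show "ft_fam G i 0 = ft_fam G j 0" for i j by (simp add: ft_fam_0)
  fix j n and x :: "real^'a"
  let ?G = "\<lambda>x. (- \<i> * of_real (x $ j)) ^ n * G x"
  have "(ft ?G has_derivative (\<lambda>h. ft (\<lambda>z. (- \<i> * of_real (z \<bullet> h)) * ?G z) x)) (at (x + 0 *\<^sub>R axis j 1))"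
    using rapid_has_derivative[OF rapid_pow[OF assms]] by simp
  moreover have "((\<lambda>s. x + s *\<^sub>R axis j 1) has_derivative (\<lambda>s. s *\<^sub>R axis j 1)) (at 0)"
    by (auto intro!: derivative_eq_intros)
  ultimately have "((\<lambda>s. ft ?G (x + s *\<^sub>R axis j 1)) has_derivative (\<lambda>s. ft (\<lambda>z. (- \<i> * of_real (z \<bullet> (s *\<^sub>R axis j 1))) * ?G z) x)) (at 0)"
    by (intro has_derivative_compose[where f="\<lambda>s. x + s *\<^sub>R axis j 1" and g="ft ?G"])
  moreover have "ft (\<lambda>z. (- \<i> * of_real (z \<bullet> (s *\<^sub>R axis j 1))) * ?G z) x = s *\<^sub>R ft_fam G j (Suc n) x" for s
    using ft_cmult[of "of_real s" "\<lambda>x. (- \<i> * of_real (x $ j)) ^ Suc n * G x" x]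
    by (simp add: ft_fam_def inner_axis scaleR_conv_of_real[where 'a=complex] mult_ac)
  ultimately show "((\<lambda>s. ft_fam G j n (x + s *\<^sub>R axis j 1)) has_vector_derivative ft_fam G j (Suc n) x) (at 0)"
    by (simp add: has_vector_derivative_def ft_fam_def[abs_def])
qed

text \<open>Pure derivatives of the transform correspond to powers of one coordinate, a special case
  of the monomial bound. The constant \<open>A\<close> is uniform over all families, which later
  yields continuity and not merely invariance.\<close>

lemma gs_fam_bound_ft:
  assumes ab: "a > 0" "b > 0" "a + b > 1" and h: "h > 0" and r: "r > 0"
  shows "\<exists>h'>0. \<exists>r'>0. \<exists>A>0. \<forall>(H :: 'd::finite \<Rightarrow> nat \<Rightarrow> real^'d \<Rightarrow> complex) C j. coord_fam H \<longrightarrow> gs_fam_bound a b h' r' C H \<longrightarrow>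
    gs_fam_bound b a h r (A * C) (ft_fam (H j 0))"
proof -
  obtain h' r' A where *: "h' > 0" "r' > 0" "A > 0" and bd: "\<And>(H :: 'd \<Rightarrow> nat \<Rightarrow> real^'d \<Rightarrow> complex) C \<beta> j y. coord_fam H \<Longrightarrow> gs_fam_bound a b h' r' C H \<Longrightarrow>
    cmod (ft (\<lambda>x. vpow \<beta> x * H j 0 x) y) \<le> A * C * h ^ (\<Sum>l\<in>UNIV. \<beta> l) * fact (\<Sum>l\<in>UNIV. \<beta> l) powr b * exp (- r * norm y powr (1 / a))"
    using ft_monom_bound[where 'd='d, OF ab h r] by blast
  have "gs_fam_bound b a h r (A * C) (ft_fam (H j 0))" if H: "coord_fam H" and b: "gs_fam_bound a b h' r' C H"
    for H :: "'d \<Rightarrow> nat \<Rightarrow> real^'d \<Rightarrow> complex" and C j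
    unfolding fam_bound_def
  proof (intro allI)
    fix k n and y :: "real^'d"
    show "cmod (ft_fam (H j 0) k n y) \<le> A * C * exp (- r * norm y powr (1 / a)) * h ^ n * fact n powr b"
      using bd[OF H b, of "unit_idx k n" j y] by (simp add: ft_fam_vpow norm_mult norm_power mult_ac)
  qed
  then show ?thesis using * by blast
qed

lemma gs_fam_ft:
  assumes ab: "a > 0" "b > 0" "a + b > 1" and H: "gs_fam a b H"
  shows "gs_fam b a (ft_fam (H j 0))"
  unfolding gs_fam_def
proof (intro conjI allI impI)
  show "coord_fam (ft_fam (H j 0))" by (intro coord_fam_ft gs_fam_rapid[OF ab(2) H])
  fix h r :: real assume "h > 0" "r > 0"
  from gs_fam_bound_ft[OF ab this] obtain h' r' A where *: "h' > 0" "r' > 0"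
    "\<And>(H :: 'a \<Rightarrow> nat \<Rightarrow> real^'a \<Rightarrow> complex) C j. coord_fam H \<Longrightarrow> gs_fam_bound a b h' r' C H \<Longrightarrow> gs_fam_bound b a h r (A * C) (ft_fam (H j 0))"
    by blast
  obtain C where "gs_fam_bound a b h' r' C H" using H *(1,2) unfolding gs_fam_def by blast
  then show "\<exists>C. gs_fam_bound b a h r C (ft_fam (H j 0))" using *(3)[of H C j] H unfolding gs_fam_def by blast
qed

lemma gs_fam_ft_rapid:
  assumes ab: "a > 0" "b > 0" "a + b > 1" and H: "gs_fam a b H"
  shows "rapid (ft (H j 0))"
  using gs_fam_rapid[OF ab(1) gs_fam_ft[OF ab H, of j], of j 0] by (simp add: ft_fam_0)

lemma gs_fam_inversion:
  fixes H :: "'d::finite \<Rightarrow> nat \<Rightarrow> real^'d \<Rightarrow> complex"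
  assumes ab: "a > 0" "b > 0" "a + b > 1" and H: "gs_fam a b H"
  shows "ft (ft (H j 0)) x = (2 * pi) ^ CARD('d) * H j 0 (- x)"
  by (rule ft_inversion) (use gs_fam_rapid[OF ab(2) H] gs_fam_ft_rapid[OF ab H] rapid_wt_dom in auto)

subsection \<open>The Fourier characterization of Gelfand--Shilov spaces\<close>

lemma inv_ft_has_derivative:
  assumes "rapid G"
  shows "((\<lambda>x. ft G (- x)) has_derivative (\<lambda>h. ft (\<lambda>\<eta>. (\<i> * of_real (\<eta> \<bullet> h)) * G \<eta>) (- x))) (at x)"
proof -
  have "((\<lambda>x. ft G (- x)) has_derivative (\<lambda>h. ft (\<lambda>\<eta>. (- \<i> * of_real (\<eta> \<bullet> (- h))) * G \<eta>) (- x))) (at x)"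
    by (rule has_derivative_compose[where f=uminus and g="ft G", OF _ rapid_has_derivative[OF assms]])
       (auto intro!: derivative_eq_intros)
  then show ?thesis by simp
qed

text \<open>With the factor \<open>- \<i>\<close> in \<open>D_op\<close> the derivative becomes
  multiplication by the frequency without further constants; iterated derivatives then give
  monomials that depend only on the counts of the indices.\<close>

lemma D_op_inv_ft:
  assumes "rapid G"
  shows "D_op j (\<lambda>x. ft G (- x)) = (\<lambda>x. ft (\<lambda>\<eta>. of_real (\<eta> $ j) * G \<eta>) (- x))"
proof
  fix x
  have "D_op j (\<lambda>x. ft G (- x)) x = - \<i> * ft (\<lambda>\<eta>. (\<i> * of_real (\<eta> \<bullet> axis j 1)) * G \<eta>) (- x)"
    unfolding D_op_def by (simp only: frechet_derivative_at[OF inv_ft_has_derivative[OF assms], symmetric])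
  also have "\<dots> = ft (\<lambda>\<eta>. of_real (\<eta> $ j) * G \<eta>) (- x)"
    using ft_cmult[of "- \<i>" "\<lambda>\<eta>. (\<i> * of_real (\<eta> \<bullet> axis j 1)) * G \<eta>" "- x"] by (simp add: inner_axis mult.assoc[symmetric])
  finally show "D_op j (\<lambda>x. ft G (- x)) x = ft (\<lambda>\<eta>. of_real (\<eta> $ j) * G \<eta>) (- x)" .
qed

lemma vpow_Cons: "vpow (count_list (j # js)) x = of_real (x $ j) * vpow (count_list js) x"
proof -
  have "(\<Prod>l\<in>UNIV. (x $ l) ^ count_list (j # js) l) = (\<Prod>l\<in>UNIV. (if l = j then x $ j else 1) * (x $ l) ^ count_list js l)"
    by (intro prod.cong) auto
  then show ?thesis by (simp add: vpow_def prod.distrib)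
qed

lemma foldr_D_op_inv_ft:
  assumes "rapid G"
  shows "foldr D_op js (\<lambda>x. ft G (- x)) = (\<lambda>x. ft (\<lambda>\<eta>. vpow (count_list js) \<eta> * G \<eta>) (- x))"
proof (induction js)
  case Nil
  then show ?case by (simp add: vpow_def)
next
  case (Cons j js)
  then show ?case using D_op_inv_ft[OF rapid_vpow[OF assms], of j "count_list js"]
    by (simp only: foldr_Cons o_apply) (simp only: vpow_Cons mult.assoc)
qed

lemma smooth_inv_ft:
  assumes "rapid G"
  shows "smooth (\<lambda>x. ft G (- x))"
  unfolding smooth_def foldr_D_op_inv_ft[OF assms]
  using inv_ft_has_derivative[OF rapid_vpow[OF assms]]
  by (auto simp: differentiable_on_def differentiable_def intro: has_derivative_at_withinI)

lemma multi_list_exists: "\<exists>js. \<forall>j. count_list js j = \<beta> (j::'d::finite)"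
proof -
  have "\<exists>js. \<forall>j. count_list js j = (if j \<in> S then \<beta> j else 0)" if "finite S" for S :: "'d set"
    using that
  proof (induction S)
    case empty
    show ?case by (intro exI[of _ "[]"]) simp
  next
    case (insert k S)
    then obtain js where js: "\<forall>j. count_list js j = (if j \<in> S then \<beta> j else 0)" by blast
    have "count_list (replicate n k) j = (if j = k then n else 0)" for n j by (induction n) auto
    then have "\<forall>j. count_list (replicate (\<beta> k) k @ js) j = (if j \<in> insert k S then \<beta> j else 0)"
      using js insert by auto
    then show ?case by blast
  qed
  from this[of UNIV] show ?thesis by simp
qed

text \<open>The list picked by the choice operator is known only through its counts, and on the
  Fourier side only the counts enter.\<close>

lemma D_multi_inv_ft:
  assumes "rapid G"
  shows "D_multi \<beta> (\<lambda>x. ft G (- x)) = (\<lambda>x. ft (\<lambda>\<eta>. vpow (($) \<beta>) \<eta> * G \<eta>) (- x))"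
proof -
  define js where "js = (SOME js. \<forall>j. count_list js j = \<beta> $ j)"
  have "\<forall>j. count_list js j = \<beta> $ j" unfolding js_def by (rule someI_ex) (rule multi_list_exists)
  then have "count_list js = ($) \<beta>" by auto
  then show ?thesis unfolding D_multi_def js_def[symmetric] foldr_D_op_inv_ft[OF assms] by simp
qed

lemma mi_fact_ge_1: "mi_fact \<alpha> \<ge> 1"
  unfolding mi_fact_def by (intro prod_ge_1) simp

lemma fact_mi_size_le: "fact (mi_size (\<alpha> :: nat^'d::finite)) \<le> real CARD('d) ^ mi_size \<alpha> * mi_fact \<alpha>"
  unfolding mi_size_def mi_fact_def using fact_sum_le[of "UNIV :: 'd set" "($) \<alpha>"] by simp

lemma cmod_mi_power_le: "\<bar>mi_power x \<alpha>\<bar> \<le> norm x ^ mi_size \<alpha>"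
  using cmod_vpow_le[of "($) \<alpha>" x] by (simp add: vpow_def mi_power_def mi_size_def norm_of_real del: of_real_prod)

text \<open>Recovers the mixed quotients of the definition from pure derivatives on the Fourier
  side. The monomial bound delivers factorials of \<open>mi_size\<close>; passing to products of
  factorials costs powers of the dimension, for which \<open>g\<close> and \<open>k\<close> make
  room.\<close>

lemma gs_quot_inv_ft:
  fixes \<nu> \<mu> :: real
  assumes ab: "\<nu> > 0" "\<mu> > 0" "\<nu> + \<mu> > 1" and h: "h > 0"
  shows "\<exists>h'>0. \<exists>r'>0. \<exists>A>0. \<forall>(H :: 'd::finite \<Rightarrow> nat \<Rightarrow> real^'d \<Rightarrow> complex) C j z. gs_fam \<nu> \<mu> H \<longrightarrow> gs_fam_bound \<nu> \<mu> h' r' C H \<longrightarrow>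
    gs_quot \<nu> \<mu> h (\<lambda>x. ft (H j 0) (- x)) z \<le> A * C"
proof -
  define d where "d = real CARD('d)"
  have d: "d \<ge> 1" by (simp add: d_def Suc_leI)
  define g where "g = h / d powr \<nu>"
  define k where "k = h / d powr \<mu>"
  have gk: "g > 0" "k > 0" using h d by (auto simp: g_def k_def)
  \<comment> \<open>With this rate the growth in the bound for the monomial in \<open>x\<close> is
    cancelled exactly by the decay of the derivative.\<close>
  define r where "r = \<nu> / g powr (1 / \<nu>)"
  have r: "r > 0" using ab gk by (simp add: r_def)
  have rg: "(\<nu> / r) powr \<nu> = g" using ab gk by (simp add: r_def powr_powr)
  obtain h' r' A where *: "h' > 0" "r' > 0" "A > 0" and bd: "\<And>(H :: 'd \<Rightarrow> nat \<Rightarrow> real^'d \<Rightarrow> complex) C \<beta> j y. coord_fam H \<Longrightarrow> gs_fam_bound \<nu> \<mu> h' r' C H \<Longrightarrow>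
    cmod (ft (\<lambda>x. vpow \<beta> x * H j 0 x) y) \<le> A * C * k ^ (\<Sum>l\<in>UNIV. \<beta> l) * fact (\<Sum>l\<in>UNIV. \<beta> l) powr \<mu> * exp (- r * norm y powr (1 / \<nu>))"
    using ft_monom_bound[where 'd='d, OF ab gk(2) r] by blast
  have "gs_quot \<nu> \<mu> h (\<lambda>x. ft (H j 0) (- x)) z \<le> A * C" if H: "gs_fam \<nu> \<mu> H" and b: "gs_fam_bound \<nu> \<mu> h' r' C H"
    for H :: "'d \<Rightarrow> nat \<Rightarrow> real^'d \<Rightarrow> complex" and C j z
  proof -
    obtain x \<alpha> \<beta> where z: "z = (x, \<alpha>, \<beta>)" by (cases z) auto
    have C: "C \<ge> 0" by (rule gs_fam_bound_nonneg[OF b])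
    have fc: "fact (mi_size \<gamma>) powr c \<le> (d powr c) ^ mi_size \<gamma> * mi_fact \<gamma> powr c" if "c > 0" for \<gamma> :: "nat^'d" and c
    proof -
      have "fact (mi_size \<gamma>) powr c \<le> (d ^ mi_size \<gamma> * mi_fact \<gamma>) powr c"
        unfolding d_def using that by (intro powr_mono2 fact_mi_size_le) auto
      also have "\<dots> = (d powr c) ^ mi_size \<gamma> * mi_fact \<gamma> powr c"
        using d that by (simp add: powr_mult powr_power_commute)
      finally show ?thesis .
    qed
    have 1: "cmod (of_real (mi_power x \<alpha>)) \<le> h ^ mi_size \<alpha> * mi_fact \<alpha> powr \<nu> * exp (r * norm x powr (1 / \<nu>))"
    proof -
      have "cmod (of_real (mi_power x \<alpha>)) \<le> norm x ^ mi_size \<alpha>" using cmod_mi_power_le by simp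
      also have "\<dots> \<le> g ^ mi_size \<alpha> * fact (mi_size \<alpha>) powr \<nu> * exp (r * norm x powr (1 / \<nu>))"
        using power_le_fact_powr_exp[of "norm x" \<nu> r "mi_size \<alpha>"] ab r rg by simp
      also have "\<dots> \<le> g ^ mi_size \<alpha> * ((d powr \<nu>) ^ mi_size \<alpha> * mi_fact \<alpha> powr \<nu>) * exp (r * norm x powr (1 / \<nu>))"
        using gk fc[OF ab(1)] by (intro mult_right_mono mult_left_mono) auto
      also have "g ^ mi_size \<alpha> * ((d powr \<nu>) ^ mi_size \<alpha> * mi_fact \<alpha> powr \<nu>) = (g * d powr \<nu>) ^ mi_size \<alpha> * mi_fact \<alpha> powr \<nu>"
        by (simp add: power_mult_distrib)
      also have "g * d powr \<nu> = h" using d by (simp add: g_def)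
      finally show ?thesis .
    qed
    have 2: "cmod (D_multi \<beta> (\<lambda>x. ft (H j 0) (- x)) x) \<le> A * C * h ^ mi_size \<beta> * mi_fact \<beta> powr \<mu> * exp (- r * norm x powr (1 / \<nu>))"
    proof -
      have rp: "rapid (H j 0)" by (rule gs_fam_rapid[OF ab(2) H])
      have "cmod (D_multi \<beta> (\<lambda>x. ft (H j 0) (- x)) x) \<le> A * C * k ^ mi_size \<beta> * fact (mi_size \<beta>) powr \<mu> * exp (- r * norm x powr (1 / \<nu>))"
        unfolding D_multi_inv_ft[OF rp] mi_size_def using bd[OF _ b, of "($) \<beta>" j "- x"] H by (simp add: gs_fam_def)
      also have "\<dots> \<le> A * C * k ^ mi_size \<beta> * ((d powr \<mu>) ^ mi_size \<beta> * mi_fact \<beta> powr \<mu>) * exp (- r * norm x powr (1 / \<nu>))"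
        using gk fc[OF ab(2)] * C by (intro mult_right_mono mult_left_mono) auto
      also have "A * C * k ^ mi_size \<beta> * ((d powr \<mu>) ^ mi_size \<beta> * mi_fact \<beta> powr \<mu>) = A * C * (k * d powr \<mu>) ^ mi_size \<beta> * mi_fact \<beta> powr \<mu>"
        by (simp add: power_mult_distrib)
      also have "k * d powr \<mu> = h" using d by (simp add: k_def)
      finally show ?thesis .
    qed
    have "cmod (of_real (mi_power x \<alpha>) * D_multi \<beta> (\<lambda>x. ft (H j 0) (- x)) x)
       \<le> (h ^ mi_size \<alpha> * mi_fact \<alpha> powr \<nu> * exp (r * norm x powr (1 / \<nu>))) * (A * C * h ^ mi_size \<beta> * mi_fact \<beta> powr \<mu> * exp (- r * norm x powr (1 / \<nu>)))"
      unfolding norm_mult using h by (intro mult_mono 1 2) auto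
    also have "\<dots> = A * C * (h ^ mi_size (\<alpha> + \<beta>) * mi_fact \<alpha> powr \<nu> * mi_fact \<beta> powr \<mu>) * (exp (r * norm x powr (1 / \<nu>)) * exp (- r * norm x powr (1 / \<nu>)))"
      by (simp add: mi_size_def sum.distrib power_add mult_ac)
    also have "exp (r * norm x powr (1 / \<nu>)) * exp (- r * norm x powr (1 / \<nu>)) = 1" by (simp flip: exp_add)
    finally have "cmod (of_real (mi_power x \<alpha>) * D_multi \<beta> (\<lambda>x. ft (H j 0) (- x)) x)
        \<le> A * C * (h ^ mi_size (\<alpha> + \<beta>) * mi_fact \<alpha> powr \<nu> * mi_fact \<beta> powr \<mu>)" by simp
    moreover have "h ^ mi_size (\<alpha> + \<beta>) * mi_fact \<alpha> powr \<nu> * mi_fact \<beta> powr \<mu> > 0"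
      using h mi_fact_ge_1[of \<alpha>] mi_fact_ge_1[of \<beta>] by simp
    ultimately show ?thesis unfolding z gs_quot_def by (simp add: divide_le_eq)
  qed
  then show ?thesis using * by blast
qed

lemma gs_space_inv_ft:
  assumes ab: "\<nu> > 0" "\<mu> > 0" "\<nu> + \<mu> > 1" and H: "gs_fam \<nu> \<mu> H"
  shows "(\<lambda>x. ft (H j 0) (- x)) \<in> gs_space \<nu> \<mu>"
  unfolding gs_space_def
proof (intro CollectI conjI allI impI)
  show "smooth (\<lambda>x. ft (H j 0) (- x))" by (intro smooth_inv_ft gs_fam_rapid[OF ab(2) H])
  fix h :: real assume h: "h > 0"
  obtain h' r' A where *: "h' > 0" "r' > 0" "A > 0" and bd: "\<And>(H :: 'a \<Rightarrow> nat \<Rightarrow> real^'a \<Rightarrow> complex) C j z. gs_fam \<nu> \<mu> H \<Longrightarrow> gs_fam_bound \<nu> \<mu> h' r' C H \<Longrightarrow>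
    gs_quot \<nu> \<mu> h (\<lambda>x. ft (H j 0) (- x)) z \<le> A * C"
    using gs_quot_inv_ft[where 'd='a, OF ab h] by blast
  obtain C where "gs_fam_bound \<nu> \<mu> h' r' C H" using H * unfolding gs_fam_def by blast
  from bd[OF H this, of j] show "bdd_above (range (gs_quot \<nu> \<mu> h (\<lambda>x. ft (H j 0) (- x))))"
    by (auto intro!: bdd_aboveI[of _ "A * C"])
qed

section \<open>Test functions as families\<close>

text \<open>The factor \<open>\<i> ^ n\<close> turns the operators \<open>D_op\<close> back into
  ordinary derivatives.\<close>

definition deriv_fam :: "(real^'d::finite \<Rightarrow> complex) \<Rightarrow> 'd \<Rightarrow> nat \<Rightarrow> real^'d \<Rightarrow> complex" where
  "deriv_fam f j n x = \<i> ^ n * foldr D_op (replicate n j) f x"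

lemma deriv_fam_0: "deriv_fam f j 0 = f"
  by (rule ext) (simp add: deriv_fam_def)

lemma coord_fam_deriv_fam:
  assumes "smooth f"
  shows "coord_fam (deriv_fam f)"
  unfolding coord_fam_def
proof (intro conjI allI)
  have diff: "foldr D_op js f differentiable_on UNIV" for js using assms by (simp add: smooth_def)
  show "continuous_on UNIV (deriv_fam f j n)" for j n
    unfolding deriv_fam_def by (intro continuous_intros differentiable_imp_continuous_on diff)
  show "deriv_fam f i 0 = deriv_fam f j 0" for i j by (simp add: deriv_fam_0)
  fix j n and x :: "real^'a"
  let ?g = "foldr D_op (replicate n j) f"
  have "?g differentiable (at x)" using diff[of "replicate n j"] unfolding differentiable_on_def by blast
  then have "(?g has_derivative frechet_derivative ?g (at x)) (at (x + 0 *\<^sub>R axis j 1))"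
    by (simp add: frechet_derivative_works)
  moreover have "((\<lambda>s. x + s *\<^sub>R axis j 1) has_derivative (\<lambda>s. s *\<^sub>R axis j 1)) (at 0)"
    by (auto intro!: derivative_eq_intros)
  ultimately have "((\<lambda>s. ?g (x + s *\<^sub>R axis j 1)) has_derivative (\<lambda>s. frechet_derivative ?g (at x) (s *\<^sub>R axis j 1))) (at 0)"
    by (intro has_derivative_compose[where f="\<lambda>s. x + s *\<^sub>R axis j 1" and g="?g"])
  moreover have "frechet_derivative ?g (at x) (s *\<^sub>R axis j 1) = s *\<^sub>R (\<i> * foldr D_op (replicate (Suc n) j) f x)" for s
  proof -
    have "linear (frechet_derivative ?g (at x))"
      using diff[of "replicate n j"] unfolding differentiable_on_def by (intro linear_frechet_derivative) blast
    then show ?thesis by (simp add: linear_scale D_op_def)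
  qed
  ultimately have "((\<lambda>s. ?g (x + s *\<^sub>R axis j 1)) has_vector_derivative \<i> * foldr D_op (replicate (Suc n) j) f x) (at 0)"
    by (simp add: has_vector_derivative_def)
  then have "((\<lambda>s. \<i> ^ n * ?g (x + s *\<^sub>R axis j 1)) has_vector_derivative \<i> ^ n * (\<i> * foldr D_op (replicate (Suc n) j) f x)) (at 0)"
    by (rule has_vector_derivative_mult_right)
  then show "((\<lambda>s. deriv_fam f j n (x + s *\<^sub>R axis j 1)) has_vector_derivative deriv_fam f j (Suc n) x) (at 0)"
    by (simp add: deriv_fam_def mult_ac)
qed

lemma count_list_eq_replicate:
  assumes "\<forall>l. count_list js l = (if l = j then n else 0)"
  shows "js = replicate n j"
  using assms
proof (induction js arbitrary: n)
  case Nil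
  then show ?case by (metis count_list.simps(1) replicate_empty)
next
  case (Cons k js)
  have k: "k = j" using Cons.prems[rule_format, of k] by (auto split: if_splits)
  with Cons.prems[rule_format, of j] obtain m where n: "n = Suc m" by (cases n) auto
  have "\<forall>l. count_list js l = (if l = j then m else 0)"
    using Cons.prems k n by (metis count_list.simps(2) diff_Suc_1 add_right_imp_eq Suc_eq_plus1)
  then show ?case using Cons.IH k n by simp
qed

text \<open>A list whose counts are concentrated at one index is constant, so here the choice
  operator returns a known list.\<close>

lemma D_multi_unit: "D_multi (\<chi> l. if l = j then n else 0) f = foldr D_op (replicate n j) f"
proof -
  define js where "js = (SOME js. \<forall>l. count_list js l = (\<chi> l. if l = j then n else 0) $ l)"
  have "\<forall>l. count_list js l = (\<chi> l. if l = j then n else 0) $ l"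
    unfolding js_def by (rule someI_ex) (rule multi_list_exists)
  then have "js = replicate n j" by (intro count_list_eq_replicate) simp
  moreover have "D_multi (\<chi> l. if l = j then n else 0) f = foldr D_op js f"
    unfolding D_multi_def js_def ..
  ultimately show ?thesis by simp
qed

lemma gs_quot_le_seminorm:
  assumes "f \<in> gs_space \<nu> \<mu>" "h > 0"
  shows "gs_quot \<nu> \<mu> h f z \<le> gs_seminorm \<nu> \<mu> h f"
  unfolding gs_seminorm_def using assms by (intro cSUP_upper) (auto simp: gs_space_def)

lemma gs_quot_nonneg: "h > 0 \<Longrightarrow> gs_quot \<nu> \<mu> h f z \<ge> 0"
  by (cases z) (auto simp: gs_quot_def)

lemma gs_seminorm_nonneg:
  assumes "f \<in> gs_space \<nu> \<mu>" "h > 0"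
  shows "gs_seminorm \<nu> \<mu> h f \<ge> 0"
  using gs_quot_le_seminorm[OF assms] gs_quot_nonneg[OF assms(2)] order_trans by blast

lemma deriv_fam_coord_bound:
  assumes f: "f \<in> gs_space \<nu> \<mu>" and h: "h > 0"
  shows "\<bar>x $ k\<bar> ^ N * cmod (deriv_fam f j n x) \<le> gs_seminorm \<nu> \<mu> h f * h ^ (N + n) * fact N powr \<nu> * fact n powr \<mu>"
proof -
  define \<alpha> where "\<alpha> = (\<chi> l. if l = k then N else 0)"
  define \<beta> where "\<beta> = (\<chi> l. if l = j then n else 0)"
  have 1: "mi_power x \<alpha> = (x $ k) ^ N"
    using vpow_unit_idx[of k N x] unfolding vpow_def unit_idx_def \<alpha>_def mi_power_def of_real_power[symmetric] of_real_eq_iff by simp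
  have 2: "mi_fact \<alpha> = fact N" "mi_fact \<beta> = fact n"
    by (simp_all add: mi_fact_def \<alpha>_def \<beta>_def if_distrib cong: if_cong)
  have 3: "mi_size (\<alpha> + \<beta>) = N + n" by (simp add: mi_size_def \<alpha>_def \<beta>_def sum.distrib)
  have 4: "D_multi \<beta> f = foldr D_op (replicate n j) f" unfolding \<beta>_def by (rule D_multi_unit)
  have "gs_quot \<nu> \<mu> h f (x, \<alpha>, \<beta>) \<le> gs_seminorm \<nu> \<mu> h f" by (rule gs_quot_le_seminorm[OF f h])
  then have "\<bar>x $ k\<bar> ^ N * cmod (deriv_fam f j n x) / (h ^ (N + n) * fact N powr \<nu> * fact n powr \<mu>) \<le> gs_seminorm \<nu> \<mu> h f"
    by (simp add: gs_quot_def 1 2 3 4 deriv_fam_def norm_mult norm_power power_abs)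
  then show ?thesis using h by (simp add: divide_le_eq mult.assoc)
qed

text \<open>Only quotients with a power of one coordinate and a pure derivative are read off from
  the seminorm; the largest coordinate of \<open>x\<close> stands in for its norm, and summing over
  the powers gives the decay.\<close>

lemma gs_fam_bound_deriv_fam:
  assumes ab: "\<nu> > 0" and h: "h > 0" and r: "r > 0"
  shows "\<exists>h'>0. \<forall>f :: real^'d::finite \<Rightarrow> complex. f \<in> gs_space \<nu> \<mu> \<longrightarrow> gs_fam_bound \<mu> \<nu> h r (2 powr \<nu> * gs_seminorm \<nu> \<mu> h' f) (deriv_fam f)"
proof -
  define d where "d = real CARD('d)"
  have d: "d \<ge> 1" by (simp add: d_def Suc_leI)
  define g where "g = (\<nu> / (2 * r)) powr \<nu>"
  have g: "g > 0" using ab r by (simp add: g_def)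
  \<comment> \<open>\<open>h\<close> serves the derivatives and \<open>g / d\<close> the powers of
    the norm, the dimension \<open>d\<close> paying for the passage to one coordinate.\<close>
  define h' where "h' = min h (g / d)"
  have h': "h' > 0" "h' \<le> h" "d * h' \<le> g" using h g d by (auto simp: h'_def min_def field_simps)
  have "gs_fam_bound \<mu> \<nu> h r (2 powr \<nu> * gs_seminorm \<nu> \<mu> h' f) (deriv_fam f)" if f: "f \<in> gs_space \<nu> \<mu>" for f :: "real^'d \<Rightarrow> complex"
    unfolding fam_bound_def
  proof (intro allI)
    fix j n and x :: "real^'d"
    define p where "p = gs_seminorm \<nu> \<mu> h' f"
    have p: "p \<ge> 0" unfolding p_def by (rule gs_seminorm_nonneg[OF f h'(1)])
    obtain k where k: "norm x \<le> d * \<bar>x $ k\<bar>" unfolding d_def using norm_le_max_coord by blast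
    have "norm x ^ N * cmod (deriv_fam f j n x) \<le> (p * h ^ n * fact n powr \<mu>) * g ^ N * fact N powr \<nu>" for N
    proof -
      have "norm x ^ N * cmod (deriv_fam f j n x) \<le> (d * \<bar>x $ k\<bar>) ^ N * cmod (deriv_fam f j n x)"
        by (intro mult_right_mono power_mono k) auto
      also have "\<dots> = d ^ N * (\<bar>x $ k\<bar> ^ N * cmod (deriv_fam f j n x))" by (simp add: power_mult_distrib)
      also have "\<dots> \<le> d ^ N * (p * h' ^ (N + n) * fact N powr \<nu> * fact n powr \<mu>)"
        unfolding p_def using d by (intro mult_left_mono deriv_fam_coord_bound[OF f h'(1)]) auto
      also have "\<dots> = p * h' ^ n * fact n powr \<mu> * (d * h') ^ N * fact N powr \<nu>" by (simp add: power_add power_mult_distrib)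
      also have "\<dots> \<le> p * h ^ n * fact n powr \<mu> * g ^ N * fact N powr \<nu>"
        using h' p d h by (intro mult_right_mono mult_mono mult_left_mono power_mono mult_nonneg_nonneg) auto
      finally show ?thesis .
    qed
    then have "cmod (deriv_fam f j n x) * exp (r * norm x powr (1 / \<nu>)) \<le> 2 powr \<nu> * (p * h ^ n * fact n powr \<mu>)"
      by (intro exp_powr_le_of_powers[OF ab r]) (auto simp: g_def)
    then show "cmod (deriv_fam f j n x) \<le> 2 powr \<nu> * gs_seminorm \<nu> \<mu> h' f * exp (- r * norm x powr (1 / \<nu>)) * h ^ n * fact n powr \<mu>"
      unfolding p_def[symmetric] by (simp add: exp_minus field_simps)
  qed
  then show ?thesis using h' by blast
qed

lemma gs_fam_deriv_fam:
  assumes "\<nu> > 0" "f \<in> gs_space \<nu> \<mu>"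
  shows "gs_fam \<mu> \<nu> (deriv_fam f)"
  unfolding gs_fam_def
proof (intro conjI allI impI)
  show "coord_fam (deriv_fam f)" using assms by (intro coord_fam_deriv_fam) (simp add: gs_space_def)
qed (use gs_fam_bound_deriv_fam[OF assms(1)] assms(2) in blast)

lemma gs_space_rapid:
  assumes "\<nu> > 0" "f \<in> gs_space \<nu> \<mu>"
  shows "rapid f"
  using gs_fam_rapid[OF assms(1) gs_fam_deriv_fam[OF assms], of undefined 0] by (simp add: deriv_fam_0)

lemma gs_fam_ft_fam:
  assumes "\<nu> > 0" "\<mu> > 0" "\<nu> + \<mu> > 1" "f \<in> gs_space \<nu> \<mu>"
  shows "gs_fam \<nu> \<mu> (ft_fam f)"
  using gs_fam_ft[OF assms(2,1) _ gs_fam_deriv_fam[OF assms(1,4)], of undefined] assms by (simp add: deriv_fam_0 add.commute)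

lemma gs_space_inversion:
  fixes f :: "real^'d::finite \<Rightarrow> complex"
  assumes "\<nu> > 0" "\<mu> > 0" "\<nu> + \<mu> > 1" "f \<in> gs_space \<nu> \<mu>"
  shows "ft (ft f) x = (2 * pi) ^ CARD('d) * f (- x)"
  using gs_fam_inversion[OF assms(2,1) _ gs_fam_deriv_fam[OF assms(1,4)], of undefined] assms by (simp add: deriv_fam_0 add.commute)

text \<open>The quantitative half of the Fourier characterisation: one seminorm of \<open>f\<close>
  controls a given bound on its transform. Combined with \<open>gs_quot_inv_ft\<close> it makes
  operators defined on the Fourier side continuous.\<close>

lemma gs_fam_bound_ft_fam:
  assumes ab: "\<nu> > 0" "\<mu> > 0" "\<nu> + \<mu> > 1" and h: "h > 0" and r: "r > 0"
  shows "\<exists>h'>0. \<exists>A>0. \<forall>f :: real^'d::finite \<Rightarrow> complex. f \<in> gs_space \<nu> \<mu> \<longrightarrow> gs_fam_bound \<nu> \<mu> h r (A * gs_seminorm \<nu> \<mu> h' f) (ft_fam f)"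
proof -
  have ba: "\<mu> + \<nu> > 1" using ab by simp
  obtain h1 r1 A where *: "h1 > 0" "r1 > 0" "A > 0" and b1: "\<And>(H :: 'd \<Rightarrow> nat \<Rightarrow> real^'d \<Rightarrow> complex) C j. coord_fam H \<Longrightarrow> gs_fam_bound \<mu> \<nu> h1 r1 C H \<Longrightarrow>
     gs_fam_bound \<nu> \<mu> h r (A * C) (ft_fam (H j 0))"
    using gs_fam_bound_ft[where 'd='d, OF ab(2,1) ba h r] by blast
  obtain h' where h': "h' > 0" and b2: "\<And>f :: real^'d \<Rightarrow> complex. f \<in> gs_space \<nu> \<mu> \<Longrightarrow> gs_fam_bound \<mu> \<nu> h1 r1 (2 powr \<nu> * gs_seminorm \<nu> \<mu> h' f) (deriv_fam f)"
    using gs_fam_bound_deriv_fam[where 'd='d, OF ab(1) *(1,2)] by blast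
  have "gs_fam_bound \<nu> \<mu> h r ((A * 2 powr \<nu>) * gs_seminorm \<nu> \<mu> h' f) (ft_fam f)" if f: "f \<in> gs_space \<nu> \<mu>" for f :: "real^'d \<Rightarrow> complex"
    using b1[OF _ b2[OF f], of undefined] gs_fam_deriv_fam[OF ab(1) f] by (simp add: deriv_fam_0 gs_fam_def mult.assoc)
  moreover have "A * 2 powr \<nu> > 0" using * by simp
  ultimately show ?thesis using h' by blast
qed

subsection \<open>Linear and topological structure\<close>

lemma D_op_lin:
  assumes f: "f differentiable at x" and g: "g differentiable at x"
  shows "D_op j (\<lambda>x. a * f x + b * g x) x = a * D_op j f x + b * D_op j g x"
proof -
  have "((\<lambda>x. a * f x + b * g x) has_derivative
      (\<lambda>h. a * frechet_derivative f (at x) h + b * frechet_derivative g (at x) h)) (at x)"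
    using f g by (intro has_derivative_add has_derivative_mult_right) (auto simp: frechet_derivative_works)
  from frechet_derivative_at[OF this, symmetric] show ?thesis
    unfolding D_op_def by (simp add: algebra_simps)
qed

lemma foldr_D_op_lin:
  assumes f: "smooth f" and g: "smooth g"
  shows "foldr D_op js (\<lambda>x. a * f x + b * g x) = (\<lambda>x. a * foldr D_op js f x + b * foldr D_op js g x)"
proof (induction js)
  case (Cons j js)
  have "foldr D_op js f differentiable at x" "foldr D_op js g differentiable at x" for x
    using f g unfolding smooth_def differentiable_on_def by blast+
  then show ?case by (simp add: Cons.IH D_op_lin fun_eq_iff)
qed simp

lemma smooth_lin:
  assumes f: "smooth f" and g: "smooth g"
  shows "smooth (\<lambda>x. a * f x + b * g x)"
  unfolding smooth_def foldr_D_op_lin[OF f g]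
  using f g unfolding smooth_def by (auto intro!: derivative_intros)

lemma gs_quot_lin:
  assumes f: "smooth f" and g: "smooth g" and h: "h > 0"
  shows "gs_quot \<nu> \<mu> h (\<lambda>x. a * f x + b * g x) z \<le> cmod a * gs_quot \<nu> \<mu> h f z + cmod b * gs_quot \<nu> \<mu> h g z"
proof -
  obtain x \<alpha> \<beta> where z: "z = (x, \<alpha>, \<beta>)" by (cases z) auto
  let ?m = "complex_of_real (mi_power x \<alpha>)" and ?N = "h ^ mi_size (\<alpha> + \<beta>) * mi_fact \<alpha> powr \<nu> * mi_fact \<beta> powr \<mu>"
  have "cmod (?m * (a * D_multi \<beta> f x + b * D_multi \<beta> g x)) \<le> cmod a * cmod (?m * D_multi \<beta> f x) + cmod b * cmod (?m * D_multi \<beta> g x)"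
    unfolding distrib_left by (rule order_trans[OF norm_triangle_ineq]) (simp add: norm_mult mult_ac)
  then have "cmod (?m * (a * D_multi \<beta> f x + b * D_multi \<beta> g x)) / ?N
      \<le> (cmod a * cmod (?m * D_multi \<beta> f x) + cmod b * cmod (?m * D_multi \<beta> g x)) / ?N"
    using h by (intro divide_right_mono) auto
  moreover have "D_multi \<beta> (\<lambda>x. a * f x + b * g x) x = a * D_multi \<beta> f x + b * D_multi \<beta> g x"
    unfolding D_multi_def foldr_D_op_lin[OF f g] ..
  ultimately show ?thesis unfolding z gs_quot_def by (simp add: add_divide_distrib)
qed

lemma gs_seminorm_least:
  assumes "\<And>z. gs_quot \<nu> \<mu> h f z \<le> c"
  shows "gs_seminorm \<nu> \<mu> h f \<le> c"
  unfolding gs_seminorm_def using assms by (intro cSUP_least) auto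

lemma gs_space_smooth: "f \<in> gs_space \<nu> \<mu> \<Longrightarrow> smooth f"
  by (simp add: gs_space_def)

lemma gs_quot_lin_le:
  assumes f: "f \<in> gs_space \<nu> \<mu>" and g: "g \<in> gs_space \<nu> \<mu>" and h: "h > 0"
  shows "gs_quot \<nu> \<mu> h (\<lambda>x. a * f x + b * g x) z \<le> cmod a * gs_seminorm \<nu> \<mu> h f + cmod b * gs_seminorm \<nu> \<mu> h g"
  by (rule order_trans[OF gs_quot_lin[OF gs_space_smooth[OF f] gs_space_smooth[OF g] h]])
     (intro add_mono mult_left_mono gs_quot_le_seminorm f g h norm_ge_zero)

lemma gs_space_lin:
  assumes f: "f \<in> gs_space \<nu> \<mu>" and g: "g \<in> gs_space \<nu> \<mu>"
  shows "(\<lambda>x. a * f x + b * g x) \<in> gs_space \<nu> \<mu>"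
  unfolding gs_space_def
  using smooth_lin[OF gs_space_smooth[OF f] gs_space_smooth[OF g]] gs_quot_lin_le[OF f g]
  by (auto intro!: bdd_aboveI2)

lemma gs_seminorm_lin:
  assumes f: "f \<in> gs_space \<nu> \<mu>" and g: "g \<in> gs_space \<nu> \<mu>" and h: "h > 0"
  shows "gs_seminorm \<nu> \<mu> h (\<lambda>x. a * f x + b * g x) \<le> cmod a * gs_seminorm \<nu> \<mu> h f + cmod b * gs_seminorm \<nu> \<mu> h g"
  by (rule gs_seminorm_least[OF gs_quot_lin_le[OF f g h]])

lemma gs_space_diff:
  assumes f: "f \<in> gs_space \<nu> \<mu>" and g: "g \<in> gs_space \<nu> \<mu>"
  shows "(\<lambda>x. f x - g x) \<in> gs_space \<nu> \<mu>"
  using gs_space_lin[OF f g, of 1 "-1"] by simp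

lemma gs_space_cmult:
  assumes f: "f \<in> gs_space \<nu> \<mu>"
  shows "(\<lambda>x. a * f x) \<in> gs_space \<nu> \<mu>"
  using gs_space_lin[OF f f, of a 0] by simp

lemma gs_seminorm_cmult:
  assumes f: "f \<in> gs_space \<nu> \<mu>" and h: "h > 0"
  shows "gs_seminorm \<nu> \<mu> h (\<lambda>x. a * f x) \<le> cmod a * gs_seminorm \<nu> \<mu> h f"
  using gs_seminorm_lin[OF f f h, of a 0] by simp

lemma foldr_D_op_zero: "foldr D_op js (\<lambda>x. 0) = (\<lambda>x. 0)"
proof (induction js)
  case (Cons j js)
  have "D_op j (\<lambda>x. 0) = (\<lambda>x. 0)" by (simp add: D_op_def frechet_derivative_const fun_eq_iff)
  then show ?case by (simp add: Cons.IH)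
qed simp

lemma D_multi_zero: "D_multi \<beta> (\<lambda>x. 0) = (\<lambda>x. 0)"
  by (simp add: D_multi_def foldr_D_op_zero)

lemma gs_space_zero: "(\<lambda>x. 0) \<in> gs_space \<nu> \<mu>"
proof -
  have "smooth (\<lambda>x::real^'a. 0)" by (simp add: smooth_def foldr_D_op_zero)
  moreover have "gs_quot \<nu> \<mu> h (\<lambda>x::real^'a. 0) = (\<lambda>z. 0)" for h
    by (auto simp: gs_quot_def D_multi_zero fun_eq_iff)
  ultimately show ?thesis by (simp add: gs_space_def)
qed

lemma gs_seminorm_zero: "gs_seminorm \<nu> \<mu> h (\<lambda>x. 0) = 0"
proof -
  have "gs_quot \<nu> \<mu> h (\<lambda>x::real^'a. 0) = (\<lambda>z. 0)"
    by (auto simp: gs_quot_def D_multi_zero fun_eq_iff)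
  then show ?thesis by (simp add: gs_seminorm_def)
qed

lemma gs_seminorm_antimono:
  fixes f :: "real^'d::finite \<Rightarrow> complex"
  assumes f: "f \<in> gs_space \<nu> \<mu>" and h: "0 < h" "h \<le> h'"
  shows "gs_seminorm \<nu> \<mu> h' f \<le> gs_seminorm \<nu> \<mu> h f"
proof (rule gs_seminorm_least)
  fix z :: "(real^'d) \<times> (nat^'d) \<times> (nat^'d)"
  obtain x \<alpha> \<beta> where z: "z = (x, \<alpha>, \<beta>)" by (cases z) auto
  have "gs_quot \<nu> \<mu> h' f z \<le> gs_quot \<nu> \<mu> h f z"
    unfolding z gs_quot_def prod.case using h mi_fact_ge_1[of \<alpha>] mi_fact_ge_1[of \<beta>]
    by (intro divide_left_mono mult_right_mono power_mono mult_pos_pos) auto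
  then show "gs_quot \<nu> \<mu> h' f z \<le> gs_seminorm \<nu> \<mu> h f" using gs_quot_le_seminorm[OF f h(1)] order_trans by blast
qed

text \<open>Each \<open>D_op\<close> carries a factor \<open>- \<i>\<close>, so conjugation changes
  the sign once per derivative.\<close>

lemma foldr_D_op_cnj:
  assumes "smooth f"
  shows "foldr D_op js (\<lambda>x. cnj (f x)) = (\<lambda>x. (-1) ^ length js * cnj (foldr D_op js f x))"
proof (induction js)
  case (Cons j js)
  let ?g = "foldr D_op js f"
  have "D_op j (\<lambda>x. (-1) ^ length js * cnj (?g x)) x = - ((-1) ^ length js * cnj (D_op j ?g x))" for x
  proof -
    have "?g differentiable at x" using assms unfolding smooth_def differentiable_on_def by blast
    then have "((\<lambda>x. (-1) ^ length js * cnj (?g x)) has_derivative (\<lambda>h. (-1) ^ length js * cnj (frechet_derivative ?g (at x) h))) (at x)"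
      by (intro has_derivative_mult_right has_derivative_cnj) (simp add: frechet_derivative_works)
    from frechet_derivative_at[OF this] show ?thesis unfolding D_op_def by (simp add: fun_eq_iff)
  qed
  then show ?case by (simp add: Cons.IH fun_eq_iff)
qed simp

lemma gs_space_cnj:
  assumes f: "f \<in> gs_space \<nu> \<mu>"
  shows "(\<lambda>x. cnj (f x)) \<in> gs_space \<nu> \<mu>"
proof -
  have s: "smooth f" by (rule gs_space_smooth[OF f])
  have "smooth (\<lambda>x. cnj (f x))"
    unfolding smooth_def foldr_D_op_cnj[OF s] differentiable_on_def
  proof (intro allI ballI)
    fix js x
    have "foldr D_op js f differentiable at x" using s unfolding smooth_def differentiable_on_def by blast
    then have "((\<lambda>x. (-1) ^ length js * cnj (foldr D_op js f x)) has_derivative (\<lambda>h. (-1) ^ length js * cnj (frechet_derivative (foldr D_op js f) (at x) h))) (at x)"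
      by (intro has_derivative_mult_right has_derivative_cnj) (simp add: frechet_derivative_works)
    then show "(\<lambda>x. (-1) ^ length js * cnj (foldr D_op js f x)) differentiable (at x within UNIV)"
      by (auto simp: differentiable_def)
  qed
  moreover have "gs_quot \<nu> \<mu> h (\<lambda>x. cnj (f x)) = gs_quot \<nu> \<mu> h f" for h
    by (auto simp: gs_quot_def fun_eq_iff D_multi_def foldr_D_op_cnj[OF s] norm_mult norm_power)
  ultimately show ?thesis using f by (simp add: gs_space_def)
qed

section \<open>Seminorm balls, continuous maps and functionals\<close>

abbreviation gs_ball :: "real \<Rightarrow> real \<Rightarrow> (real^'d::finite \<Rightarrow> complex) \<Rightarrow> real \<Rightarrow> real \<Rightarrow> (real^'d \<Rightarrow> complex) set" where
  "gs_ball \<nu> \<mu> f h e \<equiv> {g \<in> gs_space \<nu> \<mu>. gs_seminorm \<nu> \<mu> h (\<lambda>x. g x - f x) < e}"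

lemma openin_gs_ball:
  assumes "f \<in> gs_space \<nu> \<mu>" "h > 0" "e > 0"
  shows "openin (gs_topology \<nu> \<mu>) (gs_ball \<nu> \<mu> f h e)"
  unfolding gs_topology_def by (rule topology_generated_by_Basis) (use assms in blast)

lemma gs_ball_center: "f \<in> gs_space \<nu> \<mu> \<Longrightarrow> e > 0 \<Longrightarrow> f \<in> gs_ball \<nu> \<mu> f h e"
  by (simp add: gs_seminorm_zero)

lemma gs_seminorm_triangle:
  assumes "f \<in> gs_space \<nu> \<mu>" "g \<in> gs_space \<nu> \<mu>" "k \<in> gs_space \<nu> \<mu>" "h > 0"
  shows "gs_seminorm \<nu> \<mu> h (\<lambda>x. f x - k x) \<le> gs_seminorm \<nu> \<mu> h (\<lambda>x. f x - g x) + gs_seminorm \<nu> \<mu> h (\<lambda>x. g x - k x)"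
  using gs_seminorm_lin[OF gs_space_diff[OF assms(1,2)] gs_space_diff[OF assms(2,3)] assms(4), of 1 1] by simp

lemma gs_ball_subset:
  assumes g: "g \<in> gs_ball \<nu> \<mu> f h e" and f: "f \<in> gs_space \<nu> \<mu>" and h: "h > 0"
  shows "\<exists>e'>0. gs_ball \<nu> \<mu> g h e' \<subseteq> gs_ball \<nu> \<mu> f h e"
proof (intro exI conjI)
  show "e - gs_seminorm \<nu> \<mu> h (\<lambda>x. g x - f x) > 0" using g by simp
  show "gs_ball \<nu> \<mu> g h (e - gs_seminorm \<nu> \<mu> h (\<lambda>x. g x - f x)) \<subseteq> gs_ball \<nu> \<mu> f h e"
  proof
    fix k assume k: "k \<in> gs_ball \<nu> \<mu> g h (e - gs_seminorm \<nu> \<mu> h (\<lambda>x. g x - f x))"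
    then show "k \<in> gs_ball \<nu> \<mu> f h e" using gs_seminorm_triangle[of k \<nu> \<mu> g f h] g f h by auto
  qed
qed

text \<open>The seminorms grow as \<open>h\<close> decreases, so an intersection of two balls with a
  common centre contains a third. The balls, introduced as a subbase, thus form a base.\<close>

lemma gs_open_ball:
  assumes "openin (gs_topology \<nu> \<mu>) U" "f \<in> U"
  shows "f \<in> gs_space \<nu> \<mu> \<and> (\<exists>h>0. \<exists>e>0. gs_ball \<nu> \<mu> f h e \<subseteq> U)"
proof -
  have "generate_topology_on {gs_ball \<nu> \<mu> f h e |f h e. f \<in> gs_space \<nu> \<mu> \<and> h > 0 \<and> e > 0} U"
    using assms(1) unfolding gs_topology_def by (rule openin_topology_generated_by)
  then show ?thesis using assms(2)
  proof (induction arbitrary: f)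
    case (Int A B)
    then obtain h1 e1 h2 e2 where f: "f \<in> gs_space \<nu> \<mu>" and *: "h1 > 0" "e1 > 0" "gs_ball \<nu> \<mu> f h1 e1 \<subseteq> A" "h2 > 0" "e2 > 0" "gs_ball \<nu> \<mu> f h2 e2 \<subseteq> B"
      by (meson IntD1 IntD2)
    have "gs_ball \<nu> \<mu> f (min h1 h2) (min e1 e2) \<subseteq> gs_ball \<nu> \<mu> f h1 e1 \<inter> gs_ball \<nu> \<mu> f h2 e2"
    proof
      fix g assume g: "g \<in> gs_ball \<nu> \<mu> f (min h1 h2) (min e1 e2)"
      then have d: "(\<lambda>x. g x - f x) \<in> gs_space \<nu> \<mu>" using f by (auto intro: gs_space_diff)
      show "g \<in> gs_ball \<nu> \<mu> f h1 e1 \<inter> gs_ball \<nu> \<mu> f h2 e2"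
        using g gs_seminorm_antimono[OF d, of "min h1 h2" h1] gs_seminorm_antimono[OF d, of "min h1 h2" h2] * by auto
    qed
    then have "gs_ball \<nu> \<mu> f (min h1 h2) (min e1 e2) \<subseteq> A \<inter> B" using * by blast
    moreover have "min h1 h2 > 0" "min e1 e2 > 0" using * by auto
    ultimately show ?case using f by blast
  next
    case (UN K)
    then obtain k where "k \<in> K" "f \<in> k" by blast
    with UN.IH[OF this] show ?case by (meson Sup_upper order_trans)
  next
    case (Basis s)
    then obtain f0 h e where s: "s = gs_ball \<nu> \<mu> f0 h e" "f0 \<in> gs_space \<nu> \<mu>" "h > 0" "e > 0" by blast
    with gs_ball_subset[where g=f and f=f0 and h=h and e=e] Basis.prems show ?case by blast
  qed simp
qed

lemma topspace_gs_topology: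
  "topspace (gs_topology \<nu> \<mu>) = (gs_space \<nu> \<mu> :: (real^'d::finite \<Rightarrow> complex) set)"
proof
  show "topspace (gs_topology \<nu> \<mu>) \<subseteq> (gs_space \<nu> \<mu> :: (real^'d \<Rightarrow> complex) set)"
    using gs_open_ball[OF openin_topspace[of "gs_topology \<nu> \<mu>"]] by blast
  show "(gs_space \<nu> \<mu> :: (real^'d \<Rightarrow> complex) set) \<subseteq> topspace (gs_topology \<nu> \<mu>)"
  proof
    fix f :: "real^'d \<Rightarrow> complex" assume f: "f \<in> gs_space \<nu> \<mu>"
    have "gs_ball \<nu> \<mu> f 1 1 \<subseteq> topspace (gs_topology \<nu> \<mu>)"
      by (rule openin_subset[OF openin_gs_ball[OF f]]) auto
    then show "f \<in> topspace (gs_topology \<nu> \<mu>)" using gs_ball_center[OF f, of 1 1] by auto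
  qed
qed

lemma continuous_map_gs:
  fixes A :: "(real^'d::finite \<Rightarrow> complex) \<Rightarrow> real^'d \<Rightarrow> complex"
  assumes A: "\<And>f. f \<in> gs_space \<nu> \<mu> \<Longrightarrow> A f \<in> gs_space \<nu> \<mu>"
    and diff: "\<And>f g x. f \<in> gs_space \<nu> \<mu> \<Longrightarrow> g \<in> gs_space \<nu> \<mu> \<Longrightarrow> A (\<lambda>x. f x - g x) x = A f x - A g x"
    and bd: "\<And>h. h > 0 \<Longrightarrow> \<exists>h'>0. \<exists>C. \<forall>f\<in>gs_space \<nu> \<mu>. gs_seminorm \<nu> \<mu> h (A f) \<le> C * gs_seminorm \<nu> \<mu> h' f"
  shows "continuous_map (gs_topology \<nu> \<mu>) (gs_topology \<nu> \<mu>) A"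
  unfolding continuous_map_def topspace_gs_topology
proof (intro conjI allI impI)
  show "A \<in> gs_space \<nu> \<mu> \<rightarrow> gs_space \<nu> \<mu>" using A by blast
  fix U :: "(real^'d \<Rightarrow> complex) set" assume U: "openin (gs_topology \<nu> \<mu>) U"
  show "openin (gs_topology \<nu> \<mu>) {x \<in> gs_space \<nu> \<mu>. A x \<in> U}"
  proof (subst openin_subopen, intro ballI)
    fix f assume "f \<in> {x \<in> gs_space \<nu> \<mu>. A x \<in> U}"
    then have f: "f \<in> gs_space \<nu> \<mu>" "A f \<in> U" by auto
    obtain h e where he: "h > 0" "e > 0" "gs_ball \<nu> \<mu> (A f) h e \<subseteq> U" using gs_open_ball[OF U f(2)] by blast
    obtain h' C where h': "h' > 0" and C: "\<And>f. f \<in> gs_space \<nu> \<mu> \<Longrightarrow> gs_seminorm \<nu> \<mu> h (A f) \<le> C * gs_seminorm \<nu> \<mu> h' f"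
      using bd[OF he(1)] by blast
    define e' where "e' = e / (\<bar>C\<bar> + 1)"
    have e': "e' > 0" using he by (simp add: e'_def)
    have "gs_ball \<nu> \<mu> f h' e' \<subseteq> {x \<in> gs_space \<nu> \<mu>. A x \<in> U}"
    proof
      fix g assume g: "g \<in> gs_ball \<nu> \<mu> f h' e'"
      then have gs: "g \<in> gs_space \<nu> \<mu>" by simp
      have d: "(\<lambda>x. g x - f x) \<in> gs_space \<nu> \<mu>" by (rule gs_space_diff[OF gs f(1)])
      have "gs_seminorm \<nu> \<mu> h (\<lambda>x. A g x - A f x) = gs_seminorm \<nu> \<mu> h (A (\<lambda>x. g x - f x))"
        using diff[OF gs f(1)] by presburger
      also have "\<dots> \<le> C * gs_seminorm \<nu> \<mu> h' (\<lambda>x. g x - f x)" by (rule C[OF d])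
      also have "\<dots> \<le> (\<bar>C\<bar> + 1) * gs_seminorm \<nu> \<mu> h' (\<lambda>x. g x - f x)"
        using gs_seminorm_nonneg[OF d h'] by (intro mult_right_mono) auto
      also have "\<dots> < (\<bar>C\<bar> + 1) * e'" using g by (intro mult_strict_left_mono) auto
      also have "\<dots> = e" by (simp add: e'_def)
      finally have "A g \<in> gs_ball \<nu> \<mu> (A f) h e" using A[OF gs] by simp
      then show "g \<in> {x \<in> gs_space \<nu> \<mu>. A x \<in> U}" using he gs by blast
    qed
    then show "\<exists>T. openin (gs_topology \<nu> \<mu>) T \<and> f \<in> T \<and> T \<subseteq> {x \<in> gs_space \<nu> \<mu>. A x \<in> U}"
      using openin_gs_ball[OF f(1) h' e'] gs_ball_center[OF f(1) e'] by blast
  qed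
qed

text \<open>Continuity at 0 gives a ball on which \<open>u\<close> stays below 1, and homogeneity
  extends this to an estimate by one seminorm.\<close>

lemma gs_dual_bound:
  assumes u: "u \<in> gs_dual \<nu> \<mu>"
  shows "\<exists>h>0. \<exists>C\<ge>0. \<forall>f\<in>gs_space \<nu> \<mu>. cmod (u f) \<le> C * gs_seminorm \<nu> \<mu> h f"
proof -
  have lin: "u (\<lambda>x. a * f x + b * g x) = a * u f + b * u g" if "f \<in> gs_space \<nu> \<mu>" "g \<in> gs_space \<nu> \<mu>" for f g a b
    using u that unfolding gs_dual_def by blast
  have u0: "u (\<lambda>x. 0) = 0" using lin[OF gs_space_zero gs_space_zero, of 0 0] by simp
  have ucm: "u (\<lambda>x. a * f x) = a * u f" if "f \<in> gs_space \<nu> \<mu>" for f a using lin[OF that that, of a 0] by simp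
  have "continuous_map (gs_topology \<nu> \<mu>) euclidean u" using u by (simp add: gs_dual_def)
  then have "openin (gs_topology \<nu> \<mu>) {f \<in> topspace (gs_topology \<nu> \<mu>). u f \<in> ball 0 1}"
    by (rule openin_continuous_map_preimage) simp
  moreover have "(\<lambda>x. 0) \<in> {f \<in> topspace (gs_topology \<nu> \<mu>). u f \<in> ball 0 1}"
    by (simp add: topspace_gs_topology gs_space_zero u0)
  ultimately obtain h e where he: "h > 0" "e > 0" "gs_ball \<nu> \<mu> (\<lambda>x. 0) h e \<subseteq> {f \<in> topspace (gs_topology \<nu> \<mu>). u f \<in> ball 0 1}"
    using gs_open_ball by blast
  \<comment> \<open>Proved for every \<open>w\<close> above the claimed bound, so that the rescaling
    factor is finite also when the seminorm of \<open>f\<close> is 0.\<close>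
  have "cmod (u f) \<le> (1 / e) * gs_seminorm \<nu> \<mu> h f" if f: "f \<in> gs_space \<nu> \<mu>" for f
  proof (rule dense_ge)
    fix w assume w: "1 / e * gs_seminorm \<nu> \<mu> h f < w"
    define s where "s = e * w"
    have ps: "gs_seminorm \<nu> \<mu> h f < s" using w he by (simp add: s_def field_simps)
    then have s: "s > 0" using gs_seminorm_nonneg[OF f he(1)] by linarith
    let ?g = "\<lambda>x. of_real (e / s) * f x"
    have g: "?g \<in> gs_space \<nu> \<mu>" by (rule gs_space_cmult[OF f])
    have "gs_seminorm \<nu> \<mu> h ?g \<le> (e / s) * gs_seminorm \<nu> \<mu> h f"
      using gs_seminorm_cmult[OF f he(1), of "of_real (e / s)"] s he by (simp add: norm_divide)
    also have "\<dots> < (e / s) * s" using ps s he by (intro mult_strict_left_mono) auto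
    also have "\<dots> = e" using s by simp
    finally have "?g \<in> gs_ball \<nu> \<mu> (\<lambda>x. 0) h e" using g by simp
    then have "cmod (u ?g) < 1" using he(3) by auto
    then have "(e / s) * cmod (u f) < 1" unfolding ucm[OF f] using s he by (simp add: norm_mult norm_divide)
    moreover have "w > 0" using s he by (simp add: s_def zero_less_mult_iff)
    ultimately show "cmod (u f) \<le> w" using he by (simp add: s_def field_simps)
  qed
  then show ?thesis using he by (metis zero_le_divide_1_iff less_imp_le)
qed

lemma gs_dualI:
  assumes lin: "\<And>f g a b. f \<in> gs_space \<nu> \<mu> \<Longrightarrow> g \<in> gs_space \<nu> \<mu> \<Longrightarrow> u (\<lambda>x. a * f x + b * g x) = a * u f + b * u g"
    and zero: "\<And>f. f \<notin> gs_space \<nu> \<mu> \<Longrightarrow> u f = 0"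
    and h: "h > 0" and bd: "\<And>f. f \<in> gs_space \<nu> \<mu> \<Longrightarrow> cmod (u f) \<le> C * gs_seminorm \<nu> \<mu> h f"
  shows "u \<in> gs_dual \<nu> \<mu>"
proof -
  have "continuous_map (gs_topology \<nu> \<mu>) euclidean u"
    unfolding continuous_map_def topspace_gs_topology
  proof (intro conjI allI impI)
    fix U :: "complex set" assume "openin euclidean U"
    then have U: "open U" by simp
    show "openin (gs_topology \<nu> \<mu>) {x \<in> gs_space \<nu> \<mu>. u x \<in> U}"
    proof (subst openin_subopen, intro ballI)
      fix f assume "f \<in> {x \<in> gs_space \<nu> \<mu>. u x \<in> U}"
      then have f: "f \<in> gs_space \<nu> \<mu>" "u f \<in> U" by auto
      obtain e where e: "e > 0" "ball (u f) e \<subseteq> U" using U f(2) open_contains_ball by blast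
      define e' where "e' = e / (\<bar>C\<bar> + 1)"
      have e': "e' > 0" using e by (simp add: e'_def)
      have "gs_ball \<nu> \<mu> f h e' \<subseteq> {x \<in> gs_space \<nu> \<mu>. u x \<in> U}"
      proof
        fix g assume g: "g \<in> gs_ball \<nu> \<mu> f h e'"
        then have gs: "g \<in> gs_space \<nu> \<mu>" by simp
        have d: "(\<lambda>x. g x - f x) \<in> gs_space \<nu> \<mu>" by (rule gs_space_diff[OF gs f(1)])
        have "cmod (u g - u f) = cmod (u (\<lambda>x. g x - f x))" using lin[OF gs f(1), of 1 "-1"] by simp
        also have "\<dots> \<le> C * gs_seminorm \<nu> \<mu> h (\<lambda>x. g x - f x)" by (rule bd[OF d])
        also have "\<dots> \<le> (\<bar>C\<bar> + 1) * gs_seminorm \<nu> \<mu> h (\<lambda>x. g x - f x)"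
          using gs_seminorm_nonneg[OF d h] by (intro mult_right_mono) auto
        also have "\<dots> < (\<bar>C\<bar> + 1) * e'" using g by (intro mult_strict_left_mono) auto
        also have "\<dots> = e" by (simp add: e'_def)
        finally have "u g \<in> ball (u f) e" by (simp add: dist_norm norm_minus_commute)
        then show "g \<in> {x \<in> gs_space \<nu> \<mu>. u x \<in> U}" using e gs by blast
      qed
      then show "\<exists>T. openin (gs_topology \<nu> \<mu>) T \<and> f \<in> T \<and> T \<subseteq> {x \<in> gs_space \<nu> \<mu>. u x \<in> U}"
        using openin_gs_ball[OF f(1) h e'] gs_ball_center[OF f(1) e'] by blast
    qed
  qed auto
  then show ?thesis unfolding gs_dual_def using lin zero by blast
qed

lemma gs_dual_lin:
  assumes "u \<in> gs_dual \<nu> \<mu>" "f \<in> gs_space \<nu> \<mu>" "g \<in> gs_space \<nu> \<mu>"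
  shows "u (\<lambda>x. a * f x + b * g x) = a * u f + b * u g"
  using assms unfolding gs_dual_def by blast

lemma gs_dual_off: "u \<in> gs_dual \<nu> \<mu> \<Longrightarrow> f \<notin> gs_space \<nu> \<mu> \<Longrightarrow> u f = 0"
  unfolding gs_dual_def by blast

lemma gs_dual_combination:
  assumes u: "u \<in> gs_dual \<nu> \<mu>" and w: "w \<in> gs_dual \<nu> \<mu>"
  shows "(\<lambda>f. a * u f + b * w f) \<in> gs_dual \<nu> \<mu>"
proof -
  obtain h1 C1 where 1: "h1 > 0" "C1 \<ge> 0" "\<And>f. f \<in> gs_space \<nu> \<mu> \<Longrightarrow> cmod (u f) \<le> C1 * gs_seminorm \<nu> \<mu> h1 f" using gs_dual_bound[OF u] by blast
  obtain h2 C2 where 2: "h2 > 0" "C2 \<ge> 0" "\<And>f. f \<in> gs_space \<nu> \<mu> \<Longrightarrow> cmod (w f) \<le> C2 * gs_seminorm \<nu> \<mu> h2 f" using gs_dual_bound[OF w] by blast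
  show ?thesis
  proof (rule gs_dualI[where h="min h1 h2" and C="cmod a * C1 + cmod b * C2"])
    show "min h1 h2 > 0" using 1 2 by simp
    fix f :: "real^'a \<Rightarrow> complex" assume f: "f \<in> gs_space \<nu> \<mu>"
    have "cmod (a * u f + b * w f) \<le> cmod a * cmod (u f) + cmod b * cmod (w f)" by (metis norm_mult norm_triangle_ineq)
    also have "\<dots> \<le> cmod a * (C1 * gs_seminorm \<nu> \<mu> (min h1 h2) f) + cmod b * (C2 * gs_seminorm \<nu> \<mu> (min h1 h2) f)"
      using 1 2 f by (intro add_mono mult_left_mono order_trans[OF 1(3)] order_trans[OF 2(3)] gs_seminorm_antimono) auto
    finally show "cmod (a * u f + b * w f) \<le> (cmod a * C1 + cmod b * C2) * gs_seminorm \<nu> \<mu> (min h1 h2) f" by (simp add: algebra_simps)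
  qed (simp_all add: gs_dual_lin[OF u] gs_dual_lin[OF w] gs_dual_off[OF u] gs_dual_off[OF w] algebra_simps)
qed

subsection \<open>Embedding and weak* density\<close>

locale gs =
  fixes \<nu> \<mu> :: real
  assumes nu: "\<nu> > 0" and mu: "\<mu> > 0" and numu: "\<nu> + \<mu> > 1"
begin

lemmas ab = nu mu numu

text \<open>Moments with an integrable majorant, controlled by one seminorm. Decay of rate 2 is
  split: half of it cancels \<open>norm x ^ n\<close>, the other half gives the weight.\<close>

lemma gs_power_wt: "\<exists>h>0. \<exists>C\<ge>0. \<forall>f\<in>gs_space \<nu> \<mu>. \<forall>x::real^'d::finite. norm x ^ n * cmod (f x) \<le> C * gs_seminorm \<nu> \<mu> h f * wt x"
proof -
  obtain W where W: "W > 0" "\<And>x::real^'d. exp (- 1 * norm x powr (1 / \<nu>)) \<le> W * wt x" using exp_le_wt[of 1 \<nu>] nu by auto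
  obtain h where h: "h > 0" and b: "\<And>f :: real^'d \<Rightarrow> complex. f \<in> gs_space \<nu> \<mu> \<Longrightarrow> gs_fam_bound \<mu> \<nu> 1 2 (2 powr \<nu> * gs_seminorm \<nu> \<mu> h f) (deriv_fam f)"
    using gs_fam_bound_deriv_fam[where 'd='d and \<mu>=\<mu>, OF nu zero_less_one, of 2] by auto
  define c where "c = ((\<nu> / 1) powr \<nu>) ^ n * fact n powr \<nu>"
  have "norm x ^ n * cmod (f x) \<le> (c * 2 powr \<nu> * W) * gs_seminorm \<nu> \<mu> h f * wt x" if f: "f \<in> gs_space \<nu> \<mu>" for f and x :: "real^'d"
  proof -
    have "cmod (deriv_fam f undefined 0 x) \<le> 2 powr \<nu> * gs_seminorm \<nu> \<mu> h f * exp (- 2 * norm x powr (1 / \<nu>)) * 1 ^ 0 * fact 0 powr \<mu>"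
      using b[OF f] unfolding fam_bound_def by blast
    then have 1: "cmod (f x) \<le> 2 powr \<nu> * gs_seminorm \<nu> \<mu> h f * exp (- 2 * norm x powr (1 / \<nu>))"
      by (simp add: deriv_fam_0)
    have 2: "norm x ^ n \<le> c * exp (1 * norm x powr (1 / \<nu>))"
      using power_le_fact_powr_exp[of "norm x" \<nu> 1 n] nu by (simp add: c_def)
    have "norm x ^ n * cmod (f x) \<le> (c * exp (1 * norm x powr (1 / \<nu>))) * (2 powr \<nu> * gs_seminorm \<nu> \<mu> h f * exp (- 2 * norm x powr (1 / \<nu>)))"
      by (intro mult_mono 1 2) (auto simp: c_def)
    also have "\<dots> = c * 2 powr \<nu> * gs_seminorm \<nu> \<mu> h f * (exp (1 * norm x powr (1 / \<nu>)) * exp (- 2 * norm x powr (1 / \<nu>)))" by simp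
    also have "exp (1 * norm x powr (1 / \<nu>)) * exp (- 2 * norm x powr (1 / \<nu>)) = exp (- 1 * norm x powr (1 / \<nu>))" by (simp flip: exp_add)
    also have "c * 2 powr \<nu> * gs_seminorm \<nu> \<mu> h f * \<dots> \<le> c * 2 powr \<nu> * gs_seminorm \<nu> \<mu> h f * (W * wt x)"
      using gs_seminorm_nonneg[OF f h] by (intro mult_left_mono W) (auto simp: c_def)
    finally show ?thesis by (simp add: mult_ac)
  qed
  then show ?thesis using h W by (intro exI[of _ h] conjI exI[of _ "c * 2 powr \<nu> * W"]) (auto simp: c_def)
qed

lemma gs_wt_dom: "f \<in> gs_space \<nu> \<mu> \<Longrightarrow> wt_dom f"
  by (intro rapid_wt_dom gs_space_rapid[OF nu])

lemma gs_bounded: "f \<in> gs_space \<nu> \<mu> \<Longrightarrow> \<exists>K. \<forall>x. cmod (f x) \<le> K"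
proof -
  assume "f \<in> gs_space \<nu> \<mu>"
  then obtain K where K: "\<And>x. cmod (f x) \<le> K * wt x" using gs_wt_dom[of f] unfolding wt_dom_def by blast
  have "cmod (f x) \<le> \<bar>K\<bar>" for x
  proof -
    have "K * wt x \<le> \<bar>K\<bar> * 1" using wt_le_1[of x] by (intro mult_mono) auto
    then show ?thesis using K[of x] by simp
  qed
  then show ?thesis by blast
qed

lemma gs_mult_integrable:
  assumes "f \<in> gs_space \<nu> \<mu>" "g \<in> gs_space \<nu> \<mu>"
  shows "integrable lborel (\<lambda>x. f x * g x)"
proof -
  obtain K where "\<And>x. cmod (g x) \<le> K" using gs_bounded[OF assms(2)] by blast
  then show ?thesis
    using wt_dom_mult[OF gs_wt_dom[OF assms(1)], of g K] gs_wt_dom[OF assms(2)] by (auto intro: wt_dom_integrable wt_dom_continuous)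
qed

lemma gs_embed_dual:
  fixes f :: "real^'d::finite \<Rightarrow> complex"
  assumes f: "f \<in> gs_space \<nu> \<mu>"
  shows "gs_embed \<nu> \<mu> f \<in> gs_dual \<nu> \<mu>"
proof -
  obtain h C where h: "h > 0" and C: "C \<ge> 0" "\<And>g x. g \<in> gs_space \<nu> \<mu> \<Longrightarrow> cmod (g x) \<le> C * gs_seminorm \<nu> \<mu> h g * wt (x :: real^'d)" using gs_power_wt[where 'd='d, of 0] by auto
  obtain K where K: "\<And>x. cmod (f x) \<le> K" using gs_bounded[OF f] by blast
  have K0: "K \<ge> 0" using K[of 0] norm_ge_zero order_trans by blast
  define I where "I = (LINT x|lborel. wt (x::real^'d))"
  show ?thesis
  proof (rule gs_dualI[OF _ _ h, where C="K * C * I"])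
    fix g :: "real^'d \<Rightarrow> complex" assume g: "g \<in> gs_space \<nu> \<mu>"
    have "cmod (LINT x|lborel. f x * g x) \<le> (LINT x|lborel. K * (C * gs_seminorm \<nu> \<mu> h g * wt (x::real^'d)))"
    proof (rule Bochner_Integration.integral_norm_bound_integral)
      show "integrable lborel (\<lambda>x. f x * g x)" by (rule gs_mult_integrable[OF f g])
      show "integrable lborel (\<lambda>x::real^'d. K * (C * gs_seminorm \<nu> \<mu> h g * wt x))" by (intro integrable_mult_right integrable_wt)
      show "norm (f x * g x) \<le> K * (C * gs_seminorm \<nu> \<mu> h g * wt x)" for x
        unfolding norm_mult by (intro mult_mono K C(2)[OF g] K0) auto
    qed
    then show "cmod (gs_embed \<nu> \<mu> f g) \<le> K * C * I * gs_seminorm \<nu> \<mu> h g" using g by (simp add: gs_embed_def I_def mult_ac)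
  next
    fix g k :: "real^'d \<Rightarrow> complex" and a b assume g: "g \<in> gs_space \<nu> \<mu>" and k: "k \<in> gs_space \<nu> \<mu>"
    have "(LINT x|lborel. f x * (a * g x + b * k x)) = (LINT x|lborel. a * (f x * g x) + b * (f x * k x))"
      by (simp add: algebra_simps)
    also have "\<dots> = a * (LINT x|lborel. f x * g x) + b * (LINT x|lborel. f x * k x)"
      using gs_mult_integrable[OF f g] gs_mult_integrable[OF f k] by simp
    finally show "gs_embed \<nu> \<mu> f (\<lambda>x. a * g x + b * k x) = a * gs_embed \<nu> \<mu> f g + b * gs_embed \<nu> \<mu> f k"
      using g k gs_space_lin[OF g k] by (simp add: gs_embed_def)
  qed (simp add: gs_embed_def)
qed

text \<open>A nonempty open set is not negligible, so a continuous function that vanishes almost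
  everywhere vanishes.\<close>

lemma continuous_integral_pos:
  fixes F :: "real^'d::finite \<Rightarrow> real"
  assumes c: "continuous_on UNIV F" and i: "integrable lborel F" and nn: "\<And>x. F x \<ge> 0" and z: "(LINT x|lborel. F x) = 0"
  shows "F x = 0"
proof -
  have ae: "AE x in lborel. F x = 0" using integral_nonneg_eq_0_iff_AE[OF i] nn z by simp
  have op: "open {x. F x \<noteq> 0}" using c by (intro open_Collect_neq continuous_on_const)
  have "emeasure lborel {x. F x \<noteq> 0} = 0"
    using ae op by (subst (asm) AE_iff_measurable[where N="{x. F x \<noteq> 0}"]) auto
  then have "negligible {x. F x \<noteq> 0}" using op
    by (simp add: negligible_iff_null_sets null_sets_completionI null_setsI)
  then have "{x. F x \<noteq> 0} = {}" using op open_not_negligible by blast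
  then show ?thesis by blast
qed

text \<open>Definiteness of the inner product; it makes the interpolation step below solvable and
  lets the reconstruction formula be divided by the norm of the window.\<close>

lemma gs_norm_sq_zero:
  assumes f: "f \<in> gs_space \<nu> \<mu>" and z: "(LINT x|lborel. cnj (f x) * f x) = 0"
  shows "f = (\<lambda>x. 0)"
proof -
  have eq: "cnj (f x) * f x = complex_of_real ((cmod (f x))\<^sup>2)" for x
    using complex_norm_square[of "f x"] by (simp add: mult.commute)
  have i: "integrable lborel (\<lambda>x. cnj (f x) * f x)" by (rule gs_mult_integrable[OF gs_space_cnj[OF f] f])
  have "integrable lborel (\<lambda>x. (cmod (f x))\<^sup>2)" using i unfolding eq by (simp only: complex_of_real_integrable_eq)
  moreover have "(LINT x|lborel. (cmod (f x))\<^sup>2) = 0" using z unfolding eq by (simp only: integral_complex_of_real of_real_eq_0_iff)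
  moreover have "continuous_on UNIV (\<lambda>x. (cmod (f x))\<^sup>2)"
    by (intro continuous_intros wt_dom_continuous[OF gs_wt_dom[OF f]])
  ultimately have "(cmod (f x))\<^sup>2 = 0" for x
    using continuous_integral_pos[of "\<lambda>x. (cmod (f x))\<^sup>2" x] by auto
  then show ?thesis by auto
qed

lemma gs_space_sum:
  assumes "finite S" "\<And>i. i \<in> S \<Longrightarrow> f i \<in> gs_space \<nu> \<mu>"
  shows "(\<lambda>x. \<Sum>i\<in>S. c i * f i x) \<in> gs_space \<nu> \<mu>"
  using assms
proof (induction S)
  case empty
  show ?case using gs_space_zero by simp
next
  case (insert k S)
  then show ?case using gs_space_lin[of "f k" \<nu> \<mu> "\<lambda>x. \<Sum>i\<in>S. c i * f i x" "c k" 1] by simp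
qed

lemma gs_dual_sum:
  assumes u: "u \<in> gs_dual \<nu> \<mu>" and "finite S" "\<And>i. i \<in> S \<Longrightarrow> f i \<in> gs_space \<nu> \<mu>"
  shows "u (\<lambda>x. \<Sum>i\<in>S. c i * f i x) = (\<Sum>i\<in>S. c i * u (f i))"
  using assms(2,3)
proof (induction S)
  case empty
  show ?case using gs_dual_lin[OF u gs_space_zero gs_space_zero, of 0 0] by simp
next
  case (insert k S)
  then have "u (\<lambda>x. c k * f k x + 1 * (\<Sum>i\<in>S. c i * f i x)) = c k * u (f k) + 1 * u (\<lambda>x. \<Sum>i\<in>S. c i * f i x)"
    by (intro gs_dual_lin[OF u] gs_space_sum) auto
  then show ?case using insert by simp
qed

text \<open>Finitely many values of a functional are interpolated by a test function, namely by one in the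
  span of the conjugates of the arguments: the Gram matrix is inverted one vector at a time.\<close>

lemma gs_interpolation:
  assumes "finite S" "S \<subseteq> gs_space \<nu> \<mu>" "u \<in> gs_dual \<nu> \<mu>"
  shows "\<exists>c. \<forall>g\<in>S. gs_embed \<nu> \<mu> (\<lambda>x. \<Sum>i\<in>S. c i * cnj (i x)) g = u g"
  using assms
proof (induction S arbitrary: u)
  case empty
  then show ?case by simp
next
  case (insert k S)
  have k: "k \<in> gs_space \<nu> \<mu>" and S: "S \<subseteq> gs_space \<nu> \<mu>" using insert by auto
  have ck: "(\<lambda>x. cnj (k x)) \<in> gs_space \<nu> \<mu>" by (rule gs_space_cnj[OF k])
  have comb: "(\<lambda>x. \<Sum>i\<in>S. c i * cnj (i x)) \<in> gs_space \<nu> \<mu>" for c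
    using gs_space_sum[OF insert.hyps(1), of "\<lambda>i x. cnj (i x)" c] S gs_space_cnj by blast
  obtain c where c: "\<And>g. g \<in> S \<Longrightarrow> gs_embed \<nu> \<mu> (\<lambda>x. \<Sum>i\<in>S. c i * cnj (i x)) g = u g"
    using insert.IH[OF S insert.prems(2)] by blast
  \<comment> \<open>The induction hypothesis for the functional of \<open>cnj k\<close> yields its
    projection \<open>e\<close> onto the span of the conjugates of \<open>S\<close>; the residual
    \<open>r = cnj k - e\<close> annihilates \<open>S\<close>.\<close>
  obtain b where b: "\<And>g. g \<in> S \<Longrightarrow> gs_embed \<nu> \<mu> (\<lambda>x. \<Sum>i\<in>S. b i * cnj (i x)) g = gs_embed \<nu> \<mu> (\<lambda>x. cnj (k x)) g"
    using insert.IH[OF S gs_embed_dual[OF ck]] by blast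
  define f where "f = (\<lambda>x. \<Sum>i\<in>S. c i * cnj (i x))"
  define e where "e = (\<lambda>x. \<Sum>i\<in>S. b i * cnj (i x))"
  define r where "r = (\<lambda>x. cnj (k x) - e x)"
  have fs: "f \<in> gs_space \<nu> \<mu>" and es: "e \<in> gs_space \<nu> \<mu>" unfolding f_def e_def by (rule comb)+
  have rs: "r \<in> gs_space \<nu> \<mu>" unfolding r_def by (rule gs_space_diff[OF ck es])
  have emb: "gs_embed \<nu> \<mu> (\<lambda>x. a * f1 x + a' * f2 x) g = a * gs_embed \<nu> \<mu> f1 g + a' * gs_embed \<nu> \<mu> f2 g"
    if "f1 \<in> gs_space \<nu> \<mu>" "f2 \<in> gs_space \<nu> \<mu>" for f1 f2 a a' and g :: "real^'a \<Rightarrow> complex"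
    using gs_mult_integrable[OF that(1)] gs_mult_integrable[OF that(2)]
    by (simp add: gs_embed_def distrib_right mult.assoc)
  have r0: "gs_embed \<nu> \<mu> r g = 0" if "g \<in> S" for g
    using emb[OF ck es, of 1 "-1" g] b[OF that] by (simp add: r_def e_def)
  \<comment> \<open>\<open>k\<close> differs from \<open>cnj r\<close> by an element of the span of
    \<open>S\<close>, on which \<open>r\<close> vanishes; hence the value of \<open>r\<close> at
    \<open>k\<close> is its squared norm.\<close>
  have rr: "gs_embed \<nu> \<mu> r k = (LINT x|lborel. cnj (cnj (r x)) * cnj (r x))"
  proof -
    have e_conj: "cnj (e x) = (\<Sum>i\<in>S. cnj (b i) * i x)" for x by (simp add: e_def)
    have "gs_embed \<nu> \<mu> r (\<lambda>x. 1 * k x + (-1) * (\<Sum>i\<in>S. cnj (b i) * i x)) = 1 * gs_embed \<nu> \<mu> r k + (-1) * gs_embed \<nu> \<mu> r (\<lambda>x. \<Sum>i\<in>S. cnj (b i) * i x)"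
      by (intro gs_dual_lin[OF gs_embed_dual[OF rs]] k gs_space_sum insert.hyps) (use S in auto)
    also have "gs_embed \<nu> \<mu> r (\<lambda>x. \<Sum>i\<in>S. cnj (b i) * i x) = 0"
      using gs_dual_sum[OF gs_embed_dual[OF rs] insert.hyps(1), of "\<lambda>i. i" "\<lambda>i. cnj (b i)"] S r0 by auto
    finally have "gs_embed \<nu> \<mu> r k = gs_embed \<nu> \<mu> r (\<lambda>x. cnj (r x))"
      unfolding r_def by (simp add: e_conj)
    then show ?thesis using gs_space_cnj[OF rs] by (simp add: gs_embed_def)
  qed
  have ins: "(\<Sum>i\<in>insert k S. c' i * cnj (i x)) = c' k * cnj (k x) + (\<Sum>i\<in>S. c' i * cnj (i x))" for c' x
    using insert.hyps by simp
  show ?case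
  proof (cases "gs_embed \<nu> \<mu> r k = 0")
    case True
    \<comment> \<open>A vanishing residual puts \<open>k\<close> into the span of \<open>S\<close>.
      Every functional is then determined at \<open>k\<close> by its values on \<open>S\<close>, and
      the old coefficients serve with weight 0 at \<open>k\<close>.\<close>
    then have "(\<lambda>x. cnj (r x)) = (\<lambda>x. 0)" using gs_norm_sq_zero[OF gs_space_cnj[OF rs]] rr by simp
    then have "r x = 0" for x by (metis complex_cnj_zero_iff)
    then have ke: "k x = (\<Sum>i\<in>S. cnj (b i) * i x)" for x
      unfolding r_def e_def by (metis (no_types, lifting) cnj_sum complex_cnj_cnj complex_cnj_mult eq_iff_diff_eq_0 sum.cong)
    have val: "w k = (\<Sum>i\<in>S. cnj (b i) * w i)" if "w \<in> gs_dual \<nu> \<mu>" for w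
    proof -
      have "k = (\<lambda>x. \<Sum>i\<in>S. cnj (b i) * i x)" by (rule ext) (rule ke)
      then have "w k = w (\<lambda>x. \<Sum>i\<in>S. cnj (b i) * i x)" by (rule arg_cong)
      also have "\<dots> = (\<Sum>i\<in>S. cnj (b i) * w i)" by (rule gs_dual_sum[OF that insert.hyps(1)]) (use S in blast)
      finally show ?thesis .
    qed
    have "u k = gs_embed \<nu> \<mu> f k"
      unfolding val[OF insert.prems(2)] val[OF gs_embed_dual[OF fs]] using c by (simp add: f_def)
    moreover have "(\<Sum>i\<in>insert k S. (c(k := 0)) i * cnj (i x)) = f x" for x
      unfolding ins f_def using insert.hyps by (auto intro!: sum.cong)
    ultimately show ?thesis using c by (intro exI[of _ "c(k := 0)"]) (auto simp: f_def)
  next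
    case False
    \<comment> \<open>A multiple of \<open>r\<close> corrects the value at \<open>k\<close> without
      disturbing the values on \<open>S\<close>.\<close>
    define l where "l = (u k - gs_embed \<nu> \<mu> f k) / gs_embed \<nu> \<mu> r k"
    define c' where "c' i = (if i = k then l else c i - l * b i)" for i
    have "(\<Sum>i\<in>insert k S. c' i * cnj (i x)) = 1 * f x + l * r x" for x
    proof -
      have "(\<Sum>i\<in>S. c' i * cnj (i x)) = (\<Sum>i\<in>S. c i * cnj (i x) - l * (b i * cnj (i x)))"
        using insert.hyps by (intro sum.cong) (auto simp: c'_def algebra_simps)
      then show ?thesis unfolding ins by (simp add: c'_def f_def r_def e_def sum_subtractf sum_distrib_left algebra_simps)
    qed
    then have "gs_embed \<nu> \<mu> (\<lambda>x. \<Sum>i\<in>insert k S. c' i * cnj (i x)) g = gs_embed \<nu> \<mu> f g + l * gs_embed \<nu> \<mu> r g" for g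
      using emb[OF fs rs, of 1 l g] by simp
    then have "\<forall>g\<in>insert k S. gs_embed \<nu> \<mu> (\<lambda>x. \<Sum>i\<in>insert k S. c' i * cnj (i x)) g = u g"
      using False c r0 by (auto simp: l_def f_def)
    then show ?thesis by blast
  qed
qed

lemma topspace_weak_star: "topspace (weak_star \<nu> \<mu>) = gs_dual \<nu> \<mu>"
  unfolding weak_star_def by simp

text \<open>If two extensions differed at \<open>u\<close> and \<open>g\<close>, they would differ
  on a whole weak* neighbourhood of \<open>u\<close>. Such a neighbourhood restricts finitely many
  values only, and by interpolation it contains an embedded test function, where the two must
  agree.\<close>

lemma dual_extension_unique:
  fixes T1 T2 :: "((real^'d::finite \<Rightarrow> complex) \<Rightarrow> complex) \<Rightarrow> (real^'d \<Rightarrow> complex) \<Rightarrow> complex"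
  assumes T1: "dual_extension \<nu> \<mu> A T1" and T2: "dual_extension \<nu> \<mu> A T2"
  shows "T1 = T2"
proof (rule extensionalityI)
  show "T1 \<in> extensional (gs_dual \<nu> \<mu>)" "T2 \<in> extensional (gs_dual \<nu> \<mu>)" using T1 T2 by (auto simp: dual_extension_def)
  fix u :: "(real^'d \<Rightarrow> complex) \<Rightarrow> complex" assume u: "u \<in> gs_dual \<nu> \<mu>"
  show "T1 u = T2 u"
  proof (rule ext, rule ccontr)
    fix g assume ne: "T1 u g \<noteq> T2 u g"
    have ev: "continuous_map (weak_star \<nu> \<mu>) euclidean (\<lambda>w. T w g)" if "dual_extension \<nu> \<mu> A T" for T
    proof -
      have "continuous_map (weak_star \<nu> \<mu>) (product_topology (\<lambda>_. euclidean) UNIV) T"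
        using that unfolding dual_extension_def weak_star_def by (auto simp: continuous_map_in_subtopology)
      then show ?thesis by (simp add: continuous_map_componentwise_UNIV)
    qed
    have "continuous_map (weak_star \<nu> \<mu>) euclidean (\<lambda>w. T1 w g - T2 w g)"
      by (intro continuous_map_diff ev T1 T2)
    then have "openin (weak_star \<nu> \<mu>) {w \<in> topspace (weak_star \<nu> \<mu>). T1 w g - T2 w g \<in> - {0}}"
      by (rule openin_continuous_map_preimage) (simp add: open_Compl)
    then obtain Q where Q: "openin (product_topology (\<lambda>_. euclidean) UNIV) Q"
      and Qeq: "{w \<in> gs_dual \<nu> \<mu>. T1 w g - T2 w g \<in> - {0}} = Q \<inter> gs_dual \<nu> \<mu>"
      unfolding topspace_weak_star unfolding weak_star_def openin_subtopology by blast
    have uQ: "u \<in> Q" using u ne Qeq by auto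
    then obtain X where X: "u \<in> Pi\<^sub>E UNIV X" "finite {i. X i \<noteq> UNIV}" "Pi\<^sub>E UNIV X \<subseteq> Q"
      using product_topology_open_contains_basis[OF Q uQ] unfolding topspace_euclidean by blast
    \<comment> \<open>Arguments off the test space are left out: all elements of the dual vanish
      there, and so does the embedding.\<close>
    define S where "S = {i. X i \<noteq> UNIV} \<inter> gs_space \<nu> \<mu>"
    obtain c where c: "\<And>k. k \<in> S \<Longrightarrow> gs_embed \<nu> \<mu> (\<lambda>x. \<Sum>i\<in>S. c i * cnj (i x)) k = u k"
    proof -
      have "finite S" "S \<subseteq> gs_space \<nu> \<mu>" using X(2) by (auto simp: S_def)
      from gs_interpolation[OF this u] show ?thesis using that by blast
    qed
    define f where "f = (\<lambda>x. \<Sum>i\<in>S. c i * cnj (i x))"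
    have fs: "f \<in> gs_space \<nu> \<mu>"
      unfolding f_def
    proof (rule gs_space_sum)
      show "finite S" using X(2) by (simp add: S_def)
      show "(\<lambda>x. cnj (i x)) \<in> gs_space \<nu> \<mu>" if "i \<in> S" for i
        using that by (intro gs_space_cnj) (simp add: S_def)
    qed
    have "gs_embed \<nu> \<mu> f \<in> Pi\<^sub>E UNIV X"
    proof (simp add: PiE_iff, intro allI)
      fix k
      show "gs_embed \<nu> \<mu> f k \<in> X k"
      proof (cases "X k = UNIV")
        case False
        have "gs_embed \<nu> \<mu> f k = u k"
        proof (cases "k \<in> gs_space \<nu> \<mu>")
          case True
          then show ?thesis using c[of k] False by (simp add: S_def f_def)
        next
          case False
          then show ?thesis using gs_dual_off[OF u False] by (simp add: gs_embed_def)
        qed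
        then show ?thesis using X(1) by (auto simp: PiE_iff)
      qed simp
    qed
    then have "gs_embed \<nu> \<mu> f \<in> Q \<inter> gs_dual \<nu> \<mu>" using X(3) gs_embed_dual[OF fs] by blast
    then have "T1 (gs_embed \<nu> \<mu> f) g \<noteq> T2 (gs_embed \<nu> \<mu> f) g" unfolding Qeq[symmetric] by auto
    moreover have "T1 (gs_embed \<nu> \<mu> f) = T2 (gs_embed \<nu> \<mu> f)" using T1 T2 fs by (simp add: dual_extension_def)
    ultimately show False by simp
  qed
qed

end

subsection \<open>Fourier multipliers\<close>

context gs
begin

definition gs_multiplier :: "('d::finite \<Rightarrow> nat \<Rightarrow> real^'d \<Rightarrow> complex) \<Rightarrow> bool" where
  "gs_multiplier P \<longleftrightarrow> coord_fam P \<and> (\<forall>h>0. \<exists>D\<ge>0. \<exists>R>0. fam_bound \<nu> h (\<lambda>\<eta>. D * exp (R * norm \<eta> powr (1 / \<mu>))) P)"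

text \<open>A quasi-triangle inequality for powers of the norm. Its price is the factor
  \<open>2 powr c\<close> in the rate, for which the constants \<open>k\<close> below make
  up.\<close>

lemma exp_shift_le:
  fixes x a :: "real^'d::finite"
  assumes c: "c > 0" and r: "r \<ge> 0"
  shows "exp (- r * norm (x + a) powr c) \<le> exp (r * norm a powr c) * exp (- (r / 2 powr c) * norm x powr c)"
proof -
  have "norm x powr c \<le> 2 powr c * (norm (x + a) powr c + norm a powr c)"
    using norm_add_powr_le[of c "x + a" "- a"] c by simp
  then have "(r / 2 powr c) * norm x powr c \<le> (r / 2 powr c) * (2 powr c * (norm (x + a) powr c + norm a powr c))"
    using r by (intro mult_left_mono) auto
  also have "\<dots> = r * norm (x + a) powr c + r * norm a powr c" by (simp add: algebra_simps)
  finally show ?thesis by (simp flip: exp_add)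
qed

lemma gs_fam_bound_multiplier:
  fixes P :: "'d::finite \<Rightarrow> nat \<Rightarrow> real^'d \<Rightarrow> complex"
  assumes P: "gs_multiplier P" and h: "h > 0" and r: "r > 0"
  shows "\<exists>h'>0. \<exists>r'>0. \<exists>A>0. \<forall>H C. gs_fam_bound \<nu> \<mu> h' r' C H \<longrightarrow> gs_fam_bound \<nu> \<mu> h r (A * C) (fam_mult P (fam_shift a H))"
proof -
  obtain D R where D: "D \<ge> 0" and R: "R > 0" and PD: "fam_bound \<nu> (h / 2) (\<lambda>\<eta>. D * exp (R * norm \<eta> powr (1 / \<mu>))) P"
    using P h unfolding gs_multiplier_def by (meson half_gt_zero)
  define k where "k = 2 powr (1 / \<mu>)"
  have k: "k > 0" by (simp add: k_def)
  \<comment> \<open>\<open>k\<close> makes up for the loss in the shift and \<open>R\<close> for the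
    growth of the multiplier.\<close>
  define r' where "r' = k * (R + r)"
  have r': "r' > 0" using k R r by (simp add: r'_def)
  define A where "A = (D + 1) * exp (r' * norm a powr (1 / \<mu>))"
  have A: "A > 0" using D by (simp add: A_def)
  have "gs_fam_bound \<nu> \<mu> h r (A * C) (fam_mult P (fam_shift a H))" if H: "gs_fam_bound \<nu> \<mu> (h / 2) r' C H" for H :: "'d \<Rightarrow> nat \<Rightarrow> real^'d \<Rightarrow> complex" and C
  proof (rule fam_bound_mono)
    show "fam_bound \<nu> (2 * (h / 2)) (\<lambda>x. D * exp (R * norm x powr (1 / \<mu>)) * (C * exp (- r' * norm (x + a) powr (1 / \<mu>)))) (fam_mult P (fam_shift a H))"
      by (rule fam_bound_mult[OF PD fam_bound_shift[OF H]]) (use nu h in auto)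
    fix x :: "real^'d"
    have C: "C \<ge> 0" by (rule gs_fam_bound_nonneg[OF H])
    have "exp (- r' * norm (x + a) powr (1 / \<mu>)) \<le> exp (r' * norm a powr (1 / \<mu>)) * exp (- (R + r) * norm x powr (1 / \<mu>))"
      using exp_shift_le[of "1 / \<mu>" r' x a] mu r' k by (simp add: k_def[symmetric] r'_def)
    then have "D * exp (R * norm x powr (1 / \<mu>)) * (C * exp (- r' * norm (x + a) powr (1 / \<mu>)))
        \<le> (D + 1) * exp (R * norm x powr (1 / \<mu>)) * (C * (exp (r' * norm a powr (1 / \<mu>)) * exp (- (R + r) * norm x powr (1 / \<mu>))))"
      using C D by (intro mult_mono) auto
    also have "\<dots> = A * C * (exp (R * norm x powr (1 / \<mu>)) * exp (- (R + r) * norm x powr (1 / \<mu>)))" by (simp add: A_def)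
    also have "exp (R * norm x powr (1 / \<mu>)) * exp (- (R + r) * norm x powr (1 / \<mu>)) = exp (- r * norm x powr (1 / \<mu>))"
      by (simp add: algebra_simps flip: exp_add)
    finally show "D * exp (R * norm x powr (1 / \<mu>)) * (C * exp (- r' * norm (x + a) powr (1 / \<mu>))) \<le> A * C * exp (- r * norm x powr (1 / \<mu>))" .
  qed (use h in auto)
  then show ?thesis using h r' A by (meson half_gt_zero)
qed

lemma gs_fam_multiplier:
  fixes P :: "'d::finite \<Rightarrow> nat \<Rightarrow> real^'d \<Rightarrow> complex"
  assumes P: "gs_multiplier P" and H: "gs_fam \<nu> \<mu> H"
  shows "gs_fam \<nu> \<mu> (fam_mult P (fam_shift a H))"
  unfolding gs_fam_def
proof (intro conjI allI impI)
  show "coord_fam (fam_mult P (fam_shift a H))" using P H by (intro coord_fam_mult coord_fam_shift) (auto simp: gs_multiplier_def gs_fam_def)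
  fix h r :: real assume "h > 0" "r > 0"
  from gs_fam_bound_multiplier[OF P this, of a] obtain h' r' A where *: "h' > 0" "r' > 0" "\<And>H C. gs_fam_bound \<nu> \<mu> h' r' C H \<Longrightarrow> gs_fam_bound \<nu> \<mu> h r (A * C) (fam_mult P (fam_shift a H))"
    by blast
  obtain C where "gs_fam_bound \<nu> \<mu> h' r' C H" using H * unfolding gs_fam_def by blast
  then show "\<exists>C. gs_fam_bound \<nu> \<mu> h r C (fam_mult P (fam_shift a H))" using *(3) by blast
qed

text \<open>On transforms it acts as \<open>F \<mapsto> M * F (\<cdot> + a)\<close>. The multiplier
  enters as a plain function, so the operator is independent of the family that witnesses its
  derivative bounds.\<close>

definition mult_op :: "(real^'d::finite \<Rightarrow> complex) \<Rightarrow> real^'d \<Rightarrow> (real^'d \<Rightarrow> complex) \<Rightarrow> real^'d \<Rightarrow> complex" where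
  "mult_op M a f x = ft (\<lambda>\<eta>. M \<eta> * ft f (\<eta> + a)) (- x) / (2 * pi) ^ CARD('d)"

lemma mult_op_fam:
  "mult_op (P j 0) a f = (\<lambda>x. (1 / (2 * pi) ^ CARD('d)) * ft (fam_mult P (fam_shift a (ft_fam f)) (j::'d::finite) 0) (- x))"
  by (rule ext) (simp add: mult_op_def fam_mult_0[abs_def] fam_shift_def ft_fam_0 flip: fam_mult_0)

lemma mult_op_gs_space:
  assumes P: "gs_multiplier P" and f: "f \<in> gs_space \<nu> \<mu>"
  shows "mult_op (P j 0) a f \<in> gs_space \<nu> \<mu>"
  unfolding mult_op_fam by (intro gs_space_cmult gs_space_inv_ft[OF ab] gs_fam_multiplier P gs_fam_ft_fam[OF ab] f)

lemma gs_ft_rapid: "f \<in> gs_space \<nu> \<mu> \<Longrightarrow> rapid (ft f)"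
  using gs_fam_rapid[OF mu gs_fam_ft_fam[OF ab], of f undefined 0] by (simp add: ft_fam_0)

lemma gs_ft_lin:
  assumes "f \<in> gs_space \<nu> \<mu>" "g \<in> gs_space \<nu> \<mu>"
  shows "ft (\<lambda>x. a * f x + b * g x) y = a * ft f y + b * ft g y"
  by (rule ft_add) (use assms in \<open>auto intro: gs_wt_dom\<close>)

lemma mult_op_dom:
  assumes P: "gs_multiplier P" and f: "f \<in> gs_space \<nu> \<mu>"
  shows "rapid (\<lambda>\<eta>. P j 0 \<eta> * ft f (\<eta> + a))"
proof -
  have "rapid (fam_mult P (fam_shift a (ft_fam f)) j 0)"
    by (rule gs_fam_rapid[OF mu]) (rule gs_fam_multiplier[OF P gs_fam_ft_fam[OF ab f]])
  then show ?thesis by (simp add: fam_mult_0[abs_def] fam_shift_def ft_fam_0)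
qed

lemma mult_op_lin:
  assumes P: "gs_multiplier P" and f: "f \<in> gs_space \<nu> \<mu>" and g: "g \<in> gs_space \<nu> \<mu>"
  shows "mult_op (P j 0) a (\<lambda>x. c * f x + d * g x) x = c * mult_op (P j 0) a f x + d * mult_op (P j 0) a g x"
proof -
  have "ft (\<lambda>\<eta>. P j 0 \<eta> * ft (\<lambda>x. c * f x + d * g x) (\<eta> + a)) (- x) =
      ft (\<lambda>\<eta>. c * (P j 0 \<eta> * ft f (\<eta> + a)) + d * (P j 0 \<eta> * ft g (\<eta> + a))) (- x)"
    unfolding gs_ft_lin[OF f g] by (simp add: algebra_simps)
  also have "\<dots> = c * ft (\<lambda>\<eta>. P j 0 \<eta> * ft f (\<eta> + a)) (- x) + d * ft (\<lambda>\<eta>. P j 0 \<eta> * ft g (\<eta> + a)) (- x)"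
    by (intro ft_add rapid_wt_dom mult_op_dom P f g)
  finally show ?thesis by (simp add: mult_op_def add_divide_distrib)
qed

text \<open>By inversion \<open>f\<close> is itself an inverse transform up to the factor
  \<open>K\<close>, so bounds on \<open>ft_fam f\<close> return to the quotients of
  \<open>f\<close>.\<close>

lemma gs_quot_gs_fam_bound:
  assumes h: "h > 0"
  shows "\<exists>h'>0. \<exists>r'>0. \<exists>A>0. \<forall>f C z. f \<in> gs_space \<nu> \<mu> \<longrightarrow> gs_fam_bound \<nu> \<mu> h' r' C (ft_fam f) \<longrightarrow> gs_quot \<nu> \<mu> h (f :: real^'d::finite \<Rightarrow> complex) z \<le> A * C"
proof -
  obtain h' r' A where *: "h' > 0" "r' > 0" "A > 0" and bd: "\<And>(H :: 'd \<Rightarrow> nat \<Rightarrow> real^'d \<Rightarrow> complex) C j z. gs_fam \<nu> \<mu> H \<Longrightarrow> gs_fam_bound \<nu> \<mu> h' r' C H \<Longrightarrow>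
    gs_quot \<nu> \<mu> h (\<lambda>x. ft (H j 0) (- x)) z \<le> A * C"
    using gs_quot_inv_ft[where 'd='d, OF ab h] by blast
  define K where "K = (2 * pi) ^ CARD('d)"
  have K: "K > 0" by (simp add: K_def)
  have "gs_quot \<nu> \<mu> h f z \<le> (A / K) * C" if f: "f \<in> gs_space \<nu> \<mu>" and b: "gs_fam_bound \<nu> \<mu> h' r' C (ft_fam f)" for f :: "real^'d \<Rightarrow> complex" and C z
  proof -
    define g where "g = (\<lambda>x. ft (ft_fam f undefined 0) (- x))"
    have g: "g x = of_real K * f x" for x
      using gs_space_inversion[OF ab f, of "- x"] by (simp add: g_def ft_fam_0 K_def)
    have gg: "g \<in> gs_space \<nu> \<mu>" unfolding g_def by (rule gs_space_inv_ft[OF ab gs_fam_ft_fam[OF ab f]])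
    have fg: "f = (\<lambda>x. of_real (1 / K) * g x + 0 * g x)" unfolding g using K by simp
    have "gs_quot \<nu> \<mu> h f z \<le> cmod (of_real (1 / K)) * gs_quot \<nu> \<mu> h g z + cmod 0 * gs_quot \<nu> \<mu> h g z"
      by (subst fg) (rule gs_quot_lin[OF gs_space_smooth[OF gg] gs_space_smooth[OF gg] h])
    also have "\<dots> = gs_quot \<nu> \<mu> h g z / K" using K by (simp add: norm_divide)
    also have "\<dots> \<le> (A * C) / K"
      unfolding g_def using K by (intro divide_right_mono bd[OF gs_fam_ft_fam[OF ab f] b]) auto
    finally show ?thesis by simp
  qed
  moreover have "A / K > 0" using * K by simp
  ultimately show ?thesis using * by blast
qed

lemma integral_neg_ft: "ft (\<lambda>x. F (- x)) y = ft F (- y)" if "F \<in> borel_measurable borel"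
proof -
  have "(\<lambda>x. F x * exp (- \<i> * complex_of_real (x \<bullet> (- y)))) \<in> borel_measurable borel"
    by (intro borel_measurable_times that borel_measurable_continuous_onI continuous_intros)
  from integral_lborel_uminus[OF this] show ?thesis unfolding ft_def by simp
qed

lemma ft_mult_op:
  assumes P: "gs_multiplier P" and f: "f \<in> gs_space \<nu> \<mu>"
  shows "ft (mult_op (P j 0) a f) \<eta> = P j 0 \<eta> * ft f (\<eta> + a)"
proof -
  let ?H = "fam_mult P (fam_shift a (ft_fam f))"
  have H: "gs_fam \<nu> \<mu> ?H" by (rule gs_fam_multiplier[OF P gs_fam_ft_fam[OF ab f]])
  have "ft (mult_op (P j 0) a f) \<eta> = (1 / (2 * pi) ^ CARD('a)) * ft (\<lambda>x. ft (?H j 0) (- x)) \<eta>"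
    unfolding mult_op_fam by (rule ft_cmult)
  also have "ft (\<lambda>x. ft (?H j 0) (- x)) \<eta> = ft (ft (?H j 0)) (- \<eta>)"
    by (rule integral_neg_ft) (intro wt_dom_measurable rapid_wt_dom gs_fam_ft_rapid[OF ab H])
  also have "\<dots> = (2 * pi) ^ CARD('a) * ?H j 0 \<eta>" using gs_fam_inversion[OF ab H, of j "- \<eta>"] by simp
  finally show ?thesis by (simp add: fam_mult_0 fam_shift_def ft_fam_0)
qed

lemma mult_op_seminorm:
  assumes P: "gs_multiplier P" and h: "h > 0"
  shows "\<exists>h'>0. \<exists>C\<ge>0. \<forall>f\<in>gs_space \<nu> \<mu>. gs_seminorm \<nu> \<mu> h (mult_op (P j 0) a f) \<le> C * gs_seminorm \<nu> \<mu> h' (f :: real^'d::finite \<Rightarrow> complex)"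
proof -
  obtain h1 r1 A1 where 1: "h1 > 0" "r1 > 0" "A1 > 0" and b1: "\<And>(f :: real^'d \<Rightarrow> complex) C z. f \<in> gs_space \<nu> \<mu> \<Longrightarrow> gs_fam_bound \<nu> \<mu> h1 r1 C (ft_fam f) \<Longrightarrow> gs_quot \<nu> \<mu> h f z \<le> A1 * C"
    using gs_quot_gs_fam_bound[where 'd='d, OF h] by blast
  obtain h1' r1' A1' where one: "h1' > 0" "r1' > 0" "A1' > 0" and b1': "\<And>(H :: 'd \<Rightarrow> nat \<Rightarrow> real^'d \<Rightarrow> complex) C j z. gs_fam \<nu> \<mu> H \<Longrightarrow> gs_fam_bound \<nu> \<mu> h1' r1' C H \<Longrightarrow>
    gs_quot \<nu> \<mu> h (\<lambda>x. ft (H j 0) (- x)) z \<le> A1' * C"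
    using gs_quot_inv_ft[where 'd='d, OF ab h] by blast
  obtain h2 r2 A2 where 2: "h2 > 0" "r2 > 0" "A2 > 0" and b2: "\<And>H C. gs_fam_bound \<nu> \<mu> h2 r2 C H \<Longrightarrow> gs_fam_bound \<nu> \<mu> h1' r1' (A2 * C) (fam_mult P (fam_shift a H))"
    using gs_fam_bound_multiplier[OF P one(1,2), of a] by blast
  obtain h3 A3 where 3: "h3 > 0" "A3 > 0" and b3: "\<And>f :: real^'d \<Rightarrow> complex. f \<in> gs_space \<nu> \<mu> \<Longrightarrow> gs_fam_bound \<nu> \<mu> h2 r2 (A3 * gs_seminorm \<nu> \<mu> h3 f) (ft_fam f)"
    using gs_fam_bound_ft_fam[where 'd='d, OF ab 2(1,2)] by blast
  define K where "K = (2 * pi) ^ CARD('d)"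
  have K: "K > 0" by (simp add: K_def)
  have "gs_seminorm \<nu> \<mu> h (mult_op (P j 0) a f) \<le> (A1' * A2 * A3 / K) * gs_seminorm \<nu> \<mu> h3 f" if f: "f \<in> gs_space \<nu> \<mu>" for f :: "real^'d \<Rightarrow> complex"
  proof -
    let ?H = "fam_mult P (fam_shift a (ft_fam f))"
    have H: "gs_fam \<nu> \<mu> ?H" by (rule gs_fam_multiplier[OF P gs_fam_ft_fam[OF ab f]])
    let ?g = "\<lambda>x. ft (?H j 0) (- x)"
    have g: "?g \<in> gs_space \<nu> \<mu>" by (rule gs_space_inv_ft[OF ab H])
    have "mult_op (P j 0) a f = (\<lambda>x. of_real (1 / K) * ?g x)" unfolding mult_op_fam by (simp add: K_def)
    then have "gs_seminorm \<nu> \<mu> h (mult_op (P j 0) a f) \<le> cmod (of_real (1 / K)) * gs_seminorm \<nu> \<mu> h ?g"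
      using gs_seminorm_cmult[OF g h, of "of_real (1 / K)"] by simp
    also have "\<dots> \<le> cmod (of_real (1 / K)) * (A1' * (A2 * (A3 * gs_seminorm \<nu> \<mu> h3 f)))"
      by (intro mult_left_mono gs_seminorm_least b1'[OF H] b2 b3 f) simp
    finally show ?thesis using K by (simp add: norm_divide)
  qed
  then show ?thesis using 3 K one(3) 2(3) by (intro exI[of _ h3] conjI exI[of _ "A1' * A2 * A3 / K"]) auto
qed

lemma mult_op_continuous:
  assumes P: "gs_multiplier P"
  shows "continuous_map (gs_topology \<nu> \<mu>) (gs_topology \<nu> \<mu>) (mult_op (P j 0) a)"
proof (rule continuous_map_gs)
  show "mult_op (P j 0) a f \<in> gs_space \<nu> \<mu>" if "f \<in> gs_space \<nu> \<mu>" for f by (rule mult_op_gs_space[OF P that])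
  show "mult_op (P j 0) a (\<lambda>x. f x - g x) x = mult_op (P j 0) a f x - mult_op (P j 0) a g x"
    if "f \<in> gs_space \<nu> \<mu>" "g \<in> gs_space \<nu> \<mu>" for f g x using mult_op_lin[OF P that, of j a 1 "-1" x] by simp
  show "\<exists>h'>0. \<exists>C. \<forall>f\<in>gs_space \<nu> \<mu>. gs_seminorm \<nu> \<mu> h (mult_op (P j 0) a f) \<le> C * gs_seminorm \<nu> \<mu> h' f" if "h > 0" for h
    using mult_op_seminorm[OF P that, of j a] by blast
qed

text \<open>In Parseval form both sides are integrals over frequency, exchanged by the reflection
  \<open>\<eta> \<mapsto> - a - \<eta>\<close>.\<close>

lemma mult_op_transpose:
  assumes P: "gs_multiplier P" and P': "gs_multiplier P'" and PP: "\<And>\<eta>. P' j 0 \<eta> = P j 0 (- \<eta> - a)"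
    and f: "f \<in> gs_space \<nu> \<mu>" and g: "g \<in> gs_space \<nu> \<mu>"
  shows "(LINT x|lborel. mult_op (P j 0) a f x * g x) = (LINT x|lborel. f x * mult_op (P' j 0) a g x)"
proof -
  define K where "K = complex_of_real ((2 * pi) ^ CARD('a))"
  have half: "(LINT x|lborel. mult_op (P j 0) a f x * g x) = (LINT \<eta>|lborel. P j 0 \<eta> * ft f (\<eta> + a) * ft g (- \<eta>)) / K"
    if P: "gs_multiplier P" and f: "f \<in> gs_space \<nu> \<mu>" and g: "g \<in> gs_space \<nu> \<mu>" for P :: "'a \<Rightarrow> nat \<Rightarrow> real^'a \<Rightarrow> complex" and f g j
  proof -
    let ?G = "\<lambda>\<eta>. P j 0 \<eta> * ft f (\<eta> + a)"
    have G: "wt_dom ?G" by (intro rapid_wt_dom mult_op_dom P f)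
    have gd: "wt_dom g" by (rule gs_wt_dom[OF g])
    have gn: "continuous_on UNIV (\<lambda>x. g (- x))"
      by (rule continuous_on_compose2[OF wt_dom_continuous[OF gd, of UNIV]]) (auto intro!: continuous_intros)
    have mg: "g \<in> borel_measurable borel" by (rule wt_dom_measurable[OF gd])
    have ig: "integrable lborel (\<lambda>x. g (- x))" using integrable_lborel_affine[OF wt_dom_integrable[OF gd], of "-1" 0] by simp
    have mG: "ft ?G \<in> borel_measurable borel" by (intro borel_measurable_continuous_onI ft_continuous G)
    have "(LINT x|lborel. mult_op (P j 0) a f x * g x) = (LINT x|lborel. ft ?G (- x) * g x) / K"
      by (simp add: mult_op_def K_def)
    also have "(LINT x|lborel. ft ?G (- x) * g x) = (LINT x|lborel. ft ?G x * g (- x))"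
      using integral_lborel_uminus[of "\<lambda>x. ft ?G (- x) * g x"] mG mg by simp
    also have "\<dots> = (LINT \<eta>|lborel. ?G \<eta> * ft (\<lambda>x. g (- x)) \<eta>)" by (rule ft_mult_swap[OF G gn ig])
    finally show ?thesis by (simp add: integral_neg_ft[OF mg])
  qed
  have m: "(\<lambda>\<eta>. P j 0 \<eta> * ft f (\<eta> + a) * ft g (- \<eta>)) \<in> borel_measurable borel"
  proof (intro borel_measurable_continuous_onI continuous_intros)
    show "continuous_on UNIV (P j 0)" using P by (auto simp: gs_multiplier_def intro: coord_famD)
    show "continuous_on UNIV (\<lambda>\<eta>. ft f (\<eta> + a))" "continuous_on UNIV (\<lambda>\<eta>. ft g (- \<eta>))"
      by (rule continuous_on_compose2[OF ft_continuous[OF gs_wt_dom]]; use f g in \<open>auto intro!: continuous_intros\<close>)+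
  qed
  have "(LINT \<eta>|lborel. P j 0 \<eta> * ft f (\<eta> + a) * ft g (- \<eta>)) = (LINT \<eta>|lborel. P j 0 (- a + (-1) *\<^sub>R \<eta>) * ft f ((- a + (-1) *\<^sub>R \<eta>) + a) * ft g (- (- a + (-1) *\<^sub>R \<eta>)))"
    using integral_lborel_affine[OF m, of "-1" "- a"] by simp
  also have "\<dots> = (LINT \<eta>|lborel. P' j 0 \<eta> * ft g (\<eta> + a) * ft f (- \<eta>))"
    unfolding PP by (intro Bochner_Integration.integral_cong) (auto simp: algebra_simps minus_diff_commute)
  finally have "(LINT x|lborel. mult_op (P j 0) a f x * g x) = (LINT x|lborel. mult_op (P' j 0) a g x * f x)"
    unfolding half[OF P f g] half[OF P' g f] by simp
  then show ?thesis by (simp add: mult.commute)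
qed

end

subsection \<open>Exponentials of polynomial phases\<close>

text \<open>Cauchy's inequality on circles of radius \<open>\<rho> = Y powr (1 - \<nu>) / h\<close> with
  \<open>Y = \<lambda> + r\<^sub>1 \<bar>s\<bar> powr (1 / \<mu>) + L\<close>: the radius is small enough for the growth of the phase on the
  circle to be at most \<open>Y\<close>, and \<open>\<rho> ^ (- n)\<close> costs only \<open>h ^ n n! powr (\<nu> - 1) exp ((\<nu> - 1) Y)\<close>.\<close>

lemma phase_deriv_bound:
  fixes \<nu> \<mu> C h :: real and m :: nat
  assumes mu: "\<mu> > 0" and nu: "\<nu> > 1" and m: "m \<ge> 2" and num: "\<mu> * (real m - 1) \<le> \<nu>" and C: "C > 0" and h: "h > 0"
  shows "\<exists>D>0. \<exists>R>0. \<forall>l\<ge>0. \<forall>Q. Q holomorphic_on UNIV \<longrightarrow> (\<forall>s::real. Im (Q (of_real s)) = 0) \<longrightarrow>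
     (\<forall>(s::real) z. cmod (Q (of_real s + z) - Q (of_real s)) \<le> C * cmod z * (1 + \<bar>s\<bar> + cmod z) * (1 + l powr \<mu> + \<bar>s\<bar> + cmod z) ^ (m - 2)) \<longrightarrow>
     (\<forall>n (s::real). cmod ((deriv ^^ n) (\<lambda>z. exp (\<i> * Q z)) (of_real s)) \<le> D * h ^ n * fact n powr \<nu> * exp (\<nu> * l + R * \<bar>s\<bar> powr (1 / \<mu>)))"
proof -
  \<comment> \<open>The proportion of \<open>Y^\<mu>\<close> below which \<open>1\<close>,
    \<open>\<bar>s\<bar>\<close> and the radius are kept; it is small enough for the constants
    \<open>C\<close>, \<open>3\<close> and \<open>4 ^ (m - 2)\<close> to be absorbed by
    \<open>h\<close>.\<close>
  define \<theta> where "\<theta> = min 1 (h / (3 * 4 ^ (m - 2) * C))"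
  have th: "\<theta> > 0" "\<theta> \<le> 1" "3 * 4 ^ (m - 2) * C * \<theta> \<le> h"
  proof -
    show "\<theta> > 0" "\<theta> \<le> 1" using h C by (auto simp: \<theta>_def)
    have "3 * 4 ^ (m - 2) * C * \<theta> \<le> 3 * 4 ^ (m - 2) * C * (h / (3 * 4 ^ (m - 2) * C))"
      using C by (intro mult_left_mono) (auto simp: \<theta>_def)
    then show "3 * 4 ^ (m - 2) * C * \<theta> \<le> h" using C by simp
  qed
  \<comment> \<open>Comparing the radius \<open>Y^(1 - \<nu>) / h\<close> with
    \<open>\<theta> Y^\<mu>\<close> amounts to a lower bound for
    \<open>Y^(\<mu> + \<nu> - 1)\<close>, whose exponent is positive.\<close>
  define \<tau> where "\<tau> = \<mu> + \<nu> - 1"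
  have tau: "\<tau> > 0" using mu nu by (simp add: \<tau>_def)
  define r1 where "r1 = (1 / \<theta>) powr (1 / \<mu>)"
  have r1: "r1 > 0" using th by (simp add: r1_def)
  \<comment> \<open>The three entries enforce \<open>Y \<ge> 1\<close>,
    \<open>1 \<le> \<theta> Y^\<mu>\<close> and \<open>\<rho> \<le> \<theta> Y^\<mu>\<close>; the
    summand of \<open>Y\<close> with \<open>r1\<close> enforces the same for
    \<open>\<bar>s\<bar>\<close>.\<close>
  define L where "L = max 1 (max ((1 / \<theta>) powr (1 / \<mu>)) ((1 / (h * \<theta>)) powr (1 / \<tau>)))"
  have L: "L \<ge> 1" "L \<ge> (1 / \<theta>) powr (1 / \<mu>)" "L \<ge> (1 / (h * \<theta>)) powr (1 / \<tau>)" by (auto simp: L_def)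
  have "cmod ((deriv ^^ n) (\<lambda>z. exp (\<i> * Q z)) (of_real s)) \<le> exp (\<nu> * L) * h ^ n * fact n powr \<nu> * exp (\<nu> * l + (\<nu> * r1) * \<bar>s\<bar> powr (1 / \<mu>))"
    if l: "l \<ge> 0" and hol: "Q holomorphic_on UNIV" and re: "\<And>s::real. Im (Q (of_real s)) = 0"
      and bd: "\<And>(s::real) z. cmod (Q (of_real s + z) - Q (of_real s)) \<le> C * cmod z * (1 + \<bar>s\<bar> + cmod z) * (1 + l powr \<mu> + \<bar>s\<bar> + cmod z) ^ (m - 2)"
    for l Q n and s :: real
  proof -
    define Y where "Y = l + r1 * \<bar>s\<bar> powr (1 / \<mu>) + L"
    have Y: "Y \<ge> 1" "Y \<ge> L" "Y \<ge> l" "Y \<ge> r1 * \<bar>s\<bar> powr (1 / \<mu>)" 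
    proof -
      have "r1 * \<bar>s\<bar> powr (1 / \<mu>) \<ge> 0" using r1 by simp
      then show "Y \<ge> 1" "Y \<ge> L" "Y \<ge> l" "Y \<ge> r1 * \<bar>s\<bar> powr (1 / \<mu>)" using l L(1) by (auto simp: Y_def)
    qed
    have Y0: "Y > 0" using Y by simp
    define \<rho> where "\<rho> = Y powr (1 - \<nu>) / h"
    have rho: "\<rho> > 0" using Y0 h by (simp add: \<rho>_def)
    have e1: "1 \<le> \<theta> * Y powr \<mu>"
    proof -
      have "(1 / \<theta>) = ((1 / \<theta>) powr (1 / \<mu>)) powr \<mu>" using th mu by (simp add: powr_powr)
      also have "\<dots> \<le> Y powr \<mu>" using L Y mu by (intro powr_mono2) auto
      finally show ?thesis using th by (simp add: field_simps)
    qed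
    have e2: "\<bar>s\<bar> \<le> \<theta> * Y powr \<mu>"
    proof -
      have "(1 / \<theta>) * \<bar>s\<bar> = (r1 * \<bar>s\<bar> powr (1 / \<mu>)) powr \<mu>" using th mu by (simp add: r1_def powr_mult powr_powr)
      also have "\<dots> \<le> Y powr \<mu>" using Y mu r1 by (intro powr_mono2) auto
      finally show ?thesis using th by (simp add: field_simps)
    qed
    have e3: "\<rho> \<le> \<theta> * Y powr \<mu>"
    proof -
      have "(1 / (h * \<theta>)) = ((1 / (h * \<theta>)) powr (1 / \<tau>)) powr \<tau>" using th h tau by (simp add: powr_powr)
      also have "\<dots> \<le> Y powr \<tau>" using L Y tau by (intro powr_mono2) auto
      also have "Y powr \<tau> = Y powr \<mu> / Y powr (1 - \<nu>)" by (simp add: \<tau>_def algebra_simps flip: powr_diff)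
      finally show ?thesis using th h Y0 by (simp add: \<rho>_def field_simps)
    qed
    have e4: "l powr \<mu> \<le> Y powr \<mu>" using Y l mu by (intro powr_mono2) auto
    have b: "cmod (Q (of_real s + z) - Q (of_real s)) \<le> Y" if z: "cmod z = \<rho>" for z
    proof -
      have "cmod (Q (of_real s + z) - Q (of_real s)) \<le> C * \<rho> * (1 + \<bar>s\<bar> + \<rho>) * (1 + l powr \<mu> + \<bar>s\<bar> + \<rho>) ^ (m - 2)"
        using bd[of s z] z by simp
      also have "\<dots> \<le> C * \<rho> * (3 * (\<theta> * Y powr \<mu>)) * (4 * Y powr \<mu>) ^ (m - 2)"
      proof (intro mult_mono power_mono)
        show "1 + \<bar>s\<bar> + \<rho> \<le> 3 * (\<theta> * Y powr \<mu>)" using e1 e2 e3 by simp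
        have "\<theta> * Y powr \<mu> \<le> Y powr \<mu>" using th by (intro mult_left_le_one_le) auto
        then show "1 + l powr \<mu> + \<bar>s\<bar> + \<rho> \<le> 4 * Y powr \<mu>" using e1 e2 e3 e4 by simp
      qed (use C rho th in auto)
      also have "\<dots> = (3 * 4 ^ (m - 2) * C * \<theta> / h) * (Y powr (1 - \<nu>) * Y powr \<mu> * (Y powr \<mu>) ^ (m - 2))"
        by (simp add: \<rho>_def power_mult_distrib)
      also have "\<dots> \<le> 1 * (Y powr (1 - \<nu>) * Y powr \<mu> * (Y powr \<mu>) ^ (m - 2))"
        using th(3) h by (intro mult_right_mono) (auto simp: divide_le_eq)
      also have "\<dots> = Y powr (1 - \<nu> + \<mu> + \<mu> * real (m - 2))"
        using Y0 by (simp add: powr_add powr_realpow[symmetric] powr_powr)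
      \<comment> \<open>Here \<open>\<mu> (m - 1) \<le> \<nu>\<close> enters: the exponent equals
        \<open>1 - \<nu> + \<mu> (m - 1)\<close>.\<close>
      also have "\<dots> \<le> Y powr 1"
        using Y num m by (intro powr_mono) (auto simp: of_nat_diff algebra_simps)
      finally show ?thesis using Y0 by simp
    qed
    have "cmod ((deriv ^^ n) (\<lambda>z. exp (\<i> * Q z)) (of_real s)) \<le> fact n * exp Y / \<rho> ^ n"
    proof (rule Cauchy_inequality[OF _ _ rho])
      show "(\<lambda>z. exp (\<i> * Q z)) holomorphic_on ball (of_real s) \<rho>"
        by (intro holomorphic_intros holomorphic_on_subset[OF hol]) auto
      show "continuous_on (cball (of_real s) \<rho>) (\<lambda>z. exp (\<i> * Q z))"
        by (intro continuous_intros holomorphic_on_imp_continuous_on holomorphic_on_subset[OF hol]) auto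
      fix x assume x: "cmod (of_real s - x) = \<rho>"
      define z where "z = x - of_real s"
      have z: "cmod z = \<rho>" "x = of_real s + z" using x by (auto simp: z_def norm_minus_commute)
      \<comment> \<open>The phase is real at \<open>s\<close>, so on the circle its imaginary part
        is that of the increment.\<close>
      have "cmod (exp (\<i> * Q x)) = exp (- Im (Q x))" by simp
      also have "- Im (Q x) = - Im (Q (of_real s + z) - Q (of_real s))" using re[of s] z by simp
      also have "\<dots> \<le> Y" using abs_Im_le_cmod[of "Q (of_real s + z) - Q (of_real s)"] b[OF z(1)] by linarith
      finally show "cmod (exp (\<i> * Q x)) \<le> exp Y" by simp
    qed
    also have "\<dots> = fact n * exp Y * h ^ n * (Y powr (\<nu> - 1)) ^ n"
    proof -
      have "1 / \<rho> = h * Y powr (\<nu> - 1)" using h Y0 by (simp add: \<rho>_def powr_diff field_simps)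
      then have "(1 / \<rho>) ^ n = h ^ n * (Y powr (\<nu> - 1)) ^ n" by (simp only: power_mult_distrib)
      moreover have "fact n * exp Y / \<rho> ^ n = fact n * exp Y * (1 / \<rho>) ^ n" by (simp add: power_one_over)
      ultimately show ?thesis by (simp only: mult.assoc)
    qed
    also have "(Y powr (\<nu> - 1)) ^ n = (Y ^ n) powr (\<nu> - 1)" using Y0 nu by (intro powr_power_commute) auto
    also have "\<dots> \<le> (fact n * exp Y) powr (\<nu> - 1)"
      using power_over_fact_le_exp[of Y n] Y0 nu by (intro powr_mono2) (auto simp: field_simps)
    also have "\<dots> = fact n powr (\<nu> - 1) * exp ((\<nu> - 1) * Y)" by (simp add: powr_mult exp_powr_real mult.commute)
    also have "fact n * exp Y * h ^ n * (fact n powr (\<nu> - 1) * exp ((\<nu> - 1) * Y)) =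
        h ^ n * (fact n powr 1 * fact n powr (\<nu> - 1)) * (exp Y * exp ((\<nu> - 1) * Y))" by simp
    also have "fact n powr 1 * fact n powr (\<nu> - 1) = (fact n :: real) powr \<nu>" by (simp only: powr_add[symmetric]) simp
    also have "exp Y * exp ((\<nu> - 1) * Y) = exp (\<nu> * Y)" by (simp add: algebra_simps flip: exp_add)
    also have "\<nu> * Y = \<nu> * L + (\<nu> * l + (\<nu> * r1) * \<bar>s\<bar> powr (1 / \<mu>))" by (simp add: Y_def algebra_simps)
    finally show ?thesis using h by (simp add: exp_add mult_ac)
  qed
  moreover have "\<nu> * r1 > 0" using nu r1 by simp
  ultimately show ?thesis by (intro exI[of _ "exp (\<nu> * L)"] conjI exI[of _ "\<nu> * r1"]) auto
qed

text \<open>The phase splits into functions of one variable each, so a coordinate derivative falls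
  on a single factor and can be taken as a complex derivative, to which Cauchy's estimate
  applies.\<close>

definition phase_fam :: "('d::finite \<Rightarrow> complex \<Rightarrow> complex) \<Rightarrow> 'd \<Rightarrow> nat \<Rightarrow> real^'d \<Rightarrow> complex" where
  "phase_fam Q j n x = (\<Prod>l\<in>UNIV - {j}. exp (\<i> * Q l (of_real (x $ l)))) *
     (deriv ^^ n) (\<lambda>z. exp (\<i> * Q j z)) (of_real (x $ j))"

lemma phase_fam_0: "phase_fam Q j 0 x = (\<Prod>l\<in>UNIV. exp (\<i> * Q l (of_real (x $ l))))"
  by (simp add: phase_fam_def prod.remove[of UNIV j] mult.commute)

lemma coord_fam_phase:
  assumes Q: "\<And>l. Q l holomorphic_on UNIV"
  shows "coord_fam (phase_fam Q)"
  unfolding coord_fam_def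
proof (intro conjI allI)
  have hE: "(\<lambda>z. exp (\<i> * Q j z)) holomorphic_on UNIV" for j by (intro holomorphic_intros Q)
  have hd: "(deriv ^^ n) (\<lambda>z. exp (\<i> * Q j z)) holomorphic_on UNIV" for n j
    by (rule holomorphic_higher_deriv[OF hE]) simp
  have c: "continuous_on UNIV (\<lambda>x::real^'a. F (of_real (x $ j)))" if "F holomorphic_on UNIV" for F j
    by (rule continuous_on_compose2[OF holomorphic_on_imp_continuous_on[OF that]]) (auto intro!: continuous_intros)
  show "continuous_on UNIV (phase_fam Q j n)" for j n
    unfolding phase_fam_def by (intro continuous_intros c hd hE Q)
  show "phase_fam Q i 0 = phase_fam Q j 0" for i j by (rule ext) (simp only: phase_fam_0)
  fix j n and x :: "real^'a"
  define c where "c = (\<Prod>l\<in>UNIV - {j}. exp (\<i> * Q l (of_real (x $ l))))"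
  let ?F = "\<lambda>n. (deriv ^^ n) (\<lambda>z. exp (\<i> * Q j z))"
  have eq: "phase_fam Q j n (x + s *\<^sub>R axis j 1) = c * ?F n (of_real (x $ j) + of_real s)" for n s
  proof -
    have "(\<Prod>l\<in>UNIV - {j}. exp (\<i> * Q l (of_real ((x + s *\<^sub>R axis j 1) $ l)))) = c"
      unfolding c_def by (intro prod.cong) (auto simp: axis_def)
    then show ?thesis unfolding phase_fam_def by (simp add: axis_def)
  qed
  have "(?F n has_field_derivative ?F (Suc n) (of_real (x $ j))) (at (of_real (x $ j) + of_real 0))"
    using holomorphic_derivI[OF hd[of n j], of "of_real (x $ j)"] by simp
  then have "(?F n \<circ> (\<lambda>s. of_real (x $ j) + of_real s) has_vector_derivative 1 * ?F (Suc n) (of_real (x $ j))) (at 0)"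
    by (intro field_vector_diff_chain_at) (auto intro!: derivative_eq_intros simp: has_vector_derivative_of_real)
  then have "((\<lambda>s. c * ?F n (of_real (x $ j) + of_real s)) has_vector_derivative c * ?F (Suc n) (of_real (x $ j))) (at 0)"
    by (intro has_vector_derivative_mult_right) (simp add: o_def)
  then show "((\<lambda>s. phase_fam Q j n (x + s *\<^sub>R axis j 1)) has_vector_derivative phase_fam Q j (Suc n) x) (at 0)"
    using eq[of "Suc n" 0] by (simp add: eq)
qed

text \<open>The undifferentiated factors have modulus 1 because the phases are real on the real
  line, so the one-variable bound carries over.\<close>

lemma fam_bound_phase:
  fixes Q :: "'d::finite \<Rightarrow> complex \<Rightarrow> complex"
  assumes mu: "\<mu> > 0" and D: "D \<ge> 0" and R: "R \<ge> 0" and h: "h \<ge> 0"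
    and re: "\<And>l (s::real). Im (Q l (of_real s)) = 0"
    and bd: "\<And>l n (s::real). cmod ((deriv ^^ n) (\<lambda>z. exp (\<i> * Q l z)) (of_real s)) \<le> D * h ^ n * fact n powr \<nu> * exp (c + R * \<bar>s\<bar> powr (1 / \<mu>))"
  shows "fam_bound \<nu> h (\<lambda>x. D * exp (c + R * norm x powr (1 / \<mu>))) (phase_fam Q)"
  unfolding fam_bound_def
proof (intro allI)
  fix j n and x :: "real^'d"
  have "cmod (\<Prod>l\<in>UNIV - {j}. exp (\<i> * Q l (of_real (x $ l)))) = 1"
    by (simp add: prod_norm[symmetric] re)
  then have "cmod (phase_fam Q j n x) \<le> D * h ^ n * fact n powr \<nu> * exp (c + R * \<bar>x $ j\<bar> powr (1 / \<mu>))"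
    unfolding phase_fam_def norm_mult using bd[of n j "x $ j"] by simp
  also have "\<dots> \<le> D * h ^ n * fact n powr \<nu> * exp (c + R * norm x powr (1 / \<mu>))"
    using mu D R h component_le_norm_cart[of x j]
    by (intro mult_left_mono exp_le_cancel_iff[THEN iffD2] add_left_mono powr_mono2 mult_nonneg_nonneg) auto
  finally show "cmod (phase_fam Q j n x) \<le> D * exp (c + R * norm x powr (1 / \<mu>)) * h ^ n * fact n powr \<nu>"
    by (simp add: mult_ac)
qed

section \<open>Growth and second order differences of polynomials\<close>

lemma poly_growth:
  fixes p :: "complex poly"
  assumes "degree p \<le> k"
  shows "\<exists>C\<ge>0. \<forall>z. cmod (poly p z) \<le> C * (1 + cmod z) ^ k"
proof -
  have "cmod (poly p z) \<le> (\<Sum>i\<le>degree p. cmod (coeff p i)) * (1 + cmod z) ^ k" for z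
  proof -
    have "cmod (poly p z) \<le> (\<Sum>i\<le>degree p. cmod (coeff p i) * cmod z ^ i)"
      unfolding poly_altdef by (rule order_trans[OF norm_sum]) (simp add: norm_mult norm_power)
    also have "\<dots> \<le> (\<Sum>i\<le>degree p. cmod (coeff p i) * (1 + cmod z) ^ k)"
    proof (intro sum_mono mult_left_mono)
      fix i assume "i \<in> {..degree p}"
      then have "i \<le> k" using assms by simp
      have "cmod z ^ i \<le> (1 + cmod z) ^ i" by (intro power_mono) auto
      also have "\<dots> \<le> (1 + cmod z) ^ k" using \<open>i \<le> k\<close> by (intro power_increasing) auto
      finally show "cmod z ^ i \<le> (1 + cmod z) ^ k" .
    qed auto
    finally show ?thesis by (simp add: sum_distrib_right)
  qed
  moreover have "(\<Sum>i\<le>degree p. cmod (coeff p i)) \<ge> 0" by (intro sum_nonneg) auto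
  ultimately show ?thesis by blast
qed

text \<open>The mean value inequality, first for the derivative of \<open>p\<close> on a disc and
  then for \<open>p\<close> minus the linear part at \<open>a\<close>. The intermediate base point
  \<open>a + s\<close> lets the estimate serve both for \<open>a = 0\<close> and for a frozen
  frequency \<open>a\<close>.\<close>

lemma poly_second_order:
  fixes p :: "complex poly"
  assumes "degree p \<le> m" "m \<ge> 2"
  shows "\<exists>C\<ge>0. \<forall>a s z. cmod (poly p (a + s + z) - poly p (a + s) - poly (pderiv p) a * z)
     \<le> C * cmod z * (cmod s + cmod z) * (1 + cmod a + cmod s + cmod z) ^ (m - 2)"
proof -
  have "degree (pderiv (pderiv p)) \<le> m - 2" using assms by (simp add: degree_pderiv)
  from poly_growth[OF this] obtain C where C: "C \<ge> 0" "\<And>z. cmod (poly (pderiv (pderiv p)) z) \<le> C * (1 + cmod z) ^ (m - 2)" by blast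
  have "cmod (poly p (a + s + z) - poly p (a + s) - poly (pderiv p) a * z)
     \<le> C * cmod z * (cmod s + cmod z) * (1 + cmod a + cmod s + cmod z) ^ (m - 2)" for a s z
  proof -
    define S where "S = cmod a + cmod s + cmod z"
    define B where "B = C * (1 + S) ^ (m - 2)"
    have S: "S \<ge> 0" by (simp add: S_def)
    have B: "B \<ge> 0" using C S by (simp add: B_def)
    have d1: "cmod (poly (pderiv p) x - poly (pderiv p) y) \<le> B * cmod (x - y)" if "x \<in> cball 0 S" "y \<in> cball 0 S" for x y
    proof (rule field_differentiable_bound[OF convex_cball _ _ that])
      show "(poly (pderiv p) has_field_derivative poly (pderiv (pderiv p)) w) (at w within cball 0 S)" for w
        by (rule DERIV_subset[OF poly_DERIV]) simp
      show "cmod (poly (pderiv (pderiv p)) w) \<le> B" if "w \<in> cball 0 S" for w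
      proof -
        have "cmod (poly (pderiv (pderiv p)) w) \<le> C * (1 + cmod w) ^ (m - 2)" by (rule C)
        also have "\<dots> \<le> C * (1 + S) ^ (m - 2)" using that C by (intro mult_left_mono power_mono) auto
        finally show ?thesis by (simp add: B_def)
      qed
    qed
    define g where "g w = poly p (a + s + w) - poly (pderiv p) a * w" for w
    have "cmod (g z - g 0) \<le> (B * (cmod s + cmod z)) * cmod (z - 0)"
    proof (rule field_differentiable_bound[OF convex_cball[of 0 "cmod z"]])
      show "(g has_field_derivative (poly (pderiv p) (a + s + w) - poly (pderiv p) a)) (at w within cball 0 (cmod z))" for w
        unfolding g_def
        by (auto intro!: derivative_eq_intros DERIV_chain2[OF poly_DERIV, where g="\<lambda>w. a + s + w"] DERIV_subset[where t=UNIV])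
      show "cmod (poly (pderiv p) (a + s + w) - poly (pderiv p) a) \<le> B * (cmod s + cmod z)" if "w \<in> cball 0 (cmod z)" for w
      proof -
        have w: "cmod w \<le> cmod z" using that by simp
        have n: "cmod (a + s + w) \<le> cmod a + cmod s + cmod w" by (metis add_right_mono norm_triangle_ineq norm_triangle_le)
        have "cmod (poly (pderiv p) (a + s + w) - poly (pderiv p) a) \<le> B * cmod (a + s + w - a)"
          by (rule d1) (use n w in \<open>auto simp: S_def\<close>)
        also have "cmod (a + s + w - a) \<le> cmod s + cmod z"
          using norm_triangle_ineq[of s w] w by (simp add: algebra_simps)
        finally show ?thesis using B by (simp add: mult_left_mono)
      qed
    qed auto
    then show ?thesis by (simp add: g_def B_def S_def mult_ac algebra_simps)
  qed
  then show ?thesis using C by blast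
qed

subsection \<open>Time-frequency shifts\<close>

text \<open>Families that arise from different constructions are identified as soon as they
  represent the same function.\<close>

lemma coord_fam_unique:
  assumes H: "coord_fam H" and K: "coord_fam K" and eq: "H j 0 = K j 0"
  shows "H j n = K j n"
proof (induction n)
  case (Suc n)
  show ?case
  proof
    fix x
    show "H j (Suc n) x = K j (Suc n) x"
      using vector_derivative_unique_at[OF coord_famD(2)[OF H, of j n x]] coord_famD(2)[OF K, of j n x] Suc by simp
  qed
qed (rule eq)

definition char_fam :: "real^'d::finite \<Rightarrow> 'd \<Rightarrow> nat \<Rightarrow> real^'d \<Rightarrow> complex" where
  "char_fam x j n \<eta> = (- \<i> * of_real (x $ j)) ^ n * exp (- \<i> * of_real (x \<bullet> \<eta>))"

lemma coord_fam_char: "coord_fam (char_fam x)"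
  unfolding coord_fam_def
proof (intro conjI allI)
  show "continuous_on UNIV (char_fam x j n)" for j n
    unfolding char_fam_def by (intro continuous_intros)
  show "char_fam x i 0 = char_fam x j 0" for i j by (simp add: char_fam_def fun_eq_iff)
  fix j n and \<eta> :: "real^'a"
  let ?c = "(- \<i> * of_real (x $ j)) ^ n * exp (- \<i> * of_real (x \<bullet> \<eta>))"
  have eq: "char_fam x j n (\<eta> + s *\<^sub>R axis j 1) = ?c * exp ((- \<i> * of_real (x $ j)) * of_real s)" for s
    by (simp add: char_fam_def inner_add_right inner_axis algebra_simps flip: exp_add)
  have "((\<lambda>z. exp ((- \<i> * of_real (x $ j)) * z)) has_field_derivative (- \<i> * of_real (x $ j))) (at (of_real 0))"
    by (auto intro!: derivative_eq_intros)
  then have "((\<lambda>z. exp ((- \<i> * of_real (x $ j)) * z)) \<circ> of_real has_vector_derivative 1 * (- \<i> * of_real (x $ j))) (at 0)"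
    by (intro field_vector_diff_chain_at) (auto intro!: derivative_eq_intros simp: has_vector_derivative_of_real)
  then have "((\<lambda>s. ?c * exp ((- \<i> * of_real (x $ j)) * of_real s)) has_vector_derivative ?c * (- \<i> * of_real (x $ j))) (at 0)"
    by (intro has_vector_derivative_mult_right) (simp add: o_def)
  moreover have "?c * (- \<i> * of_real (x $ j)) = char_fam x j (Suc n) \<eta>" by (simp add: char_fam_def mult_ac)
  ultimately show "((\<lambda>s. char_fam x j n (\<eta> + s *\<^sub>R axis j 1)) has_vector_derivative char_fam x j (Suc n) \<eta>) (at 0)"
    by (simp only: eq)
qed

text \<open>The conjugate of the modulated window in \<open>stft\<close>, with \<open>\<psi>\<close>
  the conjugate of the window; hence the minus sign in the character.\<close>

definition tf_shift :: "(real^'d::finite \<Rightarrow> complex) \<Rightarrow> real^'d \<Rightarrow> real^'d \<Rightarrow> real^'d \<Rightarrow> complex" where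
  "tf_shift \<psi> x \<xi> y = exp (- \<i> * of_real (y \<bullet> \<xi>)) * \<psi> (y - x)"

context gs
begin

text \<open>Derivatives of the character are powers of \<open>x\<close>; trading these for
  factorials leaves a factor that is exponential in \<open>norm x powr (1 / \<nu>)\<close>.\<close>

lemma fam_bound_char:
  assumes h: "h > 0"
  shows "fam_bound \<nu> h (\<lambda>\<eta>. exp ((\<nu> / h powr (1 / \<nu>)) * norm x powr (1 / \<nu>))) (char_fam x)"
  unfolding fam_bound_def
proof (intro allI)
  fix j n and \<eta> :: "real^'a"
  define R where "R = \<nu> / h powr (1 / \<nu>)"
  have R: "R > 0" using h nu by (simp add: R_def)
  have Rh: "(\<nu> / R) powr \<nu> = h" using h nu by (simp add: R_def powr_powr)
  have "cmod (char_fam x j n \<eta>) = \<bar>x $ j\<bar> ^ n" by (simp add: char_fam_def norm_mult norm_power)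
  also have "\<dots> \<le> norm x ^ n" by (intro power_mono component_le_norm_cart) auto
  also have "\<dots> \<le> h ^ n * fact n powr \<nu> * exp (R * norm x powr (1 / \<nu>))"
    using power_le_fact_powr_exp[of "norm x" \<nu> R n] nu R Rh by simp
  finally show "cmod (char_fam x j n \<eta>) \<le> exp (\<nu> / h powr (1 / \<nu>) * norm x powr (1 / \<nu>)) * h ^ n * fact n powr \<nu>"
    by (simp add: R_def mult_ac)
qed

text \<open>The inverse transform of the function underlying \<open>H\<close>; for a coordinate
  family it does not depend on the index.\<close>

definition inv_fam :: "('d::finite \<Rightarrow> nat \<Rightarrow> real^'d \<Rightarrow> complex) \<Rightarrow> real^'d \<Rightarrow> complex" where
  "inv_fam H x = ft (H undefined 0) (- x) / (2 * pi) ^ CARD('d)"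

text \<open>The last claim identifies the given derivatives with those of the transform, so bounds
  on \<open>H\<close> become bounds on \<open>ft_fam\<close> of the function recovered from
  it.\<close>

lemma inv_fam:
  fixes H :: "'d::finite \<Rightarrow> nat \<Rightarrow> real^'d \<Rightarrow> complex"
  assumes H: "gs_fam \<nu> \<mu> H"
  shows "inv_fam H \<in> gs_space \<nu> \<mu>" and "ft (inv_fam H) = H j 0" and "ft_fam (inv_fam H) = H"
proof -
  let ?H = "H undefined 0"
  have eq: "inv_fam H = (\<lambda>x. (1 / (2 * pi) ^ CARD('d)) * ft ?H (- x))" by (simp add: inv_fam_def fun_eq_iff)
  show 1: "inv_fam H \<in> gs_space \<nu> \<mu>"
    unfolding eq by (intro gs_space_cmult gs_space_inv_ft[OF ab H])
  have 2: "ft (inv_fam H) = H j 0" for j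
  proof
    fix \<eta>
    have "ft (inv_fam H) \<eta> = (1 / (2 * pi) ^ CARD('d)) * ft (\<lambda>x. ft ?H (- x)) \<eta>"
      unfolding eq by (rule ft_cmult)
    also have "ft (\<lambda>x. ft ?H (- x)) \<eta> = ft (ft ?H) (- \<eta>)"
      by (rule integral_neg_ft) (intro wt_dom_measurable rapid_wt_dom gs_fam_ft_rapid[OF ab H])
    also have "\<dots> = (2 * pi) ^ CARD('d) * ?H \<eta>" using gs_fam_inversion[OF ab H, of undefined "- \<eta>"] by simp
    also have "?H = H j 0" using H coord_famD(3) unfolding gs_fam_def by blast
    finally show "ft (inv_fam H) \<eta> = H j 0 \<eta>" by simp
  qed
  then show "ft (inv_fam H) = H j 0" .
  show "ft_fam (inv_fam H) = H"
  proof (intro ext)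
    fix j n \<eta>
    have "ft_fam (inv_fam H) j n = H j n"
    proof (rule coord_fam_unique)
      show "coord_fam (ft_fam (inv_fam H))" by (intro coord_fam_ft gs_space_rapid[OF nu 1])
      show "coord_fam H" using H by (simp add: gs_fam_def)
      show "ft_fam (inv_fam H) j 0 = H j 0" by (simp add: ft_fam_0 2)
    qed
    then show "ft_fam (inv_fam H) j n \<eta> = H j n \<eta>" by simp
  qed
qed

definition tf_shift_fam :: "(real^'d::finite \<Rightarrow> complex) \<Rightarrow> real^'d \<Rightarrow> real^'d \<Rightarrow> 'd \<Rightarrow> nat \<Rightarrow> real^'d \<Rightarrow> complex" where
  "tf_shift_fam \<psi> x \<xi> = fam_shift \<xi> (fam_mult (char_fam x) (ft_fam \<psi>))"

text \<open>Homogeneous of degree 1 under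
  \<open>(x, \<xi>) \<mapsto> (s^\<nu> x, s^\<mu> \<xi>)\<close>, the scaling in the wave front
  set.\<close>

definition aniso :: "real^'d::finite \<Rightarrow> real^'d \<Rightarrow> real" where
  "aniso x \<xi> = norm x powr (1 / \<nu>) + norm \<xi> powr (1 / \<mu>)"

lemma aniso_nonneg: "aniso x \<xi> \<ge> 0" by (simp add: aniso_def)

text \<open>A shift in space multiplies the transform by a character and a modulation translates it;
  each costs an exponential in its own half of \<open>aniso\<close>.\<close>

lemma tf_shift_fam_bound:
  fixes \<psi> :: "real^'d::finite \<Rightarrow> complex"
  assumes psi: "\<psi> \<in> gs_space \<nu> \<mu>" and h: "h > 0" and r: "r > 0"
  shows "\<exists>C\<ge>0. \<exists>R>0. \<forall>x \<xi>. gs_fam_bound \<nu> \<mu> h r (C * exp (R * aniso x \<xi>)) (tf_shift_fam \<psi> x \<xi>)"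
proof -
  define k where "k = 2 powr (1 / \<mu>)"
  have k: "k > 0" by (simp add: k_def)
  obtain C where C: "gs_fam_bound \<nu> \<mu> (h / 2) (k * r) C (ft_fam \<psi>)"
    using gs_fam_ft_fam[OF ab psi] h r k unfolding gs_fam_def by (meson half_gt_zero mult_pos_pos)
  have C0: "C \<ge> 0" by (rule gs_fam_bound_nonneg[OF C])
  define R1 where "R1 = \<nu> / (h / 2) powr (1 / \<nu>)"
  have R1: "R1 > 0" using nu h by (simp add: R1_def)
  define R where "R = max R1 (k * r)"
  have R: "R > 0" "R1 \<le> R" "k * r \<le> R" using R1 by (auto simp: R_def)
  have "gs_fam_bound \<nu> \<mu> h r (C * exp (R * aniso x \<xi>)) (tf_shift_fam \<psi> x \<xi>)" for x \<xi>
    unfolding tf_shift_fam_def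
  proof (rule fam_bound_mono)
    show "fam_bound \<nu> (2 * (h / 2)) (\<lambda>\<eta>. exp (R1 * norm x powr (1 / \<nu>)) * (C * exp (- (k * r) * norm (\<eta> + \<xi>) powr (1 / \<mu>)))) (fam_shift \<xi> (fam_mult (char_fam x) (ft_fam \<psi>)))"
      unfolding R1_def by (rule fam_bound_shift[OF fam_bound_mult[OF fam_bound_char C]]) (use h nu in auto)
    fix \<eta> :: "real^'d"
    have "exp (- (k * r) * norm (\<eta> + \<xi>) powr (1 / \<mu>)) \<le> exp ((k * r) * norm \<xi> powr (1 / \<mu>)) * exp (- r * norm \<eta> powr (1 / \<mu>))"
      using exp_shift_le[of "1 / \<mu>" "k * r" \<eta> \<xi>] mu k r by (simp add: k_def)
    also have "\<dots> \<le> exp (R * norm \<xi> powr (1 / \<mu>)) * exp (- r * norm \<eta> powr (1 / \<mu>))"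
      using R by (intro mult_right_mono) (auto intro!: mult_right_mono)
    finally have "exp (R1 * norm x powr (1 / \<nu>)) * (C * exp (- (k * r) * norm (\<eta> + \<xi>) powr (1 / \<mu>)))
       \<le> exp (R * norm x powr (1 / \<nu>)) * (C * (exp (R * norm \<xi> powr (1 / \<mu>)) * exp (- r * norm \<eta> powr (1 / \<mu>))))"
      using C0 R by (intro mult_mono mult_left_mono) (auto intro!: mult_right_mono)
    also have "\<dots> = C * exp (R * aniso x \<xi>) * exp (- r * norm \<eta> powr (1 / \<mu>))"
      by (simp add: aniso_def distrib_left exp_add)
    finally show "exp (R1 * norm x powr (1 / \<nu>)) * (C * exp (- (k * r) * norm (\<eta> + \<xi>) powr (1 / \<mu>))) \<le> C * exp (R * aniso x \<xi>) * exp (- r * norm \<eta> powr (1 / \<mu>))" .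
  qed (use h in auto)
  then show ?thesis using C0 R by blast
qed

lemma gs_fam_tf_shift_fam:
  assumes psi: "\<psi> \<in> gs_space \<nu> \<mu>"
  shows "gs_fam \<nu> \<mu> (tf_shift_fam \<psi> x \<xi>)"
  unfolding gs_fam_def
proof (intro conjI allI impI)
  show "coord_fam (tf_shift_fam \<psi> x \<xi>)"
    unfolding tf_shift_fam_def using gs_fam_ft_fam[OF ab psi] by (intro coord_fam_shift coord_fam_mult coord_fam_char) (simp add: gs_fam_def)
qed (use tf_shift_fam_bound[OF psi] in blast)

lemma tf_shift_fam_0: "tf_shift_fam \<psi> x \<xi> j 0 \<eta> = exp (- \<i> * of_real (x \<bullet> (\<eta> + \<xi>))) * ft \<psi> (\<eta> + \<xi>)"
  by (simp add: tf_shift_fam_def fam_shift_def fam_mult_0 char_fam_def ft_fam_0)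

lemma tf_shift_inv_fam:
  fixes \<psi> :: "real^'d::finite \<Rightarrow> complex"
  assumes psi: "\<psi> \<in> gs_space \<nu> \<mu>"
  shows "tf_shift \<psi> x \<xi> = inv_fam (tf_shift_fam \<psi> x \<xi>)"
proof
  fix y
  let ?F = "\<lambda>\<eta>. exp (- \<i> * of_real (x \<bullet> \<eta>)) * ft \<psi> \<eta> * exp (- \<i> * complex_of_real ((\<eta> - \<xi>) \<bullet> (- y)))"
  have m: "?F \<in> borel_measurable borel"
    by (intro borel_measurable_continuous_onI continuous_intros ft_continuous gs_wt_dom psi)
  have "ft (tf_shift_fam \<psi> x \<xi> undefined 0) (- y) = (LINT \<eta>|lborel. ?F (\<eta> + \<xi>))"
    unfolding ft_def tf_shift_fam_0[abs_def] by (simp add: ft_def)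
  also have "\<dots> = (LINT \<eta>|lborel. ?F \<eta>)" by (rule integral_lborel_shift[OF m])
  also have "\<dots> = (LINT \<eta>|lborel. exp (- \<i> * of_real (y \<bullet> \<xi>)) * (ft \<psi> \<eta> * exp (- \<i> * complex_of_real (\<eta> \<bullet> (x - y)))))"
  proof (rule Bochner_Integration.integral_cong[OF refl])
    fix \<eta>
    have "exp (- \<i> * of_real (x \<bullet> \<eta>)) * exp (- \<i> * complex_of_real ((\<eta> - \<xi>) \<bullet> (- y))) = exp (- \<i> * of_real (y \<bullet> \<xi>)) * exp (- \<i> * complex_of_real (\<eta> \<bullet> (x - y)))"
      by (simp add: inner_diff_left inner_diff_right inner_commute algebra_simps flip: exp_add)
    note e = this
    have "?F \<eta> = (exp (- \<i> * of_real (x \<bullet> \<eta>)) * exp (- \<i> * complex_of_real ((\<eta> - \<xi>) \<bullet> (- y)))) * ft \<psi> \<eta>"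
      by (simp only: mult_ac)
    then show "?F \<eta> = exp (- \<i> * of_real (y \<bullet> \<xi>)) * (ft \<psi> \<eta> * exp (- \<i> * complex_of_real (\<eta> \<bullet> (x - y))))"
      unfolding e by (simp only: mult_ac)
  qed
  also have "\<dots> = exp (- \<i> * of_real (y \<bullet> \<xi>)) * ft (ft \<psi>) (x - y)" by (simp add: ft_def)
  also have "ft (ft \<psi>) (x - y) = (2 * pi) ^ CARD('d) * \<psi> (y - x)" using gs_space_inversion[OF ab psi, of "x - y"] by simp
  finally show "tf_shift \<psi> x \<xi> y = inv_fam (tf_shift_fam \<psi> x \<xi>) y" by (simp add: inv_fam_def tf_shift_def)
qed

lemma tf_shift_gs_space: "\<psi> \<in> gs_space \<nu> \<mu> \<Longrightarrow> tf_shift \<psi> x \<xi> \<in> gs_space \<nu> \<mu>"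
  unfolding tf_shift_inv_fam by (intro inv_fam(1) gs_fam_tf_shift_fam)

lemma ft_tf_shift: "\<psi> \<in> gs_space \<nu> \<mu> \<Longrightarrow> ft (tf_shift \<psi> x \<xi>) \<eta> = exp (- \<i> * of_real (x \<bullet> (\<eta> + \<xi>))) * ft \<psi> (\<eta> + \<xi>)"
  unfolding tf_shift_inv_fam inv_fam(2)[OF gs_fam_tf_shift_fam, of \<psi> x \<xi> undefined] by (rule tf_shift_fam_0)

lemma tf_shift_seminorm:
  fixes \<psi> :: "real^'d::finite \<Rightarrow> complex"
  assumes psi: "\<psi> \<in> gs_space \<nu> \<mu>" and h: "h > 0"
  shows "\<exists>C\<ge>0. \<exists>R>0. \<forall>x \<xi>. gs_seminorm \<nu> \<mu> h (tf_shift \<psi> x \<xi>) \<le> C * exp (R * aniso x \<xi>)"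
proof -
  obtain h' r' A where *: "h' > 0" "r' > 0" "A > 0" and b: "\<And>(f :: real^'d \<Rightarrow> complex) C z. f \<in> gs_space \<nu> \<mu> \<Longrightarrow> gs_fam_bound \<nu> \<mu> h' r' C (ft_fam f) \<Longrightarrow> gs_quot \<nu> \<mu> h f z \<le> A * C"
    using gs_quot_gs_fam_bound[where 'd='d, OF h] by blast
  obtain C R where C: "C \<ge> 0" "R > 0" "\<And>x \<xi>. gs_fam_bound \<nu> \<mu> h' r' (C * exp (R * aniso x \<xi>)) (tf_shift_fam \<psi> x \<xi>)"
    using tf_shift_fam_bound[OF psi *(1,2)] by blast
  have "gs_seminorm \<nu> \<mu> h (tf_shift \<psi> x \<xi>) \<le> (A * C) * exp (R * aniso x \<xi>)" for x \<xi>
  proof (rule gs_seminorm_least)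
    fix z
    have "gs_quot \<nu> \<mu> h (tf_shift \<psi> x \<xi>) z \<le> A * (C * exp (R * aniso x \<xi>))"
      by (rule b[OF tf_shift_gs_space[OF psi]]) (simp only: tf_shift_inv_fam[OF psi] inv_fam(3)[OF gs_fam_tf_shift_fam[OF psi]] C(3))
    then show "gs_quot \<nu> \<mu> h (tf_shift \<psi> x \<xi>) z \<le> (A * C) * exp (R * aniso x \<xi>)" by (simp add: mult.assoc)
  qed
  then show ?thesis using C * by (intro exI[of _ "A * C"] conjI exI[of _ R]) auto
qed

subsection \<open>Functionals and integrals\<close>

text \<open>The bound is an absolute moment of \<open>f\<close>, which tends to 0 by dominated
  convergence along a bounded sequence that tends to 0 pointwise.\<close>

lemma ft_fam_le:
  assumes "f \<in> gs_space \<nu> \<mu>"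
  shows "cmod (ft_fam f j n \<eta>) \<le> (LINT x|lborel. norm x ^ n * cmod (f x))"
proof -
  have r: "rapid (\<lambda>x. (- \<i> * of_real (x $ j)) ^ n * f x)" by (rule rapid_pow[OF gs_space_rapid[OF nu assms]])
  obtain h C where hC: "h > 0" "C \<ge> 0" "\<And>x. norm x ^ n * cmod (f x) \<le> C * gs_seminorm \<nu> \<mu> h f * wt x"
    using gs_power_wt[where 'd='a, of n] assms by blast
  have i: "integrable lborel (\<lambda>x. norm x ^ n * cmod (f x))"
  proof (rule Bochner_Integration.integrable_bound[where f="\<lambda>x. C * gs_seminorm \<nu> \<mu> h f * wt x"])
    show "integrable lborel (\<lambda>x::real^'a. C * gs_seminorm \<nu> \<mu> h f * wt x)" by (intro integrable_mult_right integrable_wt)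
    have "continuous_on UNIV (\<lambda>x. norm x ^ n * cmod (f x))" by (intro continuous_intros wt_dom_continuous[OF gs_wt_dom[OF assms]])
    then show "(\<lambda>x. norm x ^ n * cmod (f x)) \<in> borel_measurable lborel" by (simp add: borel_measurable_continuous_onI)
    show "AE x in lborel. norm (norm x ^ n * cmod (f x)) \<le> norm (C * gs_seminorm \<nu> \<mu> h f * wt x)"
    proof (intro AE_I2)
      fix x
      have "norm (norm x ^ n * cmod (f x)) = norm x ^ n * cmod (f x)" by simp
      also have "\<dots> \<le> norm (C * gs_seminorm \<nu> \<mu> h f * wt x)" using hC(3)[of x] by (simp only: real_norm_def)
      finally show "norm (norm x ^ n * cmod (f x)) \<le> norm (C * gs_seminorm \<nu> \<mu> h f * wt x)" .
    qed
  qed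
  show ?thesis
    unfolding ft_fam_def ft_def
  proof (rule Bochner_Integration.integral_norm_bound_integral[OF integrable_char[OF rapid_wt_dom[OF r]] i])
    fix x
    show "norm ((- \<i> * complex_of_real (x $ j)) ^ n * f x * exp (- \<i> * complex_of_real (x \<bullet> \<eta>))) \<le> norm x ^ n * cmod (f x)"
      by (auto simp: norm_mult norm_power intro!: mult_right_mono power_mono component_le_norm_cart)
  qed
qed

text \<open>A Montel type property: on bounded sets, pointwise convergence implies convergence in the
  Gelfand--Shilov topology.\<close>

lemma gs_dual_pointwise_limit:
  fixes F :: "nat \<Rightarrow> real^'d::finite \<Rightarrow> complex"
  assumes u: "u \<in> gs_dual \<nu> \<mu>" and F: "\<And>i. F i \<in> gs_space \<nu> \<mu>" and f: "f \<in> gs_space \<nu> \<mu>"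
    and bd: "\<And>h. h > 0 \<Longrightarrow> \<exists>C. \<forall>i. gs_seminorm \<nu> \<mu> h (F i) \<le> C" and lim: "\<And>x. (\<lambda>i. F i x) \<longlonglongrightarrow> f x"
  shows "(\<lambda>i. u (F i)) \<longlonglongrightarrow> u f"
proof -
  define g where "g i = (\<lambda>x. F i x - f x)" for i
  have gi: "g i \<in> gs_space \<nu> \<mu>" for i unfolding g_def by (rule gs_space_diff[OF F f])
  have ug: "u (g i) = u (F i) - u f" for i using gs_dual_lin[OF u F[of i] f, of 1 "-1"] by (simp add: g_def)
  have bdg: "\<exists>C\<ge>0. \<forall>i. gs_seminorm \<nu> \<mu> h (g i) \<le> C" if h: "h > 0" for h
  proof -
    obtain C where C: "\<And>i. gs_seminorm \<nu> \<mu> h (F i) \<le> C" using bd[OF h] by blast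
    have "gs_seminorm \<nu> \<mu> h (g i) \<le> \<bar>C\<bar> + gs_seminorm \<nu> \<mu> h f" for i
      using gs_seminorm_lin[OF F[of i] f h, of 1 "-1"] C[of i] by (simp add: g_def)
    then show ?thesis using gs_seminorm_nonneg[OF f h] by (intro exI[of _ "\<bar>C\<bar> + gs_seminorm \<nu> \<mu> h f"]) auto
  qed
  obtain h0 C0 where h0: "h0 > 0" "C0 \<ge> 0" "\<And>f. f \<in> gs_space \<nu> \<mu> \<Longrightarrow> cmod (u f) \<le> C0 * gs_seminorm \<nu> \<mu> h0 f"
    using gs_dual_bound[OF u] by blast
  obtain h r A where *: "h > 0" "r > 0" "A > 0" and qb: "\<And>(f :: real^'d \<Rightarrow> complex) C z. f \<in> gs_space \<nu> \<mu> \<Longrightarrow> gs_fam_bound \<nu> \<mu> h r C (ft_fam f) \<Longrightarrow> gs_quot \<nu> \<mu> h0 f z \<le> A * C"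
    using gs_quot_gs_fam_bound[where 'd='d, OF h0(1)] by blast
  \<comment> \<open>A bound with half the scale and one more unit of decay leaves the spare factor
    \<open>(1 / 2) ^ n * exp (- norm \<eta> powr (1 / \<mu>))\<close>, small for large
    \<open>n\<close> or large \<open>\<eta>\<close>.\<close>
  have r1: "r + 1 > 0" "h / 2 > 0" using * by auto
  obtain h3 A3 where 3: "h3 > 0" "A3 > 0" and b3: "\<And>f :: real^'d \<Rightarrow> complex. f \<in> gs_space \<nu> \<mu> \<Longrightarrow> gs_fam_bound \<nu> \<mu> (h / 2) (r + 1) (A3 * gs_seminorm \<nu> \<mu> h3 f) (ft_fam f)"
    using gs_fam_bound_ft_fam[where 'd='d, OF ab r1(2,1)] by blast
  obtain C3 where C3: "C3 \<ge> 0" "\<And>i. gs_seminorm \<nu> \<mu> h3 (g i) \<le> C3" using bdg[OF 3(1)] by blast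
  define K where "K = A3 * C3"
  have K: "K \<ge> 0" using 3 C3 by (simp add: K_def)
  have Kb: "gs_fam_bound \<nu> \<mu> (h / 2) (r + 1) K (ft_fam (g i))" for i
    by (rule gs_fam_bound_mono[OF b3[OF gi]]) (use r1 3 C3 in \<open>auto simp: K_def\<close>)
  have int0: "(\<lambda>i. LINT x|lborel. norm x ^ n * cmod (g i x)) \<longlonglongrightarrow> 0" for n
  proof -
    obtain h4 C4 where h4: "h4 > 0" "C4 \<ge> 0" "\<And>f (x::real^'d). f \<in> gs_space \<nu> \<mu> \<Longrightarrow> norm x ^ n * cmod (f x) \<le> C4 * gs_seminorm \<nu> \<mu> h4 f * wt x"
      using gs_power_wt[where 'd='d, of n] by blast
    obtain C5 where C5: "C5 \<ge> 0" "\<And>i. gs_seminorm \<nu> \<mu> h4 (g i) \<le> C5" using bdg[OF h4(1)] by blast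
    have "(\<lambda>i. LINT x|lborel. norm x ^ n * cmod (g i x)) \<longlonglongrightarrow> (LINT x|(lborel :: (real^'d) measure). (0::real))"
    proof (rule integral_dominated_convergence[where w="\<lambda>x::real^'d. C4 * C5 * wt x"])
      show "integrable lborel (\<lambda>x::real^'d. C4 * C5 * wt x)" by (intro integrable_mult_right integrable_wt)
      show "(\<lambda>x. norm x ^ n * cmod (g i x)) \<in> borel_measurable lborel" for i
      proof -
        have "continuous_on UNIV (\<lambda>x. norm x ^ n * cmod (g i x))" by (intro continuous_intros wt_dom_continuous[OF gs_wt_dom[OF gi]])
        then show ?thesis by (simp add: borel_measurable_continuous_onI)
      qed
      show "AE x in lborel. (\<lambda>i. norm x ^ n * cmod (g i x)) \<longlonglongrightarrow> 0"
      proof (intro AE_I2)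
        fix x :: "real^'d"
        have "(\<lambda>i. norm x ^ n * cmod (g i x)) \<longlonglongrightarrow> norm x ^ n * cmod (f x - f x)"
          unfolding g_def by (intro tendsto_intros lim)
        then show "(\<lambda>i. norm x ^ n * cmod (g i x)) \<longlonglongrightarrow> 0" by simp
      qed
      show "AE x in lborel. norm (norm x ^ n * cmod (g i x)) \<le> C4 * C5 * wt x" for i
      proof (intro AE_I2)
        fix x :: "real^'d"
        have "norm x ^ n * cmod (g i x) \<le> C4 * gs_seminorm \<nu> \<mu> h4 (g i) * wt x" by (rule h4(3)[OF gi])
        also have "\<dots> \<le> C4 * C5 * wt x" using h4(2) C5(2) by (intro mult_right_mono mult_left_mono) auto
        finally show "norm (norm x ^ n * cmod (g i x)) \<le> C4 * C5 * wt x" by simp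
      qed
    qed simp
    then show ?thesis by simp
  qed
  have "\<forall>\<^sub>F i in sequentially. gs_fam_bound \<nu> \<mu> h r e (ft_fam (g i))" if e: "e > 0" for e
  proof -
    obtain n0 where n0: "K * (1 / 2) ^ n0 \<le> e"
    proof -
      have "(\<lambda>n. K * (1 / 2) ^ n) \<longlonglongrightarrow> K * 0" by (intro tendsto_intros) auto
      then have "\<forall>\<^sub>F n in sequentially. K * (1 / 2) ^ n < e" using e by (intro order_tendstoD(2)) auto
      then obtain N where "\<forall>n\<ge>N. K * (1 / 2) ^ n < e" unfolding eventually_sequentially by blast
      then show ?thesis by (intro that[of N]) (simp add: less_imp_le)
    qed
    \<comment> \<open>Beyond \<open>T\<close> the spare exponential brings \<open>K\<close> below
      \<open>e\<close>.\<close>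
    define T where "T = max 0 (ln (K / e))"
    have T: "K * exp (- T) \<le> e"
    proof (cases "K = 0")
      case False
      then have "K / e \<le> exp T" using K e by (subst ln_le_cancel_iff[symmetric]) (auto simp: T_def)
      then show ?thesis using e by (simp add: exp_minus field_simps)
    qed (use e in simp)
    have "\<forall>\<^sub>F i in sequentially. \<forall>n\<in>{..<n0}. (LINT x|lborel. norm x ^ n * cmod (g i x)) < e * h ^ n * fact n powr \<nu> * exp (- r * T)"
    proof (rule eventually_ball_finite)
      show "finite {..<n0}" by simp
      show "\<forall>n\<in>{..<n0}. \<forall>\<^sub>F i in sequentially. (LINT x|lborel. norm x ^ n * cmod (g i x)) < e * h ^ n * fact n powr \<nu> * exp (- r * T)"
      proof
        fix n
        have "0 < e * h ^ n * fact n powr \<nu> * exp (- r * T)" using e *(1) by simp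
        from order_tendstoD(2)[OF int0[of n] this]
        show "\<forall>\<^sub>F i in sequentially. (LINT x|lborel. norm x ^ n * cmod (g i x)) < e * h ^ n * fact n powr \<nu> * exp (- r * T)" .
      qed
    qed
    then show ?thesis
    proof (rule eventually_mono)
      fix i assume small: "\<forall>n\<in>{..<n0}. (LINT x|lborel. norm x ^ n * cmod (g i x)) < e * h ^ n * fact n powr \<nu> * exp (- r * T)"
      show "gs_fam_bound \<nu> \<mu> h r e (ft_fam (g i))"
        unfolding fam_bound_def
      proof (intro allI)
        fix j n and \<eta> :: "real^'d"
        define t where "t = norm \<eta> powr (1 / \<mu>)"
        have t: "t \<ge> 0" by (simp add: t_def)
        have big: "cmod (ft_fam (g i) j n \<eta>) \<le> (K * (1 / 2) ^ n * exp (- t)) * (exp (- r * t) * h ^ n * fact n powr \<nu>)"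
        proof -
          have "cmod (ft_fam (g i) j n \<eta>) \<le> K * exp (- (r + 1) * t) * (h / 2) ^ n * fact n powr \<nu>"
            using Kb[of i] unfolding fam_bound_def t_def by blast
          also have "exp (- (r + 1) * t) = exp (- r * t) * exp (- t)" by (simp add: algebra_simps flip: exp_add)
          also have "(h / 2) ^ n = h ^ n * (1 / 2) ^ n" by (simp add: power_divide)
          finally show ?thesis by (simp add: mult_ac)
        qed
        \<comment> \<open>For finitely many orders and bounded frequencies the moments are small by
          assumption; for all others the spare factor is.\<close>
        show "cmod (ft_fam (g i) j n \<eta>) \<le> e * exp (- r * norm \<eta> powr (1 / \<mu>)) * h ^ n * fact n powr \<nu>"
        proof (cases "n < n0 \<and> t \<le> T")
          case True
          have "cmod (ft_fam (g i) j n \<eta>) \<le> (LINT x|lborel. norm x ^ n * cmod (g i x))" by (rule ft_fam_le[OF gi])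
          also have "\<dots> \<le> e * h ^ n * fact n powr \<nu> * exp (- r * T)" using small True by (simp add: less_imp_le)
          also have "\<dots> \<le> e * h ^ n * fact n powr \<nu> * exp (- r * t)"
            using True e * by (intro mult_left_mono) auto
          finally show ?thesis by (simp add: t_def mult_ac)
        next
          case False
          have "K * (1 / 2) ^ n * exp (- t) \<le> e"
          proof (cases "n < n0")
            case True
            with False have "T \<le> t" by simp
            have "K * (1 / 2) ^ n * exp (- t) \<le> K * 1 * exp (- T)"
              using K \<open>T \<le> t\<close> by (intro mult_mono) (auto simp: power_le_one)
            then show ?thesis using T by simp
          next
            case False
            have "K * (1 / 2) ^ n * exp (- t) \<le> K * (1 / 2) ^ n0 * 1"
              using K t False by (intro mult_mono mult_left_mono power_decreasing) auto
            then show ?thesis using n0 by simp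
          qed
          then have "(K * (1 / 2) ^ n * exp (- t)) * (exp (- r * t) * h ^ n * fact n powr \<nu>) \<le> e * (exp (- r * t) * h ^ n * fact n powr \<nu>)"
            using * by (intro mult_right_mono) auto
          with big show ?thesis by (simp add: t_def mult_ac)
        qed
      qed
    qed
  qed
  note ev = this
  have "(\<lambda>i. u (g i)) \<longlonglongrightarrow> 0"
  proof (rule tendstoI)
    fix e :: real assume e: "e > 0"
    define b where "b = C0 * A + 1"
    define e' where "e' = e / (2 * b)"
    have c: "b > 0" using h0 * by (simp add: b_def add_nonneg_pos)
    have e': "e' > 0" using e c by (simp add: e'_def)
    from ev[OF e'] show "\<forall>\<^sub>F i in sequentially. dist (u (g i)) 0 < e"
    proof (rule eventually_mono)
      fix i assume gb: "gs_fam_bound \<nu> \<mu> h r e' (ft_fam (g i))"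
      have "cmod (u (g i)) \<le> C0 * gs_seminorm \<nu> \<mu> h0 (g i)" by (rule h0(3)[OF gi])
      also have "\<dots> \<le> C0 * (A * e')" using h0(2) by (intro mult_left_mono gs_seminorm_least qb[OF gi gb])
      also have "\<dots> \<le> b * e'" using e' by (simp add: b_def algebra_simps)
      also have "\<dots> = e / 2" using c by (simp add: e'_def)
      also have "\<dots> < e" using e by simp
      finally show "dist (u (g i)) 0 < e" by simp
    qed
  qed
  then have "(\<lambda>i. u (g i) + u f) \<longlonglongrightarrow> 0 + u f" by (intro tendsto_intros)
  then show ?thesis by (simp add: ug)
qed

lemma continuous_on_aniso: "continuous_on UNIV (\<lambda>z. aniso (fst z) (snd z))"
  unfolding aniso_def using nu mu by (intro continuous_intros continuous_on_powr') auto

lemma integrable_exp_aniso: "r > 0 \<Longrightarrow> integrable lborel (\<lambda>z. complex_of_real (exp (- r * aniso (fst z) (snd (z :: (real^'d::finite) \<times> (real^'d))))))"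
proof -
  assume r: "r > 0"
  obtain W1 where W1: "W1 > 0" "\<And>x::real^'d. exp (- r * norm x powr (1 / \<nu>)) \<le> W1 * wt x" using exp_le_wt[OF r nu] by auto
  obtain W2 where W2: "W2 > 0" "\<And>x::real^'d. exp (- r * norm x powr (1 / \<mu>)) \<le> W2 * wt x" using exp_le_wt[OF r mu] by auto
  have "integrable lborel (case_prod (\<lambda>(x::real^'d) (\<xi>::real^'d). complex_of_real (exp (- r * aniso x \<xi>))))"
  proof (rule integrable_pair_bound)
    show "(case_prod (\<lambda>(x::real^'d) (\<xi>::real^'d). complex_of_real (exp (- r * aniso x \<xi>)))) \<in> borel_measurable borel"
      by (intro borel_measurable_pair_continuous continuous_intros continuous_on_aniso)
    show "integrable lborel (\<lambda>x::real^'d. W1 * wt x)" "integrable lborel (\<lambda>x::real^'d. W2 * wt x)"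
      by (intro integrable_mult_right integrable_wt)+
    show "cmod (complex_of_real (exp (- r * aniso x \<xi>))) \<le> W1 * wt x * (W2 * wt \<xi>)" for x \<xi> :: "real^'d"
    proof -
      have "exp (- r * aniso x \<xi>) = exp (- r * norm x powr (1 / \<nu>)) * exp (- r * norm \<xi> powr (1 / \<mu>))"
        by (simp add: aniso_def algebra_simps flip: exp_add)
      also have "\<dots> \<le> W1 * wt x * (W2 * wt \<xi>)" using W1(1) by (intro mult_mono W1(2) W2(2)) auto
      finally show ?thesis by simp
    qed
  qed
  then show ?thesis by (simp add: case_prod_unfold)
qed

end

lemma gs_seminorm_sum:
  assumes "finite S" "\<And>i. i \<in> S \<Longrightarrow> f i \<in> gs_space \<nu> \<mu>" "h > 0"
  shows "(\<lambda>x. \<Sum>i\<in>S. c i * f i x) \<in> gs_space \<nu> \<mu> \<and>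
    gs_seminorm \<nu> \<mu> h (\<lambda>x. \<Sum>i\<in>S. c i * f i x) \<le> (\<Sum>i\<in>S. cmod (c i) * gs_seminorm \<nu> \<mu> h (f i))"
  using assms(1,2)
proof (induction S)
  case empty
  show ?case by (simp add: gs_space_zero gs_seminorm_zero)
next
  case (insert k S)
  then have k: "f k \<in> gs_space \<nu> \<mu>" and S: "(\<lambda>x. \<Sum>i\<in>S. c i * f i x) \<in> gs_space \<nu> \<mu>" by auto
  have eq: "(\<lambda>x. \<Sum>i\<in>insert k S. c i * f i x) = (\<lambda>x. c k * f k x + 1 * (\<Sum>i\<in>S. c i * f i x))"
    using insert.hyps by (simp add: fun_eq_iff)
  have "gs_seminorm \<nu> \<mu> h (\<lambda>x. c k * f k x + 1 * (\<Sum>i\<in>S. c i * f i x))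
      \<le> cmod (c k) * gs_seminorm \<nu> \<mu> h (f k) + cmod 1 * gs_seminorm \<nu> \<mu> h (\<lambda>x. \<Sum>i\<in>S. c i * f i x)"
    by (rule gs_seminorm_lin[OF k S assms(3)])
  also have "\<dots> \<le> cmod (c k) * gs_seminorm \<nu> \<mu> h (f k) + (\<Sum>i\<in>S. cmod (c i) * gs_seminorm \<nu> \<mu> h (f i))"
    using insert by simp
  finally show ?case unfolding eq using gs_space_lin[OF k S, of "c k" 1] insert.hyps by simp
qed

text \<open>When the argument takes finitely many values, the integral is a finite sum for an
  arbitrary \<open>F\<close>; it is used for values of functions, values of functionals and bounds
  on seminorms alike.\<close>

lemma integral_simple_argument:
  fixes W :: "'a::euclidean_space \<Rightarrow> 'b::{real_normed_field,banach,second_countable_topology}"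
  assumes W: "integrable lborel W" and S: "finite S" and \<sigma>: "\<And>z. \<sigma> z \<in> S" and m: "\<And>w. {z. \<sigma> z = w} \<in> sets borel"
  shows "(\<Sum>w\<in>S. (LINT z|lborel. indicator {z. \<sigma> z = w} z *\<^sub>R W z) * F w) = (LINT z|lborel. W z * F (\<sigma> z))"
proof -
  have i: "integrable lborel (\<lambda>z. indicator {z. \<sigma> z = w} z *\<^sub>R W z)" for w
    by (rule integrable_mult_indicator[OF _ W]) (simp add: m)
  have "W z * F (\<sigma> z) = (\<Sum>w\<in>S. (indicator {z. \<sigma> z = w} z *\<^sub>R W z) * F w)" for z
  proof -
    have "(\<Sum>w\<in>S. (indicator {z. \<sigma> z = w} z *\<^sub>R W z) * F w) = (\<Sum>w\<in>S. if w = \<sigma> z then W z * F w else 0)"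
      by (intro sum.cong) (auto simp: indicator_def)
    then show ?thesis using S \<sigma>[of z] by simp
  qed
  then have "(LINT z|lborel. W z * F (\<sigma> z)) = (LINT z|lborel. (\<Sum>w\<in>S. (indicator {z. \<sigma> z = w} z *\<^sub>R W z) * F w))"
    by (rule Bochner_Integration.integral_cong[OF refl])
  also have "\<dots> = (\<Sum>w\<in>S. (LINT z|lborel. (indicator {z. \<sigma> z = w} z *\<^sub>R W z) * F w))"
    by (rule Bochner_Integration.integral_sum) (intro integrable_mult_left i)
  also have "\<dots> = (\<Sum>w\<in>S. (LINT z|lborel. indicator {z. \<sigma> z = w} z *\<^sub>R W z) * F w)"
    by (intro sum.cong refl integral_mult_left_zero)
  finally show ?thesis ..
qed

context gs
begin

lemma continuous_on_tf_shift:
  assumes "continuous_on UNIV \<psi>"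
  shows "continuous_on UNIV (\<lambda>z. tf_shift \<psi> (fst z) (snd z) y)"
  unfolding tf_shift_def
  by (intro continuous_intros continuous_on_compose2[OF assms, where f="\<lambda>z. y - fst z"]) auto

text \<open>Along a convergent sequence of parameters the shifts converge pointwise and their
  seminorms stay bounded, so the Montel property applies.\<close>

lemma continuous_on_dual_tf_shift:
  assumes u: "u \<in> gs_dual \<nu> \<mu>" and psi: "\<psi> \<in> gs_space \<nu> \<mu>"
  shows "continuous_on UNIV (\<lambda>z. u (tf_shift \<psi> (fst z) (snd z)))"
proof -
  have "(\<lambda>i. u (tf_shift \<psi> (fst (w i)) (snd (w i)))) \<longlonglongrightarrow> u (tf_shift \<psi> (fst z) (snd z))" if w: "w \<longlonglongrightarrow> z" for w z
  proof (rule gs_dual_pointwise_limit[OF u])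
    show "tf_shift \<psi> (fst (w i)) (snd (w i)) \<in> gs_space \<nu> \<mu>" for i by (rule tf_shift_gs_space[OF psi])
    show "tf_shift \<psi> (fst z) (snd z) \<in> gs_space \<nu> \<mu>" by (rule tf_shift_gs_space[OF psi])
    show "(\<lambda>i. tf_shift \<psi> (fst (w i)) (snd (w i)) y) \<longlonglongrightarrow> tf_shift \<psi> (fst z) (snd z) y" for y
    proof -
      have "isCont (\<lambda>z. tf_shift \<psi> (fst z) (snd z) y) z"
        using continuous_on_tf_shift[OF wt_dom_continuous[OF gs_wt_dom[OF psi]], of y]
        unfolding continuous_on_eq_continuous_at[OF open_UNIV] by blast
      from isCont_tendsto_compose[OF this w] show ?thesis .
    qed
    fix h :: real assume "h > 0"
    from tf_shift_seminorm[OF psi this] obtain C R where C: "C \<ge> 0" "R > 0" "\<And>x \<xi>. gs_seminorm \<nu> \<mu> h (tf_shift \<psi> x \<xi>) \<le> C * exp (R * aniso x \<xi>)" by blast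
    have "isCont (\<lambda>z. aniso (fst z) (snd z)) z" using continuous_on_aniso unfolding continuous_on_eq_continuous_at[OF open_UNIV] by blast
    from isCont_tendsto_compose[OF this w] have "Bseq (\<lambda>i. aniso (fst (w i)) (snd (w i)))" by (rule convergent_imp_Bseq[OF convergentI])
    then obtain K where K: "\<forall>i. norm (aniso (fst (w i)) (snd (w i))) \<le> K" by (rule BseqE)
    have "gs_seminorm \<nu> \<mu> h (tf_shift \<psi> (fst (w i)) (snd (w i))) \<le> C * exp (R * K)" for i
    proof -
      have "aniso (fst (w i)) (snd (w i)) \<le> K" using K[rule_format, of i] by simp
      then have "C * exp (R * aniso (fst (w i)) (snd (w i))) \<le> C * exp (R * K)" using C by (intro mult_left_mono) auto
      then show ?thesis using C(3) order_trans by blast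
    qed
    then show "\<exists>C. \<forall>i. gs_seminorm \<nu> \<mu> h (tf_shift \<psi> (fst (w i)) (snd (w i))) \<le> C" by blast
  qed
  then show ?thesis by (simp add: continuous_on_sequentially o_def)
qed

lemma dual_tf_shift_bound:
  assumes u: "u \<in> gs_dual \<nu> \<mu>" and psi: "\<psi> \<in> gs_space \<nu> \<mu>"
  shows "\<exists>C\<ge>0. \<exists>R>0. \<forall>x \<xi>. cmod (u (tf_shift \<psi> x \<xi>)) \<le> C * exp (R * aniso x \<xi>)"
proof -
  obtain h0 C0 where h0: "h0 > 0" "C0 \<ge> 0" "\<And>f. f \<in> gs_space \<nu> \<mu> \<Longrightarrow> cmod (u f) \<le> C0 * gs_seminorm \<nu> \<mu> h0 f"
    using gs_dual_bound[OF u] by blast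
  from tf_shift_seminorm[OF psi h0(1)] obtain C R where C: "C \<ge> 0" "R > 0" "\<And>x \<xi>. gs_seminorm \<nu> \<mu> h0 (tf_shift \<psi> x \<xi>) \<le> C * exp (R * aniso x \<xi>)" by blast
  have "cmod (u (tf_shift \<psi> x \<xi>)) \<le> (C0 * C) * exp (R * aniso x \<xi>)" for x \<xi>
    using order_trans[OF h0(3)[OF tf_shift_gs_space[OF psi]] mult_left_mono[OF C(3) h0(2)]] by (simp add: mult.assoc)
  then show ?thesis using C h0 by (intro exI[of _ "C0 * C"] conjI exI[of _ R]) auto
qed

lemma integrable_aniso_weight:
  fixes W :: "(real^'d::finite) \<times> (real^'d) \<Rightarrow> complex"
  assumes Wc: "continuous_on UNIV W" and Wb: "\<And>r. r > 0 \<Longrightarrow> \<exists>C. \<forall>z. cmod (W z) \<le> C * exp (- r * aniso (fst z) (snd z))"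
    and R: "R \<ge> 0"
  shows "integrable lborel (\<lambda>z. cmod (W z) * exp (R * aniso (fst z) (snd z)))"
proof -
  obtain C where C: "\<And>z. cmod (W z) \<le> C * exp (- (R + 1) * aniso (fst z) (snd z))" 
  proof -
    have "R + 1 > 0" using R by simp
    from Wb[OF this] show ?thesis using that by blast
  qed
  have "integrable lborel (\<lambda>z::(real^'d) \<times> (real^'d). C * exp (- 1 * aniso (fst z) (snd z)))"
    using integrable_exp_aniso[where 'd='d, of 1] by (simp add: complex_of_real_integrable_eq)
  then show ?thesis
  proof (rule Bochner_Integration.integrable_bound)
    have "continuous_on UNIV (\<lambda>z. cmod (W z) * exp (R * aniso (fst z) (snd z)))" by (intro continuous_intros Wc continuous_on_aniso)
    then show "(\<lambda>z. cmod (W z) * exp (R * aniso (fst z) (snd z))) \<in> borel_measurable lborel" by (simp add: borel_measurable_continuous_onI)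
    show "AE z in lborel. norm (cmod (W z) * exp (R * aniso (fst z) (snd z))) \<le> norm (C * exp (- 1 * aniso (fst z) (snd z)))"
    proof (intro AE_I2)
      fix z :: "(real^'d) \<times> (real^'d)"
      have "cmod (W z) * exp (R * aniso (fst z) (snd z)) \<le> (C * exp (- (R + 1) * aniso (fst z) (snd z))) * exp (R * aniso (fst z) (snd z))"
        by (intro mult_right_mono C) auto
      also have "\<dots> = C * (exp (- (R + 1) * aniso (fst z) (snd z)) * exp (R * aniso (fst z) (snd z)))" by simp
      also have "exp (- (R + 1) * aniso (fst z) (snd z)) * exp (R * aniso (fst z) (snd z)) = exp (- 1 * aniso (fst z) (snd z))"
        by (simp add: algebra_simps flip: exp_add)
      finally show "norm (cmod (W z) * exp (R * aniso (fst z) (snd z))) \<le> norm (C * exp (- 1 * aniso (fst z) (snd z)))" by simp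
    qed
  qed
qed

text \<open>A functional commutes with a superposition of time-frequency shifts: the arguments of the shifts
  are approximated by simple functions, for which the superposition is a finite sum.\<close>

lemma dual_superposition:
  fixes W :: "(real^'d::finite) \<times> (real^'d) \<Rightarrow> complex"
  assumes u: "u \<in> gs_dual \<nu> \<mu>" and psi: "\<psi> \<in> gs_space \<nu> \<mu>" and g: "g \<in> gs_space \<nu> \<mu>"
    and Wc: "continuous_on UNIV W" and Wb: "\<And>r. r > 0 \<Longrightarrow> \<exists>C. \<forall>z. cmod (W z) \<le> C * exp (- r * aniso (fst z) (snd z))"
    and gW: "\<And>y. g y = (LINT z|lborel. W z * tf_shift \<psi> (fst z) (snd z) y)"
  shows "u g = (LINT z|lborel. W z * u (tf_shift \<psi> (fst z) (snd z)))"
proof -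
  \<comment> \<open>Simple functions converging to the identity with norms at most doubled, so that
    exponential weights in the argument remain under control.\<close>
  have "\<exists>F. (\<forall>i. simple_function (borel :: (real^'d) measure) (F i)) \<and> (\<forall>x\<in>space (borel :: (real^'d) measure). (\<lambda>i. F i x) \<longlonglongrightarrow> x) \<and>
    (\<forall>i. \<forall>x\<in>space (borel :: (real^'d) measure). dist (F i x) 0 \<le> 2 * dist x 0)"
    by (rule borel_measurable_implies_sequence_metric) simp
  then obtain s :: "nat \<Rightarrow> real^'d \<Rightarrow> real^'d" where s: "\<And>i. simple_function borel (s i)" "\<And>x. (\<lambda>i. s i x) \<longlonglongrightarrow> x" "\<And>i x. norm (s i x) \<le> 2 * norm x"
    by auto
  define \<sigma> where "\<sigma> i z = (s i (fst z), s i (snd z))" for i and z :: "(real^'d) \<times> (real^'d)"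
  define S where "S i = range (s i) \<times> range (s i)" for i
  have finS: "finite (S i)" for i using s(1)[of i] by (simp add: S_def simple_function_def)
  have \<sigma>S: "\<sigma> i z \<in> S i" for i z by (simp add: \<sigma>_def S_def)
  have \<sigma>meas: "\<sigma> i \<in> borel_measurable borel" for i
  proof -
    have m: "s i \<in> measurable borel borel" by (rule borel_measurable_simple_function[OF s(1)])
    have "(\<lambda>z. s i (fst z)) \<in> borel_measurable borel" "(\<lambda>z. s i (snd z)) \<in> borel_measurable borel"
      by (rule measurable_compose[OF borel_measurable_continuous_onI m]; intro continuous_intros)+
    then show ?thesis unfolding \<sigma>_def[abs_def] by (rule borel_measurable_Pair)
  qed
  have \<sigma>m: "{z. \<sigma> i z = w} \<in> sets borel" for i w
    using measurable_sets[OF \<sigma>meas[of i], of "{w}"] by (simp add: vimage_def)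
  have \<sigma>lim: "(\<lambda>i. \<sigma> i z) \<longlonglongrightarrow> z" for z
    using tendsto_Pair[OF s(2)[of "fst z"] s(2)[of "snd z"]] by (simp add: \<sigma>_def)
  define \<kappa> where "\<kappa> = 2 powr (1 / \<nu>) + 2 powr (1 / \<mu>)"
  have kappa: "\<kappa> > 0" by (simp add: \<kappa>_def add_pos_pos)
  have aniso\<sigma>: "aniso (fst (\<sigma> i z)) (snd (\<sigma> i z)) \<le> \<kappa> * aniso (fst z) (snd z)" for i z
  proof -
    have one: "norm (s i x) powr c \<le> 2 powr c * norm x powr c" if "c > 0" for x c
    proof -
      have "norm (s i x) powr c \<le> (2 * norm x) powr c" using s(3) that by (intro powr_mono2) auto
      then show ?thesis by (simp add: powr_mult)
    qed
    have "aniso (fst (\<sigma> i z)) (snd (\<sigma> i z)) \<le> 2 powr (1 / \<nu>) * norm (fst z) powr (1 / \<nu>) + 2 powr (1 / \<mu>) * norm (snd z) powr (1 / \<mu>)"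
      unfolding aniso_def \<sigma>_def using nu mu by (auto intro!: add_mono one)
    also have "\<dots> \<le> \<kappa> * norm (fst z) powr (1 / \<nu>) + \<kappa> * norm (snd z) powr (1 / \<mu>)"
      by (intro add_mono mult_right_mono) (auto simp: \<kappa>_def)
    finally show ?thesis by (simp add: aniso_def distrib_left)
  qed
  note Wi = integrable_aniso_weight[OF Wc Wb]
  have W0: "integrable lborel (\<lambda>z. cmod (W z))" using Wi[of 0] by simp
  have mW: "W \<in> borel_measurable borel" by (rule borel_measurable_continuous_onI[OF Wc])
  have Wint: "integrable lborel W" using W0 mW by (simp add: integrable_norm_iff)
  define c where "c i w = (LINT z|lborel. indicator {z. \<sigma> i z = w} z *\<^sub>R W z)" for i w
  define G where "G i y = (\<Sum>w\<in>S i. c i w * tf_shift \<psi> (fst w) (snd w) y)" for i y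
  have GI: "G i y = (LINT z|lborel. W z * tf_shift \<psi> (fst (\<sigma> i z)) (snd (\<sigma> i z)) y)" for i y
    unfolding G_def c_def by (rule integral_simple_argument[OF Wint finS \<sigma>S \<sigma>m, where F="\<lambda>w. tf_shift \<psi> (fst w) (snd w) y"])
  have Gs: "G i \<in> gs_space \<nu> \<mu>" for i
    unfolding G_def[abs_def] by (rule gs_space_sum[OF finS]) (rule tf_shift_gs_space[OF psi])
  have uG: "u (G i) = (LINT z|lborel. W z * u (tf_shift \<psi> (fst (\<sigma> i z)) (snd (\<sigma> i z))))" for i
  proof -
    have "u (G i) = (\<Sum>w\<in>S i. c i w * u (tf_shift \<psi> (fst w) (snd w)))"
      unfolding G_def[abs_def] by (rule gs_dual_sum[OF u finS]) (rule tf_shift_gs_space[OF psi])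
    also have "\<dots> = (LINT z|lborel. W z * u (tf_shift \<psi> (fst (\<sigma> i z)) (snd (\<sigma> i z))))"
      unfolding c_def by (rule integral_simple_argument[OF Wint finS \<sigma>S \<sigma>m, where F="\<lambda>w. u (tf_shift \<psi> (fst w) (snd w))"])
    finally show ?thesis .
  qed
  have m\<sigma>: "(\<lambda>z. F (\<sigma> i z)) \<in> borel_measurable borel" if "F \<in> borel_measurable borel" for F :: "_ \<Rightarrow> complex" and i
    by (rule measurable_compose[OF \<sigma>meas that])
  \<comment> \<open>Used for the pointwise values of the shifts, which are bounded, and for the
    values of the functional, which grow exponentially.\<close>
  have conv: "(\<lambda>i. LINT z|lborel. W z * F (\<sigma> i z)) \<longlonglongrightarrow> (LINT z|lborel. W z * F z)"
    if Fc: "continuous_on UNIV F" and Fb: "\<And>z. cmod (F z) \<le> K * exp (R * aniso (fst z) (snd z))" and R: "R \<ge> 0" and K: "K \<ge> 0" for F K R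
  proof (rule integral_dominated_convergence[where w="\<lambda>z. K * (cmod (W z) * exp (R * \<kappa> * aniso (fst z) (snd z)))"])
    have mF: "F \<in> borel_measurable borel" by (rule borel_measurable_continuous_onI[OF Fc])
    show "(\<lambda>z. W z * F z) \<in> borel_measurable lborel" using mW mF by simp
    show "(\<lambda>z. W z * F (\<sigma> i z)) \<in> borel_measurable lborel" for i using mW m\<sigma>[OF mF] by simp
    show "integrable lborel (\<lambda>z. K * (cmod (W z) * exp (R * \<kappa> * aniso (fst z) (snd z))))"
      by (intro integrable_mult_right Wi) (use R kappa in auto)
    show "AE z in lborel. (\<lambda>i. W z * F (\<sigma> i z)) \<longlonglongrightarrow> W z * F z"
    proof (intro AE_I2 tendsto_intros)
      fix z
      have "isCont F z" using Fc unfolding continuous_on_eq_continuous_at[OF open_UNIV] by blast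
      from isCont_tendsto_compose[OF this \<sigma>lim] show "(\<lambda>i. F (\<sigma> i z)) \<longlonglongrightarrow> F z" .
    qed
    show "AE z in lborel. norm (W z * F (\<sigma> i z)) \<le> K * (cmod (W z) * exp (R * \<kappa> * aniso (fst z) (snd z)))" for i
    proof (intro AE_I2)
      fix z
      have "cmod (F (\<sigma> i z)) \<le> K * exp (R * aniso (fst (\<sigma> i z)) (snd (\<sigma> i z)))" by (rule Fb)
      also have "\<dots> \<le> K * exp (R * (\<kappa> * aniso (fst z) (snd z)))"
        using K R aniso\<sigma>[of i z] by (intro mult_left_mono exp_le_cancel_iff[THEN iffD2]) auto
      finally have "cmod (W z) * cmod (F (\<sigma> i z)) \<le> cmod (W z) * (K * exp (R * (\<kappa> * aniso (fst z) (snd z))))" by (rule mult_left_mono) simp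
      then show "norm (W z * F (\<sigma> i z)) \<le> K * (cmod (W z) * exp (R * \<kappa> * aniso (fst z) (snd z)))" by (simp add: norm_mult mult_ac)
    qed
  qed
  have "(\<lambda>i. u (G i)) \<longlonglongrightarrow> u g"
  proof (rule gs_dual_pointwise_limit[OF u Gs g])
    fix h :: real assume h: "h > 0"
    from tf_shift_seminorm[OF psi h] obtain C R where C: "C \<ge> 0" "R > 0" "\<And>x \<xi>. gs_seminorm \<nu> \<mu> h (tf_shift \<psi> x \<xi>) \<le> C * exp (R * aniso x \<xi>)" by blast
    \<comment> \<open>With absolute values inside, the finite sums are compared to one integral that
      does not depend on \<open>i\<close>.\<close>
    have "gs_seminorm \<nu> \<mu> h (G i) \<le> (LINT z|lborel. cmod (W z) * (C * exp (R * \<kappa> * aniso (fst z) (snd z))))" for i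
    proof -
      have "gs_seminorm \<nu> \<mu> h (G i) \<le> (\<Sum>w\<in>S i. cmod (c i w) * gs_seminorm \<nu> \<mu> h (tf_shift \<psi> (fst w) (snd w)))"
        unfolding G_def[abs_def] using gs_seminorm_sum[OF finS tf_shift_gs_space[OF psi] h] by blast
      also have "\<dots> \<le> (\<Sum>w\<in>S i. (LINT z|lborel. indicator {z. \<sigma> i z = w} z *\<^sub>R cmod (W z)) * (C * exp (R * aniso (fst w) (snd w))))"
      proof (intro sum_mono mult_mono C(3))
        fix w
        have "cmod (c i w) \<le> (LINT z|lborel. cmod (indicator {z. \<sigma> i z = w} z *\<^sub>R W z))" unfolding c_def by (rule integral_norm_bound)
        then show "cmod (c i w) \<le> (LINT z|lborel. indicator {z. \<sigma> i z = w} z *\<^sub>R cmod (W z))" by simp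
        show "0 \<le> (LINT z|lborel. indicator {z. \<sigma> i z = w} z *\<^sub>R cmod (W z))" by (rule integral_nonneg_AE) simp
        show "0 \<le> gs_seminorm \<nu> \<mu> h (tf_shift \<psi> (fst w) (snd w))" by (rule gs_seminorm_nonneg[OF tf_shift_gs_space[OF psi] h])
      qed
      also have "\<dots> = (LINT z|lborel. cmod (W z) * (C * exp (R * aniso (fst (\<sigma> i z)) (snd (\<sigma> i z)))))"
        by (rule integral_simple_argument[OF W0 finS \<sigma>S \<sigma>m, where F="\<lambda>w. C * exp (R * aniso (fst w) (snd w))"])
      also have "\<dots> \<le> (LINT z|lborel. cmod (W z) * (C * exp (R * \<kappa> * aniso (fst z) (snd z))))"
      proof -
        have le: "cmod (W z) * (C * exp (R * aniso (fst (\<sigma> i z)) (snd (\<sigma> i z)))) \<le> cmod (W z) * (C * exp (R * \<kappa> * aniso (fst z) (snd z)))" for z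
          using C aniso\<sigma>[of i z] by (intro mult_left_mono exp_le_cancel_iff[THEN iffD2]) (auto simp: mult.assoc)
        have i2: "integrable lborel (\<lambda>z. cmod (W z) * (C * exp (R * \<kappa> * aniso (fst z) (snd z))))"
          using integrable_mult_right[OF Wi[of "R * \<kappa>"], of C] C kappa by (simp add: mult_ac)
        have "(\<lambda>z. complex_of_real (exp (R * aniso (fst z) (snd z)))) \<in> borel_measurable borel"
          by (intro borel_measurable_continuous_onI continuous_intros continuous_on_aniso)
        from m\<sigma>[OF this, of i] have "(\<lambda>z. Re (complex_of_real (exp (R * aniso (fst (\<sigma> i z)) (snd (\<sigma> i z)))))) \<in> borel_measurable borel"
          by measurable
        then have mm: "(\<lambda>z. exp (R * aniso (fst (\<sigma> i z)) (snd (\<sigma> i z)))) \<in> borel_measurable borel" by simp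
        have "integrable lborel (\<lambda>z. cmod (W z) * (C * exp (R * aniso (fst (\<sigma> i z)) (snd (\<sigma> i z)))))"
        proof (rule Bochner_Integration.integrable_bound[OF i2])
          show "(\<lambda>z. cmod (W z) * (C * exp (R * aniso (fst (\<sigma> i z)) (snd (\<sigma> i z))))) \<in> borel_measurable lborel" using mW mm by simp
          show "AE z in lborel. norm (cmod (W z) * (C * exp (R * aniso (fst (\<sigma> i z)) (snd (\<sigma> i z))))) \<le> norm (cmod (W z) * (C * exp (R * \<kappa> * aniso (fst z) (snd z))))"
            using le C(1) by (intro AE_I2) simp
        qed
        then show ?thesis by (rule integral_mono[OF _ i2 le])
      qed
      finally show ?thesis .
    qed
    then show "\<exists>C. \<forall>i. gs_seminorm \<nu> \<mu> h (G i) \<le> C" by blast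
  next
    fix y
    obtain K where K: "\<And>x. cmod (\<psi> x) \<le> K" using gs_bounded[OF psi] by blast
    have K0: "K \<ge> 0" using K[of 0] norm_ge_zero order_trans by blast
    show "(\<lambda>i. G i y) \<longlonglongrightarrow> g y"
      unfolding GI gW
      by (rule conv[OF continuous_on_tf_shift[OF wt_dom_continuous[OF gs_wt_dom[OF psi]], of y], of K 0])
         (use K K0 in \<open>auto simp: tf_shift_def norm_mult\<close>)
  qed
  moreover obtain C R where "C \<ge> 0" "R > 0" "\<And>x \<xi>. cmod (u (tf_shift \<psi> x \<xi>)) \<le> C * exp (R * aniso x \<xi>)"
    using dual_tf_shift_bound[OF u psi] by blast
  then have "(\<lambda>i. u (G i)) \<longlonglongrightarrow> (LINT z|lborel. W z * u (tf_shift \<psi> (fst z) (snd z)))"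
    unfolding uG by (intro conv[OF continuous_on_dual_tf_shift[OF u psi], of C R]) auto
  ultimately show ?thesis by (rule LIMSEQ_unique)
qed

subsection \<open>The short-time Fourier transform of test functions\<close>

text \<open>The bilinear pairing of \<open>g\<close> with
  \<open>tf_shift \<phi> x (- \<xi>)\<close>. The opposite sign makes it the coefficient in the
  expansion of \<open>g\<close> into time-frequency shifts of the conjugate window.\<close>

definition test_stft :: "(real^'d::finite \<Rightarrow> complex) \<Rightarrow> (real^'d \<Rightarrow> complex) \<Rightarrow> (real^'d) \<times> (real^'d) \<Rightarrow> complex" where
  "test_stft \<phi> g z = (LINT y|lborel. g y * \<phi> (y - fst z) * exp (\<i> * of_real (y \<bullet> snd z)))"

lemma continuous_on_test_stft:
  assumes phi: "\<phi> \<in> gs_space \<nu> \<mu>" and g: "g \<in> gs_space \<nu> \<mu>"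
  shows "continuous_on UNIV (test_stft \<phi> g)"
proof -
  obtain K where K: "\<And>x. cmod (\<phi> x) \<le> K" using gs_bounded[OF phi] by blast
  have K0: "K \<ge> 0" using K[of 0] norm_ge_zero order_trans by blast
  have mg: "g \<in> borel_measurable borel" and mphi: "\<phi> \<in> borel_measurable borel"
    using wt_dom_measurable[OF gs_wt_dom] phi g by blast+
  have "(\<lambda>i. test_stft \<phi> g (w i)) \<longlonglongrightarrow> test_stft \<phi> g z" if w: "w \<longlonglongrightarrow> z" for w z
    unfolding test_stft_def
  proof (rule integral_dominated_convergence[where w="\<lambda>y. K * cmod (g y)"])
    show "integrable lborel (\<lambda>y. K * cmod (g y))" by (intro integrable_mult_right integrable_norm wt_dom_integrable gs_wt_dom g)
    have mm: "(\<lambda>y. g y * \<phi> (y - fst z) * exp (\<i> * of_real (y \<bullet> snd z))) \<in> borel_measurable borel" for z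
      using mg mphi by measurable
    show "(\<lambda>y. g y * \<phi> (y - fst z) * exp (\<i> * of_real (y \<bullet> snd z))) \<in> borel_measurable lborel"
      "\<And>i. (\<lambda>y. g y * \<phi> (y - fst (w i)) * exp (\<i> * of_real (y \<bullet> snd (w i)))) \<in> borel_measurable lborel"
      using mm by simp_all
    show "AE y in lborel. (\<lambda>i. g y * \<phi> (y - fst (w i)) * exp (\<i> * of_real (y \<bullet> snd (w i)))) \<longlonglongrightarrow> g y * \<phi> (y - fst z) * exp (\<i> * of_real (y \<bullet> snd z))"
    proof (intro AE_I2 tendsto_intros w)
      fix y
      have "isCont \<phi> (y - fst z)" using wt_dom_continuous[OF gs_wt_dom[OF phi], of UNIV] by (simp add: continuous_on_eq_continuous_at)
      moreover have "(\<lambda>i. y - fst (w i)) \<longlonglongrightarrow> y - fst z" by (intro tendsto_intros w)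
      ultimately show "(\<lambda>i. \<phi> (y - fst (w i))) \<longlonglongrightarrow> \<phi> (y - fst z)" by (rule isCont_tendsto_compose)
    qed
    show "AE y in lborel. norm (g y * \<phi> (y - fst (w i)) * exp (\<i> * of_real (y \<bullet> snd (w i)))) \<le> K * cmod (g y)" for i
      using mult_right_mono[OF K norm_ge_zero] by (intro AE_I2) (simp add: norm_mult mult.commute)
  qed
  then show ?thesis by (simp add: continuous_on_sequentially o_def)
qed

text \<open>For fixed \<open>x\<close> the coefficients form a reflected transform of
  \<open>g * \<phi> (\<cdot> - x)\<close>, which inversion recovers; the remaining integral over
  \<open>x\<close> is the squared norm of the window. The decay hypothesis justifies Fubini and
  places the transform in the domain of inversion.\<close>

lemma test_stft_reconstruction:
  fixes \<phi> g :: "real^'d::finite \<Rightarrow> complex"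
  assumes phi: "\<phi> \<in> gs_space \<nu> \<mu>" and g: "g \<in> gs_space \<nu> \<mu>"
    and b: "\<exists>C. \<forall>z. cmod (test_stft \<phi> g z) \<le> C * exp (- 1 * aniso (fst z) (snd z))"
  shows "(LINT z|lborel. test_stft \<phi> g z * tf_shift (\<lambda>x. cnj (\<phi> x)) (fst z) (snd z) y) = (2 * pi) ^ CARD('d) * (LINT x|lborel. cnj (\<phi> x) * \<phi> x) * g y"
proof -
  let ?psi = "\<lambda>x. cnj (\<phi> x)"
  have psi: "?psi \<in> gs_space \<nu> \<mu>" by (rule gs_space_cnj[OF phi])
  have cphi: "continuous_on UNIV \<phi>" and cpsi: "continuous_on UNIV ?psi" and cg: "continuous_on UNIV g"
    using wt_dom_continuous[OF gs_wt_dom] phi psi g by blast+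
  obtain K where K: "\<And>x. cmod (\<phi> x) \<le> K" using gs_bounded[OF phi] by blast
  have K0: "K \<ge> 0" using K[of 0] norm_ge_zero order_trans by blast
  obtain C where C: "\<And>z. cmod (test_stft \<phi> g z) \<le> C * exp (- 1 * aniso (fst z) (snd z))" using b by blast
  have C0: "C \<ge> 0" using C[of 0] norm_ge_zero[of "test_stft \<phi> g 0"] by (smt (verit) exp_gt_zero mult_neg_pos)
  obtain W1 where W1: "W1 > 0" "\<And>x::real^'d. exp (- 1 * norm x powr (1 / \<nu>)) \<le> W1 * wt x" using exp_le_wt[of 1 \<nu>] nu by auto
  obtain W2 where W2: "W2 > 0" "\<And>x::real^'d. exp (- 1 * norm x powr (1 / \<mu>)) \<le> W2 * wt x" using exp_le_wt[of 1 \<mu>] mu by auto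
  have sgw: "cmod (test_stft \<phi> g (x, \<xi>)) \<le> C * (W1 * wt x * (W2 * wt \<xi>))" for x \<xi>
  proof -
    have "cmod (test_stft \<phi> g (x, \<xi>)) \<le> C * exp (- 1 * aniso x \<xi>)" using C[of "(x, \<xi>)"] by simp
    also have "exp (- 1 * aniso x \<xi>) = exp (- 1 * norm x powr (1 / \<nu>)) * exp (- 1 * norm \<xi> powr (1 / \<mu>))"
      by (simp add: aniso_def flip: exp_add)
    also have "C * \<dots> \<le> C * (W1 * wt x * (W2 * wt \<xi>))"
      using W1(1) C0 by (intro mult_left_mono mult_mono W1(2) W2(2)) auto
    finally show ?thesis .
  qed
  define F where "F x \<xi> = test_stft \<phi> g (x, \<xi>) * tf_shift ?psi x \<xi> y" for x \<xi>
  have "(LINT z|lborel. test_stft \<phi> g z * tf_shift ?psi (fst z) (snd z) y) = (LINT z|lborel. F (fst z) (snd z))" by (simp add: F_def)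
  also have "\<dots> = (LINT x|lborel. LINT \<xi>|lborel. F x \<xi>)"
  proof (rule Fubini_pair)
    have "continuous_on UNIV (\<lambda>z. F (fst z) (snd z))"
      unfolding F_def using continuous_on_test_stft[OF phi g] continuous_on_tf_shift[OF cpsi] by (auto intro!: continuous_intros)
    then show "case_prod F \<in> borel_measurable borel" by (rule borel_measurable_pair_continuous)
    show "integrable lborel (\<lambda>x::real^'d. C * W1 * K * wt x)" "integrable lborel (\<lambda>x::real^'d. W2 * wt x)"
      by (intro integrable_mult_right integrable_wt)+
    show "cmod (F x \<xi>) \<le> C * W1 * K * wt x * (W2 * wt \<xi>)" for x \<xi>
    proof -
      have "cmod (F x \<xi>) = cmod (test_stft \<phi> g (x, \<xi>)) * cmod (\<phi> (y - x))" by (simp add: F_def tf_shift_def norm_mult)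
      also have "\<dots> \<le> (C * (W1 * wt x * (W2 * wt \<xi>))) * K"
        using C0 W1(1) W2(1) by (intro mult_mono sgw K) auto
      finally show ?thesis by (simp add: mult_ac)
    qed
  qed
  also have "\<dots> = (LINT x|lborel. (2 * pi) ^ CARD('d) * g y * (cnj (\<phi> (y - x)) * \<phi> (y - x)))"
  proof (rule Bochner_Integration.integral_cong[OF refl])
    fix x
    define k where "k = (\<lambda>y. g y * \<phi> (y - x))"
    have kd: "wt_dom k" unfolding k_def
      by (rule wt_dom_mult[OF gs_wt_dom[OF g] _ K]) (rule continuous_on_compose2[OF cphi], auto intro!: continuous_intros)
    have sgk: "test_stft \<phi> g (x, \<xi>) = ft k (- \<xi>)" for \<xi> by (simp add: test_stft_def ft_def k_def)
    have fkd: "wt_dom (ft k)"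
    proof (rule wt_domI[OF ft_continuous[OF kd]])
      fix \<xi> :: "real^'d"
      have "cmod (ft k \<xi>) \<le> C * (W1 * wt x * (W2 * wt (- \<xi>)))" using sgw[of x "- \<xi>"] sgk[of "- \<xi>"] by simp
      then show "cmod (ft k \<xi>) \<le> C * W1 * wt x * W2 * wt \<xi>" by (simp add: wt_def mult_ac)
    qed
    have mfk: "ft k \<in> borel_measurable borel" by (rule wt_dom_measurable[OF fkd])
    have "(LINT \<xi>|lborel. F x \<xi>) = (LINT \<xi>|lborel. cnj (\<phi> (y - x)) * (ft k (- \<xi>) * exp (- \<i> * of_real (y \<bullet> \<xi>))))"
      by (simp add: F_def sgk tf_shift_def mult_ac)
    also have "\<dots> = cnj (\<phi> (y - x)) * (LINT \<xi>|lborel. ft k (- \<xi>) * exp (- \<i> * of_real (y \<bullet> \<xi>)))" by simp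
    also have "(LINT \<xi>|lborel. ft k (- \<xi>) * exp (- \<i> * of_real (y \<bullet> \<xi>))) = ft (\<lambda>\<xi>. ft k (- \<xi>)) y"
      by (simp add: ft_def inner_commute)
    also have "\<dots> = ft (ft k) (- y)" by (rule integral_neg_ft[OF mfk])
    also have "\<dots> = (2 * pi) ^ CARD('d) * k y" using ft_inversion[OF kd fkd, of "- y"] by simp
    finally show "(LINT \<xi>|lborel. F x \<xi>) = (2 * pi) ^ CARD('d) * g y * (cnj (\<phi> (y - x)) * \<phi> (y - x))"
      by (simp add: k_def mult_ac)
  qed
  also have "\<dots> = (2 * pi) ^ CARD('d) * g y * (LINT x|lborel. cnj (\<phi> (y - x)) * \<phi> (y - x))" by (simp add: integral_mult_right_zero)
  also have "(LINT x|lborel. cnj (\<phi> (y - x)) * \<phi> (y - x)) = (LINT x|lborel. cnj (\<phi> x) * \<phi> x)"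
  proof -
    have "(\<lambda>x. cnj (\<phi> x) * \<phi> x) \<in> borel_measurable borel" by (intro borel_measurable_continuous_onI continuous_intros cphi)
    from integral_lborel_affine[OF this, of "-1" y] show ?thesis by simp
  qed
  finally show ?thesis by (simp add: mult_ac)
qed

text \<open>Parseval's identity in bilinear form, hence the reflected argument in the second
  factor.\<close>

lemma gs_parseval:
  fixes f g :: "real^'d::finite \<Rightarrow> complex"
  assumes f: "f \<in> gs_space \<nu> \<mu>" and g: "g \<in> gs_space \<nu> \<mu>"
  shows "(LINT x|lborel. f x * g x) = (LINT \<eta>|lborel. ft f \<eta> * ft g (- \<eta>)) / (2 * pi) ^ CARD('d)"
proof -
  define K where "K = complex_of_real ((2 * pi) ^ CARD('d))"
  have K: "K \<noteq> 0" by (simp add: K_def)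
  have fd: "wt_dom (ft f)" by (rule rapid_wt_dom[OF gs_ft_rapid[OF f]])
  have gd: "wt_dom g" by (rule gs_wt_dom[OF g])
  have gn: "continuous_on UNIV (\<lambda>x. g (- x))"
    by (rule continuous_on_compose2[OF wt_dom_continuous[OF gd, of UNIV]]) (auto intro!: continuous_intros)
  have mg: "g \<in> borel_measurable borel" by (rule wt_dom_measurable[OF gd])
  have ig: "integrable lborel (\<lambda>x. g (- x))" using integrable_lborel_affine[OF wt_dom_integrable[OF gd], of "-1" 0] by simp
  have mf: "f \<in> borel_measurable borel" by (rule wt_dom_measurable[OF gs_wt_dom[OF f]])
  have ff: "ft (ft f) x = K * f (- x)" for x using gs_space_inversion[OF ab f, of x] by (simp add: K_def)
  have "(LINT x|lborel. f x * g x) = (LINT x|lborel. f (- x) * g (- x))"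
    using integral_lborel_uminus[of "\<lambda>x. f x * g x"] mf mg by simp
  also have "\<dots> = (LINT x|lborel. ft (ft f) x * g (- x)) / K" unfolding ff using K by (simp add: mult.assoc)
  also have "(LINT x|lborel. ft (ft f) x * g (- x)) = (LINT \<eta>|lborel. ft f \<eta> * ft (\<lambda>x. g (- x)) \<eta>)"
    by (rule ft_mult_swap[OF fd gn ig])
  finally show ?thesis by (simp add: integral_neg_ft[OF mg] K_def)
qed

end

subsection \<open>The kernel estimate\<close>

definition cpoly :: "real poly \<Rightarrow> complex poly" where
  "cpoly = map_poly of_real"

lemma poly_cpoly: "poly (cpoly p) (of_real s) = of_real (poly p s)"
  unfolding cpoly_def by (induction p) (simp_all add: map_poly_pCons)

lemma pderiv_cpoly: "pderiv (cpoly p) = cpoly (pderiv p)"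
  unfolding cpoly_def by (rule poly_eqI) (simp add: coeff_pderiv coeff_map_poly)

lemma degree_cpoly: "degree (cpoly p) \<le> degree p"
  unfolding cpoly_def by (rule degree_le) (simp add: coeff_map_poly coeff_eq_0)

lemma poly_holomorphic: "(\<lambda>z. poly p (z::complex)) holomorphic_on A"
  unfolding holomorphic_on_def field_differentiable_def
  by (auto intro: has_field_derivative_at_within poly_DERIV)

lemma uniform_second_order:
  fixes Q :: "'d::finite \<Rightarrow> real poly"
  assumes "\<And>l. degree (Q l) \<le> m" "m \<ge> 2"
  shows "\<exists>C>0. \<forall>l a s z. cmod (poly (cpoly (Q l)) (a + s + z) - poly (cpoly (Q l)) (a + s) - poly (pderiv (cpoly (Q l))) a * z)
     \<le> C * cmod z * (cmod s + cmod z) * (1 + cmod a + cmod s + cmod z) ^ (m - 2)"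
proof -
  have "\<exists>C\<ge>0. \<forall>a s z. cmod (poly (cpoly (Q l)) (a + s + z) - poly (cpoly (Q l)) (a + s) - poly (pderiv (cpoly (Q l))) a * z)
     \<le> C * cmod z * (cmod s + cmod z) * (1 + cmod a + cmod s + cmod z) ^ (m - 2)" for l
    by (rule poly_second_order[OF order_trans[OF degree_cpoly assms(1)] assms(2)])
  then obtain C where C: "\<And>l. C l \<ge> 0" "\<And>l a s z. cmod (poly (cpoly (Q l)) (a + s + z) - poly (cpoly (Q l)) (a + s) - poly (pderiv (cpoly (Q l))) a * z)
     \<le> C l * cmod z * (cmod s + cmod z) * (1 + cmod a + cmod s + cmod z) ^ (m - 2)" by metis
  define K where "K = 1 + (\<Sum>l\<in>UNIV. C l)"
  have le: "C l \<le> K" for l using member_le_sum[of l UNIV C] C(1) by (simp add: K_def)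
  have K: "K > 0" unfolding K_def using C(1) by (simp add: add_pos_nonneg sum_nonneg)
  have "C l * cmod z * (cmod s + cmod z) * (1 + cmod a + cmod s + cmod z) ^ (m - 2)
     \<le> K * cmod z * (cmod s + cmod z) * (1 + cmod a + cmod s + cmod z) ^ (m - 2)" for l a s z
    by (intro mult_right_mono le) auto
  then show ?thesis using C(2) K by (meson order_trans)
qed

definition poly_phase :: "('d::finite \<Rightarrow> real poly) \<Rightarrow> 'd \<Rightarrow> nat \<Rightarrow> real^'d \<Rightarrow> complex" where
  "poly_phase Q = phase_fam (\<lambda>l. poly (cpoly (Q l)))"

lemma poly_phase_0: "poly_phase Q j 0 x = exp (\<i> * of_real (\<Sum>l\<in>UNIV. poly (Q l) (x $ l)))"
  unfolding poly_phase_def phase_fam_0 poly_cpoly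
  by (simp add: exp_sum[symmetric] sum_distrib_left[symmetric])

definition poly_grad :: "('d::finite \<Rightarrow> real poly) \<Rightarrow> real^'d \<Rightarrow> real^'d" where
  "poly_grad Q \<eta> = (\<chi> l. poly (pderiv (Q l)) (\<eta> $ l))"

text \<open>The Taylor remainder of first order at \<open>b\<close>. The two parts removed act as a
  unimodular factor and as a translation in space.\<close>

definition remainder_phase :: "('d::finite \<Rightarrow> real poly) \<Rightarrow> real^'d \<Rightarrow> 'd \<Rightarrow> complex \<Rightarrow> complex" where
  "remainder_phase Q b l z = poly (cpoly (Q l)) (of_real (b $ l) + z) - poly (cpoly (Q l)) (of_real (b $ l))
     - poly (pderiv (cpoly (Q l))) (of_real (b $ l)) * z"

lemma remainder_phase_real:
  "remainder_phase Q b l (of_real s) = of_real (poly (Q l) (b $ l + s) - poly (Q l) (b $ l) - poly (pderiv (Q l)) (b $ l) * s)"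
  unfolding remainder_phase_def pderiv_cpoly by (simp flip: of_real_add add: poly_cpoly)

lemma remainder_phase_holomorphic: "remainder_phase Q b l holomorphic_on UNIV"
proof -
  have "(\<lambda>z. poly (cpoly (Q l)) (of_real (b $ l) + z)) holomorphic_on UNIV"
    using holomorphic_on_compose[of "\<lambda>z. of_real (b $ l) + z" UNIV "\<lambda>z. poly (cpoly (Q l)) z"]
    by (auto simp: o_def intro!: holomorphic_intros poly_holomorphic)
  then show ?thesis unfolding remainder_phase_def[abs_def] by (intro holomorphic_intros)
qed

context gs
begin

text \<open>The phase estimate with expansion at the origin and scale 0; the derivatives at 0 are
  fixed numbers and are included in \<open>K\<close>.\<close>

lemma poly_phase_gs_multiplier:
  fixes Q :: "'d::finite \<Rightarrow> real poly"
  assumes nu1: "\<nu> > 1" and m: "m \<ge> 2" and num: "\<mu> * (real m - 1) \<le> \<nu>" and deg: "\<And>l. degree (Q l) \<le> m"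
  shows "gs_multiplier (poly_phase Q)"
  unfolding gs_multiplier_def
proof (intro conjI allI impI)
  show "coord_fam (poly_phase Q)" unfolding poly_phase_def by (intro coord_fam_phase poly_holomorphic)
  obtain C where C: "C > 0" "\<And>l a s z. cmod (poly (cpoly (Q l)) (a + s + z) - poly (cpoly (Q l)) (a + s) - poly (pderiv (cpoly (Q l))) a * z)
     \<le> C * cmod z * (cmod s + cmod z) * (1 + cmod a + cmod s + cmod z) ^ (m - 2)"
    using uniform_second_order[of Q m] deg m by blast
  define K where "K = C + (\<Sum>l\<in>UNIV. cmod (poly (pderiv (cpoly (Q l))) 0))"
  have K: "K > 0" unfolding K_def using C(1) by (simp add: add_pos_nonneg sum_nonneg)
  have Kl: "C + cmod (poly (pderiv (cpoly (Q l))) 0) \<le> K" for l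
    using member_le_sum[of l UNIV "\<lambda>l. cmod (poly (pderiv (cpoly (Q l))) 0)"] by (simp add: K_def)
  \<comment> \<open>\<open>0 powr \<mu>\<close> is 0, so this is the growth condition of
    \<open>phase_deriv_bound\<close> at scale 0.\<close>
  have growth: "cmod (poly (cpoly (Q l)) (of_real s + z) - poly (cpoly (Q l)) (of_real s))
      \<le> K * cmod z * (1 + \<bar>s\<bar> + cmod z) * (1 + 0 powr \<mu> + \<bar>s\<bar> + cmod z) ^ (m - 2)" for l and s :: real and z
  proof -
    define E where "E = (1 + \<bar>s\<bar> + cmod z)"
    define c where "c = poly (pderiv (cpoly (Q l))) 0"
    define A where "A = poly (cpoly (Q l)) (of_real s + z) - poly (cpoly (Q l)) (of_real s)"
    have E: "E \<ge> 1" by (simp add: E_def)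
    have "cmod (A - c * z) \<le> C * cmod z * (\<bar>s\<bar> + cmod z) * E ^ (m - 2)"
      using C(2)[of l 0 "of_real s" z] by (simp add: A_def c_def E_def)
    also have "\<dots> \<le> C * cmod z * E * E ^ (m - 2)"
      using C(1) E by (intro mult_right_mono mult_left_mono) (auto simp: E_def)
    finally have 1: "cmod (A - c * z) \<le> C * cmod z * E * E ^ (m - 2)" .
    have "1 * 1 \<le> E * E ^ (m - 2)" using E by (intro mult_mono) (auto intro: one_le_power)
    then have "cmod (c * z) * 1 \<le> (cmod c * cmod z) * (E * E ^ (m - 2))" unfolding norm_mult by (intro mult_left_mono) auto
    then have "cmod A \<le> C * cmod z * E * E ^ (m - 2) + (cmod c * cmod z) * (E * E ^ (m - 2))"
      using 1 norm_triangle_ineq[of "A - c * z" "c * z"] by simp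
    also have "\<dots> = (C + cmod c) * (cmod z * E * E ^ (m - 2))" by (simp add: algebra_simps)
    also have "\<dots> \<le> K * (cmod z * E * E ^ (m - 2))" using E Kl[of l] by (intro mult_right_mono) (auto simp: c_def)
    finally show ?thesis using mu by (simp add: A_def E_def mult_ac)
  qed
  fix h :: real assume h: "h > 0"
  obtain D R where DR: "D > 0" "R > 0" and bd: "\<forall>l\<ge>0. \<forall>Q. Q holomorphic_on UNIV \<longrightarrow> (\<forall>s::real. Im (Q (of_real s)) = 0) \<longrightarrow>
     (\<forall>(s::real) z. cmod (Q (of_real s + z) - Q (of_real s)) \<le> K * cmod z * (1 + \<bar>s\<bar> + cmod z) * (1 + l powr \<mu> + \<bar>s\<bar> + cmod z) ^ (m - 2)) \<longrightarrow>
     (\<forall>n (s::real). cmod ((deriv ^^ n) (\<lambda>z. exp (\<i> * Q z)) (of_real s)) \<le> D * h ^ n * fact n powr \<nu> * exp (\<nu> * l + R * \<bar>s\<bar> powr (1 / \<mu>)))"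
    using phase_deriv_bound[OF mu nu1 m num K h] by blast
  have "fam_bound \<nu> h (\<lambda>x. D * exp (0 + R * norm x powr (1 / \<mu>))) (poly_phase Q)"
    unfolding poly_phase_def
  proof (rule fam_bound_phase[OF mu])
    fix l n and s :: real
    have "cmod ((deriv ^^ n) (\<lambda>z. exp (\<i> * poly (cpoly (Q l)) z)) (of_real s)) \<le> D * h ^ n * fact n powr \<nu> * exp (\<nu> * 0 + R * \<bar>s\<bar> powr (1 / \<mu>))"
      using bd[rule_format, OF order_refl poly_holomorphic _ growth] by (simp add: poly_cpoly)
    then show "cmod ((deriv ^^ n) (\<lambda>z. exp (\<i> * poly (cpoly (Q l)) z)) (of_real s)) \<le> D * h ^ n * fact n powr \<nu> * exp (0 + R * \<bar>s\<bar> powr (1 / \<mu>))"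
      by simp
  qed (use DR h in \<open>auto simp: poly_cpoly\<close>)
  then show "\<exists>D\<ge>0. \<exists>R>0. fam_bound \<nu> h (\<lambda>x. D * exp (R * norm x powr (1 / \<mu>))) (poly_phase Q)"
    using DR by (intro exI[of _ D] conjI exI[of _ R]) auto
qed

text \<open>Freezing at a frequency of size \<open>l^\<mu>\<close> enlarges the base of the power in
  the second order bound only by the factor \<open>1 + B\<close>, so the derivative estimate holds
  with uniform constants apart from \<open>exp (\<nu> * l)\<close>.\<close>

lemma remainder_phase_bound:
  fixes Q :: "'d::finite \<Rightarrow> real poly"
  assumes nu1: "\<nu> > 1" and m: "m \<ge> 2" and num: "\<mu> * (real m - 1) \<le> \<nu>" and deg: "\<And>l. degree (Q l) \<le> m"
    and h: "h > 0" and B: "B \<ge> 0"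
  shows "\<exists>D>0. \<exists>R>0. \<forall>l\<ge>0. \<forall>b. norm b \<le> B * (1 + l powr \<mu>) \<longrightarrow>
    fam_bound \<nu> h (\<lambda>x. D * exp (\<nu> * l + R * norm x powr (1 / \<mu>))) (phase_fam (remainder_phase Q b))"
proof -
  obtain C where C: "C > 0" "\<And>l a s z. cmod (poly (cpoly (Q l)) (a + s + z) - poly (cpoly (Q l)) (a + s) - poly (pderiv (cpoly (Q l))) a * z)
     \<le> C * cmod z * (cmod s + cmod z) * (1 + cmod a + cmod s + cmod z) ^ (m - 2)"
    using uniform_second_order[of Q m] deg m by blast
  define K where "K = C * (1 + B) ^ (m - 2)"
  have K: "K > 0" using C(1) B by (simp add: K_def)
  obtain D R where DR: "D > 0" "R > 0" and bd: "\<forall>l\<ge>0. \<forall>Q. Q holomorphic_on UNIV \<longrightarrow> (\<forall>s::real. Im (Q (of_real s)) = 0) \<longrightarrow>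
     (\<forall>(s::real) z. cmod (Q (of_real s + z) - Q (of_real s)) \<le> K * cmod z * (1 + \<bar>s\<bar> + cmod z) * (1 + l powr \<mu> + \<bar>s\<bar> + cmod z) ^ (m - 2)) \<longrightarrow>
     (\<forall>n (s::real). cmod ((deriv ^^ n) (\<lambda>z. exp (\<i> * Q z)) (of_real s)) \<le> D * h ^ n * fact n powr \<nu> * exp (\<nu> * l + R * \<bar>s\<bar> powr (1 / \<mu>)))"
    using phase_deriv_bound[OF mu nu1 m num K h] by blast
  have "fam_bound \<nu> h (\<lambda>x. D * exp (\<nu> * l + R * norm x powr (1 / \<mu>))) (phase_fam (remainder_phase Q b))"
    if l: "l \<ge> 0" and b: "norm b \<le> B * (1 + l powr \<mu>)" for l b
  proof (rule fam_bound_phase[OF mu])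
    have growth: "cmod (remainder_phase Q b k (of_real s + z) - remainder_phase Q b k (of_real s))
      \<le> K * cmod z * (1 + \<bar>s\<bar> + cmod z) * (1 + l powr \<mu> + \<bar>s\<bar> + cmod z) ^ (m - 2)" for k and s :: real and z
    proof -
      have bk: "\<bar>b $ k\<bar> \<le> B * (1 + l powr \<mu>)" using component_le_norm_cart[of b k] b by linarith
      have "remainder_phase Q b k (of_real s + z) - remainder_phase Q b k (of_real s)
         = poly (cpoly (Q k)) (of_real (b $ k) + of_real s + z) - poly (cpoly (Q k)) (of_real (b $ k) + of_real s) - poly (pderiv (cpoly (Q k))) (of_real (b $ k)) * z"
        by (simp add: remainder_phase_def algebra_simps)
      then have "cmod (remainder_phase Q b k (of_real s + z) - remainder_phase Q b k (of_real s))
         \<le> C * cmod z * (\<bar>s\<bar> + cmod z) * (1 + \<bar>b $ k\<bar> + \<bar>s\<bar> + cmod z) ^ (m - 2)"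
        using C(2)[of k "of_real (b $ k)" "of_real s" z] by simp
      also have "\<dots> \<le> C * cmod z * (1 + \<bar>s\<bar> + cmod z) * ((1 + B) * (1 + l powr \<mu> + \<bar>s\<bar> + cmod z)) ^ (m - 2)"
      proof (intro mult_mono power_mono)
        have "1 + \<bar>b $ k\<bar> + \<bar>s\<bar> + cmod z \<le> 1 + B * (1 + l powr \<mu>) + \<bar>s\<bar> + cmod z" using bk by simp
        also have "\<dots> \<le> (1 + B) * (1 + l powr \<mu> + \<bar>s\<bar> + cmod z)"
        proof -
          have "0 \<le> l powr \<mu> + B * (\<bar>s\<bar> + cmod z)" using B by simp
          then show ?thesis by (simp add: algebra_simps)
        qed
        finally show "1 + \<bar>b $ k\<bar> + \<bar>s\<bar> + cmod z \<le> (1 + B) * (1 + l powr \<mu> + \<bar>s\<bar> + cmod z)" .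
      qed (use C in auto)
      finally show ?thesis by (simp add: K_def power_mult_distrib mult_ac)
    qed
    fix k n and s :: real
    show "cmod ((deriv ^^ n) (\<lambda>z. exp (\<i> * remainder_phase Q b k z)) (of_real s)) \<le> D * h ^ n * fact n powr \<nu> * exp (\<nu> * l + R * \<bar>s\<bar> powr (1 / \<mu>))"
      using bd[rule_format, OF l remainder_phase_holomorphic _ growth] by (simp add: remainder_phase_real)
  qed (use DR h in \<open>auto simp: remainder_phase_real\<close>)
  then show ?thesis using DR by blast
qed

text \<open>The transform of \<open>tf_shift \<psi> x \<xi>\<close> is centred at
  \<open>- \<xi>\<close>, and after the translation by \<open>a\<close> at
  \<open>b = - (\<xi> + a)\<close>. Centring the Parseval integral there and splitting the phase at
  \<open>b\<close>, the constant part disappears in the modulus and the linear part moves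
  \<open>x\<close> by the gradient.\<close>

lemma test_stft_mult_op_tf_shift:
  fixes Q :: "'d::finite \<Rightarrow> real poly" and \<phi> \<psi> :: "real^'d \<Rightarrow> complex"
  assumes P: "gs_multiplier (poly_phase Q)" and phi: "\<phi> \<in> gs_space \<nu> \<mu>" and psi: "\<psi> \<in> gs_space \<nu> \<mu>"
  shows "cmod (test_stft \<phi> (mult_op (poly_phase Q j 0) a (tf_shift \<psi> x \<xi>)) (x', \<xi>')) \<le>
    cmod (ft (fam_mult (fam_mult (phase_fam (remainder_phase Q (- (\<xi> + a)))) (ft_fam \<psi>)) (fam_shift (\<xi>' - (\<xi> + a)) (fam_neg (ft_fam \<phi>))) j 0)
      (x - poly_grad Q (- (\<xi> + a)) - x'))"
    (is "_ \<le> cmod (ft ?J _)")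
proof -
  define b where "b = - (\<xi> + a)"
  define X where "X = x - poly_grad Q b"
  define G where "G = mult_op (poly_phase Q j 0) a (tf_shift \<psi> x \<xi>)"
  have G: "G \<in> gs_space \<nu> \<mu>" unfolding G_def by (rule mult_op_gs_space[OF P tf_shift_gs_space[OF psi]])
  define Th where "Th = tf_shift \<phi> x' (- \<xi>')"
  have Th: "Th \<in> gs_space \<nu> \<mu>" unfolding Th_def by (rule tf_shift_gs_space[OF phi])
  define I where "I \<eta> = ft G \<eta> * ft Th (- \<eta>)" for \<eta>
  define c where "c = exp (\<i> * of_real (\<Sum>l\<in>UNIV. poly (Q l) (b $ l))) * exp (- \<i> * of_real (x' \<bullet> (- b - \<xi>')))"
  have cc: "cmod c = 1" by (simp add: c_def norm_mult)
  have Ib: "I (\<zeta> + b) = c * (?J \<zeta> * exp (- \<i> * of_real (\<zeta> \<bullet> (X - x'))))" for \<zeta>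
  proof -
    have ftG: "ft G (\<zeta> + b) = exp (\<i> * of_real (\<Sum>l\<in>UNIV. poly (Q l) ((\<zeta> + b) $ l))) * (exp (- \<i> * of_real (x \<bullet> \<zeta>)) * ft \<psi> \<zeta>)"
      unfolding G_def ft_mult_op[OF P tf_shift_gs_space[OF psi]] poly_phase_0 ft_tf_shift[OF psi] by (simp add: b_def)
    have ftT: "ft Th (- (\<zeta> + b)) = exp (\<i> * of_real (x' \<bullet> \<zeta>)) * exp (- \<i> * of_real (x' \<bullet> (- b - \<xi>'))) * ft \<phi> (- (\<zeta> + (\<xi>' + b)))"
      unfolding Th_def ft_tf_shift[OF phi] by (simp add: inner_diff_right inner_add_right algebra_simps flip: exp_add)
    have ph: "(\<Sum>l\<in>UNIV. poly (Q l) ((\<zeta> + b) $ l)) = (\<Sum>l\<in>UNIV. poly (Q l) (b $ l)) + poly_grad Q b \<bullet> \<zeta>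
        + (\<Sum>l\<in>UNIV. poly (Q l) (b $ l + \<zeta> $ l) - poly (Q l) (b $ l) - poly (pderiv (Q l)) (b $ l) * \<zeta> $ l)"
      by (simp add: poly_grad_def inner_vec_def sum_subtractf add.commute)
    have J0: "?J \<zeta> = exp (\<i> * of_real (\<Sum>l\<in>UNIV. poly (Q l) (b $ l + \<zeta> $ l) - poly (Q l) (b $ l) - poly (pderiv (Q l)) (b $ l) * \<zeta> $ l))
        * ft \<psi> \<zeta> * ft \<phi> (- (\<zeta> + (\<xi>' + b)))"
    proof -
      have pr: "(\<Prod>l\<in>UNIV. exp (\<i> * complex_of_real (f l))) = exp (\<i> * of_real (\<Sum>l\<in>UNIV. f l))" for f :: "'d \<Rightarrow> real"
        by (simp add: exp_sum[symmetric] sum_distrib_left)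
      have e: "\<xi>' - (\<xi> + a) = \<xi>' + b" by (simp add: b_def)
      show ?thesis
        unfolding fam_mult_0 fam_shift_def fam_neg_def ft_fam_0 phase_fam_0 e b_def[symmetric] remainder_phase_real pr
        by (simp only: power_0 mult_1)
    qed
    have "exp (- \<i> * of_real (\<zeta> \<bullet> (X - x'))) = exp (\<i> * of_real (poly_grad Q b \<bullet> \<zeta>)) * exp (- \<i> * of_real (x \<bullet> \<zeta>)) * exp (\<i> * of_real (x' \<bullet> \<zeta>))"
      by (simp add: X_def inner_diff_right inner_commute algebra_simps flip: exp_add)
    then show ?thesis unfolding I_def ftG ftT J0 ph of_real_add distrib_left exp_add c_def by (simp only: mult_ac)
  qed
  have mI: "I \<in> borel_measurable borel"
    unfolding I_def by (intro borel_measurable_continuous_onI continuous_intros ft_continuous gs_wt_dom G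
        continuous_on_compose2[OF ft_continuous[OF gs_wt_dom[OF Th]], where f="\<lambda>\<eta>. - \<eta>"]) auto
  have "test_stft \<phi> G (x', \<xi>') = (LINT y|lborel. G y * Th y)"
    by (simp add: test_stft_def Th_def tf_shift_def mult_ac)
  also have "\<dots> = (LINT \<eta>|lborel. I \<eta>) / (2 * pi) ^ CARD('d)" unfolding I_def by (rule gs_parseval[OF G Th])
  also have "(LINT \<eta>|lborel. I \<eta>) = (LINT \<zeta>|lborel. I (\<zeta> + b))" by (rule integral_lborel_shift[OF mI, symmetric])
  also have "\<dots> = c * ft ?J (X - x')" unfolding Ib ft_def by simp
  finally have "cmod (test_stft \<phi> G (x', \<xi>')) = cmod (ft ?J (X - x')) / (2 * pi) ^ CARD('d)"
    by (simp add: norm_divide norm_mult cc norm_power)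
  \<comment> \<open>The normalising factor is at most 1 and is dropped.\<close>
  also have "\<dots> \<le> cmod (ft ?J (X - x')) / 1"
  proof (rule divide_left_mono)
    have "1 \<le> 2 * pi" using pi_ge_two by simp
    then show "1 \<le> (2 * pi) ^ CARD('d)" by (rule one_le_power)
  qed auto
  finally show ?thesis by (simp add: G_def X_def b_def)
qed

lemma kernel_bound:
  fixes Q :: "'d::finite \<Rightarrow> real poly" and \<phi> \<psi> :: "real^'d \<Rightarrow> complex"
  assumes nu1: "\<nu> > 1" and m: "m \<ge> 2" and num: "\<mu> * (real m - 1) \<le> \<nu>" and deg: "\<And>l. degree (Q l) \<le> m"
    and phi: "\<phi> \<in> gs_space \<nu> \<mu>" and psi: "\<psi> \<in> gs_space \<nu> \<mu>" and B: "B \<ge> 0" and r: "r > 0"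
  shows "\<exists>C\<ge>0. \<forall>l\<ge>0. \<forall>x \<xi> x' \<xi>'. norm (\<xi> + a) \<le> B * (1 + l powr \<mu>) \<longrightarrow>
    cmod (test_stft \<phi> (mult_op (poly_phase Q j 0) a (tf_shift \<psi> x \<xi>)) (x', \<xi>'))
      \<le> C * exp (\<nu> * l) * exp (- r * aniso (x' - (x - poly_grad Q (- (\<xi> + a)))) (\<xi>' - (\<xi> + a)))"
proof -
  have P: "gs_multiplier (poly_phase Q)" by (rule poly_phase_gs_multiplier[OF nu1 m num deg])
  obtain h C0 where h: "h > 0" and C0: "C0 > 0" and dec: "\<And>(H :: 'd \<Rightarrow> nat \<Rightarrow> real^'d \<Rightarrow> complex) K j y. coord_fam H \<Longrightarrow> fam_bound \<nu> h (\<lambda>x. K * wt x) H \<Longrightarrow>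
     cmod (ft (H j 0) y) \<le> C0 * K * exp (- r * norm y powr (1 / \<nu>))"
    using ft_decay[where 'd='d, OF nu r] by blast
  \<comment> \<open>There are two Leibniz products, each of which doubles the scale.\<close>
  have h4: "h / 4 > 0" "h / 2 > 0" using h by auto
  obtain D R where D: "D > 0" and R: "R > 0" and ph: "\<And>l b. l \<ge> 0 \<Longrightarrow> norm b \<le> B * (1 + l powr \<mu>) \<Longrightarrow>
    fam_bound \<nu> (h / 4) (\<lambda>x. D * exp (\<nu> * l + R * norm x powr (1 / \<mu>))) (phase_fam (remainder_phase Q b))"
    using remainder_phase_bound[where Q=Q, OF nu1 m num deg h4(1) B] by blast
  define k where "k = 2 powr (1 / \<mu>)"
  have k: "k > 0" by (simp add: k_def)
  have kr: "k * r > 0" using k r by simp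
  then have rr: "R + k * r + 1 > 0" "k * r > 0" using R by linarith+
  \<comment> \<open>Rate \<open>R\<close> against the growth of the phase, \<open>k * r\<close>
    against the shift of the other window, 1 for the integrable weight.\<close>
  obtain C1 where C1: "gs_fam_bound \<nu> \<mu> (h / 4) (R + k * r + 1) C1 (ft_fam \<psi>)"
    using gs_fam_ft_fam[OF ab psi] h4 rr unfolding gs_fam_def by blast
  obtain C2 where C2: "gs_fam_bound \<nu> \<mu> (h / 2) (k * r) C2 (ft_fam \<phi>)"
    using gs_fam_ft_fam[OF ab phi] h4 rr unfolding gs_fam_def by blast
  have C12: "C1 \<ge> 0" "C2 \<ge> 0" using gs_fam_bound_nonneg[OF C1] gs_fam_bound_nonneg[OF C2] by auto
  have cpsi: "coord_fam (ft_fam \<psi>)" and cphi: "coord_fam (ft_fam \<phi>)"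
    using gs_fam_ft_fam[OF ab psi] gs_fam_ft_fam[OF ab phi] by (auto simp: gs_fam_def)
  obtain W where W: "W > 0" "\<And>x::real^'d. exp (- 1 * norm x powr (1 / \<mu>)) \<le> W * wt x" using exp_le_wt[of 1 \<mu>] mu by auto
  have "cmod (test_stft \<phi> (mult_op (poly_phase Q j 0) a (tf_shift \<psi> x \<xi>)) (x', \<xi>'))
      \<le> (C0 * D * C1 * C2 * W) * exp (\<nu> * l) * exp (- r * aniso (x' - (x - poly_grad Q (- (\<xi> + a)))) (\<xi>' - (\<xi> + a)))"
    if l: "l \<ge> 0" and b: "norm (\<xi> + a) \<le> B * (1 + l powr \<mu>)" for l x \<xi> x' \<xi>'
  proof -
    define \<tau> where "\<tau> = \<xi>' - (\<xi> + a)"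
    let ?H = "fam_mult (fam_mult (phase_fam (remainder_phase Q (- (\<xi> + a)))) (ft_fam \<psi>)) (fam_shift \<tau> (fam_neg (ft_fam \<phi>)))"
    define K where "K = D * C1 * C2 * W * exp (\<nu> * l) * exp (- r * norm \<tau> powr (1 / \<mu>))"
    have cH: "coord_fam ?H"
      by (intro coord_fam_mult coord_fam_shift coord_fam_neg coord_fam_phase cpsi cphi remainder_phase_holomorphic)
    have nb: "norm (- (\<xi> + a)) \<le> B * (1 + l powr \<mu>)" using b by (simp only: norm_minus_cancel)
    have b1: "fam_bound \<nu> (h / 2) (\<lambda>x. D * exp (\<nu> * l + R * norm x powr (1 / \<mu>)) * (C1 * exp (- (R + k * r + 1) * norm x powr (1 / \<mu>)))) (fam_mult (phase_fam (remainder_phase Q (- (\<xi> + a)))) (ft_fam \<psi>))"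
      using fam_bound_mult[OF ph[OF l nb] C1] nu h by simp
    have b2: "fam_bound \<nu> (h / 2) (\<lambda>x. C2 * exp (- (k * r) * norm (x + \<tau>) powr (1 / \<mu>))) (fam_shift \<tau> (fam_neg (ft_fam \<phi>)))"
      using fam_bound_shift[OF fam_bound_neg[OF C2], of \<tau>] by (simp only: norm_minus_cancel)
    have "fam_bound \<nu> h (\<lambda>x. K * wt x) ?H"
    proof (rule fam_bound_mono)
      show "fam_bound \<nu> h (\<lambda>x. D * exp (\<nu> * l + R * norm x powr (1 / \<mu>)) * (C1 * exp (- (R + k * r + 1) * norm x powr (1 / \<mu>))) * (C2 * exp (- (k * r) * norm (x + \<tau>) powr (1 / \<mu>)))) ?H"
        using fam_bound_mult[OF b1 b2] nu h by simp
      fix x :: "real^'d"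
      define t where "t = norm x powr (1 / \<mu>)"
      have "exp (- (k * r) * norm (\<tau> + x) powr (1 / \<mu>)) \<le> exp ((k * r) * norm x powr (1 / \<mu>)) * exp (- r * norm \<tau> powr (1 / \<mu>))"
        using exp_shift_le[of "1 / \<mu>" "k * r" \<tau> x] mu rr k by (simp add: k_def)
      then have e: "exp (- (k * r) * norm (x + \<tau>) powr (1 / \<mu>)) \<le> exp ((k * r) * t) * exp (- r * norm \<tau> powr (1 / \<mu>))"
        by (simp add: t_def add.commute)
      have "D * exp (\<nu> * l + R * norm x powr (1 / \<mu>)) * (C1 * exp (- (R + k * r + 1) * norm x powr (1 / \<mu>))) * (C2 * exp (- (k * r) * norm (x + \<tau>) powr (1 / \<mu>)))
        \<le> D * exp (\<nu> * l + R * t) * (C1 * exp (- (R + k * r + 1) * t)) * (C2 * (exp ((k * r) * t) * exp (- r * norm \<tau> powr (1 / \<mu>))))"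
        unfolding t_def[symmetric] using D C12 by (intro mult_left_mono e) auto
      also have "\<dots> = D * C1 * C2 * exp (- r * norm \<tau> powr (1 / \<mu>)) * (exp (\<nu> * l + R * t) * exp (- (R + k * r + 1) * t) * exp ((k * r) * t))"
        by simp
      also have "exp (\<nu> * l + R * t) * exp (- (R + k * r + 1) * t) * exp ((k * r) * t) = exp (\<nu> * l) * exp (- 1 * t)"
        by (simp add: algebra_simps flip: exp_add)
      also have "D * C1 * C2 * exp (- r * norm \<tau> powr (1 / \<mu>)) * (exp (\<nu> * l) * exp (- 1 * t)) \<le> D * C1 * C2 * exp (- r * norm \<tau> powr (1 / \<mu>)) * (exp (\<nu> * l) * (W * wt x))"
        unfolding t_def using D C12 by (intro mult_left_mono W) auto
      finally show "D * exp (\<nu> * l + R * norm x powr (1 / \<mu>)) * (C1 * exp (- (R + k * r + 1) * norm x powr (1 / \<mu>))) * (C2 * exp (- (k * r) * norm (x + \<tau>) powr (1 / \<mu>)))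
        \<le> K * wt x" by (simp add: K_def mult_ac)
    qed (use h in auto)
    from dec[OF cH this, of j "x - poly_grad Q (- (\<xi> + a)) - x'"]
    have "cmod (test_stft \<phi> (mult_op (poly_phase Q j 0) a (tf_shift \<psi> x \<xi>)) (x', \<xi>')) \<le> C0 * K * exp (- r * norm (x - poly_grad Q (- (\<xi> + a)) - x') powr (1 / \<nu>))"
      using test_stft_mult_op_tf_shift[OF P phi psi, of j a x \<xi> x' \<xi>'] unfolding \<tau>_def by linarith
    also have "norm (x - poly_grad Q (- (\<xi> + a)) - x') = norm (x' - (x - poly_grad Q (- (\<xi> + a))))" by (rule norm_minus_commute)
    also have "C0 * K * exp (- r * norm (x' - (x - poly_grad Q (- (\<xi> + a)))) powr (1 / \<nu>)) =
       (C0 * D * C1 * C2 * W) * exp (\<nu> * l) * exp (- r * aniso (x' - (x - poly_grad Q (- (\<xi> + a)))) (\<xi>' - (\<xi> + a)))"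
    proof -
      have "exp (- r * aniso u w) = exp (- r * norm w powr (1 / \<mu>)) * exp (- r * norm u powr (1 / \<nu>))" for u w :: "real^'d"
        by (simp add: aniso_def algebra_simps flip: exp_add)
      then show ?thesis unfolding K_def \<tau>_def by (simp only: mult_ac)
    qed
    finally show ?thesis .
  qed
  moreover have "C0 * D * C1 * C2 * W \<ge> 0" using C0 D C12 W by simp
  ultimately show ?thesis by blast
qed

end

subsection \<open>Propagation of the wave front set\<close>

text \<open>If \<open>f\<close> is not integrable, its integral is 0 by convention, and
  nonnegativity of \<open>g\<close> gives the inequality.\<close>

lemma integral_le_of_le:
  fixes f g :: "'a \<Rightarrow> real"
  assumes "integrable M g" "\<And>x. f x \<le> g x" "\<And>x. 0 \<le> g x"
  shows "integral\<^sup>L M f \<le> integral\<^sup>L M g"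
proof (cases "integrable M f")
  case True
  then show ?thesis using assms by (intro integral_mono) auto
next
  case False
  then show ?thesis using assms(3) by (simp add: not_integrable_integral_eq integral_nonneg_AE)
qed

context gs
begin

lemma stft_eq_tf_shift:
  "stft \<phi> u x \<xi> = complex_of_real ((2 * pi) powr (- (real CARD('d) / 2))) * u (tf_shift (\<lambda>y. cnj (\<phi> y)) x (\<xi> :: real^'d::finite))"
  by (simp add: stft_def pairing_def tf_shift_def[abs_def] exp_cnj)

lemma aniso_add_le: "aniso (x + y) (\<xi> + \<eta>) \<le> (2 powr (1 / \<nu>) + 2 powr (1 / \<mu>)) * (aniso x \<xi> + aniso y \<eta>)"
proof -
  define p where "p = 2 powr (1 / \<nu>)"
  define q where "q = 2 powr (1 / \<mu>)"
  have pq: "p > 0" "q > 0" by (simp_all add: p_def q_def)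
  have "aniso (x + y) (\<xi> + \<eta>) \<le> p * (norm x powr (1 / \<nu>) + norm y powr (1 / \<nu>)) + q * (norm \<xi> powr (1 / \<mu>) + norm \<eta> powr (1 / \<mu>))"
    unfolding aniso_def p_def q_def using nu mu by (intro add_mono norm_add_powr_le) auto
  also have "\<dots> \<le> (p + q) * (norm x powr (1 / \<nu>) + norm y powr (1 / \<nu>)) + (p + q) * (norm \<xi> powr (1 / \<mu>) + norm \<eta> powr (1 / \<mu>))"
    using pq by (intro add_mono mult_right_mono) auto
  finally show ?thesis unfolding aniso_def p_def q_def by (simp add: algebra_simps)
qed

lemma aniso_scale: "s > 0 \<Longrightarrow> aniso (s powr \<nu> *\<^sub>R x) (s powr \<mu> *\<^sub>R \<xi>) = s * aniso x \<xi>"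
  using nu mu by (simp add: aniso_def powr_mult powr_powr distrib_left)

lemma integral_exp_aniso_shift:
  fixes X \<Xi> :: "real^'d::finite"
  shows "integrable lborel (\<lambda>z. exp (- 1 * aniso (fst z - X) (snd z - \<Xi>)))"
    and "(LINT z|lborel. exp (- 1 * aniso (fst z - X) (snd z - \<Xi>))) = (LINT z|lborel. exp (- 1 * aniso (fst z) (snd (z :: (real^'d) \<times> (real^'d)))))"
proof -
  let ?f = "\<lambda>z :: (real^'d) \<times> (real^'d). exp (- 1 * aniso (fst z) (snd z))"
  have i: "integrable lborel ?f" using integrable_exp_aniso[where 'd='d, of 1] by (simp add: complex_of_real_integrable_eq)
  have e: "?f (- (X, \<Xi>) + 1 *\<^sub>R z) = exp (- 1 * aniso (fst z - X) (snd z - \<Xi>))" for z by (simp add: algebra_simps)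
  show "integrable lborel (\<lambda>z. exp (- 1 * aniso (fst z - X) (snd z - \<Xi>)))"
    using integrable_lborel_affine[OF i, of 1 "- (X, \<Xi>)"] unfolding e by simp
  have "?f \<in> borel_measurable borel" using borel_measurable_integrable[OF i] by simp
  from integral_lborel_affine[OF this, of 1 "- (X, \<Xi>)"] show "(LINT z|lborel. exp (- 1 * aniso (fst z - X) (snd z - \<Xi>))) = (LINT z|lborel. ?f z)"
    unfolding e by simp
qed

text \<open>The reconstruction formula with moduli inside. It reduces an estimate of
  \<open>u g\<close> to pointwise bounds on the transforms of \<open>g\<close> and of
  \<open>u\<close>; the constant depends on the window only.\<close>

lemma dual_reconstruction:
  fixes \<phi> g :: "real^'d::finite \<Rightarrow> complex"
  assumes u: "u \<in> gs_dual \<nu> \<mu>" and phi: "\<phi> \<in> gs_space \<nu> \<mu>" "\<phi> \<noteq> (\<lambda>_. 0)"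
  shows "\<exists>K>0. \<forall>g\<in>gs_space \<nu> \<mu>. (\<forall>r>0. \<exists>C. \<forall>z. cmod (test_stft \<phi> g z) \<le> C * exp (- r * aniso (fst z) (snd z))) \<longrightarrow>
    cmod (u g) \<le> K * (LINT z|lborel. cmod (test_stft \<phi> g z) * cmod (u (tf_shift (\<lambda>y. cnj (\<phi> y)) (fst z) (snd z))))"
proof -
  let ?psi = "\<lambda>y. cnj (\<phi> y)"
  define c where "c = (2 * pi) ^ CARD('d) * (LINT x|lborel. cnj (\<phi> x) * \<phi> x)"
  have c: "c \<noteq> 0" using gs_norm_sq_zero[OF phi(1)] phi(2) by (auto simp: c_def)
  have psi: "?psi \<in> gs_space \<nu> \<mu>" by (rule gs_space_cnj[OF phi(1)])
  have "cmod (u g) \<le> (1 / cmod c) * (LINT z|lborel. cmod (test_stft \<phi> g z) * cmod (u (tf_shift ?psi (fst z) (snd z))))"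
    if g: "g \<in> gs_space \<nu> \<mu>" and b: "\<forall>r>0. \<exists>C. \<forall>z. cmod (test_stft \<phi> g z) \<le> C * exp (- r * aniso (fst z) (snd z))" for g
  proof -
    have "u g = (LINT z|lborel. (test_stft \<phi> g z / c) * u (tf_shift ?psi (fst z) (snd z)))"
    proof (rule dual_superposition[OF u psi g])
      show "continuous_on UNIV (\<lambda>z. test_stft \<phi> g z / c)" using c by (intro continuous_intros continuous_on_test_stft phi g) auto
      fix r :: real assume "r > 0"
      then obtain C where C: "\<And>z. cmod (test_stft \<phi> g z) \<le> C * exp (- r * aniso (fst z) (snd z))" using b by blast
      have "cmod (test_stft \<phi> g z / c) \<le> (C / cmod c) * exp (- r * aniso (fst z) (snd z))" for z
        using divide_right_mono[OF C[of z], of "cmod c"] by (simp add: norm_divide)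
      then show "\<exists>C. \<forall>z. cmod (test_stft \<phi> g z / c) \<le> C * exp (- r * aniso (fst z) (snd z))" by blast
    next
      fix y
      have "\<exists>C. \<forall>z. cmod (test_stft \<phi> g z) \<le> C * exp (- 1 * aniso (fst z) (snd z))" using b zero_less_one by blast
      from test_stft_reconstruction[OF phi(1) g this, of y]
      have "(LINT z|lborel. test_stft \<phi> g z * tf_shift ?psi (fst z) (snd z) y) = c * g y" by (simp add: c_def)
      moreover have "(LINT z|lborel. test_stft \<phi> g z / c * tf_shift ?psi (fst z) (snd z) y) = (LINT z|lborel. test_stft \<phi> g z * tf_shift ?psi (fst z) (snd z) y) / c"
        by simp
      ultimately show "g y = (LINT z|lborel. test_stft \<phi> g z / c * tf_shift ?psi (fst z) (snd z) y)" using c by simp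
    qed
    then have "cmod (u g) = cmod (LINT z|lborel. (test_stft \<phi> g z / c) * u (tf_shift ?psi (fst z) (snd z)))"
      by (rule arg_cong)
    also have "\<dots> \<le> (LINT z|lborel. cmod ((test_stft \<phi> g z / c) * u (tf_shift ?psi (fst z) (snd z))))"
      by (rule integral_norm_bound)
    also have "\<dots> = (LINT z|lborel. (1 / cmod c) * (cmod (test_stft \<phi> g z) * cmod (u (tf_shift ?psi (fst z) (snd z)))))"
      by (simp add: norm_mult norm_divide)
    finally show ?thesis by simp
  qed
  moreover have "1 / cmod c > 0" using c by simp
  ultimately show ?thesis by blast
qed

section \<open>Transposed multipliers on the dual\<close>

text \<open>The transpose of \<open>mult_op\<close>; the value 0 off the test space keeps the result
  in the dual.\<close>

definition dual_op :: "(real^'d::finite \<Rightarrow> complex) \<Rightarrow> real^'d \<Rightarrow> ((real^'d \<Rightarrow> complex) \<Rightarrow> complex) \<Rightarrow> (real^'d \<Rightarrow> complex) \<Rightarrow> complex" where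
  "dual_op M a u = (\<lambda>g. if g \<in> gs_space \<nu> \<mu> then u (mult_op M a g) else 0)"

lemma dual_op_dual:
  assumes P: "gs_multiplier P" and u: "u \<in> gs_dual \<nu> \<mu>"
  shows "dual_op (P j 0) a u \<in> gs_dual \<nu> \<mu>"
proof -
  obtain h C where h: "h > 0" "C \<ge> 0" "\<And>f. f \<in> gs_space \<nu> \<mu> \<Longrightarrow> cmod (u f) \<le> C * gs_seminorm \<nu> \<mu> h f"
    using gs_dual_bound[OF u] by blast
  obtain h' C' where h': "h' > 0" "C' \<ge> 0" "\<And>f. f \<in> gs_space \<nu> \<mu> \<Longrightarrow> gs_seminorm \<nu> \<mu> h (mult_op (P j 0) a f) \<le> C' * gs_seminorm \<nu> \<mu> h' f"
    using mult_op_seminorm[OF P h(1), of j a] by blast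
  show ?thesis
  proof (rule gs_dualI[OF _ _ h'(1), where C="C * C'"])
    fix f :: "real^'a \<Rightarrow> complex" assume f: "f \<in> gs_space \<nu> \<mu>"
    have "cmod (u (mult_op (P j 0) a f)) \<le> C * gs_seminorm \<nu> \<mu> h (mult_op (P j 0) a f)" by (rule h(3)[OF mult_op_gs_space[OF P f]])
    also have "\<dots> \<le> C * (C' * gs_seminorm \<nu> \<mu> h' f)" by (intro mult_left_mono h'(3) f h)
    finally show "cmod (dual_op (P j 0) a u f) \<le> C * C' * gs_seminorm \<nu> \<mu> h' f" using f by (simp add: dual_op_def mult.assoc)
  next
    fix f g :: "real^'a \<Rightarrow> complex" and c d assume f: "f \<in> gs_space \<nu> \<mu>" and g: "g \<in> gs_space \<nu> \<mu>"
    have "mult_op (P j 0) a (\<lambda>x. c * f x + d * g x) = (\<lambda>x. c * mult_op (P j 0) a f x + d * mult_op (P j 0) a g x)"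
      using mult_op_lin[OF P f g] by (simp add: fun_eq_iff)
    then show "dual_op (P j 0) a u (\<lambda>x. c * f x + d * g x) = c * dual_op (P j 0) a u f + d * dual_op (P j 0) a u g"
      using f g gs_space_lin[OF f g] gs_dual_lin[OF u mult_op_gs_space[OF P f] mult_op_gs_space[OF P g]] by (simp add: dual_op_def)
  qed (simp add: dual_op_def)
qed

text \<open>The wave front set estimate: the kernel is concentrated at distance \<open>o(\<lambda>)\<close>, in the anisotropic
  sense, from the transported point, and elsewhere its decay beats the growth of the short-time
  Fourier transform of \<open>u\<close>.\<close>

lemma stft_dual_op_decay:
  fixes Q :: "'d::finite \<Rightarrow> real poly" and \<phi> :: "real^'d \<Rightarrow> complex"
  assumes nu1: "\<nu> > 1" and m: "m \<ge> 2" and num: "\<mu> * (real m - 1) \<le> \<nu>" and deg: "\<And>l. degree (Q l) \<le> m"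
    and phi: "\<phi> \<in> gs_space \<nu> \<mu>" "\<phi> \<noteq> (\<lambda>_. 0)" and u: "u \<in> gs_dual \<nu> \<mu>"
    and U: "open U" "(y0, \<xi>0) \<in> U"
    and dec: "\<And>r. r > 0 \<Longrightarrow> \<exists>C. \<forall>s>0. \<forall>x \<xi>. (x, \<xi>) \<in> U \<longrightarrow> exp (r * s) * cmod (stft \<phi> u (s powr \<nu> *\<^sub>R x) (s powr \<mu> *\<^sub>R \<xi>)) \<le> C"
    and limX: "((\<lambda>(s, z). (s powr (- \<nu>)) *\<^sub>R (s powr \<nu> *\<^sub>R fst z - poly_grad Q (- (s powr \<mu> *\<^sub>R snd z + a)))) \<longlongrightarrow> y0) (at_top \<times>\<^sub>F nhds z0)"
    and lim\<Xi>: "((\<lambda>(s, z). (s powr (- \<mu>)) *\<^sub>R (s powr \<mu> *\<^sub>R snd z + a)) \<longlongrightarrow> \<xi>0) (at_top \<times>\<^sub>F nhds z0)"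
    and z0: "z0 \<noteq> 0"
  shows "\<exists>V. open V \<and> V \<subseteq> - {0} \<and> z0 \<in> V \<and> (\<forall>r>0. \<exists>C. \<forall>s>0. \<forall>x \<xi>. (x, \<xi>) \<in> V \<longrightarrow>
      exp (r * s) * cmod (stft \<phi> (dual_op (poly_phase Q j 0) a u) (s powr \<nu> *\<^sub>R x) (s powr \<mu> *\<^sub>R \<xi>)) \<le> C)"
proof -
  let ?psi = "\<lambda>y. cnj (\<phi> y)"
  let ?M = "poly_phase Q j 0"
  have psi: "?psi \<in> gs_space \<nu> \<mu>" by (rule gs_space_cnj[OF phi(1)])
  have P: "gs_multiplier (poly_phase Q)" by (rule poly_phase_gs_multiplier[OF nu1 m num deg])
  have Tu: "dual_op ?M a u \<in> gs_dual \<nu> \<mu>" by (rule dual_op_dual[OF P u])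
  define \<kappa>0 where "\<kappa>0 = (2 * pi) powr (- (real CARD('d) / 2))"
  have k0: "\<kappa>0 > 0" by (simp add: \<kappa>0_def)
  have stft_abs: "cmod (stft \<phi> w x \<xi>) = \<kappa>0 * cmod (w (tf_shift ?psi x \<xi>))" for w x \<xi>
    unfolding stft_eq_tf_shift by (simp add: norm_mult \<kappa>0_def)
  \<comment> \<open>Of the size \<open>2 * \<epsilon>\<close> one half covers the distance of the
    rescaled transported point from \<open>(y0, \<xi>0)\<close>, the other the spread of the kernel
    around it.\<close>
  obtain \<epsilon> where eps: "\<epsilon> > 0" and epsU: "\<And>x \<xi>. norm (x - y0) < 2 * \<epsilon> \<Longrightarrow> norm (\<xi> - \<xi>0) < 2 * \<epsilon> \<Longrightarrow> (x, \<xi>) \<in> U"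
  proof -
    obtain A B where AB: "open A" "open B" "y0 \<in> A" "\<xi>0 \<in> B" "A \<times> B \<subseteq> U"
      using open_prod_elim[OF U] by (metis mem_Sigma_iff)
    obtain e1 where e1: "e1 > 0" "ball y0 e1 \<subseteq> A" using AB open_contains_ball by blast
    obtain e2 where e2: "e2 > 0" "ball \<xi>0 e2 \<subseteq> B" using AB open_contains_ball by blast
    show ?thesis
    proof (rule that[of "min e1 e2 / 2"])
      show "min e1 e2 / 2 > 0" using e1 e2 by simp
      fix x \<xi> assume "norm (x - y0) < 2 * (min e1 e2 / 2)" "norm (\<xi> - \<xi>0) < 2 * (min e1 e2 / 2)"
      then have "x \<in> ball y0 e1" "\<xi> \<in> ball \<xi>0 e2" by (auto simp: dist_norm norm_minus_commute)
      then show "(x, \<xi>) \<in> U" using e1 e2 AB by blast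
    qed
  qed
  have "\<forall>\<^sub>F sz in at_top \<times>\<^sub>F nhds z0.
      dist ((\<lambda>(s, z). (s powr (- \<nu>)) *\<^sub>R (s powr \<nu> *\<^sub>R fst z - poly_grad Q (- (s powr \<mu> *\<^sub>R snd z + a)))) sz) y0 < \<epsilon> \<and>
      dist ((\<lambda>(s, z). (s powr (- \<mu>)) *\<^sub>R (s powr \<mu> *\<^sub>R snd z + a)) sz) \<xi>0 < \<epsilon>"
    by (intro eventually_conj tendstoD[OF limX eps] tendstoD[OF lim\<Xi> eps])
  \<comment> \<open>Splitting the product filter yields a threshold for \<open>s\<close> and a
    neighbourhood of \<open>z0\<close> that work together.\<close>
  then obtain Pf Pg where Pf: "\<forall>\<^sub>F s in at_top. Pf s" and Pg: "\<forall>\<^sub>F z in nhds z0. Pg z"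
    and PP: "\<And>s z. Pf s \<Longrightarrow> Pg z \<Longrightarrow> norm ((s powr (- \<nu>)) *\<^sub>R (s powr \<nu> *\<^sub>R fst z - poly_grad Q (- (s powr \<mu> *\<^sub>R snd z + a))) - y0) < \<epsilon> \<and>
      norm ((s powr (- \<mu>)) *\<^sub>R (s powr \<mu> *\<^sub>R snd z + a) - \<xi>0) < \<epsilon>"
    unfolding eventually_prod_filter by (auto simp: dist_norm)
  obtain s0 where s0: "\<And>s. s \<ge> s0 \<Longrightarrow> Pf s" using Pf unfolding eventually_at_top_linorder by blast
  obtain V0 where V0: "open V0" "z0 \<in> V0" "\<And>z. z \<in> V0 \<Longrightarrow> Pg z" using Pg unfolding eventually_nhds by blast
  \<comment> \<open>The ball keeps the points bounded, which is what the small scales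
    require.\<close>
  define V where "V = V0 \<inter> ball z0 1 \<inter> - {0}"
  have V: "open V" "V \<subseteq> - {0}" "z0 \<in> V" using V0 z0 by (auto simp: V_def)
  define s1 where "s1 = max s0 1"
  define B where "B = norm \<xi>0 + \<epsilon>"
  define By where "By = norm y0 + \<epsilon>"
  have B: "B \<ge> 0" "By \<ge> 0" using eps by (auto simp: B_def By_def)
  define K where "K = By powr (1 / \<nu>) + B powr (1 / \<mu>)"
  have K: "K \<ge> 0" by (simp add: K_def)
  \<comment> \<open>A displacement beyond \<open>\<epsilon> s^\<nu>\<close> in space or
    \<open>\<epsilon> s^\<mu>\<close> in frequency has anisotropic size at least
    \<open>\<epsilon>' s\<close>.\<close>
  define \<epsilon>' where "\<epsilon>' = min (\<epsilon> powr (1 / \<nu>)) (\<epsilon> powr (1 / \<mu>))"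
  have eps': "\<epsilon>' > 0" using eps by (simp add: \<epsilon>'_def)
  define \<kappa> where "\<kappa> = 2 powr (1 / \<nu>) + 2 powr (1 / \<mu>)"
  have kappa: "\<kappa> > 0" by (simp add: \<kappa>_def add_pos_pos)
  obtain Cr where Cr: "Cr > 0" "\<And>g. g \<in> gs_space \<nu> \<mu> \<Longrightarrow> (\<forall>r>0. \<exists>C. \<forall>z. cmod (test_stft \<phi> g z) \<le> C * exp (- r * aniso (fst z) (snd z))) \<Longrightarrow>
    cmod (u g) \<le> Cr * (LINT z|lborel. cmod (test_stft \<phi> g z) * cmod (u (tf_shift ?psi (fst z) (snd z))))"
    using dual_reconstruction[OF u phi] by blast
  obtain C1 R where C1: "C1 \<ge> 0" "R > 0" "\<And>x \<xi>. cmod (u (tf_shift ?psi x \<xi>)) \<le> C1 * exp (R * aniso x \<xi>)"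
    using dual_tf_shift_bound[OF u psi] by blast
  define I where "I = (LINT z|lborel. exp (- 1 * aniso (fst z) (snd (z :: (real^'d) \<times> (real^'d)))))"
  have I: "I \<ge> 0" unfolding I_def by (rule integral_nonneg_AE) simp
  \<comment> \<open>The admissibility condition of the reconstruction estimate, for one shift at a
    time; here the scale is 0 and the constants may depend on the shift.\<close>
  have decay: "\<exists>C. \<forall>z. cmod (test_stft \<phi> (mult_op ?M a (tf_shift ?psi x \<xi>)) z) \<le> C * exp (- r * aniso (fst z) (snd z))" if r: "r > 0" for r x \<xi>
  proof -
    define X where "X = x - poly_grad Q (- (\<xi> + a))"
    define \<Xi> where "\<Xi> = \<xi> + a"
    have "r * \<kappa> > 0" using r kappa by simp
    from kernel_bound[where Q=Q, OF nu1 m num deg phi(1) psi norm_ge_zero[of \<Xi>] this, of a j]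
    obtain C where C: "C \<ge> 0" "\<And>l x \<xi> x' \<xi>'. l \<ge> 0 \<Longrightarrow> norm (\<xi> + a) \<le> norm \<Xi> * (1 + l powr \<mu>) \<Longrightarrow>
      cmod (test_stft \<phi> (mult_op ?M a (tf_shift ?psi x \<xi>)) (x', \<xi>')) \<le> C * exp (\<nu> * l) * exp (- (r * \<kappa>) * aniso (x' - (x - poly_grad Q (- (\<xi> + a)))) (\<xi>' - (\<xi> + a)))" by blast
    have "cmod (test_stft \<phi> (mult_op ?M a (tf_shift ?psi x \<xi>)) z) \<le> (C * exp (r * \<kappa> * aniso X \<Xi>)) * exp (- r * aniso (fst z) (snd z))" for z
    proof -
      have "cmod (test_stft \<phi> (mult_op ?M a (tf_shift ?psi x \<xi>)) z) \<le> C * exp (- (r * \<kappa>) * aniso (fst z - X) (snd z - \<Xi>))"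
        using C(2)[of 0 \<xi> x "fst z" "snd z"] mu by (simp add: X_def \<Xi>_def)
      also have "- (r * \<kappa>) * aniso (fst z - X) (snd z - \<Xi>) \<le> r * \<kappa> * aniso X \<Xi> + - r * aniso (fst z) (snd z)"
      proof -
        have "r * aniso (fst z) (snd z) \<le> r * (\<kappa> * (aniso (fst z - X) (snd z - \<Xi>) + aniso X \<Xi>))"
          using aniso_add_le[of "fst z - X" X "snd z - \<Xi>" \<Xi>] r by (intro mult_left_mono) (auto simp: \<kappa>_def)
        then show ?thesis by (simp add: algebra_simps)
      qed
      finally show ?thesis using C(1) by (simp add: mult_left_mono mult.assoc flip: exp_add)
    qed
    then show ?thesis by blast
  qed
  have "\<exists>C. \<forall>s>0. \<forall>x \<xi>. (x, \<xi>) \<in> V \<longrightarrow> exp (r * s) * cmod (stft \<phi> (dual_op ?M a u) (s powr \<nu> *\<^sub>R x) (s powr \<mu> *\<^sub>R \<xi>)) \<le> C"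
    if r: "r > 0" for r
  proof -
    define R' where "R' = R * \<kappa>"
    have R': "R' > 0" using C1 kappa by (simp add: R'_def)
    \<comment> \<open>Away from the transported point the kernel must beat its own factor
      \<open>exp (\<nu> s)\<close>, the growth \<open>R' (n + K s)\<close> of the transform of
      \<open>u\<close> and the target rate \<open>r\<close>, with one unit of \<open>n\<close> left
      for integrability. Since \<open>n \<ge> \<epsilon>' s\<close> there, this rate
      suffices.\<close>
    define r' where "r' = R' + 1 + (\<nu> + R' * K + r) / \<epsilon>'"
    have r': "r' \<ge> 1" "r' > 0" "(r' - R' - 1) * \<epsilon>' = \<nu> + R' * K + r" "r' - R' - 1 \<ge> 0"
    proof -
      define q where "q = (\<nu> + R' * K + r) / \<epsilon>'"
      have "q \<ge> 0" using R' nu K r eps' by (simp add: q_def)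
      moreover have "r' = R' + 1 + q" by (simp add: r'_def q_def)
      ultimately show "r' \<ge> 1" "r' > 0" "r' - R' - 1 \<ge> 0" using R' by linarith+
      show "(r' - R' - 1) * \<epsilon>' = \<nu> + R' * K + r" using eps' by (simp add: r'_def)
    qed
    from kernel_bound[where Q=Q, OF nu1 m num deg phi(1) psi B(1) r'(2), of a j]
    obtain C2 where C2: "C2 \<ge> 0" "\<And>l x \<xi> x' \<xi>'. l \<ge> 0 \<Longrightarrow> norm (\<xi> + a) \<le> B * (1 + l powr \<mu>) \<Longrightarrow>
      cmod (test_stft \<phi> (mult_op ?M a (tf_shift ?psi x \<xi>)) (x', \<xi>')) \<le> C2 * exp (\<nu> * l) * exp (- r' * aniso (x' - (x - poly_grad Q (- (\<xi> + a)))) (\<xi>' - (\<xi> + a)))" by blast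
    \<comment> \<open>Near the transported point the decay of the transform of \<open>u\<close> has
      to make up for the factor \<open>exp (\<nu> s)\<close> as well.\<close>
    have "r + \<nu> > 0" using r nu by simp
    from dec[OF this] obtain C3 where C3: "\<And>s x \<xi>. s > 0 \<Longrightarrow> (x, \<xi>) \<in> U \<Longrightarrow> exp ((r + \<nu>) * s) * cmod (stft \<phi> u (s powr \<nu> *\<^sub>R x) (s powr \<mu> *\<^sub>R \<xi>)) \<le> C3" by blast
    define C4 where "C4 = max C1 (\<bar>C3\<bar> / \<kappa>0)"
    have C4: "C4 \<ge> 0" "C1 \<le> C4" "\<bar>C3\<bar> / \<kappa>0 \<le> C4" using C1 by (auto simp: C4_def)
    have large: "exp (r * s) * cmod (stft \<phi> (dual_op ?M a u) (s powr \<nu> *\<^sub>R x) (s powr \<mu> *\<^sub>R \<xi>)) \<le> \<kappa>0 * Cr * C2 * C4 * I"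
      if s: "s \<ge> s1" and xV: "(x, \<xi>) \<in> V" for s x \<xi>
    proof -
      have sp: "s > 0" "s \<ge> 1" "s \<ge> s0" using s by (auto simp: s1_def)
      define X where "X = s powr \<nu> *\<^sub>R x - poly_grad Q (- (s powr \<mu> *\<^sub>R \<xi> + a))"
      define \<Xi> where "\<Xi> = s powr \<mu> *\<^sub>R \<xi> + a"
      have sc: "norm (s powr (- c) *\<^sub>R w) \<le> e" if "norm w \<le> e * s powr c" for w :: "real^'d" and e c
        using that sp by (simp add: powr_minus field_simps)
      have near: "norm (s powr (- \<nu>) *\<^sub>R X - y0) < \<epsilon>" "norm (s powr (- \<mu>) *\<^sub>R \<Xi> - \<xi>0) < \<epsilon>"
        using PP[OF s0[OF sp(3)] V0(3), of "(x, \<xi>)"] xV by (auto simp: V_def X_def \<Xi>_def)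
      have Xb: "norm X \<le> By * s powr \<nu>" and \<Xi>b: "norm \<Xi> \<le> B * s powr \<mu>"
      proof -
        have "norm (s powr (- \<nu>) *\<^sub>R X) \<le> By" using near(1) norm_triangle_sub[of "s powr (- \<nu>) *\<^sub>R X" y0] by (simp add: By_def)
        then show "norm X \<le> By * s powr \<nu>" using sp by (simp add: powr_minus field_simps)
        have "norm (s powr (- \<mu>) *\<^sub>R \<Xi>) \<le> B" using near(2) norm_triangle_sub[of "s powr (- \<mu>) *\<^sub>R \<Xi>" \<xi>0] by (simp add: B_def)
        then show "norm \<Xi> \<le> B * s powr \<mu>" using sp by (simp add: powr_minus field_simps)
      qed
      have NX: "aniso X \<Xi> \<le> K * s"
      proof -
        have "norm X powr (1 / \<nu>) \<le> (By * s powr \<nu>) powr (1 / \<nu>)" using Xb nu by (intro powr_mono2) auto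
        also have "\<dots> = By powr (1 / \<nu>) * s" using sp nu by (simp add: powr_mult powr_powr)
        finally have 1: "norm X powr (1 / \<nu>) \<le> By powr (1 / \<nu>) * s" .
        have "norm \<Xi> powr (1 / \<mu>) \<le> (B * s powr \<mu>) powr (1 / \<mu>)" using \<Xi>b mu by (intro powr_mono2) auto
        also have "\<dots> = B powr (1 / \<mu>) * s" using sp mu by (simp add: powr_mult powr_powr)
        finally show ?thesis using 1 by (simp add: aniso_def K_def distrib_right)
      qed
      define G where "G = mult_op ?M a (tf_shift ?psi (s powr \<nu> *\<^sub>R x) (s powr \<mu> *\<^sub>R \<xi>))"
      have G: "G \<in> gs_space \<nu> \<mu>" unfolding G_def by (rule mult_op_gs_space[OF P tf_shift_gs_space[OF psi]])
      have \<Xi>B: "norm \<Xi> \<le> B * (1 + s powr \<mu>)" using \<Xi>b B(1) by (simp add: distrib_left)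
      have ker: "cmod (test_stft \<phi> G z) \<le> C2 * exp (\<nu> * s) * exp (- r' * aniso (fst z - X) (snd z - \<Xi>))" for z
        using C2(2)[of s "s powr \<mu> *\<^sub>R \<xi>" "s powr \<nu> *\<^sub>R x" "fst z" "snd z"] \<Xi>B sp by (simp add: G_def X_def \<Xi>_def)
      have pt: "cmod (test_stft \<phi> G z) * cmod (u (tf_shift ?psi (fst z) (snd z))) \<le> C2 * C4 * exp (- r * s) * exp (- 1 * aniso (fst z - X) (snd z - \<Xi>))" for z
      proof -
        define n where "n = aniso (fst z - X) (snd z - \<Xi>)"
        have n: "n \<ge> 0" by (simp add: n_def aniso_nonneg)
        \<comment> \<open>With \<open>e\<close> the exponent in the bound for the transform of
          \<open>u\<close>, both regions reduce to one linear inequality between exponents.\<close>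
        have step: "cmod (test_stft \<phi> G z) * cmod (u (tf_shift ?psi (fst z) (snd z))) \<le> C2 * C4 * exp (- r * s) * exp (- 1 * n)"
          if ub: "cmod (u (tf_shift ?psi (fst z) (snd z))) \<le> C4 * exp e" and ee: "\<nu> * s - r' * n + e \<le> - r * s - n" for e
        proof -
          have "cmod (test_stft \<phi> G z) * cmod (u (tf_shift ?psi (fst z) (snd z))) \<le> (C2 * exp (\<nu> * s) * exp (- r' * n)) * (C4 * exp e)"
            using ker[of z] ub C2(1) unfolding n_def by (intro mult_mono) auto
          also have "\<dots> = C2 * C4 * exp (\<nu> * s - r' * n + e)" by (simp add: exp_add exp_diff exp_minus field_simps)
          also have "\<dots> \<le> C2 * C4 * exp (- r * s - n)" using C2(1) C4(1) ee by (intro mult_left_mono) auto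
          finally show ?thesis by (simp add: exp_diff exp_minus field_simps)
        qed
        show ?thesis
        proof (cases "norm (fst z - X) \<le> \<epsilon> * s powr \<nu> \<and> norm (snd z - \<Xi>) \<le> \<epsilon> * s powr \<mu>")
          case True
          define x' where "x' = s powr (- \<nu>) *\<^sub>R fst z"
          define \<xi>' where "\<xi>' = s powr (- \<mu>) *\<^sub>R snd z"
          have z': "fst z = s powr \<nu> *\<^sub>R x'" "snd z = s powr \<mu> *\<^sub>R \<xi>'" using sp by (simp_all add: x'_def \<xi>'_def powr_minus)
          have "norm (x' - y0) \<le> norm (s powr (- \<nu>) *\<^sub>R (fst z - X)) + norm (s powr (- \<nu>) *\<^sub>R X - y0)"
            using norm_triangle_ineq[of "s powr (- \<nu>) *\<^sub>R (fst z - X)" "s powr (- \<nu>) *\<^sub>R X - y0"] by (simp add: x'_def algebra_simps)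
          moreover have "norm (s powr (- \<nu>) *\<^sub>R (fst z - X)) \<le> \<epsilon>" using True by (intro sc) auto
          ultimately have x2: "norm (x' - y0) < 2 * \<epsilon>" using near(1) by linarith
          have "norm (\<xi>' - \<xi>0) \<le> norm (s powr (- \<mu>) *\<^sub>R (snd z - \<Xi>)) + norm (s powr (- \<mu>) *\<^sub>R \<Xi> - \<xi>0)"
            using norm_triangle_ineq[of "s powr (- \<mu>) *\<^sub>R (snd z - \<Xi>)" "s powr (- \<mu>) *\<^sub>R \<Xi> - \<xi>0"] by (simp add: \<xi>'_def algebra_simps)
          moreover have "norm (s powr (- \<mu>) *\<^sub>R (snd z - \<Xi>)) \<le> \<epsilon>" using True by (intro sc) auto
          ultimately have xi2: "norm (\<xi>' - \<xi>0) < 2 * \<epsilon>" using near(2) by linarith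
          have "exp ((r + \<nu>) * s) * (\<kappa>0 * cmod (u (tf_shift ?psi (fst z) (snd z)))) \<le> C3"
            using C3[OF sp(1) epsU[OF x2 xi2]] unfolding z' stft_abs by simp
          then have "exp ((r + \<nu>) * s) * (\<kappa>0 * cmod (u (tf_shift ?psi (fst z) (snd z)))) \<le> \<bar>C3\<bar>" by linarith
          moreover have "exp (- (r + \<nu>) * s) = 1 / exp ((r + \<nu>) * s)"
            by (simp only: mult_minus_left exp_minus inverse_eq_divide)
          ultimately have "cmod (u (tf_shift ?psi (fst z) (snd z))) \<le> (\<bar>C3\<bar> / \<kappa>0) * exp (- (r + \<nu>) * s)"
            using k0 exp_gt_zero[of "(r + \<nu>) * s"] by (simp only:) (simp add: field_simps del: exp_gt_zero)
          also have "\<dots> \<le> C4 * exp (- (r + \<nu>) * s)" using C4 by (intro mult_right_mono) auto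
          finally have ub: "cmod (u (tf_shift ?psi (fst z) (snd z))) \<le> C4 * exp (- (r + \<nu>) * s)" .
          have "1 * n \<le> r' * n" using r' n by (intro mult_right_mono) auto
          then have "\<nu> * s - r' * n + - (r + \<nu>) * s \<le> - r * s - n" by (simp add: algebra_simps)
          from step[OF ub this] show ?thesis by (simp add: n_def)
        next
          case False
          have big: "\<epsilon>' * s \<le> n"
          proof (cases "norm (fst z - X) \<le> \<epsilon> * s powr \<nu>")
            case True
            with False have "\<epsilon> * s powr \<mu> \<le> norm (snd z - \<Xi>)" by simp
            then have "(\<epsilon> * s powr \<mu>) powr (1 / \<mu>) \<le> norm (snd z - \<Xi>) powr (1 / \<mu>)" using mu eps sp by (intro powr_mono2) auto
            moreover have "(\<epsilon> * s powr \<mu>) powr (1 / \<mu>) = \<epsilon> powr (1 / \<mu>) * s" using sp mu by (simp add: powr_mult powr_powr)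
            moreover have "\<epsilon>' * s \<le> \<epsilon> powr (1 / \<mu>) * s" using sp by (intro mult_right_mono) (auto simp: \<epsilon>'_def)
            ultimately show ?thesis by (simp add: n_def aniso_def add_increasing)
          next
            case False
            then have "\<epsilon> * s powr \<nu> \<le> norm (fst z - X)" by simp
            then have "(\<epsilon> * s powr \<nu>) powr (1 / \<nu>) \<le> norm (fst z - X) powr (1 / \<nu>)" using nu eps sp by (intro powr_mono2) auto
            moreover have "(\<epsilon> * s powr \<nu>) powr (1 / \<nu>) = \<epsilon> powr (1 / \<nu>) * s" using sp nu by (simp add: powr_mult powr_powr)
            moreover have "\<epsilon>' * s \<le> \<epsilon> powr (1 / \<nu>) * s" using sp by (intro mult_right_mono) (auto simp: \<epsilon>'_def)
            ultimately show ?thesis by (simp add: n_def aniso_def add_increasing2)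
          qed
          have Nz: "aniso (fst z) (snd z) \<le> \<kappa> * (n + K * s)"
          proof -
            have "aniso (fst z) (snd z) \<le> \<kappa> * (n + aniso X \<Xi>)"
              using aniso_add_le[of "fst z - X" X "snd z - \<Xi>" \<Xi>] by (simp add: \<kappa>_def n_def)
            also have "\<dots> \<le> \<kappa> * (n + K * s)" using kappa NX by (intro mult_left_mono) auto
            finally show ?thesis .
          qed
          have "cmod (u (tf_shift ?psi (fst z) (snd z))) \<le> C1 * exp (R * aniso (fst z) (snd z))" by (rule C1(3))
          moreover have "R * aniso (fst z) (snd z) \<le> R' * (n + K * s)"
            using mult_left_mono[OF Nz, of R] C1(2) by (simp add: R'_def mult.assoc)
          then have "C1 * exp (R * aniso (fst z) (snd z)) \<le> C4 * exp (R' * (n + K * s))"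
            by (intro mult_mono) (use C4 in auto)
          ultimately have ub: "cmod (u (tf_shift ?psi (fst z) (snd z))) \<le> C4 * exp (R' * (n + K * s))" by linarith
          have "(\<nu> + R' * K + r) * s \<le> (r' - R' - 1) * n"
            using mult_left_mono[OF big r'(4)] r'(3) by (simp add: mult.assoc[symmetric])
          then have "\<nu> * s - r' * n + R' * (n + K * s) \<le> - r * s - n" by (simp add: algebra_simps)
          from step[OF ub this] show ?thesis by (simp add: n_def)
        qed
      qed
      have "cmod (u G) \<le> Cr * (LINT z|lborel. cmod (test_stft \<phi> G z) * cmod (u (tf_shift ?psi (fst z) (snd z))))"
        by (rule Cr(2)[OF G]) (use decay in \<open>auto simp: G_def\<close>)
      also have "\<dots> \<le> Cr * (LINT z|lborel. C2 * C4 * exp (- r * s) * exp (- 1 * aniso (fst z - X) (snd z - \<Xi>)))"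
        using Cr(1) C2(1) C4(1)
        by (intro mult_left_mono integral_le_of_le pt integrable_mult_right integral_exp_aniso_shift(1)) auto
      also have "\<dots> = Cr * (C2 * C4 * exp (- r * s) * I)"
        unfolding I_def using integral_exp_aniso_shift(2)[of X \<Xi>] by simp
      finally have ug: "cmod (u G) \<le> Cr * (C2 * C4 * exp (- r * s) * I)" .
      have "cmod (stft \<phi> (dual_op ?M a u) (s powr \<nu> *\<^sub>R x) (s powr \<mu> *\<^sub>R \<xi>)) = \<kappa>0 * cmod (u G)"
        unfolding stft_abs dual_op_def G_def using tf_shift_gs_space[OF psi] by simp
      also have "\<dots> \<le> \<kappa>0 * (Cr * (C2 * C4 * exp (- r * s) * I))" using ug k0 by (intro mult_left_mono) auto
      finally have "exp (r * s) * cmod (stft \<phi> (dual_op ?M a u) (s powr \<nu> *\<^sub>R x) (s powr \<mu> *\<^sub>R \<xi>)) \<le> exp (r * s) * (\<kappa>0 * (Cr * (C2 * C4 * exp (- r * s) * I)))"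
        by (intro mult_left_mono) auto
      also have "\<dots> = \<kappa>0 * Cr * C2 * C4 * I * (exp (r * s) * exp (- r * s))" by simp
      also have "exp (r * s) * exp (- r * s) = 1" by (simp flip: exp_add)
      finally show ?thesis by simp
    qed
    obtain C5 R5 where C5: "C5 \<ge> 0" "R5 > 0" "\<And>x \<xi>. cmod (dual_op ?M a u (tf_shift ?psi x \<xi>)) \<le> C5 * exp (R5 * aniso x \<xi>)"
      using dual_tf_shift_bound[OF Tu psi] by blast
    define N1 where "N1 = (norm z0 + 1) powr (1 / \<nu>) + (norm z0 + 1) powr (1 / \<mu>)"
    \<comment> \<open>Below the threshold the scaled points stay in a bounded set, where the general
      exponential bound suffices.\<close>
    have small: "exp (r * s) * cmod (stft \<phi> (dual_op ?M a u) (s powr \<nu> *\<^sub>R x) (s powr \<mu> *\<^sub>R \<xi>)) \<le> exp (r * s1) * (\<kappa>0 * (C5 * exp (R5 * (s1 * N1))))"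
      if s: "0 < s" "s \<le> s1" and xV: "(x, \<xi>) \<in> V" for s x \<xi>
    proof -
      have nz: "norm (x, \<xi>) \<le> norm z0 + 1"
        using xV norm_triangle_sub[of "(x, \<xi>)" z0] by (simp add: V_def dist_norm norm_minus_commute)
      have nx: "norm x \<le> norm z0 + 1" "norm \<xi> \<le> norm z0 + 1"
        using nz norm_fst_le[of x \<xi>] norm_snd_le[of \<xi> x] by linarith+
      have "aniso x \<xi> \<le> N1" unfolding aniso_def N1_def using nx nu mu by (intro add_mono powr_mono2) auto
      then have "s * aniso x \<xi> \<le> s1 * N1" using s aniso_nonneg[of x \<xi>] by (intro mult_mono) auto
      then have e: "C5 * exp (R5 * aniso (s powr \<nu> *\<^sub>R x) (s powr \<mu> *\<^sub>R \<xi>)) \<le> C5 * exp (R5 * (s1 * N1))"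
        unfolding aniso_scale[OF s(1)] using C5 by (intro mult_left_mono) auto
      show ?thesis
        unfolding stft_abs using s r k0 by (intro mult_mono mult_left_mono order_trans[OF C5(3) e]) auto
    qed
    show ?thesis
    proof (intro exI allI impI)
      fix s :: real and x \<xi> assume s: "s > 0" and xV: "(x, \<xi>) \<in> V"
      show "exp (r * s) * cmod (stft \<phi> (dual_op ?M a u) (s powr \<nu> *\<^sub>R x) (s powr \<mu> *\<^sub>R \<xi>)) \<le> max (\<kappa>0 * Cr * C2 * C4 * I) (exp (r * s1) * (\<kappa>0 * (C5 * exp (R5 * (s1 * N1)))))"
        using large[OF _ xV, of s] small[OF s _ xV] by (cases "s \<ge> s1") auto
    qed
  qed
  then show ?thesis using V by blast
qed

lemma gs_WF_iff:
  "z \<in> gs_WF \<nu> \<mu> \<phi> u \<longleftrightarrow> z \<noteq> 0 \<and> \<not> (\<exists>U. open U \<and> U \<subseteq> - {0} \<and> z \<in> U \<and>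
     (\<forall>r>0. \<exists>C. \<forall>s>0. \<forall>x \<xi>. (x, \<xi>) \<in> U \<longrightarrow> exp (r * s) * cmod (stft \<phi> u (s powr \<nu> *\<^sub>R x) (s powr \<mu> *\<^sub>R \<xi>)) \<le> C))"
proof -
  have "bdd_above {exp (r * s) * cmod (stft \<phi> u (s powr \<nu> *\<^sub>R x) (s powr \<mu> *\<^sub>R \<xi>)) |s x \<xi>. s > 0 \<and> (x, \<xi>) \<in> U}
     \<longleftrightarrow> (\<exists>C. \<forall>s>0. \<forall>x \<xi>. (x, \<xi>) \<in> U \<longrightarrow> exp (r * s) * cmod (stft \<phi> u (s powr \<nu> *\<^sub>R x) (s powr \<mu> *\<^sub>R \<xi>)) \<le> C)" for r U
    unfolding bdd_above_def by blast
  then show ?thesis unfolding gs_WF_def by simp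
qed

end

subsection \<open>The limit of the rescaled flow\<close>

lemma poly_sum_le:
  fixes p :: "real poly"
  assumes "degree p \<le> m"
  shows "poly p x = (\<Sum>i\<le>m. coeff p i * x ^ i)"
  unfolding poly_altdef by (intro sum.mono_neutral_left) (use assms in \<open>auto simp: coeff_eq_0\<close>)

text \<open>A difference of \<open>i\<close>-th powers has the factor \<open>h\<close> and behaves
  like degree \<open>i - 1\<close>, so the expression scales like
  \<open>s^(\<mu> (i - 1) - \<nu>)\<close>; for \<open>i \<ge> 1\<close> this exponent is negative
  unless \<open>i = m\<close> and \<open>\<nu> = \<mu> (m - 1)\<close>. The limit is joint in both
  variables because the wave front set asks for a whole neighbourhood.\<close>

lemma tendsto_monomial_difference:
  fixes \<nu> \<mu> h y0 :: real
  assumes mu: "\<mu> > 0" and num: "\<mu> * (real m - 1) \<le> \<nu>" and i: "i \<le> m" and m: "m \<ge> 1"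
  shows "((\<lambda>z. fst z powr (- \<nu>) * ((fst z powr \<mu> * snd z) ^ i - (fst z powr \<mu> * snd z + h) ^ i)) \<longlongrightarrow>
     (if i = m \<and> \<nu> = \<mu> * (real m - 1) then - h * real m * y0 ^ (m - 1) else 0)) (at_top \<times>\<^sub>F nhds y0)"
proof (cases "i = 0")
  case True
  then show ?thesis using m by simp
next
  case False
  define F where "F = (at_top :: real filter) \<times>\<^sub>F nhds y0"
  have f1: "filterlim fst at_top F" and f2: "(snd \<longlongrightarrow> y0) F" unfolding F_def by (rule filterlim_fst filterlim_snd)+
  have pos: "\<forall>\<^sub>F z in F. fst z > 0" using f1 eventually_gt_at_top[of 0] unfolding filterlim_iff by blast
  have t0: "((\<lambda>z. fst z powr (- \<mu>)) \<longlongrightarrow> 0) F" by (rule tendsto_neg_powr[OF _ f1]) (use mu in simp)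
  define e where "e = \<mu> * (real i - 1) - \<nu>"
  define L where "L = (if e = 0 then 1 else 0 :: real)"
  have "\<mu> * (real i - 1) \<le> \<mu> * (real m - 1)" using i mu by (intro mult_left_mono) auto
  then have e0: "e \<le> 0" using num by (simp add: e_def)
  have eL: "(e = 0) = (i = m \<and> \<nu> = \<mu> * (real m - 1))"
  proof
    assume "e = 0"
    then have "\<mu> * (real m - 1) \<le> \<mu> * (real i - 1)" using num by (simp add: e_def)
    then have "real m \<le> real i" using mu by (simp add: mult_le_cancel_left_pos)
    then show "i = m \<and> \<nu> = \<mu> * (real m - 1)" using i \<open>e = 0\<close> by (simp add: e_def)
  qed (simp add: e_def)
  have te: "((\<lambda>z. fst z powr e) \<longlongrightarrow> L) F"
  proof (cases "e = 0")
    case True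
    have "\<forall>\<^sub>F z in F. fst z powr e = L" using pos by eventually_elim (simp add: True L_def)
    then show ?thesis by (simp add: tendsto_eventually)
  next
    case False
    then show ?thesis using e0 tendsto_neg_powr[OF _ f1, of e] by (simp add: L_def)
  qed
  have "((\<lambda>z. - h * (\<Sum>j<i. fst z powr e * ((snd z + h * fst z powr (- \<mu>)) ^ (i - Suc j) * snd z ^ j))) \<longlongrightarrow>
      - h * (\<Sum>j<i. L * ((y0 + h * 0) ^ (i - Suc j) * y0 ^ j))) F"
    by (intro tendsto_intros te t0 f2)
  also have "(\<Sum>j<i. L * ((y0 + h * 0) ^ (i - Suc j) * y0 ^ j)) = (\<Sum>j<i. L * y0 ^ (i - 1))"
    by (intro sum.cong) (auto simp flip: power_add)
  also have "- h * (\<Sum>j<i. L * y0 ^ (i - 1)) = (if i = m \<and> \<nu> = \<mu> * (real m - 1) then - h * real m * y0 ^ (m - 1) else 0)"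
    by (auto simp: L_def eL)
  finally have "((\<lambda>z. - h * (\<Sum>j<i. fst z powr e * ((snd z + h * fst z powr (- \<mu>)) ^ (i - Suc j) * snd z ^ j))) \<longlongrightarrow>
      (if i = m \<and> \<nu> = \<mu> * (real m - 1) then - h * real m * y0 ^ (m - 1) else 0)) F" .
  moreover have "\<forall>\<^sub>F z in F. - h * (\<Sum>j<i. fst z powr e * ((snd z + h * fst z powr (- \<mu>)) ^ (i - Suc j) * snd z ^ j))
      = fst z powr (- \<nu>) * ((fst z powr \<mu> * snd z) ^ i - (fst z powr \<mu> * snd z + h) ^ i)"
    using pos
  proof eventually_elim
    fix z :: "real \<times> real" assume z: "fst z > 0"
    define s where "s = fst z powr \<mu>"
    have s: "s > 0" using z by (simp add: s_def)
    have b: "s * snd z + h = s * (snd z + h * fst z powr (- \<mu>))" using z by (simp add: s_def powr_minus field_simps)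
    have pe: "fst z powr (- \<nu>) * s ^ (i - 1) = fst z powr e"
    proof -
      have "s ^ (i - 1) = fst z powr (\<mu> * real (i - 1))" using z by (simp add: s_def powr_realpow[symmetric] powr_powr)
      then show ?thesis using False by (simp add: e_def of_nat_diff flip: powr_add)
    qed
    have "fst z powr (- \<nu>) * ((s * snd z) ^ i - (s * snd z + h) ^ i)
        = fst z powr (- \<nu>) * ((- h) * (\<Sum>j<i. (s * snd z + h) ^ (i - Suc j) * (s * snd z) ^ j))"
      by (subst power_diff_sumr2) simp
    also have "\<dots> = - h * (\<Sum>j<i. fst z powr (- \<nu>) * ((s * snd z + h) ^ (i - Suc j) * (s * snd z) ^ j))"
      by (simp add: sum_distrib_left mult_ac)
    also have "(\<Sum>j<i. fst z powr (- \<nu>) * ((s * snd z + h) ^ (i - Suc j) * (s * snd z) ^ j))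
        = (\<Sum>j<i. fst z powr e * ((snd z + h * fst z powr (- \<mu>)) ^ (i - Suc j) * snd z ^ j))"
    proof (intro sum.cong refl)
      fix j assume "j \<in> {..<i}"
      then have j: "i - 1 = (i - Suc j) + j" by simp
      show "fst z powr (- \<nu>) * ((s * snd z + h) ^ (i - Suc j) * (s * snd z) ^ j) = fst z powr e * ((snd z + h * fst z powr (- \<mu>)) ^ (i - Suc j) * snd z ^ j)"
        unfolding b pe[symmetric] power_mult_distrib by (subst j) (simp add: power_add)
    qed
    finally show "- h * (\<Sum>j<i. fst z powr e * ((snd z + h * fst z powr (- \<mu>)) ^ (i - Suc j) * snd z ^ j))
      = fst z powr (- \<nu>) * ((fst z powr \<mu> * snd z) ^ i - (fst z powr \<mu> * snd z + h) ^ i)" by (simp add: s_def)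
  qed
  ultimately show ?thesis unfolding F_def by (rule Lim_transform_eventually)
qed

text \<open>Of all monomials only the one of degree \<open>m\<close> can contribute; its coefficient
  is 0 if the degree of \<open>p\<close> is smaller.\<close>

lemma tendsto_poly_difference:
  fixes \<nu> \<mu> h y0 :: real
  assumes mu: "\<mu> > 0" and num: "\<mu> * (real m - 1) \<le> \<nu>" and deg: "degree p \<le> m" and m: "m \<ge> 1"
  shows "((\<lambda>z. fst z powr (- \<nu>) * (poly p (fst z powr \<mu> * snd z) - poly p (fst z powr \<mu> * snd z + h))) \<longlongrightarrow>
     (if \<nu> = \<mu> * (real m - 1) then - h * real m * coeff p m * y0 ^ (m - 1) else 0)) (at_top \<times>\<^sub>F nhds y0)"
proof -
  have "((\<lambda>z. \<Sum>i\<le>m. coeff p i * (fst z powr (- \<nu>) * ((fst z powr \<mu> * snd z) ^ i - (fst z powr \<mu> * snd z + h) ^ i))) \<longlongrightarrow>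
     (\<Sum>i\<le>m. coeff p i * (if i = m \<and> \<nu> = \<mu> * (real m - 1) then - h * real m * y0 ^ (m - 1) else 0))) (at_top \<times>\<^sub>F nhds y0)"
    by (intro tendsto_sum tendsto_mult_left tendsto_monomial_difference mu num m) simp
  also have "(\<Sum>i\<le>m. coeff p i * (if i = m \<and> \<nu> = \<mu> * (real m - 1) then - h * real m * y0 ^ (m - 1) else 0))
      = (\<Sum>i\<le>m. if i = m then (if \<nu> = \<mu> * (real m - 1) then - h * real m * coeff p m * y0 ^ (m - 1) else 0) else 0)"
    by (intro sum.cong) auto
  also have "\<dots> = (if \<nu> = \<mu> * (real m - 1) then - h * real m * coeff p m * y0 ^ (m - 1) else 0)"
    by (simp add: sum.delta)
  finally show ?thesis
    by (simp add: poly_sum_le[OF deg] sum_subtractf[symmetric] sum_distrib_left algebra_simps)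
qed

subsection \<open>The solution operator\<close>

text \<open>The leading coefficients cancel. This brings the phase, a difference of shifted
  primitives, from degree \<open>m + 1\<close> down to \<open>m\<close>.\<close>

lemma degree_diff_shift:
  fixes q :: "real poly"
  assumes "degree q \<le> Suc m"
  shows "degree (q - pcompose q [:h, 1:]) \<le> m"
proof (cases "degree q = 0")
  case True
  then obtain c where "q = [:c:]" by (metis degree_eq_zeroE)
  then show ?thesis by simp
next
  case False
  let ?r = "pcompose q [:h, 1:]"
  have d: "degree ?r = degree q" by (simp add: degree_pcompose)
  have "lead_coeff ?r = lead_coeff q" by (subst lead_coeff_comp) auto
  then have c: "coeff (q - ?r) (degree q) = 0" using d by simp
  have "degree (q - ?r) \<le> degree q" using d degree_diff_le[of q "degree q" ?r] by simp
  then have "degree (q - ?r) < degree q"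
    using c False by (metis leading_coeff_0_iff le_neq_implies_less degree_0 neq0_conv)
  then show ?thesis using assms by simp
qed

text \<open>One component of \<open>phase v q t\<close> after the substitution
  \<open>\<xi> = \<eta> + t v\<close>, written as a polynomial.\<close>

definition sol_phase :: "real^'d::finite \<Rightarrow> ('d \<Rightarrow> real poly) \<Rightarrow> real \<Rightarrow> 'd \<Rightarrow> real poly" where
  "sol_phase v q t l = smult (1 / v $ l) (q l - pcompose (q l) [:t * v $ l, 1:])"

text \<open>The phase of the transpose of the solution operator.\<close>

definition adj_phase :: "real^'d::finite \<Rightarrow> ('d \<Rightarrow> real poly) \<Rightarrow> real \<Rightarrow> 'd \<Rightarrow> real poly" where
  "adj_phase v q t l = pcompose (sol_phase v q t l) [:- (t * v $ l), -1:]"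

lemma poly_sol_phase: "poly (sol_phase v q t l) y = (poly (q l) y - poly (q l) (y + t * v $ l)) / v $ l"
  by (simp add: sol_phase_def poly_pcompose add.commute)

lemma poly_adj_phase: "poly (adj_phase v q t l) y = poly (sol_phase v q t l) (- y - t * v $ l)"
  by (simp add: adj_phase_def poly_pcompose algebra_simps)

lemma degree_sol_phase:
  assumes "pderiv (q l) = p" "degree p \<le> m"
  shows "degree (sol_phase v q t l) \<le> m" "degree (adj_phase v q t l) \<le> m"
proof -
  have "degree (q l) \<le> Suc m" using assms by (metis degree_pderiv Suc_le_mono Suc_pred' diff_le_self le_SucI le_diff_conv add.commute plus_1_eq_Suc)
  then show 1: "degree (sol_phase v q t l) \<le> m"
    unfolding sol_phase_def by (intro order_trans[OF degree_smult_le] degree_diff_shift)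
  then show "degree (adj_phase v q t l) \<le> m" by (simp add: adj_phase_def degree_pcompose)
qed

text \<open>The gradient is a difference quotient of \<open>p\<close> with step \<open>t v\<close>,
  to leading order \<open>t\<close> times the gradient of the symbol; subtracting it from
  \<open>x\<close> leads to the preimage under the flow.\<close>

lemma poly_grad_adj_phase:
  assumes "\<And>l. pderiv (q l) = p l"
  shows "poly_grad (adj_phase v q t) (- (\<xi> + t *\<^sub>R v)) $ l = - ((poly (p l) (\<xi> $ l) - poly (p l) (\<xi> $ l + t * v $ l)) / v $ l)"
proof -
  have d: "pderiv (sol_phase v q t l) = smult (1 / v $ l) (p l - pcompose (p l) [:t * v $ l, 1:])"
    using assms by (simp add: sol_phase_def pderiv_smult pderiv_diff pderiv_pcompose pderiv_pCons)
  have "pderiv (adj_phase v q t l) = - pcompose (pderiv (sol_phase v q t l)) [:- (t * v $ l), -1:]"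
    by (simp add: adj_phase_def pderiv_pcompose pderiv_pCons)
  then show ?thesis by (simp add: poly_grad_def d poly_pcompose add.commute)
qed

context gs
begin

text \<open>The substitution \<open>\<xi> = \<eta> + t v\<close> absorbs the factor
  \<open>exp (- i t (x \<bullet> v))\<close> into the character, and the two normalisations combine
  to \<open>(2 pi)^(-d)\<close>.\<close>

lemma solution_op_eq_mult_op:
  fixes v :: "real^'d::finite"
  assumes P: "gs_multiplier (poly_phase (sol_phase v q t))" and f: "f \<in> gs_space \<nu> \<mu>"
  shows "solution_op v q t f = mult_op (poly_phase (sol_phase v q t) j 0) (t *\<^sub>R v) f"
proof
  fix x :: "real^'d"
  define c where "c = complex_of_real ((2 * pi) powr (- (real CARD('d) / 2)))"
  have cc: "c * c = 1 / (2 * pi) ^ CARD('d)"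
  proof -
    have "(2 * pi) powr (- (real CARD('d) / 2)) * (2 * pi) powr (- (real CARD('d) / 2)) = (2 * pi) powr (- real CARD('d))"
      by (simp flip: powr_add)
    also have "\<dots> = 1 / (2 * pi) ^ CARD('d)" by (simp add: powr_minus powr_realpow divide_inverse)
    finally show ?thesis unfolding c_def by (metis of_real_mult of_real_divide of_real_1 of_real_power of_real_numeral)
  qed
  define E where "E \<xi> = exp (\<i> * of_real (phase v q t \<xi>)) * ft f \<xi> * exp (\<i> * of_real (x \<bullet> \<xi>))" for \<xi>
  have ph: "(\<Sum>l\<in>UNIV. poly (sol_phase v q t l) (\<eta> $ l)) = phase v q t (\<eta> + t *\<^sub>R v)" for \<eta>
    unfolding phase_def poly_sol_phase by (intro sum.cong) (auto simp: field_simps)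
  have cph: "continuous_on UNIV (phase v q t)" unfolding phase_def by (intro continuous_intros)
  have mE: "E \<in> borel_measurable borel"
    unfolding E_def by (intro borel_measurable_continuous_onI continuous_intros cph ft_continuous gs_wt_dom f)
  have "solution_op v q t f x = c * c * (exp (- \<i> * of_real (t * (x \<bullet> v))) * (LINT \<xi>|lborel. E \<xi>))"
  proof -
    have "fourier f \<xi> = c * ft f \<xi>" for \<xi> by (simp add: fourier_def ft_def c_def)
    then have "inv_fourier (\<lambda>\<xi>. exp (\<i> * of_real (phase v q t \<xi>)) * fourier f \<xi>) x = c * (LINT \<xi>|lborel. c * E \<xi>)"
      unfolding inv_fourier_def c_def[symmetric] E_def by (simp add: mult_ac)
    then show ?thesis unfolding solution_op_def by simp
  qed
  also have "(LINT \<xi>|lborel. E \<xi>) = (LINT \<eta>|lborel. E (\<eta> + t *\<^sub>R v))" by (rule integral_lborel_shift[OF mE, symmetric])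
  also have "exp (- \<i> * of_real (t * (x \<bullet> v))) * (LINT \<eta>|lborel. E (\<eta> + t *\<^sub>R v)) = (LINT \<eta>|lborel. exp (- \<i> * of_real (t * (x \<bullet> v))) * E (\<eta> + t *\<^sub>R v))"
    by simp
  also have "\<dots> = ft (\<lambda>\<eta>. poly_phase (sol_phase v q t) j 0 \<eta> * ft f (\<eta> + t *\<^sub>R v)) (- x)"
    unfolding ft_def
  proof (rule Bochner_Integration.integral_cong[OF refl], fold ft_def)
    fix \<eta>
    have "exp (- \<i> * of_real (t * (x \<bullet> v))) * exp (\<i> * of_real (x \<bullet> (\<eta> + t *\<^sub>R v))) = exp (- \<i> * of_real (\<eta> \<bullet> (- x)))"
      by (simp add: inner_add_right inner_commute algebra_simps flip: exp_add)
    note key = this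
    have "exp (- \<i> * of_real (t * (x \<bullet> v))) * E (\<eta> + t *\<^sub>R v)
        = poly_phase (sol_phase v q t) j 0 \<eta> * ft f (\<eta> + t *\<^sub>R v) * (exp (- \<i> * of_real (t * (x \<bullet> v))) * exp (\<i> * of_real (x \<bullet> (\<eta> + t *\<^sub>R v))))"
      unfolding poly_phase_0 ph E_def by (simp only: mult_ac)
    then show "exp (- \<i> * of_real (t * (x \<bullet> v))) * E (\<eta> + t *\<^sub>R v)
        = poly_phase (sol_phase v q t) j 0 \<eta> * ft f (\<eta> + t *\<^sub>R v) * exp (- \<i> * of_real (\<eta> \<bullet> (- x)))"
      unfolding key .
  qed
  finally show "solution_op v q t f x = mult_op (poly_phase (sol_phase v q t) j 0) (t *\<^sub>R v) f x" unfolding cc mult_op_def by simp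
qed

lemma continuous_map_weak_star_eval: "continuous_map (weak_star \<nu> \<mu>) euclidean (\<lambda>u. u g)"
  unfolding weak_star_def by (intro continuous_map_from_subtopology continuous_map_product_projection) simp

text \<open>\<open>adj_phase\<close> is the phase required by \<open>mult_op_transpose\<close>, so
  composition with its multiplier agrees with the solution operator on embedded functions. In the
  weak* topology continuity is checked on single evaluations.\<close>

lemma dual_op_extension:
  fixes v :: "real^'d::finite"
  assumes P: "gs_multiplier (poly_phase (sol_phase v q t))" and P': "gs_multiplier (poly_phase (adj_phase v q t))"
  shows "dual_extension \<nu> \<mu> (solution_op v q t) (restrict (dual_op (poly_phase (adj_phase v q t) j 0) (t *\<^sub>R v)) (gs_dual \<nu> \<mu>))"
    (is "dual_extension _ _ _ (restrict ?T _)")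
  unfolding dual_extension_def
proof (intro conjI ballI allI)
  show "restrict ?T (gs_dual \<nu> \<mu>) \<in> extensional (gs_dual \<nu> \<mu>)" by simp
  show "continuous_map (weak_star \<nu> \<mu>) (weak_star \<nu> \<mu>) (restrict ?T (gs_dual \<nu> \<mu>))"
  proof -
    have "continuous_map (weak_star \<nu> \<mu>) (product_topology (\<lambda>_. euclidean) UNIV) (restrict ?T (gs_dual \<nu> \<mu>))"
      unfolding continuous_map_componentwise_UNIV
    proof
      fix g
      show "continuous_map (weak_star \<nu> \<mu>) euclidean (\<lambda>u. restrict ?T (gs_dual \<nu> \<mu>) u g)"
      proof (cases "g \<in> gs_space \<nu> \<mu>")
        case True
        show ?thesis
          by (rule continuous_map_eq[OF continuous_map_weak_star_eval[of "mult_op (poly_phase (adj_phase v q t) j 0) (t *\<^sub>R v) g"]])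
             (use True in \<open>simp add: topspace_weak_star dual_op_def\<close>)
      next
        case False
        show ?thesis
          by (rule continuous_map_eq[where f="\<lambda>_. 0"]) (use False in \<open>auto simp: topspace_weak_star dual_op_def\<close>)
      qed
    qed
    moreover have "restrict ?T (gs_dual \<nu> \<mu>) \<in> topspace (weak_star \<nu> \<mu>) \<rightarrow> gs_dual \<nu> \<mu>"
      using dual_op_dual[OF P'] by (auto simp: topspace_weak_star)
    ultimately have "continuous_map (weak_star \<nu> \<mu>) (subtopology (product_topology (\<lambda>_. euclidean) UNIV) (gs_dual \<nu> \<mu>)) (restrict ?T (gs_dual \<nu> \<mu>))"
      by (auto simp: continuous_map_in_subtopology)
    then show ?thesis by (simp only: weak_star_def[of \<nu> \<mu>, symmetric])
  qed
  show "restrict ?T (gs_dual \<nu> \<mu>) (\<lambda>f. a * u f + b * w f) = (\<lambda>f. a * restrict ?T (gs_dual \<nu> \<mu>) u f + b * restrict ?T (gs_dual \<nu> \<mu>) w f)"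
    if "u \<in> gs_dual \<nu> \<mu>" "w \<in> gs_dual \<nu> \<mu>" for u w a b
    using that gs_dual_combination[OF that, of a b] by (auto simp: dual_op_def fun_eq_iff)
  show "restrict ?T (gs_dual \<nu> \<mu>) (gs_embed \<nu> \<mu> f) = gs_embed \<nu> \<mu> (solution_op v q t f)" if f: "f \<in> gs_space \<nu> \<mu>" for f
  proof
    fix g
    have PP: "poly_phase (adj_phase v q t) j 0 \<eta> = poly_phase (sol_phase v q t) j 0 (- \<eta> - t *\<^sub>R v)" for \<eta>
      by (simp add: poly_phase_0 poly_adj_phase)
    have R: "restrict ?T (gs_dual \<nu> \<mu>) (gs_embed \<nu> \<mu> f) = ?T (gs_embed \<nu> \<mu> f)" using gs_embed_dual[OF f] by simp
    show "restrict ?T (gs_dual \<nu> \<mu>) (gs_embed \<nu> \<mu> f) g = gs_embed \<nu> \<mu> (solution_op v q t f) g"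
    proof (cases "g \<in> gs_space \<nu> \<mu>")
      case True
      have "gs_embed \<nu> \<mu> f (mult_op (poly_phase (adj_phase v q t) j 0) (t *\<^sub>R v) g) = (LINT x|lborel. mult_op (poly_phase (sol_phase v q t) j 0) (t *\<^sub>R v) f x * g x)"
        using mult_op_transpose[where P=\<open>poly_phase (sol_phase v q t)\<close> and P'=\<open>poly_phase (adj_phase v q t)\<close>, OF P P' PP f True] mult_op_gs_space[OF P' True]
        by (simp add: gs_embed_def)
      then show ?thesis unfolding R using True solution_op_eq_mult_op[OF P f, of j] by (simp add: dual_op_def gs_embed_def)
    next
      case False
      then show ?thesis unfolding R by (simp add: dual_op_def gs_embed_def)
    qed
  qed
qed

text \<open>On the Fourier side the two translations cancel, and the phases for \<open>t\<close> and
  \<open>- t\<close>, taken at mutually shifted points, add up to 0.\<close>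

lemma dual_op_inverse:
  fixes v :: "real^'d::finite"
  assumes P: "\<And>t. gs_multiplier (poly_phase (adj_phase v q t))" and u: "u \<in> gs_dual \<nu> \<mu>"
  shows "dual_op (poly_phase (adj_phase v q (- t)) j 0) ((- t) *\<^sub>R v) (dual_op (poly_phase (adj_phase v q t) j 0) (t *\<^sub>R v) u) = u"
proof
  fix g
  let ?S = "\<lambda>t. mult_op (poly_phase (adj_phase v q t) j 0) (t *\<^sub>R v)"
  show "dual_op (poly_phase (adj_phase v q (- t)) j 0) ((- t) *\<^sub>R v) (dual_op (poly_phase (adj_phase v q t) j 0) (t *\<^sub>R v) u) g = u g"
  proof (cases "g \<in> gs_space \<nu> \<mu>")
    case True
    have g1: "?S (- t) g \<in> gs_space \<nu> \<mu>" by (rule mult_op_gs_space[OF P True])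
    have g2: "?S t (?S (- t) g) \<in> gs_space \<nu> \<mu>" by (rule mult_op_gs_space[OF P g1])
    have "ft (?S t (?S (- t) g)) \<eta> = ft g \<eta>" for \<eta>
    proof -
      have "(\<Sum>l\<in>UNIV. poly (adj_phase v q t l) (\<eta> $ l)) + (\<Sum>l\<in>UNIV. poly (adj_phase v q (- t) l) ((\<eta> + t *\<^sub>R v) $ l)) = 0"
        unfolding sum.distrib[symmetric] poly_adj_phase poly_sol_phase
        by (intro sum.neutral ballI) (simp add: algebra_simps flip: add_divide_distrib)
      then have "poly_phase (adj_phase v q t) j 0 \<eta> * poly_phase (adj_phase v q (- t)) j 0 (\<eta> + t *\<^sub>R v) = 1"
        unfolding poly_phase_0 exp_add[symmetric] distrib_left[symmetric] of_real_add[symmetric] by simp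
      then show ?thesis unfolding ft_mult_op[OF P g1] ft_mult_op[OF P True] by (simp flip: mult.assoc)
    qed
    then have "ft (?S t (?S (- t) g)) = ft g" by (rule ext)
    then have "complex_of_real ((2 * pi) ^ CARD('d)) * ?S t (?S (- t) g) x = of_real ((2 * pi) ^ CARD('d)) * g x" for x
      using gs_space_inversion[OF ab g2, of "- x"] gs_space_inversion[OF ab True, of "- x"] by simp
    then have "?S t (?S (- t) g) = g" by (simp add: fun_eq_iff)
    then show ?thesis using True g1 by (simp add: dual_op_def)
  qed (simp add: dual_op_def gs_dual_off[OF u])
qed

text \<open>The gradient of the principal part in the critical case and 0 otherwise, so that one
  argument covers both assertions on wave front sets.\<close>

definition flow_field :: "('d::finite \<Rightarrow> real poly) \<Rightarrow> nat \<Rightarrow> real^'d \<Rightarrow> real^'d" where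
  "flow_field p m \<xi> = (\<chi> l. if \<nu> = \<mu> * (real m - 1) then real m * coeff (p l) m * (\<xi> $ l) ^ (m - 1) else 0)"

lemma tendsto_rescaled_shift:
  fixes a :: "real^'d::finite" and w :: "(real^'d) \<times> (real^'d)"
  shows "((\<lambda>(s, z). (s powr (- \<mu>)) *\<^sub>R (s powr \<mu> *\<^sub>R snd z + a)) \<longlongrightarrow> snd w) (at_top \<times>\<^sub>F nhds w)"
proof -
  define F where "F = (at_top :: real filter) \<times>\<^sub>F nhds w"
  have f1: "filterlim fst at_top F" and f2: "(snd \<longlongrightarrow> w) F" unfolding F_def by (rule filterlim_fst filterlim_snd)+
  have pos: "\<forall>\<^sub>F z in F. fst z > 0" using f1 eventually_gt_at_top[of 0] unfolding filterlim_iff by blast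
  have t0: "((\<lambda>z. fst z powr (- \<mu>)) \<longlongrightarrow> 0) F" by (rule tendsto_neg_powr[OF _ f1]) (use mu in simp)
  have "((\<lambda>z. snd (snd z) + fst z powr (- \<mu>) *\<^sub>R a) \<longlongrightarrow> snd w + 0 *\<^sub>R a) F"
    by (intro tendsto_intros t0 f2)
  moreover have "\<forall>\<^sub>F z in F. snd (snd z) + fst z powr (- \<mu>) *\<^sub>R a = (case z of (s, z) \<Rightarrow> (s powr (- \<mu>)) *\<^sub>R (s powr \<mu> *\<^sub>R snd z + a))"
    using pos by eventually_elim (auto simp: scaleR_add_right powr_minus)
  ultimately show ?thesis
    unfolding F_def by (simp add: Lim_transform_eventually)
qed

text \<open>Componentwise this is the polynomial limit with step \<open>h = t v\<close>; division by
  the component of \<open>v\<close> leaves \<open>t\<close> times the field.\<close>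

lemma tendsto_rescaled_flow:
  fixes v :: "real^'d::finite" and w :: "(real^'d) \<times> (real^'d)"
  assumes num: "\<mu> * (real m - 1) \<le> \<nu>" and m: "m \<ge> 1" and v: "\<And>l. v $ l \<noteq> 0"
    and p: "\<And>l. pderiv (q l) = p l" and deg: "\<And>l. degree (p l) \<le> m"
  shows "((\<lambda>(s, z). (s powr (- \<nu>)) *\<^sub>R (s powr \<nu> *\<^sub>R fst z - poly_grad (adj_phase v q t) (- (s powr \<mu> *\<^sub>R snd z + t *\<^sub>R v)))) \<longlongrightarrow>
       fst w - t *\<^sub>R flow_field p m (snd w)) (at_top \<times>\<^sub>F nhds w)"
proof -
  define F where "F = (at_top :: real filter) \<times>\<^sub>F nhds w"
  have f1: "filterlim fst at_top F" and f2: "(snd \<longlongrightarrow> w) F" unfolding F_def by (rule filterlim_fst filterlim_snd)+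
  have pos: "\<forall>\<^sub>F z in F. fst z > 0" using f1 eventually_gt_at_top[of 0] unfolding filterlim_iff by blast
  show "((\<lambda>(s, z). (s powr (- \<nu>)) *\<^sub>R (s powr \<nu> *\<^sub>R fst z - poly_grad (adj_phase v q t) (- (s powr \<mu> *\<^sub>R snd z + t *\<^sub>R v)))) \<longlongrightarrow>
       fst w - t *\<^sub>R flow_field p m (snd w)) (at_top \<times>\<^sub>F nhds w)"
  proof (rule vec_tendstoI)
    fix l
    have "filterlim (\<lambda>z. (fst z, snd (snd z) $ l)) (at_top \<times>\<^sub>F nhds (snd w $ l)) F"
      by (intro filterlim_Pair f1 tendsto_intros f2)
    from filterlim_compose[OF tendsto_poly_difference[OF mu num deg[of l] m, of "t * v $ l"] this]
    have D: "((\<lambda>z. fst z powr (- \<nu>) * (poly (p l) (fst z powr \<mu> * snd (snd z) $ l) - poly (p l) (fst z powr \<mu> * snd (snd z) $ l + t * v $ l))) \<longlongrightarrow>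
       (if \<nu> = \<mu> * (real m - 1) then - (t * v $ l) * real m * coeff (p l) m * (snd w $ l) ^ (m - 1) else 0)) F" by simp
    have "((\<lambda>z. fst (snd z) $ l + (fst z powr (- \<nu>) * (poly (p l) (fst z powr \<mu> * snd (snd z) $ l) - poly (p l) (fst z powr \<mu> * snd (snd z) $ l + t * v $ l))) / v $ l) \<longlongrightarrow>
       fst w $ l + (if \<nu> = \<mu> * (real m - 1) then - (t * v $ l) * real m * coeff (p l) m * (snd w $ l) ^ (m - 1) else 0) / v $ l) F"
      by (intro tendsto_intros D f2 v)
    also have "fst w $ l + (if \<nu> = \<mu> * (real m - 1) then - (t * v $ l) * real m * coeff (p l) m * (snd w $ l) ^ (m - 1) else 0) / v $ l
       = (fst w - t *\<^sub>R flow_field p m (snd w)) $ l"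
      using v[of l] by (simp add: flow_field_def)
    finally show "((\<lambda>z. (case z of (s, z) \<Rightarrow> (s powr (- \<nu>)) *\<^sub>R (s powr \<nu> *\<^sub>R fst z - poly_grad (adj_phase v q t) (- (s powr \<mu> *\<^sub>R snd z + t *\<^sub>R v)))) $ l) \<longlongrightarrow>
       (fst w - t *\<^sub>R flow_field p m (snd w)) $ l) (at_top \<times>\<^sub>F nhds w)"
      unfolding F_def[symmetric]
    proof (rule Lim_transform_eventually)
      show "\<forall>\<^sub>F z in F. fst (snd z) $ l + (fst z powr (- \<nu>) * (poly (p l) (fst z powr \<mu> * snd (snd z) $ l) - poly (p l) (fst z powr \<mu> * snd (snd z) $ l + t * v $ l))) / v $ l
         = (case z of (s, z) \<Rightarrow> (s powr (- \<nu>)) *\<^sub>R (s powr \<nu> *\<^sub>R fst z - poly_grad (adj_phase v q t) (- (s powr \<mu> *\<^sub>R snd z + t *\<^sub>R v)))) $ l"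
        using pos
      proof eventually_elim
        case (elim z)
        have e: "x + b * y / c = b * (x / b - - (y / c))" if "b \<noteq> 0" for x b y c :: real using that by (simp add: field_simps)
        show ?case
          unfolding case_prod_unfold vector_minus_component vector_scaleR_component poly_grad_adj_phase[where p=p, OF p]
          using elim by (subst e) (simp_all add: powr_minus field_simps)
      qed
    qed
  qed
qed

text \<open>By contraposition: exponential decay for \<open>u\<close> near the preimage of
  \<open>z\<close> passes to the image of \<open>u\<close> near \<open>z\<close>.\<close>

lemma gs_WF_dual_op_subset:
  fixes v :: "real^'d::finite" and \<phi> :: "real^'d \<Rightarrow> complex"
  assumes nu1: "\<nu> > 1" and m: "m \<ge> 2" and num: "\<mu> * (real m - 1) \<le> \<nu>" and v: "\<And>l. v $ l \<noteq> 0"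
    and p: "\<And>l. pderiv (q l) = p l" and deg: "\<And>l. degree (p l) \<le> m"
    and phi: "\<phi> \<in> gs_space \<nu> \<mu>" "\<phi> \<noteq> (\<lambda>_. 0)" and u: "u \<in> gs_dual \<nu> \<mu>"
    and z: "z \<in> gs_WF \<nu> \<mu> \<phi> (dual_op (poly_phase (adj_phase v q t) j 0) (t *\<^sub>R v) u)"
  shows "(fst z - t *\<^sub>R flow_field p m (snd z), snd z) \<in> gs_WF \<nu> \<mu> \<phi> u"
proof (rule ccontr)
  define w where "w = (fst z - t *\<^sub>R flow_field p m (snd z), snd z)"
  assume "\<not> ?thesis"
  then have nw: "w \<notin> gs_WF \<nu> \<mu> \<phi> u" by (simp add: w_def)
  have z0: "z \<noteq> 0" using z by (simp add: gs_WF_def)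
  \<comment> \<open>Since \<open>m \<ge> 2\<close> the field vanishes at frequency 0, so the
    preimage of a nonzero point is nonzero.\<close>
  have "flow_field p m (0 :: real^'d) = 0" using m by (auto simp: flow_field_def vec_eq_iff)
  then have w0: "w \<noteq> 0" using z0 by (auto simp: w_def prod_eq_iff)
  obtain U where U: "open U" "w \<in> U" and dec: "\<And>r. r > 0 \<Longrightarrow> \<exists>C. \<forall>s>0. \<forall>x \<xi>. (x, \<xi>) \<in> U \<longrightarrow> exp (r * s) * cmod (stft \<phi> u (s powr \<nu> *\<^sub>R x) (s powr \<mu> *\<^sub>R \<xi>)) \<le> C"
    using nw w0 unfolding gs_WF_iff by blast
  have m1: "m \<ge> 1" using m by simp
  note lims = tendsto_rescaled_flow[where w=z and p=p and q=q and m=m and v=v and t=t, OF num m1 v p deg] tendsto_rescaled_shift[where w=z and a="t *\<^sub>R v"]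
  have d: "degree (adj_phase v q t l) \<le> m" for l by (rule degree_sol_phase(2)[OF p deg])
  from stft_dual_op_decay[where Q="adj_phase v q t" and j=j, OF nu1 m num d phi u U(1) U(2)[unfolded w_def] dec lims(1) lims(2) z0]
  have "z \<notin> gs_WF \<nu> \<mu> \<phi> (dual_op (poly_phase (adj_phase v q t) j 0) (t *\<^sub>R v) u)"
    unfolding gs_WF_iff by blast
  then show False using z by blast
qed

lemma gs_WF_dual_op:
  fixes v :: "real^'d::finite" and \<phi> :: "real^'d \<Rightarrow> complex"
  assumes nu1: "\<nu> > 1" and m: "m \<ge> 2" and num: "\<mu> * (real m - 1) \<le> \<nu>" and v: "\<And>l. v $ l \<noteq> 0"
    and p: "\<And>l. pderiv (q l) = p l" and deg: "\<And>l. degree (p l) \<le> m"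
    and phi: "\<phi> \<in> gs_space \<nu> \<mu>" "\<phi> \<noteq> (\<lambda>_. 0)" and u: "u \<in> gs_dual \<nu> \<mu>"
  shows "gs_WF \<nu> \<mu> \<phi> (dual_op (poly_phase (adj_phase v q t) j 0) (t *\<^sub>R v) u)
    = (\<lambda>(x, \<xi>). (x + t *\<^sub>R flow_field p m \<xi>, \<xi>)) ` gs_WF \<nu> \<mu> \<phi> u"
proof -
  let ?T = "\<lambda>t. dual_op (poly_phase (adj_phase v q t) j 0) (t *\<^sub>R v)"
  have P: "gs_multiplier (poly_phase (adj_phase v q t))" for t
    by (rule poly_phase_gs_multiplier[OF nu1 m num degree_sol_phase(2)[OF p deg]])
  have inv: "?T (- t) (?T t u) = u" by (rule dual_op_inverse[OF P u])
  note sub = gs_WF_dual_op_subset[OF nu1 m num v p deg phi]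
  show ?thesis
  proof (intro equalityI subsetI)
    fix z assume "z \<in> gs_WF \<nu> \<mu> \<phi> (?T t u)"
    from sub[OF u this] show "z \<in> (\<lambda>(x, \<xi>). (x + t *\<^sub>R flow_field p m \<xi>, \<xi>)) ` gs_WF \<nu> \<mu> \<phi> u"
      by (intro image_eqI[where x="(fst z - t *\<^sub>R flow_field p m (snd z), snd z)"]) auto
  next
    fix z assume "z \<in> (\<lambda>(x, \<xi>). (x + t *\<^sub>R flow_field p m \<xi>, \<xi>)) ` gs_WF \<nu> \<mu> \<phi> u"
    then obtain w where w: "w \<in> gs_WF \<nu> \<mu> \<phi> u" and z: "z = (fst w + t *\<^sub>R flow_field p m (snd w), snd w)" by (auto simp: case_prod_unfold)
    have "w \<in> gs_WF \<nu> \<mu> \<phi> (?T (- t) (?T t u))" using w inv by simp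
    from sub[OF dual_op_dual[OF P u] this] show "z \<in> gs_WF \<nu> \<mu> \<phi> (?T t u)" by (simp add: z)
  qed
qed

end

text \<open>Components of degree below \<open>m\<close> are absent from the principal part and have
  coefficient 0 at \<open>m\<close>, so one formula holds in every direction.\<close>

lemma gradient_principal_part:
  fixes p :: "'d::finite \<Rightarrow> real poly"
  assumes "m = max_degree p" "m \<ge> 1"
  shows "gradient (principal_part p) \<xi> $ l = real m * coeff (p l) m * (\<xi> $ l) ^ (m - 1)"
proof -
  have deg: "degree (p l) \<le> m" unfolding assms(1) max_degree_def by (intro Max_ge) auto
  let ?J = "{j. degree (p j) = m}"
  have "(principal_part p has_derivative (\<lambda>h. \<Sum>j\<in>?J. coeff (p j) m * (real m * (\<xi> $ j) ^ (m - 1) * h $ j))) (at \<xi>)"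
    unfolding principal_part_def[abs_def] assms(1)[symmetric]
    by (auto intro!: derivative_eq_intros bounded_linear_imp_has_derivative[OF bounded_linear_vec_nth] sum.cong simp: mult_ac)
  from frechet_derivative_at[OF this, symmetric]
  have "gradient (principal_part p) \<xi> $ l = (\<Sum>j\<in>?J. coeff (p j) m * (real m * (\<xi> $ j) ^ (m - 1) * (axis l 1 :: real^'d) $ j))"
    by (simp add: gradient_def)
  also have "\<dots> = (\<Sum>j\<in>?J. if j = l then real m * coeff (p l) m * (\<xi> $ l) ^ (m - 1) else 0)"
    by (intro sum.cong) (auto simp: axis_def)
  also have "\<dots> = real m * coeff (p l) m * (\<xi> $ l) ^ (m - 1)"
    using deg coeff_eq_0[of "p l" m] by (auto simp: sum.delta)
  finally show ?thesis .
qed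

theorem theorem5p3:
  fixes v :: "real ^ 'd::finite"
    and p q :: "'d \<Rightarrow> real poly"
    and m :: nat
    and \<nu> \<mu> :: real
  assumes "\<And>j. v $ j \<noteq> 0"
    and "\<And>j. p j \<noteq> 0"
    and "\<And>j. pderiv (q j) = p j"
    and "m = max_degree p"
    and "m \<ge> 2"
    and "\<nu> \<ge> \<mu> * (real m - 1)"
    and "\<mu> * (real m - 1) > 1"
  shows "\<forall>t.
    continuous_map (gs_topology \<nu> \<mu>) (gs_topology \<nu> \<mu>) (solution_op v q t) \<and>
    (\<exists>!T. dual_extension \<nu> \<mu> (solution_op v q t) T) \<and>
    (\<forall>T. dual_extension \<nu> \<mu> (solution_op v q t) T \<longrightarrow>
      (\<forall>u\<in>gs_dual \<nu> \<mu>. \<forall>\<phi>\<in>gs_space \<nu> \<mu>. \<phi> \<noteq> (\<lambda>_. 0) \<longrightarrow>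
        (\<nu> = \<mu> * (real m - 1) \<longrightarrow>
          gs_WF \<nu> \<mu> \<phi> (T u) = hamilton_flow p t ` gs_WF \<nu> \<mu> \<phi> u) \<and>
        (\<nu> > \<mu> * (real m - 1) \<longrightarrow>
          gs_WF \<nu> \<mu> \<phi> (T u) = gs_WF \<nu> \<mu> \<phi> u)))"
proof
  fix t
  have nu1: "\<nu> > 1" using assms(6,7) by linarith
  have mu: "\<mu> > 0" 
  proof (rule ccontr)
    assume "\<not> \<mu> > 0"
    then have "\<mu> * (real m - 1) \<le> 0" using assms(5) by (intro mult_nonpos_nonneg) auto
    then show False using assms(7) by simp
  qed
  interpret gs \<nu> \<mu> by unfold_locales (use nu1 mu in auto)
  have deg: "degree (p l) \<le> m" for l unfolding assms(4) max_degree_def by (intro Max_ge) auto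
  have P: "gs_multiplier (poly_phase (sol_phase v q t))" and P': "gs_multiplier (poly_phase (adj_phase v q t))"
    by (rule poly_phase_gs_multiplier[OF nu1 assms(5,6) degree_sol_phase(1)[OF assms(3) deg]]
        poly_phase_gs_multiplier[OF nu1 assms(5,6) degree_sol_phase(2)[OF assms(3) deg]])+
  \<comment> \<open>Any index serves: at order 0 \<open>poly_phase\<close> is the same function for
    all of them.\<close>
  define j :: 'd where "j = undefined"
  define T0 where "T0 = restrict (dual_op (poly_phase (adj_phase v q t) j 0) (t *\<^sub>R v)) (gs_dual \<nu> \<mu>)"
  have T0: "dual_extension \<nu> \<mu> (solution_op v q t) T0" unfolding T0_def by (rule dual_op_extension[OF P P'])
  have cont: "continuous_map (gs_topology \<nu> \<mu>) (gs_topology \<nu> \<mu>) (solution_op v q t)"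
    by (rule continuous_map_eq[OF mult_op_continuous[OF P, of j "t *\<^sub>R v"]])
       (simp add: topspace_gs_topology solution_op_eq_mult_op[OF P, of _ j])
  have ex1: "\<exists>!T. dual_extension \<nu> \<mu> (solution_op v q t) T"
    using T0 dual_extension_unique by blast
  \<comment> \<open>By uniqueness every extension is the transposed multiplier, to which the
    propagation result applies.\<close>
  have WF: "gs_WF \<nu> \<mu> \<phi> (T u) = (\<lambda>(x, \<xi>). (x + t *\<^sub>R flow_field p m \<xi>, \<xi>)) ` gs_WF \<nu> \<mu> \<phi> u"
    if "dual_extension \<nu> \<mu> (solution_op v q t) T" "u \<in> gs_dual \<nu> \<mu>" "\<phi> \<in> gs_space \<nu> \<mu>" "\<phi> \<noteq> (\<lambda>_. 0)" for T u \<phi>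
  proof -
    have "T = T0" using dual_extension_unique[OF that(1) T0] .
    then have "T u = dual_op (poly_phase (adj_phase v q t) j 0) (t *\<^sub>R v) u" using that(2) by (simp add: T0_def)
    then show ?thesis using gs_WF_dual_op[OF nu1 assms(5,6,1,3) deg that(3,4,2), where t=t and j=j] by simp
  qed
  have flow: "(\<lambda>(x, \<xi>). (x + t *\<^sub>R flow_field p m \<xi>, \<xi>)) = hamilton_flow p t" if "\<nu> = \<mu> * (real m - 1)"
  proof -
    have "flow_field p m \<xi> = gradient (principal_part p) \<xi>" for \<xi>
      unfolding flow_field_def vec_eq_iff using that assms(5) gradient_principal_part[OF assms(4)] by simp
    then show ?thesis by (simp add: hamilton_flow_def)
  qed
  have stay: "(\<lambda>(x, \<xi>). (x + t *\<^sub>R flow_field p m \<xi>, \<xi>)) = id" if "\<nu> > \<mu> * (real m - 1)"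
    using that by (auto simp: flow_field_def vec_eq_iff fun_eq_iff)
  show "continuous_map (gs_topology \<nu> \<mu>) (gs_topology \<nu> \<mu>) (solution_op v q t) \<and>
    (\<exists>!T. dual_extension \<nu> \<mu> (solution_op v q t) T) \<and>
    (\<forall>T. dual_extension \<nu> \<mu> (solution_op v q t) T \<longrightarrow>
      (\<forall>u\<in>gs_dual \<nu> \<mu>. \<forall>\<phi>\<in>gs_space \<nu> \<mu>. \<phi> \<noteq> (\<lambda>_. 0) \<longrightarrow>
        (\<nu> = \<mu> * (real m - 1) \<longrightarrow>
          gs_WF \<nu> \<mu> \<phi> (T u) = hamilton_flow p t ` gs_WF \<nu> \<mu> \<phi> u) \<and>
        (\<nu> > \<mu> * (real m - 1) \<longrightarrow>
          gs_WF \<nu> \<mu> \<phi> (T u) = gs_WF \<nu> \<mu> \<phi> u)))"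
  proof (intro conjI allI impI ballI)
    fix T and u :: "(real^'d \<Rightarrow> complex) \<Rightarrow> complex" and \<phi> :: "real^'d \<Rightarrow> complex"
    assume T: "dual_extension \<nu> \<mu> (solution_op v q t) T" and u: "u \<in> gs_dual \<nu> \<mu>"
      and phi: "\<phi> \<in> gs_space \<nu> \<mu>" "\<phi> \<noteq> (\<lambda>_. 0)"
    show "gs_WF \<nu> \<mu> \<phi> (T u) = hamilton_flow p t ` gs_WF \<nu> \<mu> \<phi> u" if "\<nu> = \<mu> * (real m - 1)"
      using WF[OF T u phi] unfolding flow[OF that] .
    show "gs_WF \<nu> \<mu> \<phi> (T u) = gs_WF \<nu> \<mu> \<phi> u" if "\<nu> > \<mu> * (real m - 1)"
      using WF[OF T u phi] unfolding stay[OF that] by simp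
  qed (use cont ex1 in auto)
qed

end
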